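(* Let $\xi_0,\xi_1,\ldots$ be nondegenerate i.i.d. complex-valued random variables with $\mathbb{E}\log(1+|\xi_0|)<\infty$. Let $f_{k,n}\in\mathbb{C}$ ($k\in\mathbb{N}_0$, $n\in\mathbb{N}$) be deterministic, and suppose there are a function $f:[0,\infty)\to[0,\infty)$ and a number $T_0\in(0,\infty]$ such that: (A1) $f(t)>0$ for $t<T_0$ and $f(t)=0$ for $t>T_0$; (A2) $f$ is continuous on $[0,T_0)$ and, if $T_0<+\infty$, left continuous at $T_0$; (A3) for every $A>0$, $\lim_{n\to\infty}\sup_{k\in[0,An]}\bigl||f_{k,n}|^{1/n}-f(k/n)\bigr|=0$ (supremum over integers $k$); (A4) $R_0:=\liminf_{t\to\infty}f(t)^{-1/t}\in(0,\infty]$; for every fixed $n\in\mathbb{N}$, $\liminf_{k\to\infty}|f_{k,n}|^{-1/k}\ge R_0$; and additionally $\liminf_{n,\,k/n\to\infty}|f_{k,n}|^{-1/k}\ge R_0$. Let $\mathbf{G}_n(z)=\sum_{k=0}^\infty \xi_k f_{k,n}z^k$, and let $I(s)=\sup_{t\ge 0}\bigl(st+\log f(t)\bigr)$ for $s\in\mathbb{R}$. Then, as $n\to\infty$, the sequence of random measures $\frac1n\mu_{\mathbf{G}_n}$ converges in probability to some deterministic locally finite measure $\mu$ on the disk $\mathbb{D}_{R_0}$. The measure $\mu$ is rotationally invariant and is characterized by $$\mu(\mathbb{D}_r)=I'(\log r),\qquad r\in(0,R_0),$$ where $I'$ denotes the left derivative of the convex function $I$.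
   Context: Notation: $\mathbb{D}_r=\{z\in\mathbb{C}:|z|<r\}$ for $r>0$, $\mathbb{D}_\infty=\mathbb{C}$. "Nondegenerate" means not a.s. constant. Conventions: $\log 0=-\infty$, and $0^{-1/t}=+\infty$. The condition $\liminf_{n,\,k/n\to\infty}|f_{k,n}|^{-1/k}\ge R_0$ means: for every $R<R_0$ there is $A>0$ such that $|f_{k,n}|^{-1/k}\ge R$ for all $n\ge A$ and all $k\ge An$. Under these assumptions the series $\mathbf{G}_n$ converges a.s. on $\mathbb{D}_{R_0}$, so it is a random analytic function there. The function $I$ is convex, finite for $s<\log R_0$, and equal to $+\infty$ for $s>\log R_0$. For a function $G$ analytic in a domain $D$ and not identically zero, $\mu_G=\sum_{z\in D: G(z)=0}n_G(z)\,\delta(z)$, where $n_G(z)$ is the multiplicity of the zero $z$ and $\delta(z)$ is the unit mass at $z$; if $G\equiv 0$, then $\mu_G=0$. Here $D=\mathbb{D}_{R_0}$. Locally finite measures on a locally compact metric space $X$ are endowed with the vague topology (convergence of integrals of continuous compactly supported functions). Random measures $\nu_n$ converge to $\nu$ in probability (resp. a.s.) if $\int_X\varphi\,d\nu_n\to\int_X\varphi\,d\nu$ in probability (resp. a.s.) for every continuous compactly supported $\varphi:X\to\mathbb{R}$. *)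

theory Defs
  imports "HOL-Probability.Probability" "HOL-Complex_Analysis.Complex_Analysis"
begin

text \<open>\<open>x\<^sup>-\<^sup>1\<^sup>/\<^sup>t\<close> for \<open>x \<ge> 0\<close> and \<open>t > 0\<close>, with the convention that it is \<open>+\<infinity>\<close> at \<open>x = 0\<close>.\<close>

definition inv_root :: "real \<Rightarrow> real \<Rightarrow> ereal" where
  "inv_root x t = (if x = 0 then \<infinity> else ereal (x powr (- 1 / t)))"

text \<open>The logarithm on \<open>[0, \<infinity>)\<close> with \<open>log 0 = -\<infinity>\<close> (the library has \<open>ln 0 = 0\<close>).\<close>

definition elog :: "real \<Rightarrow> ereal" where
  "elog x = (if x = 0 then - \<infinity> else ereal (ln x))"

definition legendre_log :: "(real \<Rightarrow> real) \<Rightarrow> real \<Rightarrow> ereal" where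
  "legendre_log f s = (SUP t\<in>{0..}. ereal (s * t) + elog (f t))"

definition random_series ::
    "(nat \<Rightarrow> 'w \<Rightarrow> complex) \<Rightarrow> (nat \<Rightarrow> nat \<Rightarrow> complex) \<Rightarrow> nat \<Rightarrow> 'w \<Rightarrow> complex \<Rightarrow> complex" where
  "random_series \<xi> a n \<omega> z = (\<Sum>k. \<xi> k \<omega> * a k n * z ^ k)"

text \<open>
  The zero counting measure of \<open>G\<close> on the domain \<open>D\<close>: the sum of the unit masses at the zeros,
  weighted by multiplicity, as a Borel measure on \<open>D\<close> (a point measure on the zero set, pushed
  forward along the inclusion). It is the null measure if \<open>G\<close> vanishes identically on \<open>D\<close>; the
  same value is used for a function that is not analytic on \<open>D\<close>, which for a random series
  occurs only on the null event where the series does not converge on \<open>D\<close>.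
\<close>

definition zero_measure :: "complex set \<Rightarrow> (complex \<Rightarrow> complex) \<Rightarrow> complex measure" where
  "zero_measure D G =
     (if G holomorphic_on D \<and> (\<exists>z\<in>D. G z \<noteq> 0)
      then distr (point_measure {z\<in>D. G z = 0} (\<lambda>z. of_nat (nat (zorder G z))))
                 (restrict_space borel D) (\<lambda>z. z)
      else null_measure (restrict_space borel D))"

definition locally_finite_measure_on :: "'a::metric_space set \<Rightarrow> 'a measure \<Rightarrow> bool" where
  "locally_finite_measure_on D \<nu> \<longleftrightarrow>
     sets \<nu> = sets (restrict_space borel D) \<and>
     (\<forall>K. compact K \<and> K \<subseteq> D \<longrightarrow> emeasure \<nu> K < \<infinity>)"

definition rotation_invariant :: "complex measure \<Rightarrow> bool" where
  "rotation_invariant \<nu> \<longleftrightarrow> (\<forall>c. cmod c = 1 \<longrightarrow> distr \<nu> \<nu> (\<lambda>z. c * z) = \<nu>)"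

definition test_function_on :: "'a::metric_space set \<Rightarrow> ('a \<Rightarrow> real) \<Rightarrow> bool" where
  "test_function_on D \<phi> \<longleftrightarrow>
     continuous_on D \<phi> \<and> (\<exists>K. compact K \<and> K \<subseteq> D \<and> (\<forall>z\<in>D - K. \<phi> z = 0))"

text \<open>
  Measurability is part of the definition: a nonmeasurable event would have \<open>measure\<close> zero.
\<close>

definition converges_in_probability ::
    "'w measure \<Rightarrow> (nat \<Rightarrow> 'w \<Rightarrow> real) \<Rightarrow> ('w \<Rightarrow> real) \<Rightarrow> bool" where
  "converges_in_probability M X Y \<longleftrightarrow>
     (\<forall>n. X n \<in> borel_measurable M) \<and> Y \<in> borel_measurable M \<and>
     (\<forall>\<epsilon>>0. (\<lambda>n. measure M {\<omega>\<in>space M. \<bar>X n \<omega> - Y \<omega>\<bar> > \<epsilon>}) \<longlonglongrightarrow> 0)"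

definition vaguely_converges_in_probability ::
    "'w measure \<Rightarrow> 'a::metric_space set \<Rightarrow> (nat \<Rightarrow> 'w \<Rightarrow> 'a measure) \<Rightarrow> ('w \<Rightarrow> 'a measure) \<Rightarrow> bool"
where
  "vaguely_converges_in_probability M D N \<nu> \<longleftrightarrow>
     (\<forall>\<phi>. test_function_on D \<phi> \<longrightarrow>
        converges_in_probability M
          (\<lambda>n \<omega>. integral\<^sup>L (N n \<omega>) \<phi>) (\<lambda>\<omega>. integral\<^sup>L (\<nu> \<omega>) \<phi>))"

text \<open>
  The property \<open>\<nu>(\<D>\<^sub>r) = I'(log r)\<close> for \<open>0 < r < R\<close>, with \<open>I'\<close> the left derivative. \<open>I\<close> is
  extended real valued; it is finite on \<open>s < log R\<close>, where \<^const>\<open>real_of_ereal\<close> is harmless.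
\<close>

definition radial_profile :: "(real \<Rightarrow> ereal) \<Rightarrow> ereal \<Rightarrow> complex measure \<Rightarrow> bool" where
  "radial_profile I R \<nu> \<longleftrightarrow>
     (\<forall>r>0. ereal r < R \<longrightarrow>
        ((\<lambda>s. real_of_ereal (I s)) has_real_derivative measure \<nu> (ball 0 r)) (at_left (ln r)))"

end

theory Submission
  imports Defs "HOL-Real_Asymp.Real_Asymp"
begin

text \<open>
  Write \<open>u z = I (log |z|)\<close> and \<open>u\<^sub>n = (1/n) log |G\<^sub>n|\<close>. The zero measure of a holomorphic function is the
  Laplacian of \<open>log |G|\<close>, and distributions are avoided by a finite difference: by Jensen, the difference
  of the means of \<open>log |\<cdot> - w|\<close> over the circles of radii \<open>r\<close> and \<open>r/2\<close> about \<open>z\<close> is an explicit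
  nonnegative kernel of \<open>z - w\<close> supported in the disk of radius \<open>r\<close>. Hence the integral of a test function
  smoothed by this kernel against the zero measure is the integral of \<open>log |G|\<close> against a fixed bounded
  function. The same identity holds for every locally finite rotation invariant measure with
  profile \<open>I'(log r)\<close> and its potential \<open>u\<close>, which gives uniqueness of the limit and reduces the theorem to
  local \<open>L\<^sup>1\<close> convergence of \<open>u\<^sub>n\<close> to \<open>u\<close> in probability.

  For the latter, \<open>u\<^sub>n \<le> u + e\<close> on compact sets, since \<open>\<xi>\<^sub>k\<close> grows subexponentially, and by the submean
  property it suffices that every small disk contains a point with \<open>u\<^sub>n \<ge> u - e\<close>. If \<open>|G\<^sub>n|\<close> is too small at
  \<open>m\<close> points of the disk, then, given all other coefficients, interpolation confines \<open>m\<close> consecutive \<open>\<xi>\<^sub>k\<close> with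
  nearly maximal weight to a tiny polydisk, which has probability at most \<open>q\<^sup>m\<close> for some \<open>q < 1\<close>.
\<close>

section \<open>Uniform measure on the circle and rotations of the plane\<close>

text \<open>Only a logarithmic moment and nondegeneracy are assumed, so neither a density nor a
  variance is at hand: the lower bound on |G| uses nothing but a radius \<open>s\<close> at which
  every ball has probability at most some \<open>q < 1\<close> under the law of
  \<open>\<xi> 0\<close>. One coefficient would give only the bound \<open>q\<close>; a window of
  \<open>m\<close> indices gives \<open>q ^ m\<close>, and all weights in it are nearly maximal
  because a shift by less than \<open>m\<close> hardly changes \<open>k / n\<close>. Two radii
  \<open>r\<close> and \<open>r / 2\<close> are compared since the harmonic part of log |G| has the
  same mean over both circles; comparing one circle with its centre would leave a logarithmically
  unbounded kernel. A test function is not itself a smoothing, and replacing it by one costs an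
  error proportional to the number of zeros. That number is controlled by the same convergence,
  applied to a cutoff. Finally, convergence in probability includes measurability: an integral over
  the random zero set is the limit of smoothed ones, which are integrals of log |G| and thus
  measurable in the outcome.\<close>

definition circle_measure :: "complex measure" where
  "circle_measure = distr (uniform_measure lborel {0..<1}) borel (\<lambda>x::real. cis (2 * pi * x))"

lemma sets_circle_measure [simp, measurable_cong]: "sets circle_measure = sets borel"
  and space_circle_measure [simp]: "space circle_measure = UNIV"
  by (simp_all add: circle_measure_def)

lemma measurable_cis [measurable]: "cis \<in> borel_measurable borel"
  by (intro borel_measurable_continuous_onI continuous_intros)

lemma prob_space_circle_measure: "prob_space circle_measure"
  unfolding circle_measure_def
  by (intro prob_space.prob_space_distr prob_space_uniform_measure) auto

interpretation circle: prob_space circle_measure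
  by (rule prob_space_circle_measure)

lemma AE_circle_measure: "AE c in circle_measure. cmod c = 1"
  unfolding circle_measure_def by (subst AE_distr_iff) auto

lemma emeasure_circle_measure:
  assumes [measurable]: "A \<in> sets borel"
  shows "emeasure circle_measure A = emeasure lborel {x\<in>{0..<1::real}. cis (2 * pi * x) \<in> A}"
proof -
  have "emeasure circle_measure A = emeasure lborel ({0..<1} \<inter> {x. cis (2 * pi * x) \<in> A})"
    unfolding circle_measure_def
    by (subst emeasure_distr) (auto simp: emeasure_uniform_measure vimage_def divide_ennreal_def)
  then show ?thesis by (simp add: Int_def)
qed

lemma emeasure_lborel_shift:
  assumes [measurable]: "A \<in> sets borel"
  shows "emeasure lborel {x::'a::euclidean_space. x + t \<in> A} = emeasure lborel A"
proof -
  have "emeasure lborel A = emeasure (distr lborel borel ((+) t)) A"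
    by (simp add: lborel_distr_plus)
  also have "\<dots> = emeasure lborel {x. x + t \<in> A}"
    by (subst emeasure_distr) (auto simp: vimage_def add.commute)
  finally show ?thesis ..
qed

text \<open>In the angle parameter a rotation is a translation modulo 1. The translated interval [a,
  1 + a) is cut at 1 and the overhang is moved back by periodicity.\<close>

lemma circle_measure_rotate:
  assumes "cmod c = 1"
  shows "distr circle_measure borel (\<lambda>z. c * z) = circle_measure"
proof (rule measure_eqI)
  fix A assume "A \<in> sets (distr circle_measure borel (\<lambda>z. c * z))"
  then have A[measurable]: "A \<in> sets borel" by simp
  \<comment> \<open>\<open>Arg\<close> takes values in (-pi, pi], so it is the fractional part that
    places the angle in [0, 1).\<close>
  define a where "a = frac (Arg c / (2 * pi))"
  have a: "0 \<le> a" "a < 1" by (auto simp: a_def frac_lt_1)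
  have c: "c = cis (2 * pi * a)"
  proof -
    have "c = cis (Arg c)"
      using assms by (metis cis_Arg complex_sgn_def div_by_1 norm_zero scaleR_one zero_neq_one inverse_1)
    also have "\<dots> = cis (2 * pi * (a + of_int \<lfloor>Arg c / (2 * pi)\<rfloor>))"
      by (simp add: a_def frac_def)
    also have "\<dots> = cis (2 * pi * a) * cis (2 * pi * of_int \<lfloor>Arg c / (2 * pi)\<rfloor>)"
      by (simp add: cis_mult algebra_simps)
    finally show ?thesis by (simp add: cis_multiple_2pi)
  qed
  define B where "B = {x::real. cis (2 * pi * x) \<in> A}"
  have B[measurable]: "B \<in> sets borel"
    unfolding B_def by measurable
  have per: "x + 1 \<in> B \<longleftrightarrow> x \<in> B" for x
    by (simp add: B_def cis_mult[symmetric] distrib_left)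
  have "emeasure (distr circle_measure borel (\<lambda>z. c * z)) A = emeasure circle_measure {z. c * z \<in> A}"
    by (subst emeasure_distr) (auto simp: vimage_def)
  also have "\<dots> = emeasure lborel {x\<in>{0..<1}. x + a \<in> B}"
    by (subst emeasure_circle_measure)
       (auto simp: B_def c cis_mult distrib_left add.commute intro!: arg_cong[of _ _ "emeasure lborel"])
  also have "{x\<in>{0..<1}. x + a \<in> B} = {x. x + a \<in> B \<inter> {a..<1+a}}"
    by auto
  also have "emeasure lborel \<dots> = emeasure lborel (B \<inter> {a..<1+a})"
    by (rule emeasure_lborel_shift) auto
  also have "B \<inter> {a..<1+a} = (B \<inter> {a..<1}) \<union> (B \<inter> {1..<1+a})"
    using a by auto
  also have "emeasure lborel \<dots> = emeasure lborel (B \<inter> {a..<1}) + emeasure lborel (B \<inter> {1..<1+a})"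
    by (rule plus_emeasure[symmetric]) auto
  also have "emeasure lborel (B \<inter> {1..<1+a}) = emeasure lborel {x. x + 1 \<in> B \<inter> {1..<1+a}}"
    by (rule emeasure_lborel_shift[symmetric]) auto
  also have "{x. x + 1 \<in> B \<inter> {1..<1+a}} = B \<inter> {0..<a}"
    using per by auto
  also have "emeasure lborel (B \<inter> {a..<1}) + emeasure lborel (B \<inter> {0..<a})
     = emeasure lborel ((B \<inter> {a..<1}) \<union> (B \<inter> {0..<a}))"
    by (rule plus_emeasure) auto
  also have "(B \<inter> {a..<1}) \<union> (B \<inter> {0..<a}) = {x\<in>{0..<1}. x \<in> B}"
    using a by auto
  also have "emeasure lborel \<dots> = emeasure circle_measure A"
    by (simp add: emeasure_circle_measure B_def)
  finally show "emeasure (distr circle_measure borel (\<lambda>z. c * z)) A = emeasure circle_measure A" .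
qed simp

lemma integral_circle_measure:
  fixes g :: "complex \<Rightarrow> 'b::{banach,second_countable_topology}"
  assumes [measurable]: "g \<in> borel_measurable borel"
  shows "(\<integral>c. g c \<partial>circle_measure) = (\<integral>x\<in>{0..<1}. g (cis (2 * pi * x)) \<partial>lborel)"
proof -
  have "uniform_measure lborel {0..<1} = density lborel (\<lambda>x::real. ennreal (indicator {0..<1} x))"
    by (simp add: uniform_measure_def divide_ennreal_def ennreal_indicator)
  then show ?thesis
    unfolding circle_measure_def
    by (simp add: integral_distr integral_density set_lebesgue_integral_def)
qed

lemma integrable_circle_measure_continuous:
  fixes g :: "complex \<Rightarrow> complex"
  assumes [measurable]: "g \<in> borel_measurable borel" and "continuous_on (sphere 0 1) g"
  shows "integrable circle_measure g"
proof -
  have "compact (g ` sphere 0 1)"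
    by (intro compact_continuous_image assms) auto
  then obtain B where "\<And>c. c \<in> sphere 0 1 \<Longrightarrow> norm (g c) \<le> B"
    using compact_imp_bounded bounded_iff by (metis imageI)
  then show ?thesis
    using AE_circle_measure
    by (intro circle.integrable_const_bound[where B=B]) (auto elim!: eventually_mono)
qed

text \<open>Cauchy's integral formula at the centre of the unit disk, for the function of
  \<open>c\<close>. Measurability is asked for separately because holomorphy constrains
  \<open>g\<close> only on the ball, while \<open>circle_measure\<close> lives on the whole
  plane.\<close>

lemma circle_mean_value:
  assumes "g holomorphic_on ball p R" "cmod b < R"
    and meas: "(\<lambda>c. g (p + b * c)) \<in> borel_measurable borel"
  shows "integrable circle_measure (\<lambda>c. g (p + b * c))"
    and "(\<integral>c. g (p + b * c) \<partial>circle_measure) = g p"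
proof -
  let ?h = "\<lambda>c. g (p + b * c)"
  have sub: "(\<lambda>c. p + b * c) ` cball 0 1 \<subseteq> ball p R"
  proof safe
    fix c :: complex assume "c \<in> cball 0 1"
    then have "cmod b * cmod c \<le> cmod b * 1"
      by (intro mult_left_mono) auto
    then show "p + b * c \<in> ball p R"
      using assms(2) by (simp add: dist_norm norm_mult)
  qed
  have h: "?h holomorphic_on cball 0 1"
    using holomorphic_on_compose_gen[OF _ assms(1) sub] by (simp add: o_def holomorphic_intros)
  have cont: "continuous_on (cball 0 1) ?h"
    using h by (rule holomorphic_on_imp_continuous_on)
  show "integrable circle_measure ?h"
    by (rule integrable_circle_measure_continuous[OF meas]) (rule continuous_on_subset[OF cont], auto)
  have "((\<lambda>u. ?h u / (u - 0)) has_contour_integral (2 * of_real pi * \<i> * ?h 0)) (circlepath 0 1)"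
    by (rule Cauchy_integral_circlepath_simple) (use h in auto)
  \<comment> \<open>The speed of the parametrisation cancels the Cauchy kernel, which leaves the
    plain average over the angle.\<close>
  then have "((\<lambda>x. ?h (cis (2 * pi * x)) / cis (2 * pi * x) * (2 * pi * \<i> * cis (2 * pi * x)))
      has_integral (2 * of_real pi * \<i> * ?h 0)) {0..1}"
    unfolding has_contour_integral_def
  proof (rule has_integral_eq[rotated], goal_cases)
    case (1 x)
    then have "vector_derivative (circlepath 0 1) (at x within {0..1}) = 2 * pi * \<i> * cis (2 * pi * x)"
      by (subst vector_derivative_circlepath01) (auto simp: cis_conv_exp mult_ac)
    moreover have "circlepath 0 1 x = cis (2 * pi * x)"
      by (simp add: circlepath cis_conv_exp mult_ac)
    ultimately show ?case by simp
  qed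
  then have "((\<lambda>x. (2 * of_real pi * \<i>) * ?h (cis (2 * pi * x))) has_integral (2 * of_real pi * \<i>) * ?h 0) {0..1}"
    by (simp add: mult_ac)
  then have "((\<lambda>x. ?h (cis (2 * pi * x))) has_integral ?h 0) {0..1}"
    by (subst (asm) has_integral_mult_right_iff) auto
  moreover have "set_integrable lborel {0..1} (\<lambda>x::real. ?h (cis (2 * pi * x)))"
    by (intro borel_integrable_atLeastAtMost' continuous_on_compose2[OF cont] continuous_intros) auto
  ultimately have "(\<integral>x\<in>{0..1}. ?h (cis (2 * pi * x)) \<partial>lborel) = ?h 0"
    using set_borel_integral_eq_integral(2) integral_unique by metis
  moreover have "(\<integral>x\<in>{0..1}. ?h (cis (2 * pi * x)) \<partial>lborel) = (\<integral>x\<in>{0..<1}. ?h (cis (2 * pi * x)) \<partial>lborel)"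
    unfolding set_lebesgue_integral_def
    by (intro integral_cong_AE)
       (use meas AE_lborel_singleton[of "1::real"] in \<open>auto elim!: eventually_mono simp: indicator_def\<close>)
  ultimately show "(\<integral>c. ?h c \<partial>circle_measure) = g p"
    by (simp add: integral_circle_measure[OF meas])
qed

text \<open>On the ball of radius 1 about 1 the principal logarithm is holomorphic, and its real
  part is the logarithm of the modulus. So the mean is the value \<open>Ln 1 = 0\<close> at the
  centre.\<close>

lemma circle_mean_ln_norm_one_plus:
  assumes "cmod b < 1"
  shows "integrable circle_measure (\<lambda>c. ln (cmod (1 + b * c)))"
    and "(\<integral>c. ln (cmod (1 + b * c)) \<partial>circle_measure) = 0"
proof -
  have Re: "Re z > 0" if "z \<in> ball 1 1" for z
    using that abs_Re_le_cmod[of "1 - z"] by (auto simp: dist_norm abs_if split: if_splits)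
  have hol: "Ln holomorphic_on ball 1 1"
    by (intro holomorphic_on_Ln) (auto dest!: Re simp: complex_nonpos_Reals_iff)
  have m: "(\<lambda>c. Ln (1 + b * c)) \<in> borel_measurable borel" by measurable
  note I = circle_mean_value[OF hol assms m]
  have eq: "AE c in circle_measure. Re (Ln (1 + b * c)) = ln (cmod (1 + b * c))"
    using AE_circle_measure
  proof eventually_elim
    case (elim c)
    have "1 + b * c \<in> ball 1 1" using elim assms by (simp add: dist_norm norm_mult)
    from Re[OF this] have "1 + b * c \<noteq> 0" by (metis zero_complex.simps(1) less_irrefl)
    then show ?case by simp
  qed
  have i: "integrable circle_measure (\<lambda>c. Re (Ln (1 + b * c)))"
    using I(1) by (rule integrable_Re)
  then show "integrable circle_measure (\<lambda>c. ln (cmod (1 + b * c)))"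
    by (subst (asm) integrable_cong_AE[OF _ _ eq]) auto
  have "(\<integral>c. ln (cmod (1 + b * c)) \<partial>circle_measure) = (\<integral>c. Re (Ln (1 + b * c)) \<partial>circle_measure)"
    using eq by (intro integral_cong_AE) auto
  also have "\<dots> = Re (\<integral>c. Ln (1 + b * c) \<partial>circle_measure)"
    using I(1) by (rule integral_Re)
  finally show "(\<integral>c. ln (cmod (1 + b * c)) \<partial>circle_measure) = 0"
    using I(2) by simp
qed

text \<open>Jensen's formula for one linear factor. The larger of the two moduli is factored out,
  which leaves \<open>1 + d * c\<close> with \<open>cmod d < 1\<close>. In the excluded case the
  singularity lies on the circle of integration; later this concerns only a null set of
  centres.\<close>

lemma circle_mean_ln_norm:
  assumes "cmod a \<noteq> cmod b"
  shows "integrable circle_measure (\<lambda>c. ln (cmod (a + b * c)))"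
    and "(\<integral>c. ln (cmod (a + b * c)) \<partial>circle_measure) = ln (max (cmod a) (cmod b))"
proof -
  obtain d e where de: "cmod d < 1" "e > 0" "e = max (cmod a) (cmod b)"
    and eq: "\<And>c. cmod c = 1 \<Longrightarrow> cmod (a + b * c) = e * cmod (1 + d * c)"
  proof (cases "cmod b < cmod a")
    case True
    then have "cmod (b / a) < 1" "cmod a > 0"
      by (auto simp: norm_divide divide_simps intro: le_less_trans[OF norm_ge_zero])
    moreover have "cmod (a + b * c) = cmod a * cmod (1 + b / a * c)" for c
      using \<open>cmod a > 0\<close> by (simp flip: norm_mult add: divide_simps)
    ultimately show ?thesis using True by (intro that[of "b / a" "cmod a"]) auto
  next
    case False
    then have less: "cmod a < cmod b" using assms by simp
    then have "b \<noteq> 0" by auto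
    have "cmod (cnj (a / b)) < 1" "cmod b > 0"
      using less \<open>b \<noteq> 0\<close> by (auto simp: norm_divide divide_simps)
    \<comment> \<open>Reflection in the unit circle, where \<open>1 / c = cnj c\<close>: conjugation
      does not change the modulus and moves the singularity outside the disk.\<close>
    moreover have "cmod (a + b * c) = cmod b * cmod (1 + cnj (a / b) * c)" if "cmod c = 1" for c
    proof -
      have "c * cnj c = 1" using that by (simp add: complex_norm_square[symmetric])
      then have "a + b * c = (b * c) * cnj (1 + cnj (a / b) * c)"
        using \<open>b \<noteq> 0\<close> by (simp add: field_simps)
      then show ?thesis
        using that by (simp only: norm_mult complex_mod_cnj)
    qed
    ultimately show ?thesis using less by (intro that[of "cnj (a / b)" "cmod b"]) auto
  qed
  have AE: "AE c in circle_measure. ln e + ln (cmod (1 + d * c)) = ln (cmod (a + b * c))"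
    using AE_circle_measure
  proof eventually_elim
    case (elim c)
    have "cmod (d * c) < 1" using elim de by (simp add: norm_mult)
    then have "1 + d * c \<noteq> 0" by (metis add_eq_0_iff norm_minus_cancel norm_one less_irrefl)
    then show ?case using elim de by (simp add: eq ln_mult)
  qed
  note * = circle_mean_ln_norm_one_plus[OF de(1)]
  have "integrable circle_measure (\<lambda>c. ln e + ln (cmod (1 + d * c)))"
    using * by auto
  then show "integrable circle_measure (\<lambda>c. ln (cmod (a + b * c)))"
    by (subst (asm) integrable_cong_AE[OF _ _ AE]) auto
  have "(\<integral>c. ln (cmod (a + b * c)) \<partial>circle_measure) = (\<integral>c. ln e + ln (cmod (1 + d * c)) \<partial>circle_measure)"
    using AE by (intro integral_cong_AE) auto
  also have "\<dots> = ln e"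
    using * circle.prob_space by simp
  finally show "(\<integral>c. ln (cmod (a + b * c)) \<partial>circle_measure) = ln (max (cmod a) (cmod b))"
    using de by simp
qed

text \<open>
  Both measures are translation invariant, so Fubini gives \<open>\<lambda>(A) \<lambda>'(B) = \<lambda>'(A) \<lambda>(B)\<close> for the
  unit ball \<open>B\<close>, whose measure is unchanged by the rotation.
\<close>

lemma distr_lborel_rotate:
  assumes c: "cmod c = 1"
  shows "distr lborel borel (\<lambda>z::complex. c * z) = lborel"
proof (rule measure_eqI)
  let ?L = "distr lborel borel (\<lambda>z::complex. c * z)"
  have "c \<noteq> 0" using c by auto
  fix A assume "A \<in> sets ?L"
  then have A[measurable]: "A \<in> sets borel" by simp
  define B where "B = ball (0::complex) 1"
  have [measurable]: "B \<in> sets borel" by (simp add: B_def)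
  have fin: "emeasure lborel B \<noteq> \<infinity>" "emeasure lborel B \<noteq> 0"
    by (simp_all add: B_def emeasure_ball unit_ball_vol_2)
  have "sigma_finite_measure ?L"
  proof
    let ?C = "range (\<lambda>n::nat. ball (0::complex) n)"
    have "emeasure ?L (ball 0 n) \<noteq> \<infinity>" for n :: nat
    proof -
      have "(\<lambda>z. c * z) -` ball 0 n = ball 0 n"
        using c by (auto simp: norm_mult)
      then show ?thesis
        by (subst emeasure_distr) (auto simp: emeasure_ball)
    qed
    moreover have "\<Union>?C = UNIV"
      by (auto simp: reals_Archimedean2)
    ultimately show "\<exists>A. countable A \<and> A \<subseteq> sets ?L \<and> \<Union>A = space ?L \<and> (\<forall>a\<in>A. emeasure ?L a \<noteq> \<infinity>)"
      by (intro exI[of _ ?C]) auto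
  qed
  then interpret L: sigma_finite_measure ?L .
  interpret P: pair_sigma_finite lborel ?L ..
  \<comment> \<open>Translation invariance of the rotated measure: moving by \<open>y\<close> after
    the rotation is moving by \<open>y / c\<close> before it.\<close>
  have *: "(\<integral>\<^sup>+x. indicator A (x + y) * indicator B x \<partial>?L) = (\<integral>\<^sup>+x. indicator A x * indicator B (x - y) \<partial>?L)" for y
  proof -
    have "(\<integral>\<^sup>+x. indicator A (x + y) * indicator B x \<partial>?L) = (\<integral>\<^sup>+x. indicator A (c * x + y) * indicator B (c * x) \<partial>lborel)"
      by (subst nn_integral_distr) auto
    also have "\<dots> = (\<integral>\<^sup>+x. indicator A (c * x + y) * indicator B (c * x) \<partial>distr lborel borel ((+) (- y / c)))"
      by (simp add: lborel_distr_plus)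
    also have "\<dots>
      = (\<integral>\<^sup>+x. indicator A (c * x) * indicator B (c * x - y) \<partial>lborel)"
      using \<open>c \<noteq> 0\<close> by (subst nn_integral_distr) (auto simp: right_diff_distrib)
    also have "\<dots> = (\<integral>\<^sup>+x. indicator A x * indicator B (x - y) \<partial>?L)"
      by (subst nn_integral_distr) auto
    finally show ?thesis .
  qed
  have eq: "emeasure lborel A * emeasure ?L B = emeasure ?L A * emeasure lborel B"
  proof -
    have "emeasure lborel A * emeasure ?L B = (\<integral>\<^sup>+x. emeasure lborel {y. y + x \<in> A} * indicator B x \<partial>?L)"
      by (simp add: emeasure_lborel_shift nn_integral_cmult)
    also have "\<dots> = (\<integral>\<^sup>+x. (\<integral>\<^sup>+y. indicator A (x + y) * indicator B x \<partial>lborel) \<partial>?L)"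
    proof (intro nn_integral_cong)
      fix x
      have "(\<integral>\<^sup>+y. indicator A (x + y) * indicator B x \<partial>lborel) = (\<integral>\<^sup>+y. indicator {y. y + x \<in> A} y \<partial>lborel) * indicator B x"
        by (subst nn_integral_multc[symmetric]) (auto intro!: nn_integral_cong simp: indicator_def add.commute)
      then show "emeasure lborel {y. y + x \<in> A} * indicator B x = (\<integral>\<^sup>+y. indicator A (x + y) * indicator B x \<partial>lborel)"
        by simp
    qed
    also have "\<dots> = (\<integral>\<^sup>+y. (\<integral>\<^sup>+x. indicator A (x + y) * indicator B x \<partial>?L) \<partial>lborel)"
      by (rule P.Fubini') measurable
    also have "\<dots> = (\<integral>\<^sup>+y. (\<integral>\<^sup>+x. indicator A x * indicator B (x - y) \<partial>?L) \<partial>lborel)"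
      by (simp only: *)
    also have "\<dots> = (\<integral>\<^sup>+x. (\<integral>\<^sup>+y. indicator A x * indicator B (x - y) \<partial>lborel) \<partial>?L)"
      by (rule P.Fubini'[symmetric]) measurable
    also have "\<dots> = (\<integral>\<^sup>+x. indicator A x * emeasure lborel B \<partial>?L)"
    proof (intro nn_integral_cong)
      fix x :: complex
      have [measurable]: "ball (x::complex) 1 \<in> sets borel" by simp
      have "(\<integral>\<^sup>+y. indicator A x * indicator B (x - y) \<partial>lborel) = indicator A x * (\<integral>\<^sup>+y. indicator (ball x 1) y \<partial>lborel)"
        by (subst nn_integral_cmult[symmetric])
           (auto intro!: nn_integral_cong simp: B_def indicator_def dist_norm norm_minus_commute)
      then show "(\<integral>\<^sup>+y. indicator A x * indicator B (x - y) \<partial>lborel) = indicator A x * emeasure lborel B"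
        by (simp add: B_def emeasure_ball)
    qed
    finally show ?thesis by (simp add: nn_integral_multc)
  qed
  have "(\<lambda>z. c * z) -` B = B" using c by (auto simp: B_def norm_mult)
  then have "emeasure ?L B = emeasure lborel B"
    by (subst emeasure_distr) auto
  with eq fin show "emeasure ?L A = emeasure lborel A"
    by (metis ennreal_mult_divide_eq infinity_ennreal_def)
qed simp

lemma integral_rotate:
  fixes g :: "complex \<Rightarrow> real"
  assumes "cmod c = 1" and [measurable]: "g \<in> borel_measurable borel"
  shows "(\<integral>z. g (c * z) \<partial>lborel) = (\<integral>z. g z \<partial>lborel)"
    and "integrable lborel g \<Longrightarrow> integrable lborel (\<lambda>z. g (c * z))"
proof -
  note d = distr_lborel_rotate[OF assms(1)]
  have "(\<integral>z. g z \<partial>distr lborel borel (\<lambda>z. c * z)) = (\<integral>z. g (c * z) \<partial>lborel)"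
    by (subst integral_distr) auto
  then show "(\<integral>z. g (c * z) \<partial>lborel) = (\<integral>z. g z \<partial>lborel)" by (simp add: d)
  show "integrable lborel (\<lambda>z. g (c * z))" if "integrable lborel g"
    using that by (subst (asm) d[symmetric], subst (asm) integrable_distr_eq) auto
qed

section \<open>Circle averages\<close>

text \<open>Layer cake: for z with 0 < |z| < 1, the value -ln |z| is at most the number of
  \<open>k\<close> with |z| < exp (- k), and the areas of these disks form a geometric series. At
  the origin \<open>ln 0 = 0\<close> gives the value 0.\<close>

lemma nn_integral_minus_ln_norm_finite:
  "(\<integral>\<^sup>+z. ennreal (max 0 (- ln (cmod z))) \<partial>lborel) < \<infinity>"
proof -
  have le: "ennreal (max 0 (- ln (cmod z))) \<le> (\<Sum>k. indicator (ball 0 (exp (- real k))) z)" for z :: complex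
  proof (cases "z = 0 \<or> cmod z \<ge> 1")
    case False
    then have z: "z \<noteq> 0" "cmod z < 1" by auto
    define x where "x = - ln (cmod z)"
    have "x > 0" using z by (simp add: x_def)
    define N where "N = nat \<lceil>x\<rceil>"
    have "ennreal (max 0 (- ln (cmod z))) \<le> ennreal (real N)"
      using \<open>x > 0\<close> unfolding x_def[symmetric] N_def by (intro ennreal_leI) (auto simp: max_def)
    also have "\<dots> = (\<Sum>k<N. 1)"
      by (simp add: ennreal_of_nat_eq_real_of_nat)
    also have "\<dots> = (\<Sum>k<N. indicator (ball 0 (exp (- real k))) z)"
    proof (intro sum.cong refl)
      fix k assume "k \<in> {..<N}"
      then have "real k < x" unfolding N_def by (simp, linarith)
      then have "ln (cmod z) < - real k" by (simp add: x_def)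
      then have "cmod z < exp (- real k)"
        using z by (metis exp_less_cancel_iff exp_ln zero_less_norm_iff)
      then show "1 = (indicator (ball 0 (exp (- real k))) z :: ennreal)"
        by (simp add: indicator_def)
    qed
    also have "\<dots> \<le> (\<Sum>k. indicator (ball 0 (exp (- real k))) z)"
      by (rule sum_le_suminf) auto
    finally show ?thesis .
  qed (auto simp: ennreal_neg ln_ge_zero)
  have "(\<integral>\<^sup>+z. ennreal (max 0 (- ln (cmod z))) \<partial>lborel)
      \<le> (\<integral>\<^sup>+z. (\<Sum>k. indicator (ball (0::complex) (exp (- real k))) z) \<partial>lborel)"
    by (intro nn_integral_mono le)
  also have "\<dots> = (\<Sum>k. emeasure lborel (ball (0::complex) (exp (- real k))))"
    by (subst nn_integral_suminf) (auto intro!: borel_measurable_indicator)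
  also have "\<dots> = (\<Sum>k. ennreal (pi * (exp (-2)) ^ k))"
    by (intro suminf_cong) (simp add: emeasure_ball unit_ball_vol_2 exp_of_nat_mult[symmetric] power2_eq_square exp_add[symmetric] algebra_simps)
  also have "\<dots> < \<infinity>"
  proof -
    have "summable (\<lambda>k. pi * exp (-2) ^ k)"
      by (intro summable_mult summable_geometric) auto
    then have "(\<Sum>k. ennreal (pi * (exp (-2)) ^ k)) = ennreal (\<Sum>k. pi * exp (-2) ^ k)"
      by (intro suminf_ennreal2) auto
    then show ?thesis by simp
  qed
  finally show ?thesis .
qed

lemma AE_norm_diff_ne: "AE z in (lborel :: complex measure). cmod (z - w) \<noteq> r"
proof -
  have "sphere w r \<in> null_sets lborel"
    using negligible_sphere[of w r] by (simp add: negligible_iff_null_sets null_sets_completion_iff)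
  then have "AE z in lborel. z \<notin> sphere w r" by (rule AE_not_in)
  then show ?thesis by (auto simp: dist_norm norm_minus_commute elim: eventually_mono)
qed

lemma AE_norm_ne: "AE z in (lborel :: complex measure). cmod z \<noteq> r"
  using AE_norm_diff_ne[of 0 r] by simp

lemma integrable_indicator_ball:
  "integrable lborel (\<lambda>z::complex. indicator (ball p \<rho>) z :: real)"
  using emeasure_bounded_finite[OF bounded_ball[of p \<rho>]] by (intro integrable_real_indicator) auto

lemma integrable_ball_continuous:
  fixes h :: "complex \<Rightarrow> real"
  assumes "continuous_on (cball 0 \<rho>) h"
  shows "integrable lborel (\<lambda>z. indicator (ball 0 \<rho>) z * h z)"
proof -
  have "integrable lborel (\<lambda>z. indicator (cball 0 \<rho>) z *\<^sub>R h z)"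
    using borel_integrable_compact[OF compact_cball assms] by (simp add: indicator_scaleR_eq_if)
  from integrable_mult_indicator[OF _ this, of "ball 0 \<rho>"]
  have "integrable lborel (\<lambda>z. indicator (ball 0 \<rho>) z * (indicator (cball 0 \<rho>) z * h z))" by simp
  also have "(\<lambda>z. indicator (ball 0 \<rho>) z * (indicator (cball 0 \<rho>) z * h z)) = (\<lambda>z. indicator (ball 0 \<rho>) z * h z)"
    by (auto simp: fun_eq_iff indicator_def)
  finally show ?thesis .
qed

lemma integrable_ln_norm:
  "integrable lborel (\<lambda>z::complex. indicator (ball p R) z * ln (cmod (z - w)))"
proof -
  have [measurable]: "ball p R \<in> sets borel" by simp
  define M where "M = max 0 (ln (\<bar>R\<bar> + cmod (p - w)))"
  have "integrable lborel (\<lambda>z::complex. max 0 (- ln (cmod z)))"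
    using nn_integral_minus_ln_norm_finite by (intro integrableI_bounded) auto
  then have "integrable (distr lborel borel ((+) (-w))) (\<lambda>z::complex. max 0 (- ln (cmod z)))"
    by (simp add: lborel_distr_plus)
  then have *: "integrable lborel (\<lambda>z::complex. max 0 (- ln (cmod (z - w))))"
    by (subst (asm) integrable_distr_eq) auto
  have **: "integrable lborel (\<lambda>z::complex. indicator (ball p R) z * M)"
    by (intro integrable_mult_left integrable_real_indicator) (use emeasure_bounded_finite[OF bounded_ball[of p R]] in auto)
  show ?thesis
  proof (rule Bochner_Integration.integrable_bound[OF Bochner_Integration.integrable_add[OF * **]])
    show "AE z in lborel. norm (indicator (ball p R) z * ln (cmod (z - w)))
        \<le> norm (max 0 (- ln (cmod (z - w))) + indicator (ball p R) z * M)"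
    proof (intro AE_I2)
      fix z
      have "\<bar>ln (cmod (z - w))\<bar> \<le> max 0 (- ln (cmod (z - w))) + M" if "z \<in> ball p R"
      proof (cases "z = w")
        case False
        have "cmod (z - w) \<le> \<bar>R\<bar> + cmod (p - w)"
          using that norm_triangle_ineq[of "z - p" "p - w"] by (simp add: dist_norm norm_minus_commute)
        then have "ln (cmod (z - w)) \<le> ln (\<bar>R\<bar> + cmod (p - w))"
          using False by (subst ln_le_cancel_iff) (auto intro: less_le_trans[of _ "cmod (z - w)"])
        then show ?thesis by (auto simp: M_def)
      qed (auto simp: M_def)
      then show "norm (indicator (ball p R) z * ln (cmod (z - w)))
        \<le> norm (max 0 (- ln (cmod (z - w))) + indicator (ball p R) z * M)"
        by (auto simp: indicator_def M_def)
    qed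
  qed measurable
qed

text \<open>Convolution with the uniform law on a circle; the minus sign becomes a plus when the
  average is moved to the other factor of an integral.\<close>

definition circle_avg :: "real \<Rightarrow> (complex \<Rightarrow> real) \<Rightarrow> complex \<Rightarrow> real" where
  "circle_avg r \<phi> z = (\<integral>c. \<phi> (z - of_real r * c) \<partial>circle_measure)"

lemma borel_measurable_circle_avg [measurable]:
  assumes [measurable]: "\<phi> \<in> borel_measurable borel"
  shows "circle_avg r \<phi> \<in> borel_measurable borel"
  unfolding circle_avg_def[abs_def] by measurable

lemma circle_avg_bound:
  assumes "\<phi> \<in> borel_measurable borel" "\<And>z. \<bar>\<phi> z\<bar> \<le> B"
  shows "\<bar>circle_avg r \<phi> z\<bar> \<le> B"
proof -
  have "norm (circle_avg r \<phi> z) \<le> (\<integral>c. norm (\<phi> (z - of_real r * c)) \<partial>circle_measure)"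
    unfolding circle_avg_def by (rule integral_norm_bound)
  also have "\<dots> \<le> (\<integral>c. B \<partial>circle_measure)"
    using assms order_trans[OF abs_ge_zero assms(2)]
    by (intro integral_mono circle.integrable_const_bound[where B=B]) auto
  finally show ?thesis using circle.prob_space by simp
qed

lemma circle_avg_eq_0:
  assumes "\<And>z. cmod z > a \<Longrightarrow> \<phi> z = 0" "cmod z > a + r" "r \<ge> 0"
  shows "circle_avg r \<phi> z = 0"
proof -
  have "AE c in circle_measure. \<phi> (z - of_real r * c) = 0"
    using AE_circle_measure
  proof eventually_elim
    case (elim c)
    have "cmod z - cmod (of_real r * c) \<le> cmod (z - of_real r * c)" by (rule norm_triangle_ineq2)
    then show ?case using assms elim by (intro assms(1)) (simp add: norm_mult)
  qed
  then show ?thesis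
    unfolding circle_avg_def by (rule integral_eq_zero_AE)
qed

text \<open>The form in which Fubini's hypothesis is met below: a bounded kernel times an integrable
  function of one variable, the other variable ranging over a finite measure.\<close>

lemma integrable_pair_bounded_left:
  fixes g :: "'a \<times> 'b \<Rightarrow> real" and v :: "'a \<Rightarrow> real"
  assumes "pair_sigma_finite M N" "finite_measure N" "integrable M v"
    and [measurable]: "g \<in> borel_measurable (M \<Otimes>\<^sub>M N)" and "\<And>x. \<bar>g x\<bar> \<le> B"
  shows "integrable (M \<Otimes>\<^sub>M N) (\<lambda>(x, y). g (x, y) * v x)"
proof -
  interpret pair_sigma_finite M N by fact
  interpret N: finite_measure N by fact
  have [measurable]: "v \<in> borel_measurable M" using assms(3) by auto
  show ?thesis
  proof (rule Fubini_integrable)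
    have *: "norm (\<integral>y. norm (case (x, y) of (x, y) \<Rightarrow> g (x, y) * v x) \<partial>N) \<le> norm (B * measure N (space N) * v x)"
      if "x \<in> space M" for x
    proof -
      have "B \<ge> 0" using order_trans[OF abs_ge_zero assms(5)] .
      have [measurable]: "(\<lambda>y. g (x, y)) \<in> borel_measurable N" using that by measurable
      have "(\<integral>y. norm (case (x, y) of (x, y) \<Rightarrow> g (x, y) * v x) \<partial>N) \<le> (\<integral>y. B * \<bar>v x\<bar> \<partial>N)"
        using assms(5) \<open>B \<ge> 0\<close>
        by (intro integral_mono N.integrable_const_bound[where B="B * \<bar>v x\<bar>"])
           (auto simp: abs_mult intro!: mult_right_mono)
      then show ?thesis
        using \<open>B \<ge> 0\<close> by (simp add: abs_mult mult_ac)
    qed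
    show "integrable M (\<lambda>x. \<integral>y. norm (case (x, y) of (x, y) \<Rightarrow> g (x, y) * v x) \<partial>N)"
      by (rule Bochner_Integration.integrable_bound[OF integrable_mult_right[OF assms(3), of "B * measure N (space N)"]])
         (use * in auto)
    show "AE x in M. integrable N (\<lambda>y. case (x, y) of (x, y) \<Rightarrow> g (x, y) * v x)"
    proof (intro AE_I2)
      fix x assume "x \<in> space M"
      then have [measurable]: "(\<lambda>y. g (x, y)) \<in> borel_measurable N" by measurable
      show "integrable N (\<lambda>y. case (x, y) of (x, y) \<Rightarrow> g (x, y) * v x)"
        using assms(5) by (auto intro!: integrable_mult_left N.integrable_const_bound[where B=B])
    qed
  qed measurable
qed

lemma lborel_integral_shift:
  fixes f :: "'a::euclidean_space \<Rightarrow> 'b::{banach,second_countable_topology}"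
  assumes [measurable]: "f \<in> borel_measurable borel"
  shows "(\<integral>x. f (x + t) \<partial>lborel) = (\<integral>x. f x \<partial>lborel)"
proof -
  have "(\<integral>x. f x \<partial>lborel) = (\<integral>x. f x \<partial>distr lborel borel ((+) t))"
    by (simp add: lborel_distr_plus)
  also have "\<dots> = (\<integral>x. f (x + t) \<partial>lborel)"
    by (subst integral_distr) (auto simp: add.commute)
  finally show ?thesis ..
qed

lemma lborel_integrable_shift:
  fixes f :: "'a::euclidean_space \<Rightarrow> 'b::{banach,second_countable_topology}"
  assumes "integrable lborel f"
  shows "integrable lborel (\<lambda>x. f (x + t))"
proof -
  have "integrable (distr lborel borel ((+) t)) f"
    using assms by (simp add: lborel_distr_plus)
  then show ?thesis
    by (subst (asm) integrable_distr_eq) (use assms in \<open>auto simp: add.commute\<close>)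
qed

lemma pair_sigma_finite_circle:
  "pair_sigma_finite (lborel :: complex measure) circle_measure"
  "pair_sigma_finite circle_measure (lborel :: complex measure)"
  by (intro pair_sigma_finite.intro circle.sigma_finite_measure_axioms lborel.sigma_finite_measure_axioms)+

text \<open>The average is moved from \<open>\<phi>\<close> to \<open>v\<close> by exchanging the
  integrals, translating in \<open>z\<close> at fixed \<open>c\<close>, and exchanging back. Hence
  integrability is checked on both products, before and after the translation.\<close>

lemma circle_avg_fubini:
  assumes [measurable]: "\<phi> \<in> borel_measurable borel" and B: "\<And>z. \<bar>\<phi> z\<bar> \<le> B"
    and v: "integrable lborel v"
  shows "integrable lborel (\<lambda>z. circle_avg r \<phi> z * v z)"
    and "(\<integral>z. circle_avg r \<phi> z * v z \<partial>lborel) = (\<integral>z. \<phi> z * (\<integral>c. v (z + of_real r * c) \<partial>circle_measure) \<partial>lborel)"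
proof -
  have [measurable]: "v \<in> borel_measurable borel" using v by auto
  interpret A: pair_sigma_finite "lborel :: complex measure" circle_measure by (rule pair_sigma_finite_circle)
  interpret C: pair_sigma_finite circle_measure "lborel :: complex measure" by (rule pair_sigma_finite_circle)
  have i1: "integrable (lborel \<Otimes>\<^sub>M circle_measure) (\<lambda>(z, c). \<phi> (z - of_real r * c) * v z)"
    using integrable_pair_bounded_left[OF pair_sigma_finite_circle(1) circle.finite_measure_axioms v,
      of "\<lambda>(z, c). \<phi> (z - of_real r * c)" B] by (simp add: split_beta B)
  show "integrable lborel (\<lambda>z. circle_avg r \<phi> z * v z)"
    using circle_avg_bound[OF _ B]
    by (intro Bochner_Integration.integrable_bound[OF integrable_mult_right[OF v, of B]] AE_I2)
       (auto simp: abs_mult intro!: mult_right_mono order_trans[OF circle_avg_bound[OF _ B] abs_ge_self])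
  have i2: "integrable (circle_measure \<Otimes>\<^sub>M lborel) (\<lambda>(c, z). \<phi> z * v (z + of_real r * c))"
  proof (rule C.Fubini_integrable)
    have *: "integrable lborel (\<lambda>z. v (z + of_real r * c))" for c
      by (rule lborel_integrable_shift[OF v])
    have **: "integrable lborel (\<lambda>z. \<phi> z * v (z + of_real r * c))" for c
      by (intro Bochner_Integration.integrable_bound[OF integrable_mult_right[OF *, of B]] AE_I2)
         (auto simp: abs_mult intro!: mult_right_mono order_trans[OF B abs_ge_self])
    then show "AE x in circle_measure. integrable lborel (\<lambda>y. case (x, y) of (c, z) \<Rightarrow> \<phi> z * v (z + of_real r * c))"
      by simp
    have "\<bar>\<integral>y. norm (case (x, y) of (c, z) \<Rightarrow> \<phi> z * v (z + of_real r * c)) \<partial>lborel\<bar> \<le> B * (\<integral>z. \<bar>v z\<bar> \<partial>lborel)" for x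
    proof -
      have "(\<integral>z. \<bar>\<phi> z * v (z + of_real r * x)\<bar> \<partial>lborel) \<le> (\<integral>z. B * \<bar>v (z + of_real r * x)\<bar> \<partial>lborel)"
        using integrable_norm[OF **, of x] integrable_norm[OF *, of x]
        by (intro integral_mono) (auto simp: abs_mult intro!: mult_right_mono B)
      also have "\<dots> = B * (\<integral>z. \<bar>v z\<bar> \<partial>lborel)"
        by (simp add: lborel_integral_shift[of "\<lambda>z. \<bar>v z\<bar>"])
      finally show ?thesis by (simp add: abs_of_nonneg)
    qed
    then show "integrable circle_measure (\<lambda>x. \<integral>y. norm (case (x, y) of (c, z) \<Rightarrow> \<phi> z * v (z + of_real r * c)) \<partial>lborel)"
      by (intro circle.integrable_const_bound[where B="B * (\<integral>z. \<bar>v z\<bar> \<partial>lborel)"]) auto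
  qed measurable
  have "(\<integral>z. circle_avg r \<phi> z * v z \<partial>lborel) = (\<integral>z. (\<integral>c. \<phi> (z - of_real r * c) * v z \<partial>circle_measure) \<partial>lborel)"
    by (simp add: circle_avg_def)
  also have "\<dots> = (\<integral>c. (\<integral>z. \<phi> (z - of_real r * c) * v z \<partial>lborel) \<partial>circle_measure)"
    by (rule A.Fubini_integral[OF i1, symmetric])
  also have "\<dots> = (\<integral>c. (\<integral>z. \<phi> z * v (z + of_real r * c) \<partial>lborel) \<partial>circle_measure)"
  proof (rule Bochner_Integration.integral_cong[OF refl])
    fix c
    show "(\<integral>z. \<phi> (z - of_real r * c) * v z \<partial>lborel) = (\<integral>z. \<phi> z * v (z + of_real r * c) \<partial>lborel)"
      using lborel_integral_shift[of "\<lambda>z. \<phi> (z - of_real r * c) * v z" "of_real r * c"] by simp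
  qed
  also have "\<dots> = (\<integral>z. (\<integral>c. \<phi> z * v (z + of_real r * c) \<partial>circle_measure) \<partial>lborel)"
    by (rule C.Fubini_integral[OF i2, symmetric])
  finally show "(\<integral>z. circle_avg r \<phi> z * v z \<partial>lborel) = (\<integral>z. \<phi> z * (\<integral>c. v (z + of_real r * c) \<partial>circle_measure) \<partial>lborel)"
    by simp
qed

section \<open>Logarithmic potentials and their zeros\<close>

text \<open>By Jensen, \<open>ln (max (cmod w) t)\<close> is the mean of ln |w + t c| over the unit
  circle; the kernel compares the radii \<open>r\<close> and \<open>r / 2\<close>. Keeping the
  smaller radius positive bounds it by \<open>ln 2\<close>, also at the origin.\<close>

definition radial_kernel :: "real \<Rightarrow> complex \<Rightarrow> real" where
  "radial_kernel r w = ln (max (cmod w) r) - ln (max (cmod w) (r / 2))"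

lemma radial_kernel_nonneg: "r > 0 \<Longrightarrow> radial_kernel r w \<ge> 0"
  unfolding radial_kernel_def diff_ge_0_iff_ge by (subst ln_le_cancel_iff) (auto simp: max_def)

lemma radial_kernel_le: "r > 0 \<Longrightarrow> radial_kernel r w \<le> ln 2"
proof -
  assume r: "r > 0"
  have "ln (max (cmod w) r) \<le> ln (2 * max (cmod w) (r / 2))"
    using r by (subst ln_le_cancel_iff) (auto simp: max_def)
  also have "\<dots> = ln 2 + ln (max (cmod w) (r / 2))"
    using r by (subst ln_mult) (auto simp: max_def)
  finally show ?thesis by (simp add: radial_kernel_def)
qed

lemma radial_kernel_eq_0: "r > 0 \<Longrightarrow> cmod w \<ge> r \<Longrightarrow> radial_kernel r w = 0"
  by (auto simp: radial_kernel_def max_def)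

lemma measurable_radial_kernel [measurable]: "radial_kernel r \<in> borel_measurable borel"
  unfolding radial_kernel_def[abs_def] by measurable

lemma integrable_radial_kernel: "r > 0 \<Longrightarrow> integrable lborel (radial_kernel r)"
proof -
  assume r: "r > 0"
  have "integrable lborel (\<lambda>w::complex. indicator (ball 0 r) w * ln 2 :: real)"
    by (intro integrable_mult_left integrable_real_indicator) (use emeasure_bounded_finite[OF bounded_ball[of "0::complex" r]] in auto)
  then show ?thesis
  proof (rule Bochner_Integration.integrable_bound)
    show "AE w in lborel. norm (radial_kernel r w) \<le> norm (indicator (ball 0 r) w * ln 2 :: real)"
      using radial_kernel_nonneg[OF r] radial_kernel_le[OF r] radial_kernel_eq_0[OF r]
      by (intro AE_I2) (auto simp: indicator_def)
  qed simp
qed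

text \<open>On the ball of radius \<open>r / 2\<close> the kernel is the constant
  \<open>ln 2\<close>.\<close>

lemma integral_radial_kernel_pos:
  assumes r: "r > 0"
  shows "(\<integral>w. radial_kernel r w \<partial>lborel) > 0"
proof -
  have "0 < ln 2 * measure lborel (ball (0::complex) (r / 2))"
    using r by simp
  also have "\<dots> = (\<integral>w. indicator (ball (0::complex) (r / 2)) w * ln 2 \<partial>lborel)"
    by simp
  also have "\<dots> \<le> (\<integral>w. radial_kernel r w \<partial>lborel)"
  proof (intro integral_mono integrable_radial_kernel r)
    show "integrable lborel (\<lambda>w::complex. indicator (ball 0 (r / 2)) w * ln 2 :: real)"
      by (intro integrable_mult_left integrable_real_indicator) (use emeasure_bounded_finite[OF bounded_ball[of "0::complex" "r/2"]] in auto)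
    show "indicator (ball 0 (r / 2)) w * ln 2 \<le> radial_kernel r w" for w
      using r radial_kernel_nonneg[OF r, of w]
      by (auto simp: indicator_def radial_kernel_def max_def ln_div)
  qed
  finally show ?thesis .
qed

text \<open>The quotient of \<open>G\<close> by a polynomial with the same zeros is zero-free on a
  ball, hence an exponential, and the real part of its logarithm is harmonic. A closed ball inside
  \<open>D\<close> contains only finitely many zeros: by compactness they would otherwise accumulate
  in \<open>D\<close>.\<close>

lemma nonzero_zero_free_factorization:
  assumes "G holomorphic_on D" "open D" "connected D" "cball p \<rho> \<subseteq> D" "z0 \<in> D" "G z0 \<noteq> 0"
  obtains H where "H \<in> borel_measurable borel" "H holomorphic_on ball p \<rho>"
    "finite {w \<in> cball p \<rho>. G w = 0}"
    "\<And>z. z \<in> ball p \<rho> \<Longrightarrow> G z \<noteq> 0 \<Longrightarrow>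
      ln (cmod (G z)) = Re (H z) + (\<Sum>w\<in>{w\<in>ball p \<rho>. G w = 0}. real_of_int (zorder G w) * ln (cmod (z - w)))"
proof -
  define Z where "Z = {w\<in>ball p \<rho>. G w = 0}"
  have fin: "finite {w \<in> cball p \<rho>. G w = 0}"
  proof (rule ccontr)
    assume inf: "infinite {w \<in> cball p \<rho>. G w = 0}"
    then have "\<exists>x\<in>cball p \<rho>. x islimpt {w \<in> cball p \<rho>. G w = 0}"
      using compact_cball[of p \<rho>] unfolding compact_eq_Bolzano_Weierstrass by auto
    then obtain x where x: "x \<in> cball p \<rho>" "x islimpt {w \<in> cball p \<rho>. G w = 0}" by blast
    have "G z0 = 0"
      by (rule analytic_continuation[OF assms(1-3) _ _ x(2)]) (use assms x in auto)
    then show False using assms by simp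
  qed
  then have finZ: "finite Z" unfolding Z_def by (rule rev_finite_subset) auto
  have sub: "ball p \<rho> \<subseteq> D" using assms(4) ball_subset_cball by blast
  have ana: "G analytic_on {z}" if "z \<in> D" for z
    using assms that analytic_at by blast
  have iso: "\<forall>\<^sub>F w in at z. G w \<noteq> 0" if "z \<in> D" for z
    using non_zero_neighbour_alt[OF assms(1-3) that assms(5,6)] by (auto elim: eventually_mono)
  have frequ: "\<exists>\<^sub>F w in at z. G w \<noteq> 0" if "z \<in> D" for z
    using iso[OF that] by (intro eventually_frequently) auto
  define m where "m w = nat (zorder G w)" for w
  have m: "zorder G w = int (m w)" if "w \<in> D" for w
    using zorder_ge_0[OF ana[OF that] frequ[OF that]] by (simp add: m_def)
  define P where "P z = (\<Prod>w\<in>Z. (z - w) ^ m w)" for z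
  \<comment> \<open>The quotient extends without zeros only if the orders agree at every point of
    the ball; at \<open>z\<close> only the factor with \<open>w = z\<close> contributes.\<close>
  have zo: "zorder P z = zorder G z" if "z \<in> ball p \<rho>" for z
  proof -
    have "zorder P z = (\<Sum>w\<in>Z. zorder (\<lambda>x. (x - w) ^ m w) z)"
      unfolding P_def[abs_def]
    proof (rule zorder_prod_analytic)
      fix w
      have "\<forall>\<^sub>F x in at z. x \<noteq> w"
        by (rule eventually_neq_at_within)
      then show "\<forall>\<^sub>F x in at z. (\<Prod>w\<in>Z. (x - w) ^ m w) \<noteq> 0"
      proof -
        have "\<forall>\<^sub>F x in at z. \<forall>w\<in>Z. x \<noteq> w"
          using finZ by (intro eventually_ball_finite ballI eventually_neq_at_within)
        then show ?thesis
          by eventually_elim (use finZ in auto)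
      qed
    qed (auto intro!: analytic_intros)
    also have "\<dots> = (\<Sum>w\<in>Z. if w = z then int (m w) else 0)"
    proof (intro sum.cong refl)
      fix w assume "w \<in> Z"
      show "zorder (\<lambda>x. (x - w) ^ m w) z = (if w = z then int (m w) else 0)"
      proof (cases "w = z")
        case True
        have "zorder (\<lambda>x. (x - z) ^ m z) z = int (m z)"
          by (rule zorder_eqI[of UNIV _ "\<lambda>_. 1"]) auto
        with True show ?thesis by simp
      next
        case False
        have "zorder (\<lambda>x. (x - w) ^ m w) z = 0"
          by (rule zorder_eq_0I) (use False in \<open>auto intro!: analytic_intros\<close>)
        with False show ?thesis by simp
      qed
    qed
    also have "\<dots> = (if z \<in> Z then int (m z) else 0)"
      using finZ by simp
    also have "\<dots> = zorder G z"
    proof (cases "z \<in> Z")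
      case False
      then have "G z \<noteq> 0" using that by (simp add: Z_def)
      then have "zorder G z = 0" using that sub ana by (intro zorder_eq_0I) auto
      then show ?thesis using False by simp
    qed (use m that sub in auto)
    finally show ?thesis .
  qed
  have mpos: "m w > 0" if "w \<in> Z" for w
  proof -
    have "w \<in> D" "G w = 0" using that sub by (auto simp: Z_def)
    then have "zorder G w > 0"
      using zorder_pos_iff'[OF ana frequ] by simp
    then show ?thesis using m[OF \<open>w \<in> D\<close>] by simp
  qed
  obtain h where h: "h holomorphic_on ball p \<rho>" "\<And>z. z \<in> ball p \<rho> \<Longrightarrow> h z \<noteq> 0"
      "\<And>z. z \<in> ball p \<rho> \<Longrightarrow> G z = h z * P z"
  proof (rule holomorphic_zorder_factorization[of G "ball p \<rho>" P])
    show "G holomorphic_on ball p \<rho>" using assms sub holomorphic_on_subset by blast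
    show "P holomorphic_on ball p \<rho>" unfolding P_def[abs_def] by (intro holomorphic_intros)
    fix z assume z: "z \<in> ball p \<rho>"
    show "P z = 0 \<longleftrightarrow> G z = 0"
      using z finZ mpos by (auto simp: P_def Z_def)
    show "zorder P z = zorder G z" using z by (rule zo)
  qed (use that in auto)
  obtain g where g: "g holomorphic_on ball p \<rho>" "\<And>z. z \<in> ball p \<rho> \<Longrightarrow> h z = exp (g z)"
    using holomorphic_logarithm_exists[of "ball p \<rho>" h] h
    by (metis convex_ball open_ball contractible_imp_simply_connected convex_imp_contractible simply_connected_eq_holomorphic_log)
  \<comment> \<open>Extension by zero turns local holomorphy into Borel measurability on the
    plane.\<close>
  define H where "H z = indicator (ball p \<rho>) z *\<^sub>R g z" for z
  show ?thesis
  proof (rule that[of H])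
    show "H \<in> borel_measurable borel"
      unfolding H_def[abs_def]
      by (intro borel_measurable_continuous_on_indicator holomorphic_on_imp_continuous_on g) auto
    show "H holomorphic_on ball p \<rho>"
      by (rule holomorphic_transform[OF g(1)]) (auto simp: H_def)
    show "finite {w \<in> cball p \<rho>. G w = 0}" by fact
    fix z assume z: "z \<in> ball p \<rho>" "G z \<noteq> 0"
    have "ln (cmod (G z)) = ln (exp (Re (g z)) * (\<Prod>w\<in>Z. cmod (z - w) ^ m w))"
      using h g z by (simp add: P_def norm_mult prod_norm[symmetric] norm_power)
    also have "\<dots> = Re (g z) + (\<Sum>w\<in>Z. ln (cmod (z - w) ^ m w))"
    proof -
      have "z \<noteq> w" if "w \<in> Z" for w using that z by (auto simp: Z_def)
      then have pos: "cmod (z - w) ^ m w > 0" if "w \<in> Z" for w using that by simp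
      have "ln (\<Prod>w\<in>Z. cmod (z - w) ^ m w) = (\<Sum>w\<in>Z. ln (cmod (z - w) ^ m w))"
        using finZ \<open>\<And>w. w \<in> Z \<Longrightarrow> z \<noteq> w\<close> by (intro ln_prod) auto
      moreover have "(\<Prod>w\<in>Z. cmod (z - w) ^ m w) > 0"
        using pos by (intro prod_pos) auto
      ultimately show ?thesis
        using ln_mult[of "exp (Re (g z))" "\<Prod>w\<in>Z. cmod (z - w) ^ m w"] by simp
    qed
    also have "(\<Sum>w\<in>Z. ln (cmod (z - w) ^ m w)) = (\<Sum>w\<in>Z. real_of_int (zorder G w) * ln (cmod (z - w)))"
      using z m sub by (intro sum.cong refl) (auto simp: Z_def ln_realpow)
    finally show "ln (cmod (G z)) = Re (H z) + (\<Sum>w\<in>{w\<in>ball p \<rho>. G w = 0}. real_of_int (zorder G w) * ln (cmod (z - w)))"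
      using z by (simp add: H_def Z_def)
  qed
qed

section \<open>Logarithmic potentials of finitely many points\<close>

locale log_potential =
  fixes H :: "complex \<Rightarrow> complex" and p0 :: complex and \<rho> :: real
    and Z :: "complex set" and m :: "complex \<Rightarrow> real"
  assumes H_measurable [measurable]: "H \<in> borel_measurable borel"
    and H_holomorphic: "H holomorphic_on ball p0 \<rho>"
    and finite_Z: "finite Z" and m_nonneg: "\<And>w. w \<in> Z \<Longrightarrow> m w \<ge> 0"
begin

text \<open>Serves twice: with the zeros of a holomorphic function, and with a single point and
  \<open>H = 0\<close> when a measure with a radial profile is treated.\<close>

definition pot :: "complex \<Rightarrow> real" where
  "pot z = Re (H z) + (\<Sum>w\<in>Z. m w * ln (cmod (z - w)))"

lemma pot_measurable [measurable]: "pot \<in> borel_measurable borel"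
  unfolding pot_def[abs_def] by measurable

lemma circle_mean_pot:
  assumes b: "dist p0 p + cmod b < \<rho>" and ne: "\<And>w. w \<in> Z \<Longrightarrow> cmod (p - w) \<noteq> cmod b"
  shows "integrable circle_measure (\<lambda>c. pot (p + b * c))"
    and "(\<integral>c. pot (p + b * c) \<partial>circle_measure) = Re (H p) + (\<Sum>w\<in>Z. m w * ln (max (cmod (p - w)) (cmod b)))"
proof -
  have "H holomorphic_on ball p (\<rho> - dist p0 p)"
  proof (rule holomorphic_on_subset[OF H_holomorphic])
    show "ball p (\<rho> - dist p0 p) \<subseteq> ball p0 \<rho>"
    proof
      fix x assume "x \<in> ball p (\<rho> - dist p0 p)"
      then show "x \<in> ball p0 \<rho>" using dist_triangle[of p0 x p] by auto
    qed
  qed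
  note H = circle_mean_value[OF this, of b]
  have Hb: "cmod b < \<rho> - dist p0 p" using b by simp
  have m: "(\<lambda>c. H (p + b * c)) \<in> borel_measurable borel" by measurable
  note H = H[OF Hb m]
  have eq: "p + b * c - w = (p - w) + b * c" for c w by simp
  have i: "integrable circle_measure (\<lambda>c. Re (H (p + b * c)))" using H(1) by (rule integrable_Re)
  have j: "integrable circle_measure (\<lambda>c. m w * ln (cmod (p + b * c - w)))" if "w \<in> Z" for w
    unfolding eq using circle_mean_ln_norm(1)[OF ne[OF that]] by simp
  show "integrable circle_measure (\<lambda>c. pot (p + b * c))"
    unfolding pot_def using i j by (intro Bochner_Integration.integrable_add Bochner_Integration.integrable_sum) auto
  have "(\<integral>c. pot (p + b * c) \<partial>circle_measure) = (\<integral>c. Re (H (p + b * c)) \<partial>circle_measure)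
      + (\<Sum>w\<in>Z. \<integral>c. m w * ln (cmod (p + b * c - w)) \<partial>circle_measure)"
    unfolding pot_def using i j
    by (subst Bochner_Integration.integral_add) (auto intro!: Bochner_Integration.integrable_sum Bochner_Integration.integral_sum)
  also have "(\<integral>c. Re (H (p + b * c)) \<partial>circle_measure) = Re (H p)"
    using H by (simp add: integral_Re)
  also have "(\<Sum>w\<in>Z. \<integral>c. m w * ln (cmod (p + b * c - w)) \<partial>circle_measure) = (\<Sum>w\<in>Z. m w * ln (max (cmod (p - w)) (cmod b)))"
    unfolding eq by (intro sum.cong refl) (simp add: circle_mean_ln_norm(2)[OF ne])
  finally show "(\<integral>c. pot (p + b * c) \<partial>circle_measure) = Re (H p) + (\<Sum>w\<in>Z. m w * ln (max (cmod (p - w)) (cmod b)))" .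
qed

text \<open>The strictly smaller radius gives a compact disk, on which \<open>H\<close> is
  bounded.\<close>

lemma integrable_pot:
  assumes "\<rho>' < \<rho>"
  shows "integrable lborel (\<lambda>z. indicator (ball p0 \<rho>') z * pot z)"
proof -
  have [measurable]: "ball p0 \<rho>' \<in> sets borel" by simp
  have "cball p0 \<rho>' \<subseteq> ball p0 \<rho>" using assms by auto
  then have "continuous_on (cball p0 \<rho>') H"
    using H_holomorphic holomorphic_on_imp_continuous_on continuous_on_subset by blast
  then have "bounded (H ` cball p0 \<rho>')"
    by (intro compact_imp_bounded compact_continuous_image) auto
  then obtain B where "\<forall>y\<in>H ` cball p0 \<rho>'. norm y \<le> B"
    unfolding bounded_iff by blast
  then have B: "\<And>z. z \<in> cball p0 \<rho>' \<Longrightarrow> cmod (H z) \<le> B" by blast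
  have "integrable lborel (\<lambda>z. indicator (ball p0 \<rho>') z * B)"
    by (intro integrable_mult_left integrable_real_indicator) (use emeasure_bounded_finite[OF bounded_ball[of p0 \<rho>']] in auto)
  then have "integrable lborel (\<lambda>z. indicator (ball p0 \<rho>') z * Re (H z))"
  proof (rule Bochner_Integration.integrable_bound)
    show "AE z in lborel. norm (indicator (ball p0 \<rho>') z * Re (H z)) \<le> norm (indicator (ball p0 \<rho>') z * B)"
    proof (intro AE_I2)
      fix z
      show "norm (indicator (ball p0 \<rho>') z * Re (H z)) \<le> norm (indicator (ball p0 \<rho>') z * B)"
        using B[of z] abs_Re_le_cmod[of "H z"] by (cases "z \<in> ball p0 \<rho>'") auto
    qed
  qed measurable
  moreover have "integrable lborel (\<lambda>z. \<Sum>w\<in>Z. m w * (indicator (ball p0 \<rho>') z * ln (cmod (z - w))))"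
    by (intro Bochner_Integration.integrable_sum integrable_mult_right integrable_ln_norm)
  ultimately have "integrable lborel (\<lambda>z. indicator (ball p0 \<rho>') z * Re (H z) + (\<Sum>w\<in>Z. m w * (indicator (ball p0 \<rho>') z * ln (cmod (z - w)))))"
    by (rule Bochner_Integration.integrable_add)
  then show ?thesis
    by (simp add: pot_def distrib_left sum_distrib_left mult_ac)
qed

lemma AE_dist_ne: "AE z in lborel. \<forall>w\<in>Z. cmod (z - w) \<noteq> r"
  using finite_Z AE_norm_diff_ne by (simp add: AE_finite_all)

text \<open>The truncation to radius \<open>\<rho>'\<close> is harmless: a circle of radius
  \<open>r\<close> about a point of the support of \<open>\<phi>\<close> stays inside that ball.
  Almost every centre avoids the singular case of Jensen's formula.\<close>

lemma circle_avg_pot: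
  assumes [measurable]: "\<phi> \<in> borel_measurable borel" and B: "\<And>z. \<bar>\<phi> z\<bar> \<le> B"
    and supp: "\<And>z. dist p0 z > a \<Longrightarrow> \<phi> z = 0" and r: "r > 0" "a + r < \<rho>'" "\<rho>' < \<rho>"
  shows "integrable lborel (\<lambda>z. circle_avg r \<phi> z * (indicator (ball p0 \<rho>') z * pot z))" (is ?I)
    and "integrable lborel (\<lambda>z. \<phi> z * (Re (H z) + (\<Sum>w\<in>Z. m w * ln (max (cmod (z - w)) r))))" (is ?J)
    and "(\<integral>z. circle_avg r \<phi> z * (indicator (ball p0 \<rho>') z * pot z) \<partial>lborel)
       = (\<integral>z. \<phi> z * (Re (H z) + (\<Sum>w\<in>Z. m w * ln (max (cmod (z - w)) r))) \<partial>lborel)" (is ?E)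
proof -
  let ?v = "\<lambda>z. indicator (ball p0 \<rho>') z * pot z"
  have [measurable]: "ball p0 \<rho>' \<in> sets borel" by simp
  note F = circle_avg_fubini[OF assms(1) B integrable_pot[OF r(3)], of r]
  show ?I by (rule F(1))
  have AE: "AE z in lborel. \<phi> z * (\<integral>c. ?v (z + of_real r * c) \<partial>circle_measure)
    = \<phi> z * (Re (H z) + (\<Sum>w\<in>Z. m w * ln (max (cmod (z - w)) r)))"
    using AE_dist_ne[of r]
  proof eventually_elim
    case (elim z)
    show ?case
    proof (cases "dist p0 z > a")
      case False
      have "AE c in circle_measure. ?v (z + of_real r * c) = pot (z + of_real r * c)"
        using AE_circle_measure
      proof eventually_elim
        case (elim c)
        have "dist p0 (z + of_real r * c) \<le> dist p0 z + r"
          using dist_triangle[of p0 "z + of_real r * c" z] elim r by (simp add: dist_norm norm_mult)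
        then show ?case using False r by simp
      qed
      then have "(\<integral>c. ?v (z + of_real r * c) \<partial>circle_measure) = (\<integral>c. pot (z + of_real r * c) \<partial>circle_measure)"
        by (intro integral_cong_AE) auto
      also have "\<dots> = Re (H z) + (\<Sum>w\<in>Z. m w * ln (max (cmod (z - w)) r))"
        using circle_mean_pot(2)[of z "of_real r"] elim r False by simp
      finally show ?thesis by simp
    qed (simp add: supp)
  qed
  show ?E
    unfolding F(2) using AE by (intro integral_cong_AE) auto
  have c: "continuous_on (cball p0 a) (\<lambda>z. Re (H z) + (\<Sum>w\<in>Z. m w * ln (max (cmod (z - w)) r)))"
  proof -
    have "cball p0 a \<subseteq> ball p0 \<rho>" using r by auto
    then have "continuous_on (cball p0 a) H"
      using H_holomorphic holomorphic_on_imp_continuous_on continuous_on_subset by blast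
    then show ?thesis
      using r by (intro continuous_intros) (auto simp: max_def)
  qed
  then have "bounded ((\<lambda>z. Re (H z) + (\<Sum>w\<in>Z. m w * ln (max (cmod (z - w)) r))) ` cball p0 a)"
    by (intro compact_imp_bounded compact_continuous_image) auto
  then obtain C where "\<forall>y\<in>(\<lambda>z. Re (H z) + (\<Sum>w\<in>Z. m w * ln (max (cmod (z - w)) r))) ` cball p0 a. norm y \<le> C"
    unfolding bounded_iff by blast
  then have C: "\<And>z. z \<in> cball p0 a \<Longrightarrow> \<bar>Re (H z) + (\<Sum>w\<in>Z. m w * ln (max (cmod (z - w)) r))\<bar> \<le> C"
    unfolding ball_simps real_norm_def by blast
  have "integrable lborel (\<lambda>z. indicator (cball p0 a) z * (B * C))"
    by (intro integrable_mult_left integrable_real_indicator) (use emeasure_bounded_finite[OF bounded_cball[of p0 a]] in auto)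
  then show ?J
  proof (rule Bochner_Integration.integrable_bound)
    show "AE z in lborel. norm (\<phi> z * (Re (H z) + (\<Sum>w\<in>Z. m w * ln (max (cmod (z - w)) r))))
      \<le> norm (indicator (cball p0 a) z * (B * C))"
    proof (intro AE_I2)
      fix z
      show "norm (\<phi> z * (Re (H z) + (\<Sum>w\<in>Z. m w * ln (max (cmod (z - w)) r)))) \<le> norm (indicator (cball p0 a) z * (B * C))"
      proof (cases "z \<in> cball p0 a")
        case True
        have "0 \<le> B" using order_trans[OF abs_ge_zero B] .
        have "0 \<le> C" using order_trans[OF abs_ge_zero C[OF True]] .
        have "\<bar>\<phi> z\<bar> * \<bar>Re (H z) + (\<Sum>w\<in>Z. m w * ln (max (cmod (z - w)) r))\<bar> \<le> B * C"
          using B C[OF True] \<open>0 \<le> B\<close> by (intro mult_mono) auto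
        then show ?thesis using True \<open>0 \<le> B\<close> \<open>0 \<le> C\<close> by (simp add: abs_mult)
      next
        case False
        then show ?thesis by (simp add: supp)
      qed
    qed
  qed measurable
qed

text \<open>Discrete counterpart of the fact that the Laplacian of ln |z - w| is a multiple of the
  unit mass at \<open>w\<close>. The term \<open>Re (H z)\<close> appears for both radii and
  cancels.\<close>

lemma discrete_laplacian_pot:
  assumes [measurable]: "\<phi> \<in> borel_measurable borel" and B: "\<And>z. \<bar>\<phi> z\<bar> \<le> B"
    and supp: "\<And>z. dist p0 z > a \<Longrightarrow> \<phi> z = 0" and r: "r > 0" "a + r < \<rho>'" "\<rho>' < \<rho>"
  shows "integrable lborel (\<lambda>z. (circle_avg r \<phi> z - circle_avg (r / 2) \<phi> z) * (indicator (ball p0 \<rho>') z * pot z))"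
    and "(\<integral>z. (circle_avg r \<phi> z - circle_avg (r / 2) \<phi> z) * (indicator (ball p0 \<rho>') z * pot z) \<partial>lborel)
       = (\<Sum>w\<in>Z. m w * (\<integral>z. \<phi> z * radial_kernel r (z - w) \<partial>lborel))"
proof -
  let ?v = "\<lambda>z. indicator (ball p0 \<rho>') z * pot z"
  note C1 = circle_avg_pot[OF assms(1) B supp r]
  have r2: "r / 2 > 0" "a + r / 2 < \<rho>'" using r by auto
  note C2 = circle_avg_pot[OF assms(1) B supp r2 r(3)]
  show "integrable lborel (\<lambda>z. (circle_avg r \<phi> z - circle_avg (r / 2) \<phi> z) * ?v z)"
    unfolding left_diff_distrib by (intro Bochner_Integration.integrable_diff C1(1) C2(1))
  have "(\<integral>z. (circle_avg r \<phi> z - circle_avg (r / 2) \<phi> z) * ?v z \<partial>lborel)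
    = (\<integral>z. circle_avg r \<phi> z * ?v z \<partial>lborel) - (\<integral>z. circle_avg (r / 2) \<phi> z * ?v z \<partial>lborel)"
    unfolding left_diff_distrib by (intro Bochner_Integration.integral_diff C1(1) C2(1))
  also have "\<dots> = (\<integral>z. \<phi> z * (Re (H z) + (\<Sum>w\<in>Z. m w * ln (max (cmod (z - w)) r)))
       - \<phi> z * (Re (H z) + (\<Sum>w\<in>Z. m w * ln (max (cmod (z - w)) (r / 2)))) \<partial>lborel)"
    using C1(3) C2(3) Bochner_Integration.integral_diff[OF C1(2) C2(2)] by linarith
  also have "\<dots> = (\<integral>z. (\<Sum>w\<in>Z. m w * (\<phi> z * radial_kernel r (z - w))) \<partial>lborel)"
    by (intro Bochner_Integration.integral_cong refl)
       (simp add: radial_kernel_def algebra_simps sum_distrib_left sum_subtractf)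
  also have "\<dots> = (\<Sum>w\<in>Z. \<integral>z. m w * (\<phi> z * radial_kernel r (z - w)) \<partial>lborel)"
  proof (intro Bochner_Integration.integral_sum integrable_mult_right)
    fix w
    have "integrable lborel (\<lambda>z. B * radial_kernel r (z - w))"
      using lborel_integrable_shift[OF integrable_radial_kernel[OF r(1)], of "- w"] by simp
    then show "integrable lborel (\<lambda>z. \<phi> z * radial_kernel r (z - w))"
      by (rule Bochner_Integration.integrable_bound)
         (auto simp: abs_mult intro!: AE_I2 mult_right_mono order_trans[OF B abs_ge_self])
  qed
  finally show "(\<integral>z. (circle_avg r \<phi> z - circle_avg (r / 2) \<phi> z) * ?v z \<partial>lborel)
       = (\<Sum>w\<in>Z. m w * (\<integral>z. \<phi> z * radial_kernel r (z - w) \<partial>lborel))"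
    by simp
qed

text \<open>Circle means of the potential about \<open>p\<close> replace ln |p - w| by the larger ln
  max(|p - w|, |z|). Polar coordinates are avoided: the area integral is invariant under rotations,
  so it equals its average over all rotations, which by Fubini is an integral of circle means. The
  point \<open>p\<close> is kept off \<open>Z\<close> since \<open>ln 0 = 0\<close> would spoil the
  comparison.\<close>

lemma pot_submean:
  assumes p: "dist p0 p + \<delta> \<le> \<rho>'" "\<rho>' < \<rho>" "p \<notin> Z"
  shows "pot p * measure lborel (ball p \<delta>) \<le> (\<integral>z. indicator (ball p \<delta>) z * pot z \<partial>lborel)"
proof -
  have [measurable]: "ball p \<delta> \<in> sets borel" "ball (0::complex) \<delta> \<in> sets borel" by simp_all
  interpret C: pair_sigma_finite circle_measure "lborel :: complex measure" by (rule pair_sigma_finite_circle)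
  let ?v = "\<lambda>z. indicator (ball 0 \<delta>) z * pot (p + z)"
  have "ball p \<delta> \<subseteq> ball p0 \<rho>'"
  proof
    fix x assume "x \<in> ball p \<delta>"
    then show "x \<in> ball p0 \<rho>'" using p dist_triangle[of p0 x p] by auto
  qed
  then have "integrable lborel (\<lambda>z. indicator (ball p \<delta>) z * (indicator (ball p0 \<rho>') z * pot z))"
    using integrable_mult_indicator[OF _ integrable_pot[OF p(2)], of "ball p \<delta>"] by simp
  moreover have "(\<lambda>z. indicator (ball p \<delta>) z * (indicator (ball p0 \<rho>') z * pot z)) = (\<lambda>z. indicator (ball p \<delta>) z * pot z)"
    using \<open>ball p \<delta> \<subseteq> ball p0 \<rho>'\<close> by (auto simp: indicator_def fun_eq_iff)
  ultimately have i0: "integrable lborel (\<lambda>z. indicator (ball p \<delta>) z * pot z)" by simp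
  have sh: "?v = (\<lambda>z. indicator (ball p \<delta>) (z + p) * pot (z + p))"
    by (auto simp: fun_eq_iff indicator_def dist_norm add.commute)
  have i1: "integrable lborel ?v"
    unfolding sh by (rule lborel_integrable_shift[OF i0])
  have e1: "(\<integral>z. indicator (ball p \<delta>) z * pot z \<partial>lborel) = (\<integral>z. ?v z \<partial>lborel)"
    unfolding sh by (rule lborel_integral_shift[symmetric]) measurable
  have rot: "integrable lborel (\<lambda>z. ?v (c * z))" "(\<integral>z. ?v (c * z) \<partial>lborel) = (\<integral>z. ?v z \<partial>lborel)"
    "(\<integral>z. \<bar>?v (c * z)\<bar> \<partial>lborel) = (\<integral>z. \<bar>?v z\<bar> \<partial>lborel)"
    if "cmod c = 1" for c
    using integral_rotate[OF that, of ?v] integral_rotate[OF that, of "\<lambda>z. \<bar>?v z\<bar>"] i1 by simp_all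
  have i2: "integrable (circle_measure \<Otimes>\<^sub>M lborel) (\<lambda>(c, z). ?v (c * z))"
  proof (rule C.Fubini_integrable)
    show "AE x in circle_measure. integrable lborel (\<lambda>y. case (x, y) of (c, z) \<Rightarrow> ?v (c * z))"
      using AE_circle_measure by eventually_elim (use rot in auto)
    have "AE x in circle_measure. norm (\<integral>y. norm (case (x, y) of (c, z) \<Rightarrow> ?v (c * z)) \<partial>lborel) \<le> (\<integral>z. \<bar>?v z\<bar> \<partial>lborel)"
      using AE_circle_measure by eventually_elim (use rot(3) in auto)
    then show "integrable circle_measure (\<lambda>x. \<integral>y. norm (case (x, y) of (c, z) \<Rightarrow> ?v (c * z)) \<partial>lborel)"
      by (intro circle.integrable_const_bound) auto
  qed measurable
  have "(\<integral>z. ?v z \<partial>lborel) = (\<integral>c. (\<integral>z. ?v z \<partial>lborel) \<partial>circle_measure)"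
    using circle.prob_space by simp
  also have "\<dots> = (\<integral>c. (\<integral>z. ?v (c * z) \<partial>lborel) \<partial>circle_measure)"
    using AE_circle_measure by (intro integral_cong_AE) (auto elim!: eventually_mono simp: rot)
  also have "\<dots> = (\<integral>z. (\<integral>c. ?v (c * z) \<partial>circle_measure) \<partial>lborel)"
    using C.Fubini_integral[OF i2] by simp
  finally have e2: "(\<integral>z. ?v z \<partial>lborel) = (\<integral>z. (\<integral>c. ?v (c * z) \<partial>circle_measure) \<partial>lborel)" .
  have "pot p * measure lborel (ball p \<delta>) = (\<integral>z. indicator (ball p \<delta>) z * pot p \<partial>lborel)"
    by simp
  also have "\<dots> = (\<integral>z. indicator (ball p \<delta>) (z + p) * pot p \<partial>lborel)"
    by (rule lborel_integral_shift[symmetric]) measurable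
  also have "(\<lambda>z. indicator (ball p \<delta>) (z + p) * pot p) = (\<lambda>z. indicator (ball 0 \<delta>) z * pot p)"
    by (auto simp: fun_eq_iff indicator_def dist_norm)
  also have "(\<integral>z. indicator (ball (0::complex) \<delta>) z * pot p \<partial>lborel) \<le> (\<integral>z. (\<integral>c. ?v (c * z) \<partial>circle_measure) \<partial>lborel)"
  proof (rule Bochner_Integration.integral_mono_AE)
    show "integrable lborel (\<lambda>z::complex. indicator (ball 0 \<delta>) z * pot p)"
      by (intro integrable_mult_left integrable_real_indicator) (use emeasure_bounded_finite[OF bounded_ball[of "0::complex" \<delta>]] in auto)
    show "integrable lborel (\<lambda>z. \<integral>c. ?v (c * z) \<partial>circle_measure)"
      using C.integrable_snd[OF i2] by simp
    have "AE z in lborel. \<forall>w\<in>Z. cmod (p - w) \<noteq> cmod z"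
    proof -
      have "AE z in lborel. cmod (p - w) \<noteq> cmod z" for w
        using AE_norm_ne[of "cmod (p - w)"] by (rule eventually_mono) simp
      then show ?thesis
        using finite_Z by (simp add: AE_finite_all)
    qed
    then show "AE z in lborel. indicator (ball 0 \<delta>) z * pot p \<le> (\<integral>c. ?v (c * z) \<partial>circle_measure)"
    proof eventually_elim
      case (elim z)
      have "AE c in circle_measure. ?v (c * z) = indicator (ball 0 \<delta>) z * pot (p + z * c)"
        using AE_circle_measure
        by eventually_elim (auto simp: indicator_def norm_mult mult.commute)
      then have "(\<integral>c. ?v (c * z) \<partial>circle_measure) = (\<integral>c. indicator (ball 0 \<delta>) z * pot (p + z * c) \<partial>circle_measure)"
        by (intro integral_cong_AE) auto
      also have "\<dots> = indicator (ball 0 \<delta>) z * (\<integral>c. pot (p + z * c) \<partial>circle_measure)"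
        by simp
      also have "\<dots> \<ge> indicator (ball 0 \<delta>) z * pot p"
      proof (cases "z \<in> ball 0 \<delta>")
        case True
        then have "dist p0 p + cmod z < \<rho>" using p by simp
        from circle_mean_pot(2)[OF this] elim
        have "(\<integral>c. pot (p + z * c) \<partial>circle_measure) = Re (H p) + (\<Sum>w\<in>Z. m w * ln (max (cmod (p - w)) (cmod z)))"
          by simp
        also have "\<dots> \<ge> pot p"
          unfolding pot_def
        proof (intro add_left_mono sum_mono mult_left_mono)
          fix w assume "w \<in> Z"
          then have "p \<noteq> w" using p by auto
          then show "ln (cmod (p - w)) \<le> ln (max (cmod (p - w)) (cmod z))"
            by (subst ln_le_cancel_iff) (auto simp: max_def)
        qed (rule m_nonneg)
        finally show ?thesis using True by simp
      qed simp
      finally show ?case .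
    qed
  qed
  finally show ?thesis by (simp add: e1 e2)
qed

end

section \<open>Smoothing by the radial kernel and its finite-difference dual\<close>

definition smoothing :: "real \<Rightarrow> (complex \<Rightarrow> real) \<Rightarrow> complex \<Rightarrow> real" where
  "smoothing r \<phi> w = (\<integral>z. \<phi> z * radial_kernel r (z - w) \<partial>lborel) / (\<integral>w. radial_kernel r w \<partial>lborel)"

lemma measurable_smoothing [measurable]:
  assumes [measurable]: "\<phi> \<in> borel_measurable borel"
  shows "smoothing r \<phi> \<in> borel_measurable borel"
proof -
  have [measurable]: "(\<lambda>(w, z). \<phi> z * radial_kernel r (z - w)) \<in> borel_measurable (borel \<Otimes>\<^sub>M lborel)"
    by measurable
  show ?thesis unfolding smoothing_def[abs_def] by measurable
qed

lemma integrable_mult_radial_kernel: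
  assumes [measurable]: "\<phi> \<in> borel_measurable borel" and B: "\<And>z. \<bar>\<phi> z\<bar> \<le> B" and r: "r > 0"
  shows "integrable lborel (\<lambda>z. \<phi> z * radial_kernel r (z - w))"
proof -
  have "integrable lborel (\<lambda>z. B * radial_kernel r (z - w))"
    using lborel_integrable_shift[OF integrable_radial_kernel[OF r], of "- w"] by simp
  then show ?thesis
    by (rule Bochner_Integration.integrable_bound)
       (auto simp: abs_mult intro!: AE_I2 mult_right_mono order_trans[OF B abs_ge_self])
qed

text \<open>\<open>smoothing r \<phi> w\<close> is a weighted mean of \<open>\<phi>\<close> over the
  disk of radius \<open>r\<close> about \<open>w\<close>, so it inherits any bound valid on that
  disk.\<close>

lemma abs_smoothing_diff_le:
  assumes [measurable]: "\<phi> \<in> borel_measurable borel" and B: "\<And>z. \<bar>\<phi> z\<bar> \<le> B" and r: "r > 0"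
    and e: "\<And>z. dist z w < r \<Longrightarrow> \<bar>\<phi> z - x\<bar> \<le> e"
  shows "\<bar>smoothing r \<phi> w - x\<bar> \<le> e"
proof -
  define N where "N = (\<integral>w. radial_kernel r w \<partial>lborel)"
  have N: "N > 0" unfolding N_def by (rule integral_radial_kernel_pos[OF r])
  have i0: "integrable lborel (\<lambda>z. radial_kernel r (z - w))"
    using lborel_integrable_shift[OF integrable_radial_kernel[OF r], of "- w"] by simp
  have Nw: "(\<integral>z. radial_kernel r (z - w) \<partial>lborel) = N"
    using lborel_integral_shift[of "radial_kernel r" "- w"] by (simp add: N_def)
  note i1 = integrable_mult_radial_kernel[OF assms(1) B r, of w]
  have "(smoothing r \<phi> w - x) * N = (\<integral>z. \<phi> z * radial_kernel r (z - w) \<partial>lborel) - x * N"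
    using N unfolding smoothing_def N_def[symmetric] by (simp add: left_diff_distrib)
  also have "\<dots> = (\<integral>z. \<phi> z * radial_kernel r (z - w) - x * radial_kernel r (z - w) \<partial>lborel)"
    using i0 i1 Nw by (subst Bochner_Integration.integral_diff) auto
  finally have eq: "(smoothing r \<phi> w - x) * N = (\<integral>z. (\<phi> z - x) * radial_kernel r (z - w) \<partial>lborel)"
    by (simp add: left_diff_distrib)
  have i2: "integrable lborel (\<lambda>z. (\<phi> z - x) * radial_kernel r (z - w))"
    unfolding left_diff_distrib using i0 i1 by auto
  have "\<bar>\<integral>z. (\<phi> z - x) * radial_kernel r (z - w) \<partial>lborel\<bar> \<le> (\<integral>z. \<bar>(\<phi> z - x) * radial_kernel r (z - w)\<bar> \<partial>lborel)"
    using integral_norm_bound[of lborel "\<lambda>z. (\<phi> z - x) * radial_kernel r (z - w)"] by simp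
  also have "\<dots> \<le> (\<integral>z. e * radial_kernel r (z - w) \<partial>lborel)"
  proof (rule integral_mono)
    show "integrable lborel (\<lambda>z. \<bar>(\<phi> z - x) * radial_kernel r (z - w)\<bar>)" using i2 by (rule integrable_abs)
    show "integrable lborel (\<lambda>z. e * radial_kernel r (z - w))" using i0 by auto
    fix z
    show "\<bar>(\<phi> z - x) * radial_kernel r (z - w)\<bar> \<le> e * radial_kernel r (z - w)"
    proof (cases "dist z w < r")
      case True
      then show ?thesis using e[OF True] radial_kernel_nonneg[OF r, of "z - w"]
        by (simp add: abs_mult mult_right_mono)
    next
      case False
      then show ?thesis using radial_kernel_eq_0[OF r, of "z - w"] by (simp add: dist_norm)
    qed
  qed
  also have "\<dots> = e * N" by (simp add: Nw)
  finally have "\<bar>(smoothing r \<phi> w - x) * N\<bar> \<le> e * N" unfolding eq .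
  then show ?thesis using N by (simp add: abs_mult)
qed

lemma smoothing_eq_const:
  assumes "\<phi> \<in> borel_measurable borel" "\<And>z. \<bar>\<phi> z\<bar> \<le> B" "r > 0" "\<And>z. dist z w < r \<Longrightarrow> \<phi> z = x"
  shows "smoothing r \<phi> w = x"
  using abs_smoothing_diff_le[OF assms(1-3), of w x 0] assms(4) by simp

lemma smoothing_nonneg:
  assumes "\<And>z. \<phi> z \<ge> 0" "r > 0"
  shows "smoothing r \<phi> w \<ge> 0"
  unfolding smoothing_def using assms integral_radial_kernel_pos[of r] radial_kernel_nonneg[of r]
  by (intro divide_nonneg_nonneg integral_nonneg) auto

lemma smoothing_eq_0:
  assumes "\<phi> \<in> borel_measurable borel" "\<And>z. \<bar>\<phi> z\<bar> \<le> B" "r > 0"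
    and "\<And>z. cmod z > a \<Longrightarrow> \<phi> z = 0" "cmod w \<ge> a + r"
  shows "smoothing r \<phi> w = 0"
proof (rule smoothing_eq_const[OF assms(1-3)])
  fix z assume "dist z w < r"
  then have "cmod z > a" using assms(5) norm_triangle_ineq2[of w "w - z"] by (simp add: dist_norm norm_minus_commute)
  then show "\<phi> z = 0" by (rule assms(4))
qed

text \<open>The dual of \<open>smoothing\<close>: integrating a logarithmic potential against this
  function gives, up to the mass of the kernel, the integral of \<open>smoothing r \<phi>\<close>
  against the point masses.\<close>

definition circle_avg_diff :: "real \<Rightarrow> (complex \<Rightarrow> real) \<Rightarrow> complex \<Rightarrow> real" where
  "circle_avg_diff r \<phi> z = circle_avg r \<phi> z - circle_avg (r / 2) \<phi> z"

lemma measurable_circle_avg_diff [measurable]: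
  assumes [measurable]: "\<phi> \<in> borel_measurable borel"
  shows "circle_avg_diff r \<phi> \<in> borel_measurable borel"
  unfolding circle_avg_diff_def[abs_def] by measurable

lemma circle_avg_diff_bound:
  assumes "\<phi> \<in> borel_measurable borel" "\<And>z. \<bar>\<phi> z\<bar> \<le> B"
  shows "\<bar>circle_avg_diff r \<phi> z\<bar> \<le> 2 * B"
  using circle_avg_bound[OF assms, of r z] circle_avg_bound[OF assms, of "r/2" z]
  by (simp add: circle_avg_diff_def)

lemma circle_avg_diff_eq_0:
  assumes "\<And>z. cmod z > a \<Longrightarrow> \<phi> z = 0" "cmod z > a + r" "r > 0"
  shows "circle_avg_diff r \<phi> z = 0"
  using circle_avg_eq_0[of a \<phi> r z] circle_avg_eq_0[of a \<phi> "r/2" z] assms by (simp add: circle_avg_diff_def)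

section \<open>Zeros of a holomorphic function that is not identically zero\<close>

locale nonzero_holomorphic =
  fixes G :: "complex \<Rightarrow> complex" and D :: "complex set" and z0 :: complex
  assumes hol: "G holomorphic_on D" and open_D: "open D" and connected_D: "connected D"
    and z0: "z0 \<in> D" "G z0 \<noteq> 0"
begin

definition zeros :: "real \<Rightarrow> complex set" where "zeros \<rho> = {w \<in> ball 0 \<rho>. G w = 0}"

lemma zorder_pos: "w \<in> D \<Longrightarrow> G w = 0 \<Longrightarrow> zorder G w > 0"
proof -
  assume w: "w \<in> D" "G w = 0"
  have "\<forall>\<^sub>F z in at w. G z \<noteq> 0"
    using non_zero_neighbour_alt[OF hol open_D connected_D w(1) z0] by (auto elim: eventually_mono)
  then have "\<exists>\<^sub>F z in at w. G z \<noteq> 0" by (intro eventually_frequently) auto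
  moreover have "G analytic_on {w}" using hol open_D w analytic_at by blast
  ultimately show ?thesis using zorder_pos_iff' w by metis
qed

lemma finite_zeros: "cball 0 \<rho> \<subseteq> D \<Longrightarrow> finite (zeros \<rho>)"
  unfolding zeros_def
  by (rule nonzero_zero_free_factorization[OF hol open_D connected_D _ z0, of 0 \<rho>], assumption)
     (erule rev_finite_subset, auto)

lemma potential:
  assumes "cball 0 \<rho> \<subseteq> D"
  obtains H where "log_potential H 0 \<rho> (zeros \<rho>) (\<lambda>w. real_of_int (zorder G w))"
    "\<And>z. z \<in> ball 0 \<rho> \<Longrightarrow> G z \<noteq> 0 \<Longrightarrow>
      ln (cmod (G z)) = log_potential.pot H (zeros \<rho>) (\<lambda>w. real_of_int (zorder G w)) z"
proof -
  have sub: "ball 0 \<rho> \<subseteq> D" using assms ball_subset_cball by blast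
  obtain H where H: "H \<in> borel_measurable borel" "H holomorphic_on ball 0 \<rho>"
    "finite {w \<in> cball 0 \<rho>. G w = 0}"
    "\<And>z. z \<in> ball 0 \<rho> \<Longrightarrow> G z \<noteq> 0 \<Longrightarrow>
      ln (cmod (G z)) = Re (H z) + (\<Sum>w\<in>{w\<in>ball 0 \<rho>. G w = 0}. real_of_int (zorder G w) * ln (cmod (z - w)))"
    using nonzero_zero_free_factorization[OF hol open_D connected_D assms z0] by blast
  have L: "log_potential H 0 \<rho> (zeros \<rho>) (\<lambda>w. real_of_int (zorder G w))"
  proof
    fix w assume "w \<in> zeros \<rho>"
    then have "zorder G w > 0" using sub by (intro zorder_pos) (auto simp: zeros_def)
    then show "real_of_int (zorder G w) \<ge> 0" by simp
  qed (use H finite_zeros[OF assms] in auto)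
  have "log_potential.pot H (zeros \<rho>) (\<lambda>w. real_of_int (zorder G w)) z =
      Re (H z) + (\<Sum>w\<in>zeros \<rho>. real_of_int (zorder G w) * ln (cmod (z - w)))" for z
    by (rule log_potential.pot_def[OF L])
  then show ?thesis
    using that[OF L] H(4) unfolding zeros_def by presburger
qed

lemma AE_not_zeros: "cball 0 \<rho> \<subseteq> D \<Longrightarrow> AE z in lborel. z \<in> ball 0 \<rho> \<longrightarrow> G z \<noteq> 0"
proof -
  assume "cball 0 \<rho> \<subseteq> D"
  then have "zeros \<rho> \<in> null_sets lborel"
    using finite_imp_null_set_lborel finite_zeros by blast
  then have "AE z in lborel. z \<notin> zeros \<rho>" by (rule AE_not_in)
  then show ?thesis by (rule eventually_mono) (auto simp: zeros_def)
qed

lemma measurable_ln_norm: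
  assumes "cball 0 \<rho> \<subseteq> D"
  shows "(\<lambda>z. indicator (ball 0 \<rho>) z * ln (cmod (G z))) \<in> borel_measurable borel"
proof -
  have "continuous_on (ball 0 \<rho>) G"
    using assms hol ball_subset_cball holomorphic_on_imp_continuous_on continuous_on_subset by blast
  then have [measurable]: "(\<lambda>z. indicator (ball 0 \<rho>) z *\<^sub>R G z) \<in> borel_measurable borel"
    by (intro borel_measurable_continuous_on_indicator) auto
  have "(\<lambda>z. ln (cmod (indicator (ball 0 \<rho>) z *\<^sub>R G z))) \<in> borel_measurable borel"
    by measurable
  also have "(\<lambda>z. ln (cmod (indicator (ball 0 \<rho>) z *\<^sub>R G z))) = (\<lambda>z. indicator (ball 0 \<rho>) z * ln (cmod (G z)))"
    by (auto simp: fun_eq_iff indicator_def)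
  finally show ?thesis .
qed

lemma integrable_ln_norm_holomorphic:
  assumes "cball 0 \<rho> \<subseteq> D" "\<rho>' < \<rho>"
  shows "integrable lborel (\<lambda>z. indicator (ball 0 \<rho>') z * ln (cmod (G z)))"
proof -
  obtain H where L: "log_potential H 0 \<rho> (zeros \<rho>) (\<lambda>w. real_of_int (zorder G w))" and
    eq: "\<And>z. z \<in> ball 0 \<rho> \<Longrightarrow> G z \<noteq> 0 \<Longrightarrow>
      ln (cmod (G z)) = log_potential.pot H (zeros \<rho>) (\<lambda>w. real_of_int (zorder G w)) z"
    using potential[OF assms(1)] by blast
  have "cball 0 \<rho>' \<subseteq> D" using assms by (meson order_trans subset_cball less_imp_le)
  note [measurable] = measurable_ln_norm[OF this] log_potential.pot_measurable[OF L]
  have [measurable]: "ball (0::complex) \<rho>' \<in> sets borel" by simp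
  show ?thesis
    using log_potential.integrable_pot[OF L assms(2)]
  proof (subst (asm) integrable_cong_AE)
    show "AE z in lborel. indicator (ball 0 \<rho>') z * log_potential.pot H (zeros \<rho>) (\<lambda>w. real_of_int (zorder G w)) z =
      indicator (ball 0 \<rho>') z * ln (cmod (G z))"
      using AE_not_zeros[OF assms(1)]
      by eventually_elim (use eq assms(2) in \<open>auto simp: indicator_def\<close>)
  qed auto
qed

lemma ln_norm_submean:
  assumes "cball 0 \<rho> \<subseteq> D" "cmod p + \<delta> < \<rho>" "G p \<noteq> 0" "\<delta> > 0"
  shows "ln (cmod (G p)) * measure lborel (ball p \<delta>) \<le> (\<integral>z. indicator (ball p \<delta>) z * ln (cmod (G z)) \<partial>lborel)"
proof -
  obtain H where L: "log_potential H 0 \<rho> (zeros \<rho>) (\<lambda>w. real_of_int (zorder G w))" and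
    eq: "\<And>z. z \<in> ball 0 \<rho> \<Longrightarrow> G z \<noteq> 0 \<Longrightarrow>
      ln (cmod (G z)) = log_potential.pot H (zeros \<rho>) (\<lambda>w. real_of_int (zorder G w)) z"
    using potential[OF assms(1)] by blast
  note [measurable] = measurable_ln_norm[OF assms(1)] log_potential.pot_measurable[OF L]
  have [measurable]: "ball p \<delta> \<in> sets borel" by simp
  have sub: "ball p \<delta> \<subseteq> ball 0 \<rho>"
  proof
    fix x assume "x \<in> ball p \<delta>"
    then show "x \<in> ball 0 \<rho>" using assms dist_triangle[of 0 x p] by (simp add: dist_norm)
  qed
  have m: "(\<lambda>z. indicator (ball p \<delta>) z * ln (cmod (G z))) \<in> borel_measurable borel"
  proof -
    have "(\<lambda>z. indicator (ball p \<delta>) z * (indicator (ball 0 \<rho>) z * ln (cmod (G z)))) \<in> borel_measurable borel"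
      by measurable
    also have "(\<lambda>z. indicator (ball p \<delta>) z * (indicator (ball 0 \<rho>) z * ln (cmod (G z)))) = (\<lambda>z. indicator (ball p \<delta>) z * ln (cmod (G z)))"
      using sub by (auto simp: fun_eq_iff indicator_def)
    finally show ?thesis .
  qed
  have "p \<notin> zeros \<rho>" using assms by (simp add: zeros_def)
  have "p \<in> ball 0 \<rho>" using assms by simp
  have "ln (cmod (G p)) * measure lborel (ball p \<delta>) \<le> (\<integral>z. indicator (ball p \<delta>) z * log_potential.pot H (zeros \<rho>) (\<lambda>w. real_of_int (zorder G w)) z \<partial>lborel)"
    using log_potential.pot_submean[OF L _ assms(2) \<open>p \<notin> zeros \<rho>\<close>, of \<delta>] eq[OF \<open>p \<in> ball 0 \<rho>\<close> assms(3)] by simp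
  also have "\<dots> = (\<integral>z. indicator (ball p \<delta>) z * ln (cmod (G z)) \<partial>lborel)"
  proof (rule integral_cong_AE)
    show "AE z in lborel. indicator (ball p \<delta>) z * log_potential.pot H (zeros \<rho>) (\<lambda>w. real_of_int (zorder G w)) z =
      indicator (ball p \<delta>) z * ln (cmod (G z))"
      using AE_not_zeros[OF assms(1)]
      by eventually_elim (use eq sub in \<open>auto simp: indicator_def\<close>)
  qed (use m in auto)
  finally show ?thesis .
qed

text \<open>The zero set in \<open>D\<close> may be infinite, but only finitely many zeros lie in
  the ball outside which \<open>\<phi>\<close> vanishes, so the integral against a density of the
  counting measure collapses to a finite sum.\<close>

lemma integral_zero_measure:
  assumes "cball 0 \<rho> \<subseteq> D" and \<phi>: "\<phi> \<in> borel_measurable (restrict_space borel D)"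
    and supp: "\<And>z. z \<in> D \<Longrightarrow> cmod z \<ge> \<rho> \<Longrightarrow> \<phi> z = 0"
  shows "(\<integral>z. \<phi> z \<partial>zero_measure D G) = (\<Sum>w\<in>zeros \<rho>. real_of_int (zorder G w) * \<phi> w)"
proof -
  let ?Z = "{z \<in> D. G z = 0}"
  have "(\<integral>z. \<phi> z \<partial>zero_measure D G) = (\<integral>z. \<phi> z \<partial>distr (point_measure ?Z (\<lambda>z. of_nat (nat (zorder G z)))) (restrict_space borel D) (\<lambda>z. z))"
    using hol z0 by (auto simp: zero_measure_def)
  also have "\<dots> = (\<integral>z. \<phi> z \<partial>point_measure ?Z (\<lambda>z. of_nat (nat (zorder G z))))"
    using \<phi> by (intro integral_distr) (auto simp: space_restrict_space)
  also have "point_measure ?Z (\<lambda>z. of_nat (nat (zorder G z))) = density (count_space ?Z) (\<lambda>z. ennreal (real (nat (zorder G z))))"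
    by (simp add: point_measure_def ennreal_of_nat_eq_real_of_nat)
  also have "(\<integral>z. \<phi> z \<partial>density (count_space ?Z) (\<lambda>z. ennreal (real (nat (zorder G z))))) = (\<integral>z. real (nat (zorder G z)) * \<phi> z \<partial>count_space ?Z)"
    by (subst integral_density) auto
  also have "\<dots> = (\<Sum>z | z \<in> ?Z \<and> real (nat (zorder G z)) * \<phi> z \<noteq> 0. real (nat (zorder G z)) * \<phi> z)"
  proof (rule lebesgue_integral_count_space_finite_support)
    show "finite {z \<in> ?Z. real (nat (zorder G z)) * \<phi> z \<noteq> 0}"
      by (rule finite_subset[OF _ finite_zeros[OF assms(1)]]) (use supp in \<open>force simp: zeros_def\<close>)
  qed
  also have "\<dots> = (\<Sum>w\<in>zeros \<rho>. real (nat (zorder G w)) * \<phi> w)"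
    by (rule sum.mono_neutral_left[OF finite_zeros[OF assms(1)]])
       (use supp assms(1) in \<open>force simp: zeros_def\<close>)+
  also have "\<dots> = (\<Sum>w\<in>zeros \<rho>. real_of_int (zorder G w) * \<phi> w)"
    using zorder_pos assms(1) by (intro sum.cong refl) (force simp: zeros_def)
  finally show ?thesis .
qed

text \<open>A finite-difference Poincare-Lelong formula: representing ln |G| as a potential on the
  ball turns both sides into the same sum over zeros.\<close>

lemma discrete_poincare_lelong:
  assumes "cball 0 \<rho> \<subseteq> D" and [measurable]: "\<phi> \<in> borel_measurable borel" and B: "\<And>z. \<bar>\<phi> z\<bar> \<le> B"
    and supp: "\<And>z. cmod z > a \<Longrightarrow> \<phi> z = 0" and r: "r > 0" "a + r < \<rho>"
  shows "(\<integral>z. smoothing r \<phi> z \<partial>zero_measure D G) =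
    (\<integral>z. circle_avg_diff r \<phi> z * ln (cmod (G z)) \<partial>lborel) / (\<integral>w. radial_kernel r w \<partial>lborel)"
proof -
  obtain H where L: "log_potential H 0 \<rho> (zeros \<rho>) (\<lambda>w. real_of_int (zorder G w))" and
    eq: "\<And>z. z \<in> ball 0 \<rho> \<Longrightarrow> G z \<noteq> 0 \<Longrightarrow>
      ln (cmod (G z)) = log_potential.pot H (zeros \<rho>) (\<lambda>w. real_of_int (zorder G w)) z"
    using potential[OF assms(1)] by blast
  \<comment> \<open>The potential is known to be integrable only on strictly smaller balls, so a
    radius is inserted between the support and \<open>\<rho>\<close>.\<close>
  obtain \<rho>' where \<rho>': "a + r < \<rho>'" "\<rho>' < \<rho>" using r dense by blast
  have sub': "cball 0 \<rho>' \<subseteq> D" using assms \<rho>' by (meson order_trans subset_cball less_imp_le)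
  note [measurable] = measurable_ln_norm[OF sub'] log_potential.pot_measurable[OF L]
  have [measurable]: "ball (0::complex) \<rho>' \<in> sets borel" by simp
  have sm: "smoothing r \<phi> \<in> borel_measurable (restrict_space borel D)"
    by (intro measurable_restrict_space1) measurable
  have "(\<integral>z. circle_avg_diff r \<phi> z * ln (cmod (G z)) \<partial>lborel)
    = (\<integral>z. circle_avg_diff r \<phi> z * (indicator (ball 0 \<rho>') z * ln (cmod (G z))) \<partial>lborel)"
  proof (intro Bochner_Integration.integral_cong refl)
    fix z
    show "circle_avg_diff r \<phi> z * ln (cmod (G z)) = circle_avg_diff r \<phi> z * (indicator (ball 0 \<rho>') z * ln (cmod (G z)))"
      using circle_avg_diff_eq_0[OF supp _ r(1), where z = z] \<rho>' by (cases "cmod z < \<rho>'") auto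
  qed
  also have "\<dots> = (\<integral>z. (circle_avg r \<phi> z - circle_avg (r / 2) \<phi> z) * (indicator (ball 0 \<rho>') z * log_potential.pot H (zeros \<rho>) (\<lambda>w. real_of_int (zorder G w)) z) \<partial>lborel)"
  proof (rule integral_cong_AE)
    show "AE z in lborel. circle_avg_diff r \<phi> z * (indicator (ball 0 \<rho>') z * ln (cmod (G z))) =
      (circle_avg r \<phi> z - circle_avg (r / 2) \<phi> z) * (indicator (ball 0 \<rho>') z * log_potential.pot H (zeros \<rho>) (\<lambda>w. real_of_int (zorder G w)) z)"
      using AE_not_zeros[OF assms(1)]
      by eventually_elim (use eq \<rho>' in \<open>auto simp: indicator_def circle_avg_diff_def\<close>)
  qed measurable
  also have "\<dots> = (\<Sum>w\<in>zeros \<rho>. real_of_int (zorder G w) * (\<integral>z. \<phi> z * radial_kernel r (z - w) \<partial>lborel))"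
    by (rule log_potential.discrete_laplacian_pot(2)[OF L assms(2) B _ r(1) \<rho>']) (use supp in auto)
  finally have "(\<integral>z. circle_avg_diff r \<phi> z * ln (cmod (G z)) \<partial>lborel) = \<dots>" .
  moreover have "(\<integral>z. smoothing r \<phi> z \<partial>zero_measure D G) = (\<Sum>w\<in>zeros \<rho>. real_of_int (zorder G w) * smoothing r \<phi> w)"
    by (rule integral_zero_measure[OF assms(1) sm])
       (use smoothing_eq_0[OF assms(2) B r(1) supp] r in auto)
  ultimately show ?thesis
    by (simp add: smoothing_def sum_divide_distrib)
qed

end

section \<open>From pointwise bounds to convergence of potentials\<close>

text \<open>
  The function \<open>u + e - v\<close> is nonnegative, and its integral over a ball about a point where \<open>v\<close> is at least
  \<open>u - e\<close> is controlled by the submean property; averaging over the centres of the balls avoids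
  counting the balls of a covering.
\<close>

lemma submean_L1_bound:
  fixes u v :: "complex \<Rightarrow> real"
  assumes u: "continuous_on (cball 0 \<rho>) u"
    and uc: "\<And>x y. x \<in> ball 0 \<rho> \<Longrightarrow> y \<in> ball 0 \<rho> \<Longrightarrow> dist x y < 5 * \<delta> \<Longrightarrow> \<bar>u x - u y\<bar> < e"
    and \<delta>: "\<delta> > 0" "\<rho>0 + 8 * \<delta> < \<rho>" and e: "e > 0"
    and v: "integrable lborel (\<lambda>z. indicator (ball 0 \<rho>) z * v z)"
    and upper: "AE z in lborel. z \<in> ball 0 \<rho> \<longrightarrow> v z \<le> u z + e"
    and net: "\<And>x. x \<in> cball 0 (\<rho>0 + 2 * \<delta>) \<Longrightarrow> \<exists>s\<in>S. dist x s < \<delta>"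
    and lower: "\<And>s. s \<in> S \<Longrightarrow> s \<in> ball 0 \<rho> \<and> (\<exists>p\<in>ball s \<delta>. v p \<ge> u s - e \<and>
      (\<forall>\<delta>'>0. cmod p + \<delta>' < \<rho> \<longrightarrow> v p * measure lborel (ball p \<delta>') \<le> (\<integral>z. indicator (ball p \<delta>') z * v z \<partial>lborel)))"
  shows "(\<integral>z. indicator (cball 0 \<rho>0) z * \<bar>v z - u z\<bar> \<partial>lborel) \<le> 13 * e * measure lborel (ball (0::complex) \<rho>)"
proof -
  have [measurable]: "ball x t \<in> sets borel" "cball x t \<in> sets borel" for x :: complex and t by simp_all
  define b where "b = measure lborel (ball (0::complex) (2 * \<delta>))"
  have b: "b > 0" using \<delta> by (simp add: b_def)
  have ball_measure: "measure lborel (ball x (2 * \<delta>)) = b" "measure lborel (ball x (4 * \<delta>)) = 4 * b" for x :: complex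
    using \<delta> by (simp_all add: b_def content_ball unit_ball_vol_2 power2_eq_square)
  have ball_fin: "emeasure lborel (ball x t) < \<infinity>" "emeasure lborel (cball x t) < \<infinity>" for x :: complex and t
    by (simp_all only: emeasure_bounded_finite bounded_ball bounded_cball)
  have iu: "integrable lborel (\<lambda>z. indicator (ball 0 \<rho>) z * u z)"
    by (rule integrable_ball_continuous[OF u])
  have ie: "integrable lborel (\<lambda>z. indicator (ball (0::complex) \<rho>) z * e)"
    by (intro integrable_mult_left integrable_real_indicator) (use ball_fin in auto)
  define g0 where "g0 z = indicator (ball 0 \<rho>) z * u z + indicator (ball 0 \<rho>) z * e - indicator (ball 0 \<rho>) z * v z" for z
  \<comment> \<open>\<open>g0\<close> is nonnegative only almost everywhere; its positive part is
    nonnegative at every point and can enter an \<open>ennreal\<close> integral.\<close>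
  define g where "g z = max 0 (g0 z)" for z
  have ig0: "integrable lborel g0"
    unfolding g0_def using iu ie v by (intro Bochner_Integration.integrable_diff Bochner_Integration.integrable_add)
  then have ig: "integrable lborel g"
    unfolding g_def by (intro integrable_max) auto
  then have [measurable]: "g \<in> borel_measurable borel" by auto
  have g_nonneg: "g z \<ge> 0" for z by (simp add: g_def)
  have g_eq: "AE z in lborel. g z = g0 z"
    using upper by eventually_elim (auto simp: g_def g0_def indicator_def)
  \<comment> \<open>On the ball of radius \<open>4 * \<delta>\<close> about \<open>p\<close>, of
    area \<open>4 * b\<close>, the integrand is at most \<open>u s + 2 * e - v\<close>, and the mean
    of \<open>v\<close> is at least \<open>u s - e\<close>. This leaves \<open>3 * e\<close> times
    the area.\<close>
  have local_bound: "(\<integral>z. indicator (ball x (2 * \<delta>)) z * g z \<partial>lborel) \<le> 12 * e * b" if x: "x \<in> cball 0 (\<rho>0 + 2 * \<delta>)" for x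
  proof -
    obtain s where s: "s \<in> S" "dist x s < \<delta>" using net[OF x] by blast
    obtain p where p: "dist s p < \<delta>" "v p \<ge> u s - e"
      "\<And>\<delta>'. \<delta>' > 0 \<Longrightarrow> cmod p + \<delta>' < \<rho> \<Longrightarrow> v p * measure lborel (ball p \<delta>') \<le> (\<integral>z. indicator (ball p \<delta>') z * v z \<partial>lborel)"
      and s\<rho>: "s \<in> ball 0 \<rho>"
      using lower[OF s(1)] by auto
    have xp: "dist x p < 2 * \<delta>" using s p dist_triangle[of x p s] by simp
    have np: "cmod p + 4 * \<delta> < \<rho>"
      using x xp \<delta> norm_triangle_ineq[of x "p - x"] by (simp add: dist_norm norm_minus_commute)
    have sub: "z \<in> ball 0 \<rho>" if "z \<in> ball p (4 * \<delta>)" for z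
      using that np norm_triangle_ineq[of p "z - p"] by (simp add: dist_norm norm_minus_commute)
    have bp: "ball x (2 * \<delta>) \<subseteq> ball p (4 * \<delta>)"
    proof
      fix z assume "z \<in> ball x (2 * \<delta>)"
      then show "z \<in> ball p (4 * \<delta>)" using xp dist_triangle[of p z x] by (simp add: dist_commute)
    qed
    have ibv: "integrable lborel (\<lambda>z. indicator (ball p (4 * \<delta>)) z * v z)"
    proof -
      have "integrable lborel (\<lambda>z. indicator (ball p (4 * \<delta>)) z * (indicator (ball 0 \<rho>) z * v z))"
        using integrable_mult_indicator[OF _ v, of "ball p (4 * \<delta>)"] by simp
      also have "(\<lambda>z. indicator (ball p (4 * \<delta>)) z * (indicator (ball 0 \<rho>) z * v z)) = (\<lambda>z. indicator (ball p (4 * \<delta>)) z * v z)"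
        using sub by (auto simp: fun_eq_iff indicator_def)
      finally show ?thesis .
    qed
    have ibc: "integrable lborel (\<lambda>z. indicator (ball p (4 * \<delta>)) z * (u s + 2 * e))"
      by (intro integrable_mult_left integrable_real_indicator) (use ball_fin in auto)
    have ib: "integrable lborel (\<lambda>z. indicator (ball x t) z * g z)" for x t
      using integrable_mult_indicator[OF _ ig, of "ball x t"] by simp
    have "(\<integral>z. indicator (ball x (2 * \<delta>)) z * g z \<partial>lborel) \<le> (\<integral>z. indicator (ball p (4 * \<delta>)) z * g z \<partial>lborel)"
      using bp g_nonneg by (intro integral_mono ib) (auto simp: indicator_def)
    also have "\<dots> \<le> (\<integral>z. indicator (ball p (4 * \<delta>)) z * (u s + 2 * e) - indicator (ball p (4 * \<delta>)) z * v z \<partial>lborel)"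
    proof (rule integral_mono_AE)
      show "integrable lborel (\<lambda>z. indicator (ball p (4 * \<delta>)) z * (u s + 2 * e) - indicator (ball p (4 * \<delta>)) z * v z)"
        by (rule Bochner_Integration.integrable_diff[OF ibc ibv])
      show "AE z in lborel. indicator (ball p (4 * \<delta>)) z * g z \<le> indicator (ball p (4 * \<delta>)) z * (u s + 2 * e) - indicator (ball p (4 * \<delta>)) z * v z"
        using g_eq
      proof eventually_elim
        case (elim z)
        show ?case
        proof (cases "z \<in> ball p (4 * \<delta>)")
          case True
          have "dist z s < 5 * \<delta>" using True p dist_triangle[of z s p] by (simp add: dist_commute)
          then have "\<bar>u z - u s\<bar> < e" using sub[OF True] s\<rho> by (intro uc)
          then show ?thesis using True sub[OF True] elim by (simp add: g0_def)
        qed simp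
      qed
    qed (rule ib)
    also have "\<dots> = 4 * b * (u s + 2 * e) - (\<integral>z. indicator (ball p (4 * \<delta>)) z * v z \<partial>lborel)"
      using ibc ibv by (subst Bochner_Integration.integral_diff) (auto simp: ball_measure)
    also have "\<dots> \<le> 4 * b * (u s + 2 * e) - v p * (4 * b)"
      using p(3)[of "4 * \<delta>"] \<delta> np by (simp add: ball_measure)
    also have "\<dots> \<le> 4 * b * (u s + 2 * e) - (u s - e) * (4 * b)"
      using p(2) b by (simp add: mult_right_mono)
    also have "\<dots> = 12 * e * b" by (simp add: algebra_simps)
    finally show ?thesis .
  qed
  have eb: "emeasure lborel (ball x (2 * \<delta>)) = ennreal b" for x :: complex
    using ball_fin(1)[of x "2 * \<delta>"] by (simp add: emeasure_eq_ennreal_measure ball_measure)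
  \<comment> \<open>Each \<open>y\<close> lies in the balls about a set of centres \<open>x\<close>
    of area \<open>b\<close>. Exchanging the integrals therefore bounds \<open>b\<close> times the
    integral of \<open>g\<close> by an integral of the local bounds over the centres.\<close>
  have "(\<integral>\<^sup>+y. ennreal (indicator (cball 0 \<rho>0) y * g y) \<partial>lborel) * ennreal b
     = (\<integral>\<^sup>+y. (\<integral>\<^sup>+x. ennreal (indicator (cball 0 \<rho>0) y * g y) * indicator (ball y (2 * \<delta>)) x \<partial>lborel) \<partial>lborel)"
    by (simp add: nn_integral_cmult nn_integral_multc eb)
  also have "\<dots> \<le> (\<integral>\<^sup>+y. (\<integral>\<^sup>+x. indicator (cball 0 (\<rho>0 + 2 * \<delta>)) x * ennreal (g y * indicator {(x, y). dist x y < 2 * \<delta>} (x, y)) \<partial>lborel) \<partial>lborel)"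
  proof (intro nn_integral_mono)
    fix x y :: complex
    have "x \<in> cball 0 (\<rho>0 + 2 * \<delta>)" if "y \<in> cball 0 \<rho>0" "dist y x < 2 * \<delta>"
      using that norm_triangle_ineq[of y "x - y"] by (simp add: dist_norm norm_minus_commute)
    then show "ennreal (indicator (cball 0 \<rho>0) y * g y) * indicator (ball y (2 * \<delta>)) x
      \<le> indicator (cball 0 (\<rho>0 + 2 * \<delta>)) x * ennreal (g y * indicator {(x, y). dist x y < 2 * \<delta>} (x, y))"
      by (auto simp: indicator_def dist_commute)
  qed
  also have "\<dots> = (\<integral>\<^sup>+x. (\<integral>\<^sup>+y. indicator (cball 0 (\<rho>0 + 2 * \<delta>)) x * ennreal (g y * indicator {(x, y). dist x y < 2 * \<delta>} (x, y)) \<partial>lborel) \<partial>lborel)"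
    by (rule lborel_pair.Fubini') measurable
  also have "\<dots> \<le> (\<integral>\<^sup>+x. indicator (cball (0::complex) (\<rho>0 + 2 * \<delta>)) x * ennreal (12 * e * b) \<partial>lborel)"
  proof (rule nn_integral_mono)
    fix x :: complex
    show "(\<integral>\<^sup>+y. indicator (cball 0 (\<rho>0 + 2 * \<delta>)) x * ennreal (g y * indicator {(x, y). dist x y < 2 * \<delta>} (x, y)) \<partial>lborel)
      \<le> indicator (cball 0 (\<rho>0 + 2 * \<delta>)) x * ennreal (12 * e * b)"
    proof (cases "x \<in> cball 0 (\<rho>0 + 2 * \<delta>)")
      case True
      have "(\<integral>\<^sup>+y. ennreal (g y * indicator {(x, y). dist x y < 2 * \<delta>} (x, y)) \<partial>lborel) = (\<integral>\<^sup>+y. ennreal (indicator (ball x (2 * \<delta>)) y * g y) \<partial>lborel)"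
        by (intro nn_integral_cong) (auto simp: indicator_def)
      also have "\<dots> = ennreal (\<integral>y. indicator (ball x (2 * \<delta>)) y * g y \<partial>lborel)"
        using integrable_mult_indicator[OF _ ig, of "ball x (2 * \<delta>)"] g_nonneg
        by (intro nn_integral_eq_integral) auto
      also have "\<dots> \<le> ennreal (12 * e * b)"
        using local_bound[OF True] by (rule ennreal_leI)
      finally show ?thesis using True by simp
    qed simp
  qed
  also have "\<dots> = emeasure lborel (cball (0::complex) (\<rho>0 + 2 * \<delta>)) * ennreal (12 * e * b)"
    by (simp add: nn_integral_multc)
  also have "\<dots> \<le> emeasure lborel (ball (0::complex) \<rho>) * ennreal (12 * e * b)"
    using \<delta> by (intro mult_right_mono emeasure_mono) auto
  also have "\<dots> = ennreal (12 * e * measure lborel (ball (0::complex) \<rho>)) * ennreal b"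
    using ball_fin(1)[of 0 \<rho>] e b
    by (simp add: emeasure_eq_ennreal_measure ennreal_mult[symmetric] mult_ac)
  finally have "(\<integral>\<^sup>+y. ennreal (indicator (cball 0 \<rho>0) y * g y) \<partial>lborel) * ennreal b
    \<le> ennreal (12 * e * measure lborel (ball (0::complex) \<rho>)) * ennreal b" .
  moreover have icg: "integrable lborel (\<lambda>y. indicator (cball 0 \<rho>0) y * g y)"
    using integrable_mult_indicator[OF _ ig, of "cball 0 \<rho>0"] by simp
  then have "(\<integral>\<^sup>+y. ennreal (indicator (cball 0 \<rho>0) y * g y) \<partial>lborel) = ennreal (\<integral>y. indicator (cball 0 \<rho>0) y * g y \<partial>lborel)"
    using g_nonneg by (intro nn_integral_eq_integral) auto
  moreover have "0 \<le> (\<integral>y. indicator (cball 0 \<rho>0) y * g y \<partial>lborel)"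
    using g_nonneg by (intro Bochner_Integration.integral_nonneg) auto
  ultimately have gi: "(\<integral>y. indicator (cball 0 \<rho>0) y * g y \<partial>lborel) \<le> 12 * e * measure lborel (ball (0::complex) \<rho>)"
    using b e by (simp add: ennreal_mult[symmetric])
  have "cball (0::complex) \<rho>0 \<subseteq> ball 0 \<rho>" using \<delta> by auto
  then have sub: "z \<in> ball 0 \<rho>" if "z \<in> cball (0::complex) \<rho>0" for z using that by blast
  have icc: "integrable lborel (\<lambda>z. indicator (cball (0::complex) \<rho>0) z * e)"
    by (intro integrable_mult_left integrable_real_indicator) (use ball_fin in auto)
  \<comment> \<open>From \<open>v \<le> u + e\<close> the deviation is at most \<open>g + e\<close>;
    the extra \<open>e\<close> raises the constant from 12 to 13.\<close>
  have "(\<integral>z. indicator (cball 0 \<rho>0) z * \<bar>v z - u z\<bar> \<partial>lborel) \<le> (\<integral>z. indicator (cball 0 \<rho>0) z * g z + indicator (cball 0 \<rho>0) z * e \<partial>lborel)"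
  proof (rule integral_mono_AE')
    show "integrable lborel (\<lambda>z. indicator (cball 0 \<rho>0) z * g z + indicator (cball 0 \<rho>0) z * e)"
      using icg icc by (rule Bochner_Integration.integrable_add)
    show "AE z in lborel. indicator (cball 0 \<rho>0) z * \<bar>v z - u z\<bar> \<le> indicator (cball 0 \<rho>0) z * g z + indicator (cball 0 \<rho>0) z * e"
      using g_eq upper
    proof eventually_elim
      case (elim z)
      then show ?case using sub[of z] e by (cases "z \<in> cball 0 \<rho>0") (auto simp: g0_def)
    qed
  qed (use g_nonneg e in auto)
  also have "\<dots> = (\<integral>z. indicator (cball 0 \<rho>0) z * g z \<partial>lborel) + e * measure lborel (cball (0::complex) \<rho>0)"
    using icg icc by (subst Bochner_Integration.integral_add) auto
  also have "\<dots> \<le> 12 * e * measure lborel (ball (0::complex) \<rho>) + e * measure lborel (ball (0::complex) \<rho>)"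
    using gi e \<open>cball (0::complex) \<rho>0 \<subseteq> ball 0 \<rho>\<close> ball_fin
    by (intro add_mono mult_left_mono measure_mono_fmeasurable) (auto simp: fmeasurable_def)
  finally show ?thesis by (simp add: algebra_simps)
qed

text \<open>
  The net avoids the origin because the lower bound for the random series in a small disk is
  available only around nonzero centres.
\<close>

lemma compact_punctured_net:
  fixes \<rho> :: real
  assumes "\<delta> > 0" "\<rho>0 < \<rho>"
  obtains S :: "complex set" where "finite S" "S \<subseteq> ball 0 \<rho> - {0}" "\<And>x. x \<in> cball 0 \<rho>0 \<Longrightarrow> \<exists>s\<in>S. dist x s < \<delta>"
proof -
  have "cball 0 \<rho>0 \<subseteq> (\<Union>s\<in>ball 0 \<rho> - {0::complex}. ball s \<delta>)"
  proof
    fix x :: complex assume x: "x \<in> cball 0 \<rho>0"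
    show "x \<in> (\<Union>s\<in>ball 0 \<rho> - {0}. ball s \<delta>)"
    proof (cases "x = 0")
      case True
      define t where "t = min (\<rho> / 2) (\<delta> / 2)"
      have "t > 0" "t < \<rho>" "t < \<delta>" using assms x True by (auto simp: t_def min_def)
      then show ?thesis using True by (intro UN_I[of "of_real t"]) auto
    next
      case False
      then show ?thesis using assms x by (intro UN_I[of x]) auto
    qed
  qed
  note cover = this
  show ?thesis
  proof (rule compactE_image[OF compact_cball _ cover])
    fix S assume S: "S \<subseteq> ball 0 \<rho> - {0::complex}" "finite S" "cball 0 \<rho>0 \<subseteq> (\<Union>s\<in>S. ball s \<delta>)"
    show ?thesis
    proof (rule that[OF S(2,1)])
      fix x :: complex assume "x \<in> cball 0 \<rho>0"
      with S(3) have "x \<in> (\<Union>s\<in>S. ball s \<delta>)" by blast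
      then show "\<exists>s\<in>S. dist x s < \<delta>" by (auto simp: dist_commute)
    qed
  qed simp
qed

section \<open>The Legendre transform and its left derivative\<close>

lemma le_powr_if_inv_root_ge:
  assumes "x \<ge> 0" "t > 0" "R > 0" "ereal R \<le> inv_root x t"
  shows "x \<le> R powr (- t)"
proof (cases "x = 0")
  case False
  then have x: "x > 0" using assms by simp
  have "R \<le> x powr (- 1 / t)" using assms False by (simp add: inv_root_def)
  then have "ln R \<le> ln (x powr (- 1 / t))" using assms x by (subst ln_le_cancel_iff) auto
  then have "ln R \<le> - ln x / t" using x by (simp add: ln_powr)
  then have "ln x \<le> - t * ln R" using assms by (simp add: field_simps)
  then show ?thesis using x assms by (metis exp_le_cancel_iff exp_ln powr_def less_irrefl)
qed simp

lemma ereal_dense_real: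
  assumes "ereal r < R0"
  obtains R where "r < R" "ereal R < R0"
  using assms by (metis ereal_dense2 less_ereal.simps(1))

locale legendre_profile =
  fixes f :: "real \<Rightarrow> real" and T0 R0 :: ereal
  assumes f_nonneg: "\<And>t. t \<ge> 0 \<Longrightarrow> f t \<ge> 0"
    and T0_pos: "T0 > 0"
    and f_pos: "\<And>t. t \<ge> 0 \<Longrightarrow> ereal t < T0 \<Longrightarrow> f t > 0"
    and f_zero: "\<And>t. t \<ge> 0 \<Longrightarrow> ereal t > T0 \<Longrightarrow> f t = 0"
    and f_cont: "continuous_on {t. 0 \<le> t \<and> ereal t < T0} f"
    and f_left: "\<And>T. T0 = ereal T \<Longrightarrow> continuous (at_left T) f"
    and R0_eq: "R0 = Liminf at_top (\<lambda>t. inv_root (f t) t)" and R0_pos: "R0 > 0"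
begin

lemma f0_pos: "f 0 > 0"
  using f_pos[of 0] T0_pos by (simp add: zero_ereal_def)

text \<open>At a finite \<open>T0\<close> the function may jump down to 0: left continuity bounds it
  just below \<open>T0\<close>, and it vanishes beyond.\<close>

lemma f_bounded: "\<exists>B. \<forall>t\<in>{0..A}. f t \<le> B"
proof (cases "ereal A < T0")
  case True
  then have "ereal t < T0" if "t \<le> A" for t
    using that by (meson ereal_less_eq(3) le_less_trans)
  then have "continuous_on {0..A} f"
    by (intro continuous_on_subset[OF f_cont]) auto
  then have "bounded (f ` {0..A})"
    by (intro compact_imp_bounded compact_continuous_image) auto
  then obtain B where "\<forall>y\<in>f ` {0..A}. norm y \<le> B" unfolding bounded_iff by blast
  then show ?thesis by (intro exI[of _ B]) auto
next
  case False
  then obtain T where T: "T0 = ereal T" "0 < T" "T \<le> A"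
    using T0_pos by (cases T0) auto
  have "(f \<longlongrightarrow> f T) (at_left T)"
    using f_left[OF T(1)] by (simp add: continuous_within)
  then have "\<forall>\<^sub>F t in at_left T. f t < f T + 1"
    by (rule order_tendstoD) simp
  then obtain b where b: "b < T" "\<And>t. t > b \<Longrightarrow> t < T \<Longrightarrow> f t < f T + 1"
    unfolding eventually_at_left_field by blast
  have "continuous_on {0..max b 0} f"
    using b(1) T by (intro continuous_on_subset[OF f_cont]) auto
  then have "bounded (f ` {0..max b 0})"
    by (intro compact_imp_bounded compact_continuous_image) auto
  then obtain B where B: "\<forall>y\<in>f ` {0..max b 0}. norm y \<le> B" unfolding bounded_iff by blast
  have "f t \<le> max B (f T + 1)" if "t \<ge> 0" for t
  proof -
    consider "t \<le> b" | "t > b" "t < T" | "t = T" | "t > T" by linarith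
    then show ?thesis
    proof cases
      case 1
      then have "\<bar>f t\<bar> \<le> B" using B that by auto
      then show ?thesis by linarith
    next
      case 2
      then show ?thesis using b(2)[of t] by simp
    next
      case 4
      then show ?thesis using f_zero[OF that] T f_nonneg[of T] by simp
    qed simp
  qed
  then show ?thesis by (intro exI[of _ "max B (f T + 1)"] ballI) simp
qed

lemma f_tail:
  assumes "ereal R < R0" "R > 0"
  obtains A where "A > 0" "\<And>t. t \<ge> A \<Longrightarrow> f t \<le> R powr (- t)"
proof -
  have "\<forall>\<^sub>F t in at_top. ereal R < inv_root (f t) t"
    using assms(1) unfolding R0_eq by (rule less_LiminfD)
  then obtain A where A: "\<And>t. t \<ge> A \<Longrightarrow> ereal R < inv_root (f t) t"
    by (auto simp: eventually_at_top_linorder)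
  show ?thesis
  proof (rule that[of "max A 1"])
    fix t assume "t \<ge> max A 1"
    then show "f t \<le> R powr (- t)"
      using A[of t] assms f_nonneg[of t] by (intro le_powr_if_inv_root_ge) auto
  qed simp
qed

text \<open>A radius \<open>R\<close> strictly between \<open>exp s\<close> and \<open>R0\<close>
  gives the decay \<open>R powr (- t)\<close> for large \<open>t\<close>, which outweighs
  \<open>exp (s * t)\<close>.\<close>

lemma f_exp_bounded:
  assumes "ereal (exp s) < R0"
  obtains B where "B > 0" "\<And>t. t \<ge> 0 \<Longrightarrow> f t * exp (s * t) \<le> B"
proof -
  obtain R where R: "exp s < R" "ereal R < R0" using ereal_dense_real[OF assms] .
  then have "R > 0" using exp_gt_zero[of s] by linarith
  obtain A where A: "A > 0" "\<And>t. t \<ge> A \<Longrightarrow> f t \<le> R powr (- t)"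
    by (rule f_tail[OF R(2) \<open>R > 0\<close>]) (rule that)
  obtain B where B: "\<And>t. t \<in> {0..A} \<Longrightarrow> f t \<le> B" using f_bounded[of A] by blast
  have "s \<le> ln R" using R \<open>R > 0\<close> by (simp add: ln_ge_iff less_imp_le)
  have Bpos: "B > 0" using B[of 0] f0_pos A by simp
  have "f t * exp (s * t) \<le> max 1 (B * exp (\<bar>s\<bar> * A))" if "t \<ge> 0" for t
  proof (cases "t \<le> A")
    case True
    have "s * t \<le> \<bar>s\<bar> * A" using True that by (intro mult_mono) auto
    then have "f t * exp (s * t) \<le> B * exp (\<bar>s\<bar> * A)"
      using True that B[of t] Bpos by (intro mult_mono) auto
    then show ?thesis by simp
  next
    case False
    then have "f t * exp (s * t) \<le> R powr (- t) * exp (s * t)" using A(2)[of t] by simp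
    also have "\<dots> = exp ((s - ln R) * t)"
      using \<open>R > 0\<close> by (simp add: powr_def exp_add[symmetric] algebra_simps)
    also have "\<dots> \<le> 1" using \<open>s \<le> ln R\<close> that by (simp add: mult_nonpos_nonneg)
    finally show ?thesis by simp
  qed
  then show ?thesis using that[of "max 1 (B * exp (\<bar>s\<bar> * A))"] by simp
qed

text \<open>
  \<open>J\<close> is the function \<open>I\<close> as a real function on its domain \<open>dom\<close> of finiteness, \<open>L\<close> its left derivative and
  \<open>u\<close> the potential \<open>I (log |z|)\<close>; at \<open>z = 0\<close> the value is the limit of \<open>I\<close> at \<open>-\<infinity>\<close>.
\<close>

definition J :: "real \<Rightarrow> real" where "J s = real_of_ereal (legendre_log f s)"

definition dom :: "real set" where "dom = {s. ereal (exp s) < R0}"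

lemma legendre_log_eq:
  assumes "s \<in> dom"
  shows "legendre_log f s = ereal (J s)"
proof -
  obtain B where B: "B > 0" "\<And>t. t \<ge> 0 \<Longrightarrow> f t * exp (s * t) \<le> B"
    using f_exp_bounded assms by (auto simp: dom_def)
  have "legendre_log f s \<le> ereal (ln B)"
    unfolding legendre_log_def
  proof (rule SUP_least)
    fix t :: real assume t: "t \<in> {0..}"
    show "ereal (s * t) + elog (f t) \<le> ereal (ln B)"
    proof (cases "f t = 0")
      case False
      then have "f t > 0" using f_nonneg[of t] t by simp
      then have "ln (f t * exp (s * t)) \<le> ln B"
        using B t by (subst ln_le_cancel_iff) auto
      then show ?thesis using \<open>f t > 0\<close> by (simp add: elog_def ln_mult add.commute)
    qed (simp add: elog_def)
  qed
  moreover have "ereal (ln (f 0)) \<le> legendre_log f s"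
    unfolding legendre_log_def
    using f0_pos by (intro SUP_upper2[of 0]) (auto simp: elog_def)
  ultimately show ?thesis unfolding J_def by (cases "legendre_log f s") auto
qed

lemma le_J:
  assumes "s \<in> dom" "t \<ge> 0"
  shows "f t * exp (s * t) \<le> exp (J s)"
proof (cases "f t = 0")
  case False
  then have ft: "f t > 0" using f_nonneg[of t] assms by simp
  have "ereal (s * t) + elog (f t) \<le> ereal (J s)"
    unfolding legendre_log_eq[OF assms(1), symmetric] legendre_log_def using assms by (intro SUP_upper) auto
  then have "s * t + ln (f t) \<le> J s" using ft by (simp add: elog_def)
  then have "exp (s * t + ln (f t)) \<le> exp (J s)" by simp
  then show ?thesis using ft by (simp add: exp_add mult.commute)
qed simp

lemma le_J_ln:
  assumes "s \<in> dom" "t \<ge> 0" "f t > 0"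
  shows "s * t + ln (f t) \<le> J s"
proof -
  have "exp (s * t + ln (f t)) \<le> exp (J s)"
    using le_J[OF assms(1,2)] assms(3) by (simp add: exp_add mult.commute)
  then show ?thesis by simp
qed

text \<open>The point \<open>t\<close> is kept strictly below \<open>T0\<close>, where
  \<open>f\<close> is continuous; a whole window of coefficients around index \<open>t * n\<close>
  is compared with \<open>f t\<close> later. If a near-maximum is attained at \<open>T0\<close>
  itself, left continuity moves the point slightly to the left.\<close>

lemma J_approx:
  assumes "s \<in> dom" "e > 0"
  obtains t where "t \<ge> 0" "ereal t < T0" "f t > 0" "J s - e < s * t + ln (f t)"
proof -
  have "ereal (J s - e) < legendre_log f s"
    unfolding legendre_log_eq[OF assms(1)] using assms by simp
  then obtain t where t: "t \<ge> 0" "ereal (J s - e) < ereal (s * t) + elog (f t)"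
    unfolding legendre_log_def less_SUP_iff by auto
  then have "f t \<noteq> 0" by (auto simp: elog_def)
  then have ft: "f t > 0" using f_nonneg[OF t(1)] by simp
  have less: "J s - e < s * t + ln (f t)" using t ft by (simp add: elog_def)
  show ?thesis
  proof (cases "ereal t < T0")
    case True
    then show ?thesis using that t ft less by blast
  next
    case False
    then have T: "T0 = ereal t" using f_zero[OF t(1)] ft by force
    then have "t > 0" using T0_pos by simp
    have lim: "(f \<longlongrightarrow> f t) (at_left t)"
      using f_left[OF T] by (simp add: continuous_within)
    then have "((\<lambda>x. s * x + ln (f x)) \<longlongrightarrow> s * t + ln (f t)) (at_left t)"
      using ft by (intro tendsto_intros) auto
    then have "\<forall>\<^sub>F x in at_left t. J s - e < s * x + ln (f x)"
      using less by (rule order_tendstoD)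
    moreover have "\<forall>\<^sub>F x in at_left t. x \<in> {0<..<t}"
      using \<open>t > 0\<close> by (rule eventually_at_left_real)
    ultimately have "\<forall>\<^sub>F x in at_left t. J s - e < s * x + ln (f x) \<and> x \<in> {0<..<t}"
      by eventually_elim auto
    then obtain x where "J s - e < s * x + ln (f x)" "0 < x" "x < t"
      using eventually_happens'[OF trivial_limit_at_left_real] by fastforce
    then show ?thesis using that[of x] T f_pos[of x] by simp
  qed
qed

lemma ln_f0_le_J: "s \<in> dom \<Longrightarrow> ln (f 0) \<le> J s"
  using le_J_ln[of s 0] f0_pos by simp

lemma dom_mono: "s \<in> dom \<Longrightarrow> s' \<le> s \<Longrightarrow> s' \<in> dom"
  unfolding dom_def by (auto intro: le_less_trans[of _ "ereal (exp s)"])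

lemma J_mono:
  assumes "s' \<in> dom" "s \<le> s'"
  shows "J s \<le> J s'"
proof (rule field_le_epsilon)
  fix e :: real assume "e > 0"
  have s: "s \<in> dom" using dom_mono assms by blast
  obtain t where t: "t \<ge> 0" "f t > 0" "J s - e < s * t + ln (f t)"
    using J_approx[OF s \<open>e > 0\<close>] by blast
  have "s * t \<le> s' * t" using assms t by (intro mult_right_mono) auto
  then show "J s \<le> J s' + e" using le_J_ln[OF assms(1) t(1,2)] t(3) by linarith
qed

lemma open_dom: "open dom"
proof -
  have "dom = (\<lambda>s. ereal (exp s)) -` {..<R0}" by (auto simp: dom_def)
  moreover have "open ((\<lambda>s. ereal (exp s)) -` {..<R0})"
    by (intro open_vimage open_lessThan continuous_intros)
  ultimately show ?thesis by simp
qed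

lemma convex_dom: "convex dom"
proof -
  have "is_interval dom"
    unfolding is_interval_1 by (auto intro: dom_mono)
  then show ?thesis by (simp add: is_interval_convex_1)
qed

text \<open>A supremum of affine functions of \<open>s\<close>: an almost maximal \<open>p\<close>
  for the intermediate point serves for both ends.\<close>

lemma J_convex: "convex_on dom J"
proof (rule convex_onI[OF _ convex_dom])
  fix t x y :: real assume t: "0 < t" "t < 1" and xy: "x \<in> dom" "y \<in> dom"
  let ?z = "(1 - t) *\<^sub>R x + t *\<^sub>R y"
  have z: "?z \<in> dom" using convexD[OF convex_dom xy, of "1 - t" t] t by simp
  show "J ?z \<le> (1 - t) * J x + t * J y"
  proof (rule field_le_epsilon)
    fix e :: real assume "e > 0"
    obtain p where p: "p \<ge> 0" "f p > 0" "J ?z - e < ?z * p + ln (f p)"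
      using J_approx[OF z \<open>e > 0\<close>] by blast
    have "?z * p + ln (f p) = (1 - t) * (x * p + ln (f p)) + t * (y * p + ln (f p))"
      by (simp add: algebra_simps)
    also have "\<dots> \<le> (1 - t) * J x + t * J y"
      using t le_J_ln[OF xy(1) p(1,2)] le_J_ln[OF xy(2) p(1,2)]
      by (intro add_mono mult_left_mono) auto
    finally show "J ?z \<le> (1 - t) * J x + t * J y + e" using p(3) by linarith
  qed
qed

lemma J_continuous: "continuous_on dom J"
  by (rule convex_on_continuous[OF open_dom J_convex])

lemma dom_nonempty: "\<exists>s. s \<in> dom"
proof -
  obtain R where R: "0 < R" "ereal R < R0"
    using R0_pos ereal_dense_real[of 0 R0] by (auto simp: zero_ereal_def)
  then show ?thesis by (intro exI[of _ "ln R"]) (simp add: dom_def)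
qed

text \<open>As \<open>s\<close> tends to minus infinity only small \<open>t\<close> count, and there
  \<open>f\<close> is close to \<open>f 0 > 0\<close>. This is what makes \<open>u\<close>
  continuous at the origin.\<close>

lemma J_near_bottom:
  assumes "e > 0"
  obtains s0 where "s0 \<in> dom" "\<And>s. s \<le> s0 \<Longrightarrow> J s \<le> ln (f 0) + e"
proof -
  obtain s1 where s1: "s1 \<in> dom" using dom_nonempty by blast
  have "f 0 < f 0 * exp e" using f0_pos assms by simp
  have "0 \<in> {t. 0 \<le> t \<and> ereal t < T0}" using T0_pos by (simp add: zero_ereal_def)
  then have "\<exists>d>0. \<forall>t\<in>{t. 0 \<le> t \<and> ereal t < T0}. dist t 0 < d \<longrightarrow> dist (f t) (f 0) < f 0 * exp e - f 0"
    using f_cont \<open>f 0 < f 0 * exp e\<close> unfolding continuous_on_iff by auto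
  then obtain d where d: "d > 0" "\<And>t. 0 \<le> t \<Longrightarrow> ereal t < T0 \<Longrightarrow> t < d \<Longrightarrow> f t < f 0 * exp e"
    by (auto simp: dist_real_def abs_less_iff)
  \<comment> \<open>For \<open>t \<ge> d\<close>, shifting \<open>s1\<close> by \<open>c\<close>
    lowers the exponent by at least \<open>- c * d\<close>, which is made large enough to bring
    \<open>J s1\<close> down to \<open>ln (f 0)\<close>.\<close>
  define c where "c = min 0 ((ln (f 0) - J s1) / d)"
  define s0 where "s0 = s1 + c"
  define s0' where "s0' = min s0 0"
  have "c \<le> 0" by (simp add: c_def)
  have "c * d \<le> ln (f 0) - J s1"
  proof -
    have "c \<le> (ln (f 0) - J s1) / d" by (simp add: c_def)
    then show ?thesis using d by (simp add: pos_le_divide_eq)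
  qed
  have s0: "s0' \<in> dom" using dom_mono[OF s1, of s0'] \<open>c \<le> 0\<close> by (simp add: s0_def s0'_def)
  have "J s \<le> ln (f 0) + e" if "s \<le> s0'" for s
  proof (rule field_le_epsilon)
    fix e' :: real assume "e' > 0"
    have s: "s \<in> dom" using dom_mono[OF s0 that] .
    obtain t where t: "t \<ge> 0" "ereal t < T0" "f t > 0" "J s - e' < s * t + ln (f t)"
      using J_approx[OF s \<open>e' > 0\<close>] .
    have "s * t + ln (f t) \<le> ln (f 0) + e"
    proof (cases "t < d")
      case True
      have "ln (f t) \<le> ln (f 0 * exp e)" using d(2)[OF t(1,2) True] t(3) f0_pos by (subst ln_le_cancel_iff) auto
      also have "\<dots> = ln (f 0) + e" using f0_pos by (simp add: ln_mult)
      finally show ?thesis using that t(1) mult_nonpos_nonneg[of s t] by (simp add: s0'_def)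
    next
      case False
      have "s * t \<le> (s1 + c) * t" using that t(1) by (intro mult_right_mono) (auto simp: s0'_def s0_def)
      moreover have "c * t \<le> c * d" using False \<open>c \<le> 0\<close> by (intro mult_left_mono_neg) auto
      ultimately have "s * t + ln (f t) \<le> (s1 * t + ln (f t)) + c * d" by (simp add: algebra_simps)
      also have "\<dots> \<le> ln (f 0)" using le_J_ln[OF s1 t(1,3)] \<open>c * d \<le> ln (f 0) - J s1\<close> by linarith
      finally show ?thesis using assms by simp
    qed
    then show "J s \<le> ln (f 0) + e + e'" using t(4) by linarith
  qed
  then show ?thesis using that s0 by blast
qed

definition u :: "complex \<Rightarrow> real" where
  "u z = (if z = 0 then ln (f 0) else J (ln (cmod z)))"

lemma ln_cmod_dom: "z \<noteq> 0 \<Longrightarrow> ereal (cmod z) < R0 \<Longrightarrow> ln (cmod z) \<in> dom"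
  by (simp add: dom_def)

lemma u_continuous: "continuous_on (eball 0 R0) u"
proof (rule continuous_at_imp_continuous_on, rule ballI)
  fix z :: complex assume z: "z \<in> eball 0 R0"
  show "isCont u z"
  proof (cases "z = 0")
    case False
    have "\<forall>\<^sub>F w in nhds z. w \<noteq> 0" using False by (rule t1_space_nhds)
    then have ev: "\<forall>\<^sub>F w in nhds z. u w = J (ln (cmod w))" by eventually_elim (simp add: u_def)
    have "isCont J (ln (cmod z))"
      using J_continuous open_dom ln_cmod_dom[OF False] z by (simp add: continuous_on_eq_continuous_at)
    have "isCont (\<lambda>w. ln (cmod w)) z"
      using False by (intro continuous_intros) auto
    then have "isCont (\<lambda>w. J (ln (cmod w))) z"
      using \<open>isCont J (ln (cmod z))\<close> by (rule isCont_o2)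
    then show ?thesis unfolding isCont_cong[OF ev] .
  next
    case True
    have "\<exists>d>0. \<forall>w. dist w 0 < d \<longrightarrow> dist (u w) (u 0) < e" if "e > 0" for e
    proof -
      obtain s0 where s0: "s0 \<in> dom" "\<And>s. s \<le> s0 \<Longrightarrow> J s \<le> ln (f 0) + e / 2"
        using J_near_bottom[OF half_gt_zero[OF \<open>e > 0\<close>]] by blast
      have "dist (u w) (u 0) < e" if w: "cmod w < exp s0" for w
      proof (cases "w = 0")
        case False
        then have "ln (cmod w) \<le> s0" using w ln_less_cancel_iff[of "cmod w" "exp s0"] by simp
        then show ?thesis
          using s0(2)[of "ln (cmod w)"] ln_f0_le_J[OF dom_mono[OF s0(1), of "ln (cmod w)"]] False \<open>e > 0\<close>
          by (simp add: u_def dist_real_def)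
      qed (use \<open>e > 0\<close> in simp)
      then show ?thesis by (intro exI[of _ "exp s0"]) auto
    qed
    then show ?thesis unfolding True continuous_at_eps_delta by blast
  qed
qed

end

section \<open>Chord slopes, the left derivative and its integral\<close>

context legendre_profile
begin

text \<open>For a convex function the chord slopes ending at \<open>s\<close> increase to the left
  derivative, so the limit is a supremum.\<close>

definition L :: "real \<Rightarrow> real" where
  "L s = (SUP x\<in>{..<s}. (J s - J x) / (s - x))"

lemma slope_mono:
  assumes "x < s" "s < y" "y \<in> dom"
  shows "(J s - J x) / (s - x) \<le> (J y - J x) / (y - x)"
    and "(J y - J x) / (y - x) \<le> (J y - J s) / (y - s)"
proof -
  have d: "x \<in> dom" "y \<in> dom" using assms dom_mono[of y x] by auto
  have eq: "(J a - J b) / (a - b) = (J b - J a) / (b - a)" for a b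
    by (metis minus_diff_eq minus_divide_divide)
  show "(J s - J x) / (s - x) \<le> (J y - J x) / (y - x)"
    using convex_on_slope_le(1)[OF J_convex d assms(1,2)] by (simp only: eq[of x])
  show "(J y - J x) / (y - x) \<le> (J y - J s) / (y - s)"
    using convex_on_slope_le(2)[OF J_convex d assms(1,2)] by (simp only: eq[of x y] eq[of s y])
qed

lemma slope_le_right:
  assumes "x < s" "s < y" "y \<in> dom"
  shows "(J s - J x) / (s - x) \<le> (J y - J s) / (y - s)"
  using slope_mono[OF assms] by (rule order_trans)

lemma dom_right: "s \<in> dom \<Longrightarrow> \<exists>y>s. y \<in> dom"
proof -
  assume "s \<in> dom"
  then obtain e where "e > 0" "\<And>y. dist y s < e \<Longrightarrow> y \<in> dom"
    using open_dom unfolding open_dist by blast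
  then show ?thesis by (intro exI[of _ "s + e / 2"]) (auto simp: dist_real_def)
qed

lemma bdd_slopes: "s \<in> dom \<Longrightarrow> bdd_above ((\<lambda>x. (J s - J x) / (s - x)) ` {..<s})"
proof -
  assume "s \<in> dom"
  then obtain y where "s < y" "y \<in> dom" using dom_right by blast
  then show ?thesis using slope_le_right[of _ s y] by (intro bdd_aboveI2) auto
qed

lemma slope_le_L: "s \<in> dom \<Longrightarrow> x < s \<Longrightarrow> (J s - J x) / (s - x) \<le> L s"
  unfolding L_def by (rule cSUP_upper[OF _ bdd_slopes]) auto

lemma L_le_slope: "y \<in> dom \<Longrightarrow> s < y \<Longrightarrow> L s \<le> (J y - J s) / (y - s)"
  unfolding L_def using slope_le_right[of _ s y] by (intro cSUP_least) auto

lemma L_mono: "y \<in> dom \<Longrightarrow> s \<le> y \<Longrightarrow> L s \<le> L y"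
  using L_le_slope[of y s] slope_le_L[of y s] by (cases "s = y") auto

lemma L_nonneg: "s \<in> dom \<Longrightarrow> L s \<ge> 0"
  using slope_le_L[of s "s - 1"] J_mono[of s "s - 1"] by simp

text \<open>Left continuity of \<open>L\<close>: a chord slope above \<open>c\<close> persists when
  its right endpoint moves slightly to the left. The radii of the limit measure need this, since
  open balls are described by strict inequalities.\<close>

lemma L_gt_near:
  assumes s: "s \<in> dom" and c: "c < L s"
  shows "\<exists>x<s. c < L x"
proof -
  obtain x0 where x0: "x0 < s" "c < (J s - J x0) / (s - x0)"
    using c bdd_slopes[OF s] unfolding L_def by (subst (asm) less_cSUP_iff) auto
  have "isCont J s" using J_continuous open_dom s by (simp add: continuous_on_eq_continuous_at)
  then have "(J \<longlongrightarrow> J s) (at_left s)"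
    unfolding isCont_def by (rule filterlim_mono) (auto simp: at_le)
  then have "((\<lambda>x. (J x - J x0) / (x - x0)) \<longlongrightarrow> (J s - J x0) / (s - x0)) (at_left s)"
    using x0 by (intro tendsto_intros) auto
  then have "\<forall>\<^sub>F x in at_left s. c < (J x - J x0) / (x - x0)"
    using x0(2) by (rule order_tendstoD)
  moreover have "\<forall>\<^sub>F x in at_left s. x \<in> {x0<..<s}"
    using x0(1) by (rule eventually_at_left_real)
  ultimately have "\<forall>\<^sub>F x in at_left s. x < s \<and> c < L x"
  proof eventually_elim
    case (elim x)
    then have "x \<in> dom" using dom_mono[OF s, of x] by auto
    then show ?case using elim slope_le_L[of x x0] by auto
  qed
  then show ?thesis
    using eventually_happens'[OF trivial_limit_at_left_real] by blast
qed

lemma J_left_derivative: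
  assumes s: "s \<in> dom"
  shows "(J has_real_derivative L s) (at_left s)"
  unfolding has_field_derivative_iff
proof (rule order_tendstoI)
  have ev: "\<forall>\<^sub>F x in at_left s. x < s" by (simp add: eventually_at_filter)
  have eq: "(J x - J s) / (x - s) = (J s - J x) / (s - x)" for x
    by (metis minus_diff_eq minus_divide_divide)
  fix c
  {
    assume "c < L s"
    then obtain x0 where x0: "x0 < s" "c < (J s - J x0) / (s - x0)"
      using bdd_slopes[OF s] unfolding L_def by (subst (asm) less_cSUP_iff) auto
    have "\<forall>\<^sub>F x in at_left s. x \<in> {x0<..<s}"
      using x0(1) by (rule eventually_at_left_real)
    then show "\<forall>\<^sub>F x in at_left s. c < (J x - J s) / (x - s)"
    proof eventually_elim
      case (elim x)
      then show ?case using x0 slope_mono(2)[of x0 x s] s by (auto simp: eq)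
    qed
  next
    assume "L s < c"
    then show "\<forall>\<^sub>F x in at_left s. (J x - J s) / (x - s) < c"
      using ev by (auto elim!: eventually_mono simp: eq intro: le_less_trans[OF slope_le_L[OF s]])
  }
qed

lemma L_measurable:
  assumes "b \<in> dom"
  shows "(\<lambda>x. indicator {a<..b} x * L x) \<in> borel_measurable borel"
proof -
  \<comment> \<open>Monotonicity is known only on \<open>dom\<close>; capping the argument at
    \<open>b\<close> makes the function monotone on the whole line.\<close>
  have "mono (\<lambda>x. L (min x b))"
    by (rule monoI) (auto intro!: L_mono dom_mono[OF assms] min.mono)
  then have [measurable]: "(\<lambda>x. L (min x b)) \<in> borel_measurable borel"
    by (rule borel_measurable_mono)
  have "(\<lambda>x. indicator {a<..b} x * L (min x b)) \<in> borel_measurable borel" by measurable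
  also have "(\<lambda>x. indicator {a<..b} x * L (min x b)) = (\<lambda>x. indicator {a<..b} x * L x)"
    by (auto simp: fun_eq_iff indicator_def)
  finally show ?thesis .
qed

lemma L_integrable:
  assumes "b \<in> dom"
  shows "integrable lborel (\<lambda>x. indicator {a<..b} x * L x)"
proof -
  have "integrable lborel (\<lambda>x. indicator {a<..b} x * L b)"
    by (intro integrable_mult_left integrable_real_indicator) (use emeasure_bounded_finite[OF bounded_subset[OF bounded_closed_interval[of a b] greaterThanAtMost_subseteq_atLeastAtMost_iff[THEN iffD2]]] in auto)
  then show ?thesis
    by (rule Bochner_Integration.integrable_bound)
       (use L_measurable[OF assms] L_mono[OF assms] L_nonneg[OF dom_mono[OF assms]]
        in \<open>auto simp: indicator_def intro!: AE_I2 order_trans[OF _ abs_ge_self]\<close>)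
qed

text \<open>Both the integral of \<open>L\<close> and the increment of \<open>J\<close> over [x, y]
  lie between \<open>L x * (y - x)\<close> and \<open>L y * (y - x)\<close>. On a partition of
  [a, b] into \<open>N\<close> equal pieces the discrepancies telescope to at most
  \<open>(L b - L a) * (b - a) / N\<close>.\<close>

lemma integral_L:
  assumes b: "b \<in> dom" and ab: "a \<le> b"
  shows "(\<integral>x. indicator {a<..b} x * L x \<partial>lborel) = J b - J a"
proof -
  define A where "A x y = (\<integral>t. indicator {x<..y} t * L t \<partial>lborel)" for x y
  have split: "A x z = A x y + A y z" if "x \<le> y" "y \<le> z" "z \<in> dom" for x y z
  proof -
    have "y \<in> dom" using dom_mono that by blast
    have "A x z = (\<integral>t. indicator {x<..y} t * L t + indicator {y<..z} t * L t \<partial>lborel)"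
      unfolding A_def using that by (intro Bochner_Integration.integral_cong) (auto simp: indicator_def)
    also have "\<dots> = A x y + A y z"
      unfolding A_def using that \<open>y \<in> dom\<close> by (intro Bochner_Integration.integral_add L_integrable)
    finally show ?thesis .
  qed
  have A_bounds: "L x * (y - x) \<le> A x y" "A x y \<le> L y * (y - x)" if "x \<le> y" "y \<in> dom" for x y
  proof -
    have const: "integrable lborel (\<lambda>t. indicator {x<..y} t * c)" "(\<integral>t. indicator {x<..y} t * c \<partial>lborel) = c * (y - x)" for c :: real
      using that by (auto intro!: integrable_mult_left integrable_real_indicator)
    have d: "t \<in> dom" if "t \<le> y" for t using dom_mono \<open>y \<in> dom\<close> that by blast
    show "L x * (y - x) \<le> A x y"
      unfolding A_def const(2)[symmetric] using that L_mono[OF d]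
      by (intro integral_mono const L_integrable) (auto simp: indicator_def)
    show "A x y \<le> L y * (y - x)"
      unfolding A_def const(2)[symmetric] using that L_mono
      by (intro integral_mono const L_integrable) (auto simp: indicator_def)
  qed
  have J_bounds: "L x * (y - x) \<le> J y - J x" "J y - J x \<le> L y * (y - x)" if "x \<le> y" "y \<in> dom" for x y
    using L_le_slope[of y x] slope_le_L[of y x] that by (cases "x = y"; simp add: field_simps)+
  have err: "\<bar>A x y - (J y - J x)\<bar> \<le> (L y - L x) * (y - x)" if "x \<le> y" "y \<in> dom" for x y
    using A_bounds[OF that] J_bounds[OF that] by (simp add: algebra_simps abs_le_iff)
  have "\<bar>A a b - (J b - J a)\<bar> \<le> (L b - L a) * (b - a) / real N" if "N > 0" for N :: nat
  proof -
    define h where "h = (b - a) / real N"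
    have "h \<ge> 0" using ab by (simp add: h_def)
    have "\<bar>A a (a + i * h) - (J (a + i * h) - J a)\<bar> \<le> (L (a + i * h) - L a) * h" if "i \<le> N" for i :: nat
      using that
    proof (induction i)
      case 0
      then show ?case by (simp add: A_def)
    next
      case (Suc i)
      have le: "a + real (Suc i) * h \<le> b"
      proof -
        have "real (Suc i) * h \<le> real N * h" using Suc.prems \<open>h \<ge> 0\<close> by (intro mult_right_mono) auto
        then show ?thesis using \<open>N > 0\<close> by (simp add: h_def)
      qed
      then have d: "a + real (Suc i) * h \<in> dom" using dom_mono[OF b] by blast
      have e: "a \<le> a + real i * h" "a + real i * h \<le> a + real (Suc i) * h"
        using \<open>h \<ge> 0\<close> by (auto intro!: mult_right_mono)
      have s: "A a (a + real (Suc i) * h) = A a (a + real i * h) + A (a + real i * h) (a + real (Suc i) * h)"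
        by (rule split[OF e d])
      have hh: "a + real (Suc i) * h - (a + real i * h) = h" by (simp add: algebra_simps)
      have "\<bar>A (a + real i * h) (a + real (Suc i) * h) - (J (a + real (Suc i) * h) - J (a + real i * h))\<bar>
         \<le> (L (a + real (Suc i) * h) - L (a + real i * h)) * h"
        using err[OF e(2) d] unfolding hh .
      moreover have "\<bar>A a (a + i * h) - (J (a + i * h) - J a)\<bar> \<le> (L (a + i * h) - L a) * h"
        using Suc by simp
      ultimately show ?case unfolding s left_diff_distrib by linarith
    qed
    from this[of N] show ?thesis using \<open>N > 0\<close> by (simp add: h_def)
  qed
  then have "\<bar>A a b - (J b - J a)\<bar> \<le> 0"
  proof (intro LIMSEQ_le_const[where X = "\<lambda>N. (L b - L a) * (b - a) / real N"])
    show "(\<lambda>N. (L b - L a) * (b - a) / real N) \<longlonglongrightarrow> 0" by (rule lim_const_over_n)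
  qed (auto intro!: exI[of _ 1])
  then show ?thesis by (simp add: A_def)
qed

end

section \<open>Exponential bounds for the coefficients and the series\<close>

locale coefficient_array = legendre_profile f T0 R0
  for f :: "real \<Rightarrow> real" and T0 R0 :: ereal +
  fixes a :: "nat \<Rightarrow> nat \<Rightarrow> complex"
  assumes coeff_lim: "\<And>A::real. A > 0 \<Longrightarrow>
      (\<lambda>n. SUP k\<in>{k::nat. real k \<le> A * real n}.
             \<bar>cmod (a k n) powr (1 / real n) - f (real k / real n)\<bar>) \<longlonglongrightarrow> 0"
    and coeff_fixed: "\<And>n. n \<ge> 1 \<Longrightarrow>
      liminf (\<lambda>k. inv_root (cmod (a k n)) (real k)) \<ge> R0"
    and coeff_joint: "\<And>R::real. ereal R < R0 \<Longrightarrow>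
      \<exists>A>0. \<forall>n k. real n \<ge> A \<longrightarrow> real k \<ge> A * real n \<longrightarrow>
        inv_root (cmod (a k n)) (real k) \<ge> ereal R"
begin

text \<open>A real \<open>SUP\<close> dominates its terms only over a bounded family; here
  boundedness comes from the finiteness of the index set.\<close>

lemma coeff_unif:
  assumes "A > 0" "e > 0"
  shows "\<forall>\<^sub>F n in sequentially. \<forall>k. real k \<le> A * real n \<longrightarrow> \<bar>cmod (a k n) powr (1 / real n) - f (real k / real n)\<bar> < e"
  using order_tendstoD(2)[OF coeff_lim[OF assms(1)] assms(2)]
proof eventually_elim
  case (elim n)
  have "finite {k::nat. real k \<le> A * real n}"
    by (rule finite_subset[of _ "{..nat \<lceil>A * real n\<rceil>}"]) (auto simp: le_nat_iff, linarith)
  then have "bdd_above ((\<lambda>k. \<bar>cmod (a k n) powr (1 / real n) - f (real k / real n)\<bar>) ` {k::nat. real k \<le> A * real n})"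
    by (intro bdd_above_finite finite_imageI)
  from cSUP_upper[OF _ this] show ?case
    using elim by (meson le_less_trans mem_Collect_eq)
qed

lemma powr_inverse_power: "x \<ge> 0 \<Longrightarrow> n > 0 \<Longrightarrow> (x powr (1 / real n)) ^ n = x"
  by (cases "x = 0") (auto simp: powr_realpow[symmetric] powr_powr)

text \<open>The sum is split at an index near \<open>A * n\<close>. Below it the uniform
  approximation bounds every term by the exponential with \<open>\<eta> / 2\<close> in place of
  \<open>\<eta>\<close>, and there are at most \<open>A * n + 1\<close> terms; beyond it a geometric
  series dominates. The other half of \<open>\<eta>\<close> absorbs these factors.\<close>

lemma array_sum_bound:
  assumes r: "r > 0" "ereal r < R0" and \<eta>: "\<eta> > 0"
  shows "\<forall>\<^sub>F n in sequentially. summable (\<lambda>k. cmod (a k n) * r ^ k) \<and>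
    (\<Sum>k. cmod (a k n) * r ^ k) \<le> exp (real n * (J (ln r) + \<eta>))"
proof -
  define J0 where "J0 = J (ln r)"
  have dom: "ln r \<in> dom" using r by (simp add: dom_def)
  obtain R where R: "r < R" "ereal R < R0" using ereal_dense_real[OF r(2)] .
  obtain A1 where A1: "A1 > 0" "\<And>n k. real n \<ge> A1 \<Longrightarrow> real k \<ge> A1 * real n \<Longrightarrow> inv_root (cmod (a k n)) (real k) \<ge> ereal R"
    using coeff_joint[OF R(2)] by blast
  define q where "q = r / R"
  have q: "0 < q" "q < 1" using R r by (auto simp: q_def)
  then have lnq: "ln q < 0" by simp
  \<comment> \<open>The second summand makes q^(A n) at most exp (n J0), also when \<open>J0\<close>
    is negative.\<close>
  define A where "A = A1 + \<bar>J0\<bar> / (- ln q)"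
  have A: "A \<ge> A1" "A > 0" "A * ln q \<le> J0"
  proof -
    have "\<bar>J0\<bar> / (- ln q) \<ge> 0" using lnq by (intro divide_nonneg_pos) auto
    then show "A \<ge> A1" "A > 0" using A1 by (auto simp: A_def)
    have "A * ln q = A1 * ln q - \<bar>J0\<bar>" using lnq by (simp add: A_def left_diff_distrib)
    also have "\<dots> \<le> J0" using A1 lnq mult_pos_neg[of A1 "ln q"] by linarith
    finally show "A * ln q \<le> J0" .
  qed
  \<comment> \<open>\<open>M\<close> bounds r^(k/n) for all \<open>k \<le> A * n\<close>, whether
    \<open>r\<close> is below or above 1. The error \<open>\<delta>\<close> is then chosen so that
    \<open>exp J0 + \<delta> * M\<close> equals \<open>exp (J0 + \<eta> / 2)\<close>.\<close>
  define M where "M = max 1 r powr A"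
  have M: "M \<ge> 1" using A by (simp add: M_def ge_one_powr_ge_zero)
  define \<delta> where "\<delta> = exp J0 * (exp (\<eta> / 2) - 1) / M"
  have \<delta>: "\<delta> > 0" using M \<eta> by (simp add: \<delta>_def)
  define E where "E n = exp (real n * (J0 + \<eta> / 2))" for n :: nat
  have "\<forall>\<^sub>F n in sequentially. A * real n + 1 + 1 / (1 - q) \<le> exp (real n * (\<eta> / 2))"
    using A(2) \<eta> by real_asymp
  moreover have "\<forall>\<^sub>F n in sequentially. real n \<ge> A1 \<and> n > 0"
  proof -
    have "\<forall>\<^sub>F n in sequentially. n \<ge> nat \<lceil>A1\<rceil> + 1" by (rule eventually_ge_at_top)
    then show ?thesis by eventually_elim (auto, linarith)
  qed
  ultimately show ?thesis
    using coeff_unif[OF A(2) \<delta>]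
  proof eventually_elim
    case (elim n)
    then have n: "n > 0" "real n \<ge> A1" by auto
    define K where "K = nat \<lfloor>A * real n\<rfloor>"
    have K: "k \<le> K \<longleftrightarrow> real k \<le> A * real n" for k
      using A n by (simp add: K_def le_nat_iff le_floor_iff)
    have small: "cmod (a k n) * r ^ k \<le> E n" if "k \<le> K" for k
    proof -
      have k: "real k \<le> A * real n" using that K by simp
      define x where "x = cmod (a k n) powr (1 / real n)"
      define y where "y = r powr (real k / real n)"
      have "x \<le> f (real k / real n) + \<delta>" using elim k unfolding x_def by fastforce
      then have "x * y \<le> (f (real k / real n) + \<delta>) * y" by (intro mult_right_mono) (auto simp: y_def)
      also have "\<dots> = f (real k / real n) * exp (ln r * (real k / real n)) + \<delta> * y"
        using r by (simp add: y_def powr_def algebra_simps)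
      also have "\<dots> \<le> exp J0 + \<delta> * M"
      proof (intro add_mono mult_left_mono)
        show "f (real k / real n) * exp (ln r * (real k / real n)) \<le> exp J0"
          unfolding J0_def by (rule le_J[OF dom]) auto
        have "y \<le> max 1 r powr (real k / real n)" unfolding y_def using r by (intro powr_mono2) auto
        also have "\<dots> \<le> M" unfolding M_def using k n by (intro powr_mono) (auto simp: field_simps)
        finally show "y \<le> M" .
      qed (use \<delta> in auto)
      also have "\<dots> = exp J0 * exp (\<eta> / 2)" using M by (simp add: \<delta>_def right_diff_distrib)
      also have "\<dots> = exp (J0 + \<eta> / 2)" by (simp add: exp_add)
      finally have "(x * y) ^ n \<le> exp (J0 + \<eta> / 2) ^ n"
        by (intro power_mono) (auto simp: x_def y_def)
      moreover have "x ^ n = cmod (a k n)" unfolding x_def using n by (intro powr_inverse_power) auto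
      moreover have "y ^ n = r ^ k"
        unfolding y_def using r n by (simp add: powr_realpow[symmetric] powr_powr)
      ultimately show ?thesis by (simp add: E_def power_mult_distrib exp_of_nat_mult[symmetric])
    qed
    have large: "cmod (a k n) * r ^ k \<le> q ^ k" if "k > K" for k
    proof -
      have k: "real k > A * real n" using that K[of k] by simp
      have "A * real n \<ge> A1 * real n" using A by (intro mult_right_mono) auto
      then have k1: "real k \<ge> A1 * real n" using k by linarith
      have "real k > 0" using k1 A1(1) n mult_pos_pos[of A1 "real n"] by linarith
      have "cmod (a k n) \<le> R powr (- real k)"
        using A1(2)[OF n(2) k1] \<open>real k > 0\<close> R r by (intro le_powr_if_inv_root_ge) auto
      then have "cmod (a k n) * r ^ k \<le> R powr (- real k) * r ^ k"
        using r by (intro mult_right_mono) auto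
      also have "\<dots> = q ^ k"
        using R r by (simp add: q_def powr_minus powr_realpow field_simps)
      finally show ?thesis .
    qed
    have sum_tail: "summable (\<lambda>k. cmod (a (k + Suc K) n) * r ^ (k + Suc K))"
    proof (rule summable_comparison_test')
      show "summable (\<lambda>k. q ^ Suc K * q ^ k)" using q by (intro summable_mult summable_geometric) auto
      show "norm (cmod (a (k + Suc K) n) * r ^ (k + Suc K)) \<le> q ^ Suc K * q ^ k" if "k \<ge> 0" for k
        using large[of "k + Suc K"] r by (simp add: power_add mult_ac)
    qed
    then have sum: "summable (\<lambda>k. cmod (a k n) * r ^ k)"
      by (subst (asm) summable_iff_shift)
    have "(\<Sum>k. cmod (a (k + Suc K) n) * r ^ (k + Suc K)) \<le> (\<Sum>k. q ^ Suc K * q ^ k)"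
    proof (rule suminf_le[OF _ sum_tail])
      show "summable (\<lambda>k. q ^ Suc K * q ^ k)" using q by (intro summable_mult summable_geometric) auto
      show "cmod (a (k + Suc K) n) * r ^ (k + Suc K) \<le> q ^ Suc K * q ^ k" for k
        using large[of "k + Suc K"] by (simp add: power_add mult_ac)
    qed
    also have "\<dots> = q ^ Suc K * (1 / (1 - q))"
      using q by (subst suminf_mult) (auto simp: suminf_geometric)
    also have "\<dots> \<le> E n * (1 / (1 - q))"
    proof (intro mult_right_mono)
      have "real (Suc K) \<ge> A * real n" using K[of "Suc K"] by simp
      have "q ^ Suc K = q powr real (Suc K)" using q by (simp only: powr_realpow)
      also have "\<dots> = exp (real (Suc K) * ln q)" using q by (simp add: powr_def)
      also have "\<dots> \<le> exp ((A * real n) * ln q)"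
        using \<open>real (Suc K) \<ge> A * real n\<close> lnq by (simp add: mult_right_mono_neg)
      also have "(A * real n) * ln q = real n * (A * ln q)" by simp
      also have "exp \<dots> \<le> exp (real n * (J0 + \<eta> / 2))"
        using A(3) \<eta> by (simp add: mult_left_mono)
      finally show "q ^ Suc K \<le> E n" by (simp add: E_def)
    qed (use q in auto)
    finally have tail: "(\<Sum>k. cmod (a (k + Suc K) n) * r ^ (k + Suc K)) \<le> E n * (1 / (1 - q))" .
    have "(\<Sum>k<Suc K. cmod (a k n) * r ^ k) \<le> real (card {..<Suc K}) * E n"
      by (rule sum_bounded_above) (use small in auto)
    also have "\<dots> \<le> (A * real n + 1) * E n"
      using K[of K] by (intro mult_right_mono) (auto simp: E_def)
    finally have head: "(\<Sum>k<Suc K. cmod (a k n) * r ^ k) \<le> (A * real n + 1) * E n" .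
    have "(\<Sum>k. cmod (a k n) * r ^ k) = (\<Sum>k. cmod (a (k + Suc K) n) * r ^ (k + Suc K)) + (\<Sum>k<Suc K. cmod (a k n) * r ^ k)"
      by (rule suminf_split_initial_segment[OF sum])
    also have "\<dots> \<le> E n * (A * real n + 1 + 1 / (1 - q))"
      using head tail by (simp add: algebra_simps)
    also have "\<dots> \<le> E n * exp (real n * (\<eta> / 2))"
      using elim by (intro mult_left_mono) (auto simp: E_def)
    also have "\<dots> = exp (real n * (J (ln r) + \<eta>))"
      by (simp add: E_def J0_def exp_add[symmetric] algebra_simps)
    finally show ?case using sum by simp
  qed
qed

end

context legendre_profile
begin

lemma u_continuous_cball: "ereal \<rho> < R0 \<Longrightarrow> continuous_on (cball 0 \<rho>) u"
  by (rule continuous_on_subset[OF u_continuous]) (auto intro!: le_less_trans[of _ "ereal \<rho>" R0])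

end

context coefficient_array
begin

lemma isCont_J: "s \<in> dom \<Longrightarrow> isCont J s"
  using J_continuous open_dom by (simp add: continuous_on_eq_continuous_at)

text \<open>The weights split into a power of \<open>exp \<epsilon>\<close> with exponent
  \<open>k\<close> and one with exponent \<open>n\<close>. The first enlarges the radius to
  \<open>r * exp \<epsilon>\<close>, at a cost governed by continuity of \<open>J\<close> at
  \<open>ln r\<close>; the second adds \<open>\<epsilon>\<close> to the rate. Each of the three
  losses is at most \<open>\<eta> / 3\<close>.\<close>

lemma weighted_sum_bound:
  assumes r: "r > 0" "ereal r < R0" and \<eta>: "\<eta> > 0"
  shows "\<exists>\<epsilon>>0. \<forall>\<^sub>F n in sequentially. \<forall>x. (\<forall>k. 0 \<le> x k \<and> x k \<le> exp (\<epsilon> * (real k + real n))) \<longrightarrow>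
    summable (\<lambda>k. x k * (cmod (a k n) * r ^ k)) \<and>
    (\<Sum>k. x k * (cmod (a k n) * r ^ k)) \<le> exp (real n * (J (ln r) + \<eta>))"
proof -
  have s: "ln r \<in> dom" using r by (simp add: dom_def)
  have "\<forall>\<^sub>F s in at (ln r). dist (J s) (J (ln r)) < \<eta> / 3"
    using isCont_J[OF s] \<eta> unfolding isCont_def by (intro tendstoD) auto
  moreover have "\<forall>\<^sub>F s in at (ln r). s \<in> dom"
    by (rule eventually_at_in_open'[OF open_dom s])
  ultimately have "\<forall>\<^sub>F s in at (ln r). dist (J s) (J (ln r)) < \<eta> / 3 \<and> s \<in> dom" by (rule eventually_conj)
  then obtain d where d: "d > 0" "\<And>s. s \<noteq> ln r \<Longrightarrow> dist s (ln r) < d \<Longrightarrow> dist (J s) (J (ln r)) < \<eta> / 3 \<and> s \<in> dom"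
    unfolding eventually_at by blast
  define \<epsilon> where "\<epsilon> = min (d / 2) (\<eta> / 3)"
  have \<epsilon>: "\<epsilon> > 0" "\<epsilon> < d" "\<epsilon> \<le> \<eta> / 3" using d \<eta> by (auto simp: \<epsilon>_def)
  have e: "dist (J (ln r + \<epsilon>)) (J (ln r)) < \<eta> / 3" "ln r + \<epsilon> \<in> dom"
    using d(2)[of "ln r + \<epsilon>"] \<epsilon> by (auto simp: dist_real_def)
  define r' where "r' = r * exp \<epsilon>"
  have lr': "ln r' = ln r + \<epsilon>" using r by (simp add: r'_def ln_mult)
  have r': "r' > 0" using r by (simp add: r'_def)
  then have "ereal r' < R0" using e(2) lr' by (metis dom_def exp_ln mem_Collect_eq)
  from array_sum_bound[OF r' this, of "\<eta> / 3"] \<eta>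
  have "\<forall>\<^sub>F n in sequentially. summable (\<lambda>k. cmod (a k n) * r' ^ k) \<and>
    (\<Sum>k. cmod (a k n) * r' ^ k) \<le> exp (real n * (J (ln r') + \<eta> / 3))" by simp
  then have "\<forall>\<^sub>F n in sequentially. \<forall>x. (\<forall>k. 0 \<le> x k \<and> x k \<le> exp (\<epsilon> * (real k + real n))) \<longrightarrow>
    summable (\<lambda>k. x k * (cmod (a k n) * r ^ k)) \<and>
    (\<Sum>k. x k * (cmod (a k n) * r ^ k)) \<le> exp (real n * (J (ln r) + \<eta>))"
  proof (eventually_elim, intro allI impI)
    fix n and x :: "nat \<Rightarrow> real"
    assume n: "summable (\<lambda>k. cmod (a k n) * r' ^ k) \<and>
      (\<Sum>k. cmod (a k n) * r' ^ k) \<le> exp (real n * (J (ln r') + \<eta> / 3))"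
    and x: "\<forall>k. 0 \<le> x k \<and> x k \<le> exp (\<epsilon> * (real k + real n))"
    have sm: "summable (\<lambda>k. exp (\<epsilon> * n) * (cmod (a k n) * r' ^ k))" using n by (intro summable_mult) auto
    have le: "x k * (cmod (a k n) * r ^ k) \<le> exp (\<epsilon> * n) * (cmod (a k n) * r' ^ k)" for k
    proof -
      have "x k * (cmod (a k n) * r ^ k) \<le> exp (\<epsilon> * (real k + real n)) * (cmod (a k n) * r ^ k)"
        using x r by (intro mult_right_mono) auto
      also have "exp (\<epsilon> * (real k + real n)) = exp (\<epsilon> * n) * exp \<epsilon> ^ k"
        by (simp add: exp_of_nat_mult[symmetric] exp_add[symmetric] algebra_simps)
      finally show ?thesis by (simp add: r'_def power_mult_distrib mult_ac)
    qed
    have s1: "summable (\<lambda>k. x k * (cmod (a k n) * r ^ k))"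
      using le x r by (intro summable_comparison_test'[OF sm, of 0]) auto
    have "(\<Sum>k. x k * (cmod (a k n) * r ^ k)) \<le> (\<Sum>k. exp (\<epsilon> * n) * (cmod (a k n) * r' ^ k))"
      by (rule suminf_le[OF le s1 sm])
    also have "\<dots> = exp (\<epsilon> * n) * (\<Sum>k. cmod (a k n) * r' ^ k)" using n by (intro suminf_mult) auto
    also have "\<dots> \<le> exp (\<epsilon> * n) * exp (real n * (J (ln r') + \<eta> / 3))" using n by (intro mult_left_mono) auto
    also have "\<dots> = exp (real n * (\<epsilon> + J (ln r') + \<eta> / 3))" by (simp add: exp_add[symmetric] algebra_simps)
    also have "\<dots> \<le> exp (real n * (J (ln r) + \<eta>))"
    proof -
      have "\<epsilon> + J (ln r') + \<eta> / 3 \<le> J (ln r) + \<eta>"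
        using e(1) \<epsilon> \<eta> unfolding lr' dist_real_def by linarith
      then show ?thesis by (simp add: mult_left_mono)
    qed
    finally show "summable (\<lambda>k. x k * (cmod (a k n) * r ^ k)) \<and>
       (\<Sum>k. x k * (cmod (a k n) * r ^ k)) \<le> exp (real n * (J (ln r) + \<eta>))" using s1 by blast
  qed
  then show ?thesis using \<epsilon>(1) by blast
qed

lemma u_cmod: "u (of_real (cmod z)) = u z"
  by (simp add: u_def)

text \<open>One \<open>\<epsilon>\<close> must serve the whole disk, so the estimate is applied at
  finitely many radii only. A point is compared with a slightly larger grid radius, where the series
  of absolute values is larger and \<open>u\<close> has barely changed.\<close>

lemma series_upper_bound:
  assumes \<rho>: "\<rho> > 0" "ereal \<rho> < R0" and \<eta>: "\<eta> > 0"
  shows "\<exists>\<epsilon>>0. \<forall>\<^sub>F n in sequentially. \<forall>x. (\<forall>k. cmod (x k) \<le> exp (\<epsilon> * (real k + real n))) \<longrightarrow>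
    (\<forall>z\<in>cball 0 \<rho>. cmod (\<Sum>k. x k * a k n * z ^ k) \<le> exp (real n * (u z + \<eta>)))"
proof -
  have "uniformly_continuous_on (cball 0 \<rho>) u"
    using u_continuous_cball[OF \<rho>(2)] by (rule compact_uniformly_continuous) simp
  then obtain d where d: "d > 0" "\<And>x y. x \<in> cball 0 \<rho> \<Longrightarrow> y \<in> cball 0 \<rho> \<Longrightarrow> dist y x < d \<Longrightarrow> dist (u y) (u x) < \<eta> / 2"
    unfolding uniformly_continuous_on_def using \<eta> by (metis half_gt_zero)
  obtain m :: nat where m: "m > 0" "\<rho> / m < d"
  proof -
    obtain m :: nat where m: "\<rho> / d < m" using reals_Archimedean2 by blast
    have "0 < \<rho> / d" using \<rho> d by simp
    then have "0 < real m" using m by linarith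
    moreover from this have "\<rho> / m < d" using m d by (simp add: field_simps)
    ultimately show ?thesis using that by simp
  qed
  define r where "r i = \<rho> * real i / real m" for i
  have r: "r i > 0" "ereal (r i) < R0" "r i \<le> \<rho>" if "i \<in> {1..m}" for i
  proof -
    show "r i > 0" using that \<rho> m by (simp add: r_def)
    have "\<rho> * real i \<le> \<rho> * real m" using that \<rho> by (intro mult_left_mono) auto
    then show le: "r i \<le> \<rho>" using m by (simp add: r_def field_simps)
    then have "ereal (r i) \<le> ereal \<rho>" by simp
    then show "ereal (r i) < R0" using \<rho>(2) by (rule le_less_trans)
  qed
  have "\<forall>i\<in>{1..m}. \<exists>\<epsilon>>0. \<forall>\<^sub>F n in sequentially. \<forall>x. (\<forall>k. 0 \<le> x k \<and> x k \<le> exp (\<epsilon> * (real k + real n))) \<longrightarrow>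
    summable (\<lambda>k. x k * (cmod (a k n) * r i ^ k)) \<and>
    (\<Sum>k. x k * (cmod (a k n) * r i ^ k)) \<le> exp (real n * (J (ln (r i)) + \<eta> / 2))"
    using weighted_sum_bound[OF r(1,2)] \<eta> by simp
  then obtain \<epsilon>f where \<epsilon>f: "\<And>i. i \<in> {1..m} \<Longrightarrow> \<epsilon>f i > 0"
    "\<And>i. i \<in> {1..m} \<Longrightarrow> \<forall>\<^sub>F n in sequentially. \<forall>x. (\<forall>k. 0 \<le> x k \<and> x k \<le> exp (\<epsilon>f i * (real k + real n))) \<longrightarrow>
    summable (\<lambda>k. x k * (cmod (a k n) * r i ^ k)) \<and>
    (\<Sum>k. x k * (cmod (a k n) * r i ^ k)) \<le> exp (real n * (J (ln (r i)) + \<eta> / 2))"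
    by (subst (asm) bchoice_iff) blast
  define \<epsilon> where "\<epsilon> = Min (\<epsilon>f ` {1..m})"
  have \<epsilon>: "\<epsilon> > 0" "\<And>i. i \<in> {1..m} \<Longrightarrow> \<epsilon> \<le> \<epsilon>f i"
    using \<epsilon>f(1) m by (auto simp: \<epsilon>_def)
  have "\<forall>\<^sub>F n in sequentially. \<forall>i\<in>{1..m}. \<forall>x. (\<forall>k. 0 \<le> x k \<and> x k \<le> exp (\<epsilon>f i * (real k + real n))) \<longrightarrow>
    summable (\<lambda>k. x k * (cmod (a k n) * r i ^ k)) \<and>
    (\<Sum>k. x k * (cmod (a k n) * r i ^ k)) \<le> exp (real n * (J (ln (r i)) + \<eta> / 2))"
    using \<epsilon>f(2) by (intro eventually_ball_finite) auto
  then have "\<forall>\<^sub>F n in sequentially. \<forall>x. (\<forall>k. cmod (x k) \<le> exp (\<epsilon> * (real k + real n))) \<longrightarrow>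
    (\<forall>z\<in>cball 0 \<rho>. cmod (\<Sum>k. x k * a k n * z ^ k) \<le> exp (real n * (u z + \<eta>)))"
  proof (eventually_elim, intro allI impI ballI)
    fix n and x :: "nat \<Rightarrow> complex" and z :: complex
    assume H: "\<forall>i\<in>{1..m}. \<forall>x. (\<forall>k. 0 \<le> x k \<and> x k \<le> exp (\<epsilon>f i * (real k + real n))) \<longrightarrow>
      summable (\<lambda>k. x k * (cmod (a k n) * r i ^ k)) \<and>
      (\<Sum>k. x k * (cmod (a k n) * r i ^ k)) \<le> exp (real n * (J (ln (r i)) + \<eta> / 2))"
      and x: "\<forall>k. cmod (x k) \<le> exp (\<epsilon> * (real k + real n))" and z: "z \<in> cball 0 \<rho>"
    \<comment> \<open>The origin is assigned to the first positive radius, because the logarithm of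
      the grid radius is taken.\<close>
    define i where "i = max 1 (nat \<lceil>real m * cmod z / \<rho>\<rceil>)"
    have "real m * cmod z / \<rho> \<le> real m" using z \<rho> m by (simp add: field_simps)
    then have i: "i \<in> {1..m}" using m by (auto simp: i_def nat_le_iff ceiling_le_iff)
    have "real m * cmod z / \<rho> \<le> real i" unfolding i_def by linarith
    then have zi: "cmod z \<le> r i" using \<rho> m by (simp add: r_def field_simps)
    have "real i \<le> real m * cmod z / \<rho> + 1"
    proof -
      have "0 \<le> real m * cmod z / \<rho>" using \<rho> by simp
      then show ?thesis unfolding i_def by linarith
    qed
    then have iz: "r i \<le> cmod z + \<rho> / m" using \<rho> m by (simp add: r_def field_simps)
    have "cmod (x k) \<le> exp (\<epsilon>f i * (real k + real n))" for k
    proof -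
      have "\<epsilon> * (real k + real n) \<le> \<epsilon>f i * (real k + real n)" using \<epsilon>(2)[OF i] by (intro mult_right_mono) auto
      then show ?thesis using x order_trans exp_le_cancel_iff by metis
    qed
    then have S: "summable (\<lambda>k. cmod (x k) * (cmod (a k n) * r i ^ k))"
      "(\<Sum>k. cmod (x k) * (cmod (a k n) * r i ^ k)) \<le> exp (real n * (J (ln (r i)) + \<eta> / 2))"
      using bspec[OF H i, THEN spec, of "\<lambda>k. cmod (x k)"] by auto
    have le: "cmod (x k * a k n * z ^ k) \<le> cmod (x k) * (cmod (a k n) * r i ^ k)" for k
      using zi by (auto simp: norm_mult norm_power mult.assoc intro!: mult_left_mono power_mono)
    have sn: "summable (\<lambda>k. cmod (x k * a k n * z ^ k))"
      by (rule summable_comparison_test'[OF S(1), of 0]) (use le in auto)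
    have "cmod (\<Sum>k. x k * a k n * z ^ k) \<le> (\<Sum>k. cmod (x k * a k n * z ^ k))"
      by (rule summable_norm[OF sn])
    also have "\<dots> \<le> (\<Sum>k. cmod (x k) * (cmod (a k n) * r i ^ k))"
      by (rule suminf_le[OF le sn S(1)])
    also note S(2)
    also have "exp (real n * (J (ln (r i)) + \<eta> / 2)) \<le> exp (real n * (u z + \<eta>))"
    proof -
      have "J (ln (r i)) = u (of_real (r i))" using r(1)[OF i] by (simp add: u_def)
      moreover have "dist (u (of_real (r i))) (u (of_real (cmod z))) < \<eta> / 2"
        using z r[OF i] zi iz m by (intro d(2)) (auto simp: dist_of_real dist_real_def)
      ultimately have "J (ln (r i)) + \<eta> / 2 \<le> u z + \<eta>" unfolding u_cmod dist_real_def by linarith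
      then show ?thesis by (simp add: mult_left_mono)
    qed
    finally show "cmod (\<Sum>k. x k * a k n * z ^ k) \<le> exp (real n * (u z + \<eta>))" .
  qed
  then show ?thesis using \<epsilon>(1) by blast
qed

text \<open>The indices of the window divided by \<open>n\<close> tend to the near-maximiser
  \<open>t\<close>, so the weights are close to f(t)^n |z|^(t n). The power of \<open>z\<close> is
  that of the first index: once it is removed, the window is a polynomial of degree below
  \<open>m\<close>. Four approximations cost at most \<open>\<eta> / 4\<close> each: the choice of
  \<open>t\<close>, the coefficients, the modulus of \<open>z\<close>, and the rounding of
  \<open>t * n\<close>.\<close>

lemma coefficient_window:
  assumes z0: "z0 \<noteq> 0" "ereal (cmod z0) < R0" and \<eta>: "\<eta> > 0"
  obtains t \<delta> where "t \<ge> 0" "\<delta> > 0" "\<And>m. \<forall>\<^sub>F n in sequentially. \<forall>j<m. \<forall>z\<in>ball z0 \<delta>.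
      exp (real n * (u z0 - \<eta>)) \<le> cmod (a (nat \<lfloor>t * real n\<rfloor> + j) n) * cmod z ^ nat \<lfloor>t * real n\<rfloor>"
proof -
  define s where "s = ln (cmod z0)"
  have s: "s \<in> dom" using ln_cmod_dom[OF z0] by (simp add: s_def)
  have "\<eta> / 4 > 0" using \<eta> by simp
  obtain t where t: "t \<ge> 0" "ereal t < T0" "f t > 0" "J s - \<eta> / 4 < s * t + ln (f t)"
    using J_approx[OF s \<open>\<eta> / 4 > 0\<close>] by blast
  \<comment> \<open>The tolerance for \<open>ln (cmod z)\<close>: multiplied by \<open>t\<close> it
    costs at most \<open>\<eta> / 4\<close>, and \<open>t + 1\<close> covers the case
    \<open>t = 0\<close>.\<close>
  define \<kappa> where "\<kappa> = \<eta> / (4 * (t + 1))"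
  have \<kappa>: "\<kappa> > 0" "\<kappa> * t \<le> \<eta> / 4" using t \<eta> by (auto simp: \<kappa>_def field_simps)
  have "isCont (\<lambda>z. ln (cmod z)) z0" using z0 by (intro continuous_intros) auto
  then obtain \<delta>0 where \<delta>0: "\<delta>0 > 0" "\<And>z. dist z z0 < \<delta>0 \<Longrightarrow> dist (ln (cmod z)) s < \<kappa>"
    unfolding continuous_at_eps_delta s_def using \<kappa> by metis
  define \<delta> where "\<delta> = min \<delta>0 (cmod z0)"
  have \<delta>: "\<delta> > 0" using \<delta>0 z0 by (simp add: \<delta>_def)
  have near: "z \<noteq> 0" "ln (cmod z) \<ge> s - \<kappa>" if "z \<in> ball z0 \<delta>" for z
  proof -
    show "z \<noteq> 0" using that by (auto simp: \<delta>_def)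
    show "ln (cmod z) \<ge> s - \<kappa>" using \<delta>0(2)[of z] that by (auto simp: \<delta>_def dist_commute dist_real_def)
  qed
  have "\<forall>\<^sub>F n in sequentially. \<forall>z\<in>ball z0 \<delta>.
      exp (real n * (u z0 - \<eta>)) \<le> cmod (a (nat \<lfloor>t * real n\<rfloor> + j) n) * cmod z ^ nat \<lfloor>t * real n\<rfloor>" for j
  proof -
    define K where "K n = nat \<lfloor>t * real n\<rfloor>" for n :: nat
    have K: "real (K n) \<le> t * real n" "t * real n - 1 \<le> real (K n)" for n
    proof -
      have "\<lfloor>t * real n\<rfloor> \<ge> 0" using t by simp
      then have "real (K n) = of_int \<lfloor>t * real n\<rfloor>" by (simp add: K_def)
      then show "real (K n) \<le> t * real n" "t * real n - 1 \<le> real (K n)" by linarith+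
    qed
    have lim: "(\<lambda>n. real (K n + j) / real n) \<longlonglongrightarrow> t"
    proof (rule real_tendsto_sandwich)
      show "\<forall>\<^sub>F n in sequentially. (t * real n - 1) / real n \<le> real (K n + j) / real n"
      proof (rule always_eventually, rule allI)
        fix n show "(t * real n - 1) / real n \<le> real (K n + j) / real n"
          using K(2)[of n] by (intro divide_right_mono) auto
      qed
      show "\<forall>\<^sub>F n in sequentially. real (K n + j) / real n \<le> (t * real n + real j) / real n"
      proof (rule always_eventually, rule allI)
        fix n show "real (K n + j) / real n \<le> (t * real n + real j) / real n"
          using K(1)[of n] by (intro divide_right_mono) auto
      qed
      show "(\<lambda>n. (t * real n - 1) / real n) \<longlonglongrightarrow> t" by real_asymp
      show "(\<lambda>n. (t * real n + real j) / real n) \<longlonglongrightarrow> t" by real_asymp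
    qed
    define c where "c = f t * exp (- \<eta> / 4)"
    have c: "0 < c" "c < f t" using t \<eta> by (auto simp: c_def)
    have "open {x. ereal x < T0}"
      using open_vimage[OF open_lessThan[of T0], of ereal] by (simp add: vimage_def lessThan_def continuous_on_ereal)
    then have ev1: "\<forall>\<^sub>F n in sequentially. ereal (real (K n + j) / real n) < T0"
      using lim t(2) by (auto simp: tendsto_def)
    have "((\<lambda>n. f (real (K n + j) / real n)) \<longlongrightarrow> f t) sequentially"
    proof (rule continuous_on_tendsto_compose[OF f_cont lim])
      show "t \<in> {t. 0 \<le> t \<and> ereal t < T0}" using t by simp
      show "\<forall>\<^sub>F n in sequentially. real (K n + j) / real n \<in> {t. 0 \<le> t \<and> ereal t < T0}"
        using ev1 by eventually_elim auto
    qed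
    then have ev2: "\<forall>\<^sub>F n in sequentially. (c + f t) / 2 < f (real (K n + j) / real n)"
      using c by (intro order_tendstoD) auto
    have ev3: "\<forall>\<^sub>F n in sequentially. \<forall>k. real k \<le> (t + 1) * real n \<longrightarrow>
        \<bar>cmod (a k n) powr (1 / real n) - f (real k / real n)\<bar> < (f t - c) / 2"
      using t c by (intro coeff_unif) auto
    have ev4: "\<forall>\<^sub>F n in sequentially. real (K n + j) / real n < t + 1"
      using lim by (rule order_tendstoD) simp
    have ev5: "\<forall>\<^sub>F n in sequentially. \<bar>s\<bar> \<le> \<eta> / 4 * real n"
      using \<eta> by real_asymp
    show ?thesis
      using ev2 ev3 ev4 ev5 eventually_gt_at_top[of 0]
    proof (eventually_elim, intro ballI)
      fix n :: nat and z :: complex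
      assume n: "(c + f t) / 2 < f (real (K n + j) / real n)"
        "\<forall>k. real k \<le> (t + 1) * real n \<longrightarrow> \<bar>cmod (a k n) powr (1 / real n) - f (real k / real n)\<bar> < (f t - c) / 2"
        "real (K n + j) / real n < t + 1" "\<bar>s\<bar> \<le> \<eta> / 4 * real n" "0 < n" and z: "z \<in> ball z0 \<delta>"
      have "real (K n + j) \<le> (t + 1) * real n" using n(3,5) by (simp add: field_simps)
      then have "\<bar>cmod (a (K n + j) n) powr (1 / real n) - f (real (K n + j) / real n)\<bar> < (f t - c) / 2"
        using n(2) by blast
      then have "c \<le> cmod (a (K n + j) n) powr (1 / real n)" using n(1) by argo
      then have "c ^ n \<le> (cmod (a (K n + j) n) powr (1 / real n)) ^ n" using c by (intro power_mono) auto
      also have "\<dots> = cmod (a (K n + j) n)" using n by (intro powr_inverse_power) auto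
      finally have 1: "c ^ n \<le> cmod (a (K n + j) n)" .
      have "c ^ n = exp (real n * (ln (f t) - \<eta> / 4))"
      proof -
        have "exp (ln (f t) - \<eta> / 4) = exp (ln (f t)) * exp (- (\<eta> / 4))" by (simp add: exp_add[symmetric])
        then have "exp (ln (f t) - \<eta> / 4) = c" using t by (simp add: c_def)
        then show ?thesis by (simp only: exp_of_nat_mult)
      qed
      moreover have "cmod z ^ K n = exp (real (K n) * ln (cmod z))"
        using near(1)[OF z] by (simp add: exp_of_nat_mult)
      ultimately have "c ^ n * cmod z ^ K n = exp (real n * (ln (f t) - \<eta> / 4) + real (K n) * ln (cmod z))"
        by (simp add: exp_add)
      moreover have "real n * (u z0 - \<eta>) \<le> real n * (ln (f t) - \<eta> / 4) + real (K n) * ln (cmod z)"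
      proof -
        have "real (K n) * (s - \<kappa>) \<le> real (K n) * ln (cmod z)"
          using near(2)[OF z] by (intro mult_left_mono) auto
        moreover have "real (K n) * \<kappa> \<le> t * real n * \<kappa>" using K(1) \<kappa>(1) by (intro mult_right_mono) auto
        moreover have "t * real n * \<kappa> \<le> \<eta> / 4 * real n" using mult_right_mono[OF \<kappa>(2), of "real n"] by (simp add: mult_ac)
        moreover have "t * real n * s - real (K n) * s \<le> \<bar>s\<bar>"
        proof -
          have "t * real n * s - real (K n) * s = (t * real n - real (K n)) * s" by (simp add: left_diff_distrib)
          also have "\<dots> \<le> (t * real n - real (K n)) * \<bar>s\<bar>" using K(1)[of n] by (intro mult_left_mono) auto
          also have "\<dots> \<le> 1 * \<bar>s\<bar>" using K(2)[of n] by (intro mult_right_mono) auto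
          finally show ?thesis by simp
        qed
        moreover have "real n * (J s - \<eta> / 4) \<le> real n * (s * t + ln (f t))" using t(4) by (intro mult_left_mono) auto
        moreover have "u z0 = J s" using z0 by (simp add: u_def s_def)
        ultimately show ?thesis using n(4) by (simp add: algebra_simps)
      qed
      ultimately have "exp (real n * (u z0 - \<eta>)) \<le> c ^ n * cmod z ^ K n" by simp
      also have "\<dots> \<le> cmod (a (K n + j) n) * cmod z ^ K n" using 1 by (intro mult_right_mono) auto
      finally show "exp (real n * (u z0 - \<eta>)) \<le> cmod (a (nat \<lfloor>t * real n\<rfloor> + j) n) * cmod z ^ nat \<lfloor>t * real n\<rfloor>"
        by (simp add: K_def)
    qed
  qed
  then have "\<forall>\<^sub>F n in sequentially. \<forall>j\<in>{..<m}. \<forall>z\<in>ball z0 \<delta>.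
      exp (real n * (u z0 - \<eta>)) \<le> cmod (a (nat \<lfloor>t * real n\<rfloor> + j) n) * cmod z ^ nat \<lfloor>t * real n\<rfloor>" for m
    by (intro eventually_ball_finite) auto
  then show ?thesis using that[OF t(1) \<delta>] by (simp add: Ball_def)
qed

lemma conv_radius_ge:
  assumes n: "n \<ge> 1" and x: "\<And>\<epsilon>. \<epsilon> > 0 \<Longrightarrow> \<exists>C. \<forall>k. cmod (x k) \<le> C * exp (\<epsilon> * real k)"
  shows "R0 \<le> conv_radius (\<lambda>k. x k * a k n)"
proof (rule conv_radius_geI_ex)
  fix r :: real assume r: "0 < r" "ereal r < R0"
  obtain R where R: "r < R" "ereal R < R0" using ereal_dense_real[OF r(2)] .
  have "ereal R < liminf (\<lambda>k. inv_root (cmod (a k n)) (real k))"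
    using R(2) coeff_fixed[OF n] by (rule less_le_trans)
  then have ev: "\<forall>\<^sub>F k in sequentially. ereal R < inv_root (cmod (a k n)) (real k)"
    by (rule less_LiminfD)
  \<comment> \<open>Half of the available rate: the growth factor \<open>exp \<epsilon>\<close>
    turns the ratio \<open>r / R = exp (- 2 * \<epsilon>)\<close> into
    \<open>exp (- \<epsilon>) < 1\<close>.\<close>
  define \<epsilon> where "\<epsilon> = ln (R / r) / 2"
  have \<epsilon>: "\<epsilon> > 0" using R r by (simp add: \<epsilon>_def)
  obtain C where C: "\<And>k. cmod (x k) \<le> C * exp (\<epsilon> * real k)" using x[OF \<epsilon>] by blast
  define q where "q = exp \<epsilon> * (r / R)"
  have "q = exp (- \<epsilon>)"
  proof -
    have "r / R = exp (- (2 * \<epsilon>))" using R r by (simp add: \<epsilon>_def exp_minus)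
    then show ?thesis by (simp add: q_def exp_add[symmetric])
  qed
  then have q: "0 < q" "q < 1" using \<epsilon> by auto
  have "summable (\<lambda>k. x k * a k n * of_real r ^ k)"
  proof (rule summable_comparison_test_ev)
    show "\<forall>\<^sub>F k in sequentially. norm (x k * a k n * of_real r ^ k) \<le> C * q ^ k"
      using ev eventually_gt_at_top[of 0]
    proof eventually_elim
      case (elim k)
      have "cmod (a k n) \<le> R powr (- real k)"
        using elim R r by (intro le_powr_if_inv_root_ge) auto
      then have "cmod (x k) * cmod (a k n) * r ^ k \<le> (C * exp (\<epsilon> * real k)) * R powr (- real k) * r ^ k"
        using C[of k] r by (intro mult_right_mono mult_mono) (auto intro: order_trans[OF norm_ge_zero])
      also have "\<dots> = C * q ^ k"
        using R r by (simp add: q_def powr_minus powr_realpow exp_of_nat2_mult[symmetric] power_mult_distrib power_divide field_simps)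
      finally show ?case using r by (simp add: norm_mult norm_power)
    qed
    show "summable (\<lambda>k. C * q ^ k)" using q by (intro summable_mult summable_geometric) auto
  qed
  then show "\<exists>z. norm z = r \<and> summable (\<lambda>k. x k * a k n * z ^ k)"
    using r by (intro exI[of _ "of_real r"]) auto
qed

end

section \<open>Sums of power series and polynomial interpolation\<close>

lemma power_series_holomorphic:
  fixes c :: "nat \<Rightarrow> complex"
  assumes "R \<le> conv_radius c"
  shows "(\<lambda>z. \<Sum>k. c k * z ^ k) holomorphic_on eball 0 R"
proof -
  have "eball (0::complex) R \<subseteq> eball 0 (fps_conv_radius (Abs_fps c))"
    using assms by (intro eball_mono) (simp add: fps_conv_radius_def)
  from holomorphic_on_eval_fps[OF this] show ?thesis by (simp add: eval_fps_def[abs_def])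
qed

text \<open>Interpolation with a constant that depends on \<open>S\<close> alone. The induction adds
  a point \<open>w\<close>: synthetic division at \<open>w\<close> lowers the degree, and at the
  other points the quotient is at most \<open>2 / d\<close> times the bound on the values, with
  \<open>d\<close> a lower bound for their distances to \<open>w\<close>.\<close>

lemma poly_coeff_bound:
  fixes S :: "complex set"
  assumes "finite S"
  shows "\<exists>C\<ge>0. \<forall>p s. degree p < card S \<longrightarrow> (\<forall>z\<in>S. cmod (poly p z) \<le> s) \<longrightarrow> (\<forall>j. cmod (coeff p j) \<le> C * s)"
  using assms
proof (induction S)
  case empty
  show ?case by (intro exI[of _ 0]) auto
next
  case (insert w S)
  then obtain C where C: "C \<ge> 0" "\<And>p s j. degree p < card S \<Longrightarrow> (\<And>z. z \<in> S \<Longrightarrow> cmod (poly p z) \<le> s) \<Longrightarrow> cmod (coeff p j) \<le> C * s"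
    by blast
  \<comment> \<open>The inserted 1 gives the minimum a meaning when \<open>S\<close> is
    empty.\<close>
  define d where "d = Min (insert 1 ((\<lambda>z. cmod (z - w)) ` S))"
  have d: "d > 0" "\<And>z. z \<in> S \<Longrightarrow> d \<le> cmod (z - w)"
    using insert by (auto simp: d_def)
  define C' where "C' = C * (2 / d)"
  have C': "C' \<ge> 0" using C d by (simp add: C'_def)
  show ?case
  proof (intro exI[of _ "1 + C' + cmod w * C'"] conjI allI impI)
    show "0 \<le> 1 + C' + cmod w * C'" using C' by simp
    fix p :: "complex poly" and s j
    assume deg: "degree p < card (insert w S)" and bd: "\<forall>z\<in>insert w S. cmod (poly p z) \<le> s"
    have s: "s \<ge> 0" using bd norm_ge_zero order_trans by blast
    define q where "q = synthetic_div p w"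
    have p: "p = [:-w, 1:] * q + [:poly p w:]"
      unfolding q_def using synthetic_div_correct'[of w p] by simp
    have q: "cmod (coeff q i) \<le> C' * s" for i
    \<comment> \<open>For a constant \<open>p\<close> the quotient is 0, and its degree is not below
      \<open>card S\<close> when \<open>S\<close> is empty, so the induction hypothesis cannot be
      used.\<close>
    proof (cases "degree p = 0")
      case True
      then have "q = 0" by (simp add: q_def synthetic_div_eq_0_iff)
      then show ?thesis using C' s by simp
    next
      case False
      have "degree q < card S" using deg False insert by (simp add: q_def degree_synthetic_div)
      moreover have "cmod (poly q z) \<le> 2 / d * s" if "z \<in> S" for z
      proof -
        have "poly p z = (z - w) * poly q z + poly p w"
          by (subst p) (simp add: algebra_simps)
        then have "cmod (z - w) * cmod (poly q z) = cmod (poly p z - poly p w)" by (simp add: norm_mult[symmetric])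
        also have "\<dots> \<le> 2 * s" using bd that norm_triangle_ineq4[of "poly p z" "poly p w"] by fastforce
        finally have "cmod (z - w) * cmod (poly q z) \<le> 2 * s" .
        moreover have "d * cmod (poly q z) \<le> cmod (z - w) * cmod (poly q z)"
          using d(2)[OF that] by (intro mult_right_mono) auto
        ultimately show ?thesis using d(1) by (simp add: field_simps)
      qed
      ultimately have "cmod (coeff q i) \<le> C * (2 / d * s)" by (rule C(2))
      then show ?thesis by (simp add: C'_def)
    qed
    have c: "coeff p j = (case j of 0 \<Rightarrow> 0 | Suc i \<Rightarrow> coeff q i) - w * coeff q j + (if j = 0 then poly p w else 0)"
      by (subst p) (simp add: coeff_pCons split: nat.splits)
    have "cmod (coeff p j) \<le> cmod (case j of 0 \<Rightarrow> 0 | Suc i \<Rightarrow> coeff q i) + cmod w * cmod (coeff q j) + cmod (if j = 0 then poly p w else 0)"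
      unfolding c norm_mult[symmetric]
      by (intro order_trans[OF norm_triangle_ineq] add_mono norm_triangle_ineq4 order_refl)
    also have "\<dots> \<le> C' * s + cmod w * (C' * s) + s"
      using q s bd C' by (intro add_mono mult_left_mono) (auto split: nat.splits)
    also have "\<dots> = (1 + C' + cmod w * C') * s" by (simp add: algebra_simps)
    finally show "cmod (coeff p j) \<le> (1 + C' + cmod w * C') * s" .
  qed
qed

section \<open>Probabilistic estimates\<close>

text \<open>The sum counts the naturals below \<open>x\<close>; this is how the logarithmic moment
  becomes summability of tail probabilities.\<close>

lemma suminf_indicator_less_le:
  fixes x :: real
  assumes "x \<ge> 0"
  shows "(\<Sum>j::nat. indicator {y. real j < y} x :: ennreal) \<le> ennreal (x + 1)"
proof -
  have "(\<Sum>j<N. indicator {y. real j < y} x :: ennreal) \<le> ennreal (x + 1)" for N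
  proof -
    have "(\<Sum>j<N. indicator {y. real j < y} x :: ennreal) = (\<Sum>j<N. if j \<in> {j. real j < x} then 1 else 0)"
      by (intro sum.cong) (auto simp: indicator_def)
    also have "\<dots> = of_nat (card ({..<N} \<inter> {j. real j < x}))"
      by (simp add: sum.If_cases)
    also have "\<dots> \<le> of_nat (card {..<nat \<lceil>x\<rceil>})"
    proof (intro of_nat_mono card_mono)
      show "{..<N} \<inter> {j. real j < x} \<subseteq> {..<nat \<lceil>x\<rceil>}" by (auto, linarith)
    qed simp
    also have "\<dots> = ennreal (real (nat \<lceil>x\<rceil>))" by (simp add: ennreal_of_nat_eq_real_of_nat)
    also have "\<dots> \<le> ennreal (x + 1)" using assms by (intro ennreal_leI) linarith
    finally show ?thesis .
  qed
  then show ?thesis by (subst suminf_eq_SUP) (intro SUP_least)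
qed

locale random_series_setting = prob_space M + coefficient_array f T0 R0 a
  for M :: "'w measure" and f :: "real \<Rightarrow> real" and T0 R0 :: ereal and a :: "nat \<Rightarrow> nat \<Rightarrow> complex" +
  fixes \<xi> :: "nat \<Rightarrow> 'w \<Rightarrow> complex"
  assumes indep: "indep_vars (\<lambda>_. borel) \<xi> UNIV"
    and ident: "\<And>k. distr M borel (\<xi> k) = distr M borel (\<xi> 0)"
    and nondegenerate: "\<not> (\<exists>c. AE \<omega> in M. \<xi> 0 \<omega> = c)"
    and log_moment: "integrable M (\<lambda>\<omega>. ln (1 + cmod (\<xi> 0 \<omega>)))"
begin

lemma xi_measurable [measurable]: "\<xi> k \<in> borel_measurable M"
  using indep by (auto simp: indep_vars_def)

lemma prob_ident:
  assumes "A \<in> sets borel"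
  shows "prob {\<omega>\<in>space M. \<xi> k \<omega> \<in> A} = prob {\<omega>\<in>space M. \<xi> 0 \<omega> \<in> A}"
proof -
  have "prob {\<omega>\<in>space M. \<xi> k \<omega> \<in> A} = measure (distr M borel (\<xi> k)) A" for k
    using assms by (simp add: measure_distr vimage_def Int_def conj_commute)
  then show ?thesis by (simp add: ident[of k])
qed

text \<open>With \<open>X\<close> the logarithmic moment variable divided by
  \<open>\<epsilon>\<close>, the terms are at most P(X > j), and the sum of these is at most E X +
  1.\<close>

lemma summable_tail_prob:
  assumes "\<epsilon> > 0"
  shows "summable (\<lambda>j. prob {\<omega>\<in>space M. exp (\<epsilon> * real j) < cmod (\<xi> 0 \<omega>)})"
proof (rule summable_suminf_not_top)
  define X where "X \<omega> = ln (1 + cmod (\<xi> 0 \<omega>)) / \<epsilon>" for \<omega>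
  have [measurable]: "X \<in> borel_measurable M" unfolding X_def[abs_def] by measurable
  have X: "X \<omega> \<ge> 0" for \<omega> using assms by (simp add: X_def)
  have iX: "integrable M X" unfolding X_def using log_moment by auto
  have "(\<Sum>j. ennreal (prob {\<omega>\<in>space M. exp (\<epsilon> * real j) < cmod (\<xi> 0 \<omega>)}))
    \<le> (\<Sum>j. \<integral>\<^sup>+\<omega>. indicator {y. real j < y} (X \<omega>) \<partial>M)"
  proof (intro suminf_le)
    fix j
    have "ennreal (prob {\<omega>\<in>space M. exp (\<epsilon> * real j) < cmod (\<xi> 0 \<omega>)}) \<le> ennreal (prob {\<omega>\<in>space M. real j < X \<omega>})"
    proof (intro ennreal_leI finite_measure_mono subsetI)
      fix \<omega> assume "\<omega> \<in> {\<omega> \<in> space M. exp (\<epsilon> * real j) < cmod (\<xi> 0 \<omega>)}"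
      then have w: "\<omega> \<in> space M" "exp (\<epsilon> * real j) < 1 + cmod (\<xi> 0 \<omega>)" by auto
      then have "ln (exp (\<epsilon> * real j)) < ln (1 + cmod (\<xi> 0 \<omega>))"
        by (subst ln_less_cancel_iff) (auto intro: add_pos_nonneg)
      then show "\<omega> \<in> {\<omega> \<in> space M. real j < X \<omega>}" using w assms by (simp add: X_def field_simps)
    qed measurable
    also have "\<dots> = (\<integral>\<^sup>+\<omega>. indicator {\<omega>\<in>space M. real j < X \<omega>} \<omega> \<partial>M)"
      by (subst nn_integral_indicator) (auto simp: emeasure_eq_measure)
    also have "\<dots> = (\<integral>\<^sup>+\<omega>. indicator {y. real j < y} (X \<omega>) \<partial>M)"
      by (intro nn_integral_cong) (auto simp: indicator_def)
    finally show "ennreal (prob {\<omega>\<in>space M. exp (\<epsilon> * real j) < cmod (\<xi> 0 \<omega>)}) \<le> (\<integral>\<^sup>+\<omega>. indicator {y. real j < y} (X \<omega>) \<partial>M)" .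
  qed auto
  also have "\<dots> = (\<integral>\<^sup>+\<omega>. (\<Sum>j. indicator {y. real j < y} (X \<omega>)) \<partial>M)"
    by (rule nn_integral_suminf[symmetric]) measurable
  also have "\<dots> \<le> (\<integral>\<^sup>+\<omega>. ennreal (X \<omega> + 1) \<partial>M)"
    by (intro nn_integral_mono suminf_indicator_less_le X)
  also have "\<dots> = ennreal (\<integral>\<omega>. X \<omega> + 1 \<partial>M)"
    using iX X by (intro nn_integral_eq_integral) (auto simp: add_nonneg_nonneg)
  also have "\<dots> < \<top>" by simp
  finally show "(\<Sum>j. ennreal (prob {\<omega>\<in>space M. exp (\<epsilon> * real j) < cmod (\<xi> 0 \<omega>)})) \<noteq> \<top>" by simp
qed simp

text \<open>The exponent grows with \<open>k + n\<close>, so the union bound is the tail, starting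
  at \<open>n\<close>, of a convergent series. The complementary event is exactly the growth assumed
  in \<open>series_upper_bound\<close>.\<close>

lemma prob_growth:
  assumes "\<epsilon> > 0"
  shows "(\<lambda>n. prob {\<omega>\<in>space M. \<exists>k. exp (\<epsilon> * (real k + real n)) < cmod (\<xi> k \<omega>)}) \<longlonglongrightarrow> 0"
proof -
  define p where "p j = prob {\<omega>\<in>space M. exp (\<epsilon> * real j) < cmod (\<xi> 0 \<omega>)}" for j
  have sp: "summable p" unfolding p_def by (rule summable_tail_prob[OF assms])
  have p_eq: "prob {\<omega>\<in>space M. exp (\<epsilon> * (real k + real n)) < cmod (\<xi> k \<omega>)} = p (k + n)" for k n
    using prob_ident[of "{z. exp (\<epsilon> * (real k + real n)) < cmod z}" k] by (simp add: p_def)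
  have le: "prob {\<omega>\<in>space M. \<exists>k. exp (\<epsilon> * (real k + real n)) < cmod (\<xi> k \<omega>)} \<le> (\<Sum>k. p (k + n))" for n
  proof -
    have "{\<omega>\<in>space M. \<exists>k. exp (\<epsilon> * (real k + real n)) < cmod (\<xi> k \<omega>)} =
        (\<Union>k. {\<omega>\<in>space M. exp (\<epsilon> * (real k + real n)) < cmod (\<xi> k \<omega>)})" by auto
    also have "prob \<dots> \<le> (\<Sum>k. prob {\<omega>\<in>space M. exp (\<epsilon> * (real k + real n)) < cmod (\<xi> k \<omega>)})"
    proof (rule finite_measure_subadditive_countably)
      show "range (\<lambda>k. {\<omega> \<in> space M. exp (\<epsilon> * (real k + real n)) < cmod (\<xi> k \<omega>)}) \<subseteq> events" by auto
      show "summable (\<lambda>k. prob {\<omega> \<in> space M. exp (\<epsilon> * (real k + real n)) < cmod (\<xi> k \<omega>)})"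
        unfolding p_eq using sp by (simp add: summable_iff_shift)
    qed
    finally show ?thesis unfolding p_eq .
  qed
  show ?thesis
  proof (rule tendsto_sandwich[of "\<lambda>_. 0" _ _ "\<lambda>n. \<Sum>k. p (k + n)"])
    show "(\<lambda>n. \<Sum>k. p (k + n)) \<longlonglongrightarrow> 0" using suminf_exist_split2[OF sp] by simp
    show "(\<lambda>n. 0::real) \<longlonglongrightarrow> 0" by simp
  qed (use le in auto)
qed

text \<open>Almost surely the bound of \<open>prob_growth\<close> holds for some \<open>n\<close>,
  and \<open>exp (\<epsilon> * n)\<close> becomes the constant. The values 1/(m + 1) of
  \<open>\<epsilon>\<close> form a countable family that suffices.\<close>

lemma AE_growth: "AE \<omega> in M. \<forall>\<epsilon>>0. \<exists>C. \<forall>k. cmod (\<xi> k \<omega>) \<le> C * exp (\<epsilon> * real k)"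
proof -
  have "AE \<omega> in M. \<exists>n. \<forall>k. cmod (\<xi> k \<omega>) \<le> exp (\<epsilon> * (real k + real n))" if \<epsilon>: "\<epsilon> > 0" for \<epsilon>
  proof -
    define N where "N = {\<omega>\<in>space M. \<forall>n::nat. \<exists>k. exp (\<epsilon> * (real k + real n)) < cmod (\<xi> k \<omega>)}"
    have [measurable]: "N \<in> events" unfolding N_def by measurable
    have "prob N \<le> prob {\<omega>\<in>space M. \<exists>k. exp (\<epsilon> * (real k + real n)) < cmod (\<xi> k \<omega>)}" for n
      by (intro finite_measure_mono) (auto simp: N_def)
    then have "prob N \<le> 0"
      by (intro LIMSEQ_le_const[OF prob_growth[OF \<epsilon>]]) auto
    then have "prob N = 0" by (simp add: measure_le_0_iff)
    then have "AE \<omega> in M. \<omega> \<notin> N" by (simp add: prob_eq_0)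
    then show ?thesis
      using AE_space by eventually_elim (auto simp: N_def not_less)
  qed
  then have "AE \<omega> in M. \<forall>m::nat. \<exists>n. \<forall>k. cmod (\<xi> k \<omega>) \<le> exp (inverse (Suc m) * (real k + real n))"
    by (subst AE_all_countable) simp
  then show ?thesis
  proof eventually_elim
    case (elim \<omega>)
    show ?case
    proof (intro allI impI)
      fix \<epsilon> :: real assume "\<epsilon> > 0"
      then obtain m where m: "inverse (real (Suc m)) < \<epsilon>" using reals_Archimedean by blast
      obtain n where n: "\<And>k. cmod (\<xi> k \<omega>) \<le> exp (inverse (Suc m) * (real k + real n))" using elim by blast
      have "cmod (\<xi> k \<omega>) \<le> exp (\<epsilon> * real n) * exp (\<epsilon> * real k)" for k
      proof -
        have "inverse (Suc m) * (real k + real n) \<le> \<epsilon> * (real k + real n)"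
          using m by (intro mult_right_mono) auto
        then have "cmod (\<xi> k \<omega>) \<le> exp (\<epsilon> * (real k + real n))" using n[of k] by (meson exp_le_cancel_iff order_trans)
        then show ?thesis by (simp add: exp_add[symmetric] algebra_simps)
      qed
      then show "\<exists>C. \<forall>k. cmod (\<xi> k \<omega>) \<le> C * exp (\<epsilon> * real k)" by blast
    qed
  qed
qed

lemma AE_conv_radius: "AE \<omega> in M. \<forall>n\<ge>1. R0 \<le> conv_radius (\<lambda>k. \<xi> k \<omega> * a k n)"
  using AE_growth by eventually_elim (auto intro: conv_radius_ge)

text \<open>Otherwise balls of radii 1/(n + 1) would carry mass tending to 1. They would meet
  pairwise, so their centres would converge, and the limit would be an atom of full mass, which
  nondegeneracy forbids.\<close>

lemma concentration:
  obtains s q where "s > 0" "0 \<le> q" "q < 1" "\<And>x. prob {\<omega>\<in>space M. \<xi> 0 \<omega> \<in> cball x s} \<le> q"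
proof (rule ccontr)
  note obt = that
  assume "\<not> thesis"
  have neg: "\<exists>x. prob {\<omega>\<in>space M. \<xi> 0 \<omega> \<in> cball x s} > q" if "s > 0" "0 \<le> q" "q < 1" for s q
  proof (rule ccontr)
    assume "\<not> ?thesis"
    then have "\<And>x. prob {\<omega>\<in>space M. \<xi> 0 \<omega> \<in> cball x s} \<le> q" by (simp only: not_ex not_less)
    with that have thesis by (rule obt)
    with \<open>\<not> thesis\<close> show False by blast
  qed
  define s where "s n = 1 / real (n + 1)" for n :: nat
  \<comment> \<open>Each mass exceeds \<open>1 - 1 / (n + 3) \<ge> 2 / 3\<close>, so two disjoint
    balls would have total mass above 1.\<close>
  have "\<exists>x. prob {\<omega>\<in>space M. \<xi> 0 \<omega> \<in> cball x (s n)} > 1 - 1 / real (n + 3)" for n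
    by (rule neg) (auto simp: s_def)
  then obtain x where x: "\<And>n. prob {\<omega>\<in>space M. \<xi> 0 \<omega> \<in> cball (x n) (s n)} > 1 - 1 / real (n + 3)" by metis
  have close: "dist (x n) (x m) \<le> s n + s m" for n m
  proof (rule ccontr)
    assume far: "\<not> dist (x n) (x m) \<le> s n + s m"
    have disj: "{\<omega>\<in>space M. \<xi> 0 \<omega> \<in> cball (x n) (s n)} \<inter> {\<omega>\<in>space M. \<xi> 0 \<omega> \<in> cball (x m) (s m)} = {}"
    proof -
      have False if "\<xi> 0 \<omega> \<in> cball (x n) (s n)" "\<xi> 0 \<omega> \<in> cball (x m) (s m)" for \<omega>
        using that far dist_triangle[of "x n" "x m" "\<xi> 0 \<omega>"] by (simp add: dist_commute)
      then show ?thesis by blast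
    qed
    have [measurable]: "cball y t \<in> sets borel" for y :: complex and t by simp
    have "prob ({\<omega>\<in>space M. \<xi> 0 \<omega> \<in> cball (x n) (s n)} \<union> {\<omega>\<in>space M. \<xi> 0 \<omega> \<in> cball (x m) (s m)}) =
      prob {\<omega>\<in>space M. \<xi> 0 \<omega> \<in> cball (x n) (s n)} + prob {\<omega>\<in>space M. \<xi> 0 \<omega> \<in> cball (x m) (s m)}"
      by (rule finite_measure_Union[OF _ _ disj]) measurable
    then have "prob {\<omega>\<in>space M. \<xi> 0 \<omega> \<in> cball (x n) (s n)} + prob {\<omega>\<in>space M. \<xi> 0 \<omega> \<in> cball (x m) (s m)} \<le> 1"
      using prob_le_1 by metis
    moreover have "1 / real (n + 3) \<le> 1 / 3" "1 / real (m + 3) \<le> 1 / 3" by (auto simp: field_simps)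
    ultimately show False using x[of n] x[of m] by linarith
  qed
  have s0: "s \<longlonglongrightarrow> 0" unfolding s_def by real_asymp
  have s_anti: "s m \<le> s n" if "n \<le> m" for n m using that by (simp add: s_def frac_le)
  have "Cauchy x"
  proof (rule metric_CauchyI)
    fix e :: real assume "e > 0"
    then have "\<forall>\<^sub>F n in sequentially. s n < e / 2" using s0 by (intro order_tendstoD) auto
    then obtain N where N: "s N < e / 2" unfolding eventually_sequentially by blast
    show "\<exists>N. \<forall>m\<ge>N. \<forall>n\<ge>N. dist (x m) (x n) < e"
    proof (intro exI allI impI)
      fix m n assume "N \<le> m" "N \<le> n"
      then show "dist (x m) (x n) < e" using close[of m n] s_anti[of N m] s_anti[of N n] N by linarith
    qed
  qed
  then obtain c where c: "x \<longlonglongrightarrow> c" using Cauchy_convergent_iff convergent_def by blast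
  have xc: "dist (x n) c \<le> s n" for n
  proof -
    have "(\<lambda>m. dist (x n) (x m)) \<longlonglongrightarrow> dist (x n) c" using c by (intro tendsto_intros)
    moreover have "(\<lambda>m. s n + s m) \<longlonglongrightarrow> s n + 0" using s0 by (intro tendsto_intros)
    ultimately show ?thesis using close LIMSEQ_le by fastforce
  qed
  have "AE \<omega> in M. \<xi> 0 \<omega> \<in> cball c (2 * s j)" for j
  proof -
    have "prob {\<omega>\<in>space M. \<xi> 0 \<omega> \<in> cball c (2 * s j)} \<ge> 1 - 1 / real (n + 3)" if "n \<ge> j" for n
    proof -
      have "{\<omega>\<in>space M. \<xi> 0 \<omega> \<in> cball (x n) (s n)} \<subseteq> {\<omega>\<in>space M. \<xi> 0 \<omega> \<in> cball c (2 * s j)}"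
      proof safe
        fix \<omega> assume "\<xi> 0 \<omega> \<in> cball (x n) (s n)"
        then show "\<xi> 0 \<omega> \<in> cball c (2 * s j)"
          using xc[of n] s_anti[OF that] dist_triangle[of c "\<xi> 0 \<omega>" "x n"] by (simp add: dist_commute)
      qed
      then have "prob {\<omega>\<in>space M. \<xi> 0 \<omega> \<in> cball (x n) (s n)} \<le> prob {\<omega>\<in>space M. \<xi> 0 \<omega> \<in> cball c (2 * s j)}"
        by (intro finite_measure_mono) auto
      then show ?thesis using x[of n] by linarith
    qed
    moreover have "(\<lambda>n. 1 - 1 / real (n + 3)) \<longlonglongrightarrow> 1" by real_asymp
    ultimately have "1 \<le> prob {\<omega>\<in>space M. \<xi> 0 \<omega> \<in> cball c (2 * s j)}"
      by (intro LIMSEQ_le_const2) auto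
    then have "prob {\<omega>\<in>space M. \<xi> 0 \<omega> \<in> cball c (2 * s j)} = 1" using prob_le_1 by (intro antisym) auto
    then show ?thesis by (subst (asm) prob_Collect_eq_1) auto
  qed
  then have "AE \<omega> in M. \<forall>j. \<xi> 0 \<omega> \<in> cball c (2 * s j)" by (simp add: AE_all_countable)
  then have "AE \<omega> in M. \<xi> 0 \<omega> = c"
  proof eventually_elim
    case (elim \<omega>)
    have "(\<lambda>j. 2 * s j) \<longlonglongrightarrow> 2 * 0" using s0 by (intro tendsto_intros)
    then have "dist c (\<xi> 0 \<omega>) \<le> 2 * 0" using elim by (intro LIMSEQ_le_const[where X = "\<lambda>j. 2 * s j"]) auto
    then show ?case by simp
  qed
  then show False using nondegenerate by blast
qed

end

context random_series_setting
begin

text \<open>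
  Anti-concentration by Fubini: a section of \<open>S\<close> at fixed \<open>(\<xi>\<^sub>k)\<close>, \<open>k \<notin> W\<close>, lies in a polydisk of radius \<open>s\<close>.
\<close>

lemma prob_narrow_slices:
  assumes W: "finite W" "W \<noteq> {}" and sq: "\<And>x. prob {\<omega>\<in>space M. \<xi> 0 \<omega> \<in> cball x s} \<le> q" "0 \<le> q"
    and S: "S \<in> sets (PiM W (\<lambda>_. borel) \<Otimes>\<^sub>M PiM (- W) (\<lambda>_. borel))"
    and narrow: "\<And>x x' y. (x, y) \<in> S \<Longrightarrow> (x', y) \<in> S \<Longrightarrow> \<forall>k\<in>W. dist (x' k) (x k) \<le> s"
  shows "prob {\<omega>\<in>space M. (\<lambda>k\<in>W. \<xi> k \<omega>, \<lambda>k\<in>-W. \<xi> k \<omega>) \<in> S} \<le> q ^ card W"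
proof -
  let ?PW = "PiM W (\<lambda>_. borel :: complex measure)" and ?PY = "PiM (- W) (\<lambda>_. borel :: complex measure)"
  define X where "X \<omega> = (\<lambda>k\<in>W. \<xi> k \<omega>)" for \<omega>
  define Y where "Y \<omega> = (\<lambda>k\<in>-W. \<xi> k \<omega>)" for \<omega>
  have iv: "indep_var ?PW X ?PY Y"
    unfolding X_def[abs_def] Y_def[abs_def] by (rule indep_var_restrict[OF indep]) auto
  then have X: "X \<in> measurable M ?PW" and Y: "Y \<in> measurable M ?PY"
    and prod: "distr M ?PW X \<Otimes>\<^sub>M distr M ?PY Y = distr M (?PW \<Otimes>\<^sub>M ?PY) (\<lambda>\<omega>. (X \<omega>, Y \<omega>))"
    unfolding indep_var_distribution_eq by blast+
  note [measurable] = X Y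
  interpret X: prob_space "distr M ?PW X" by (rule prob_space_distr) measurable
  interpret Y: prob_space "distr M ?PY Y" by (rule prob_space_distr) measurable
  interpret XY: pair_sigma_finite "distr M ?PW X" "distr M ?PY Y" ..
  have Xdist: "distr M ?PW X = PiM W (\<lambda>k. distr M borel (\<xi> k))"
    unfolding X_def[abs_def] using W(2) indep_vars_subset[OF indep, of W]
    by (subst indep_vars_iff_distr_eq_PiM'[symmetric]) auto
  interpret F: product_sigma_finite "\<lambda>k. distr M borel (\<xi> k)"
    by (intro product_sigma_finite.intro prob_space_imp_sigma_finite prob_space_distr) measurable
  have slice: "emeasure (distr M ?PW X) ((\<lambda>x. (x, y)) -` S) \<le> ennreal (q ^ card W)" for y
  proof (cases "(\<lambda>x. (x, y)) -` S = {}")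
    case False
    then obtain x0 where x0: "(x0, y) \<in> S" by auto
    have sub: "(\<lambda>x. (x, y)) -` S \<subseteq> Pi\<^sub>E W (\<lambda>k. cball (x0 k) s)"
    proof
      fix x assume "x \<in> (\<lambda>x. (x, y)) -` S"
      then have x: "(x, y) \<in> S" by simp
      then have "x \<in> space ?PW" using sets.sets_into_space[OF S] by (auto simp: space_pair_measure)
      then show "x \<in> Pi\<^sub>E W (\<lambda>k. cball (x0 k) s)"
        using narrow[OF x x0] by (auto simp: space_PiM PiE_def)
    qed
    have "emeasure (distr M ?PW X) ((\<lambda>x. (x, y)) -` S) \<le> emeasure (distr M ?PW X) (Pi\<^sub>E W (\<lambda>k. cball (x0 k) s))"
      using sub W by (intro emeasure_mono) (auto intro!: sets_PiM_I_finite)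
    also have "\<dots> = (\<Prod>k\<in>W. emeasure (distr M borel (\<xi> k)) (cball (x0 k) s))"
      unfolding Xdist using W by (intro F.emeasure_PiM) auto
    also have "\<dots> \<le> (\<Prod>k\<in>W. ennreal q)"
    proof (rule prod_mono_ennreal)
      fix k
      have "emeasure (distr M borel (\<xi> k)) (cball (x0 k) s) = emeasure (distr M borel (\<xi> 0)) (cball (x0 k) s)"
        by (simp only: ident[of k])
      also have "\<dots> = emeasure M {\<omega>\<in>space M. \<xi> 0 \<omega> \<in> cball (x0 k) s}"
        by (subst emeasure_distr) (auto simp: vimage_def Int_def conj_commute)
      also have "\<dots> \<le> ennreal q" unfolding emeasure_eq_measure by (rule ennreal_leI[OF sq(1)])
      finally show "emeasure (distr M borel (\<xi> k)) (cball (x0 k) s) \<le> ennreal q" .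
    qed
    also have "\<dots> = ennreal (q ^ card W)" using sq(2) by (simp add: ennreal_power)
    finally show ?thesis .
  qed simp
  have "ennreal (prob {\<omega>\<in>space M. (X \<omega>, Y \<omega>) \<in> S}) = emeasure (distr M (?PW \<Otimes>\<^sub>M ?PY) (\<lambda>\<omega>. (X \<omega>, Y \<omega>))) S"
    using S by (subst emeasure_distr) (auto simp: vimage_def Int_def conj_commute emeasure_eq_measure)
  also have "\<dots> = (\<integral>\<^sup>+y. emeasure (distr M ?PW X) ((\<lambda>x. (x, y)) -` S) \<partial>distr M ?PY Y)"
    unfolding prod[symmetric] by (rule XY.emeasure_pair_measure_alt2) (use S in simp)
  also have "\<dots> \<le> (\<integral>\<^sup>+y. ennreal (q ^ card W) \<partial>distr M ?PY Y)"
    by (intro nn_integral_mono slice)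
  also have "\<dots> = ennreal (q ^ card W)" using Y.emeasure_space_1 by simp
  finally have "prob {\<omega>\<in>space M. (X \<omega>, Y \<omega>) \<in> S} \<le> q ^ card W"
    using sq(2) by (subst (asm) ennreal_le_iff) auto
  then show ?thesis by (simp add: X_def Y_def)
qed

text \<open>Prepares the interpolation: a block of \<open>m\<close> consecutive terms is a power of
  \<open>z\<close> times a polynomial of degree below \<open>m\<close>, which \<open>m\<close>
  points determine.\<close>

lemma poly_window:
  fixes c :: "nat \<Rightarrow> complex"
  defines "P \<equiv> \<lambda>k0 m. \<Sum>j<m. monom (c (k0 + j)) j"
  shows "m > 0 \<Longrightarrow> degree (P k0 m) < m" and "j < m \<Longrightarrow> coeff (P k0 m) j = c (k0 + j)"
    and "z ^ k0 * poly (P k0 m) z = (\<Sum>k\<in>{k0..<k0+m}. c k * z ^ k)"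
proof -
  show "m > 0 \<Longrightarrow> degree (P k0 m) < m"
    unfolding P_def by (intro degree_sum_less) (auto intro: le_less_trans[OF degree_monom_le])
  show "j < m \<Longrightarrow> coeff (P k0 m) j = c (k0 + j)"
    unfolding P_def by (simp add: coeff_sum)
  have "(\<Sum>k\<in>{k0..<k0+m}. c k * z ^ k) = (\<Sum>j<m. c (k0 + j) * z ^ (k0 + j))"
    by (rule sum.reindex_bij_witness[of _ "\<lambda>j. k0 + j" "\<lambda>k. k - k0"]) auto
  then show "z ^ k0 * poly (P k0 m) z = (\<Sum>k\<in>{k0..<k0+m}. c k * z ^ k)"
    unfolding P_def by (simp add: poly_sum poly_monom sum_distrib_left power_add mult_ac)
qed

text \<open>For fixed outer variables, two windows that both make the series small differ by a
  polynomial that is tiny on \<open>Z\<close>, so their entries differ by at most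
  \<open>2 * C\<close> times an exponentially small factor. Since \<open>C\<close> depends on
  \<open>Z\<close> but not on \<open>n\<close>, this is eventually below \<open>s\<close>; the
  number of points comes from \<open>q ^ m < \<kappa>\<close>.\<close>

lemma prob_small_on_points:
  assumes z0: "z0 \<noteq> 0" "ereal (cmod z0) < R0" and \<eta>: "\<eta> > 0" and \<delta>1: "\<delta>1 > 0" and \<kappa>: "\<kappa> > 0"
  shows "\<exists>Z. finite Z \<and> Z \<subseteq> ball z0 \<delta>1 \<and> (\<forall>\<^sub>F n in sequentially.
    prob {\<omega>\<in>space M. \<forall>z\<in>Z. cmod (random_series \<xi> a n \<omega> z) < exp (real n * (u z0 - \<eta>))} \<le> \<kappa>)"
proof -
  obtain s q where sq: "s > 0" "0 \<le> q" "q < 1" "\<And>x. prob {\<omega>\<in>space M. \<xi> 0 \<omega> \<in> cball x s} \<le> q"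
    using concentration by blast
  have "(\<lambda>m. q ^ m) \<longlonglongrightarrow> 0" using sq by (intro LIMSEQ_realpow_zero)
  then have "\<forall>\<^sub>F m in sequentially. q ^ m < \<kappa>" using \<kappa> by (rule order_tendstoD)
  then have "\<forall>\<^sub>F m in sequentially. q ^ m < \<kappa> \<and> m > 0" using eventually_gt_at_top by (rule eventually_conj)
  then obtain m where m: "q ^ m < \<kappa>" "m > 0" unfolding eventually_sequentially by blast
  have "\<eta> / 2 > 0" using \<eta> by simp
  obtain t \<delta> where t: "t \<ge> 0" "\<delta> > 0" and win: "\<And>m. \<forall>\<^sub>F n in sequentially. \<forall>j<m. \<forall>z\<in>ball z0 \<delta>.
      exp (real n * (u z0 - \<eta> / 2)) \<le> cmod (a (nat \<lfloor>t * real n\<rfloor> + j) n) * cmod z ^ nat \<lfloor>t * real n\<rfloor>"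
    using coefficient_window[OF z0 \<open>\<eta> / 2 > 0\<close>] by blast
  have "z0 \<in> eball 0 R0" using z0 by simp
  then obtain \<delta>2 where \<delta>2: "\<delta>2 > 0" "ball z0 \<delta>2 \<subseteq> eball 0 R0"
    using open_eball open_contains_ball by metis
  \<comment> \<open>The bound \<open>cmod z0\<close> keeps 0 out of \<open>Z\<close>; a power of
    \<open>z\<close> has to be divided out at every point.\<close>
  define \<delta>' where "\<delta>' = Min {\<delta>, \<delta>1, \<delta>2, cmod z0}"
  have \<delta>': "\<delta>' > 0" "\<delta>' \<le> \<delta>" "\<delta>' \<le> \<delta>1" "\<delta>' \<le> \<delta>2" "\<delta>' \<le> cmod z0"
    using t \<delta>1 \<delta>2 z0 by (auto simp: \<delta>'_def)
  have "infinite (ball z0 \<delta>')"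
    using uncountable_ball[OF \<delta>'(1), of z0] countable_finite by blast
  then obtain Z where Z: "finite Z" "card Z = m" "Z \<subseteq> ball z0 \<delta>'"
    using infinite_arbitrarily_large by blast
  have Z_ne: "Z \<noteq> {}" using Z m by auto
  have Z1: "Z \<subseteq> ball z0 \<delta>1" "\<And>z. z \<in> Z \<Longrightarrow> z \<in> ball z0 \<delta>" "\<And>z. z \<in> Z \<Longrightarrow> z \<noteq> 0"
    "\<And>z. z \<in> Z \<Longrightarrow> ereal (cmod z) < R0"
    using Z(3) \<delta>' \<delta>2 by (auto simp: subset_eq)
  obtain C where C: "C \<ge> 0" "\<And>p s j. degree p < card Z \<Longrightarrow> (\<And>z. z \<in> Z \<Longrightarrow> cmod (poly p z) \<le> s) \<Longrightarrow> cmod (coeff p j) \<le> C * s"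
    using poly_coeff_bound[OF Z(1)] by blast
  have "\<forall>\<^sub>F n in sequentially. 2 * C * exp (- (real n * (\<eta> / 2))) < s"
  proof -
    have "(\<lambda>n. 2 * C * exp (- (real n * (\<eta> / 2)))) \<longlonglongrightarrow> 0" using \<eta> by real_asymp
    then show ?thesis using sq(1) by (rule order_tendstoD)
  qed
  then have "\<forall>\<^sub>F n in sequentially.
    prob {\<omega>\<in>space M. \<forall>z\<in>Z. cmod (random_series \<xi> a n \<omega> z) < exp (real n * (u z0 - \<eta>))} \<le> \<kappa>"
    using win[of m] eventually_ge_at_top[of 1]
  proof eventually_elim
    case (elim n)
    define k0 where "k0 = nat \<lfloor>t * real n\<rfloor>"
    define W where "W = {k0..<k0+m}"
    have W: "finite W" "W \<noteq> {}" "card W = m" using m by (auto simp: W_def)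
    define e where "e = exp (real n * (u z0 - \<eta>))"
    \<comment> \<open>The terms outside the window as a series of their own, so that it is visibly a
      function of the outer variables alone.\<close>
    define R where "R z y = (\<Sum>k. if k \<in> W then 0 else y k * a k n * z ^ k)" for z and y :: "nat \<Rightarrow> complex"
    let ?P = "PiM W (\<lambda>_. borel :: complex measure) \<Otimes>\<^sub>M PiM (- W) (\<lambda>_. borel :: complex measure)"
    define S where "S = {p \<in> space ?P. \<forall>z\<in>Z. cmod ((\<Sum>k\<in>W. fst p k * a k n * z ^ k) + R z (snd p)) < e}"
    have m1: "(\<lambda>p. fst p k * a k n * z ^ k) \<in> borel_measurable ?P" if "k \<in> W" for k z
    proof -
      have [measurable]: "(\<lambda>x. x k) \<in> borel_measurable (PiM W (\<lambda>_. borel :: complex measure))"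
        using that by (rule measurable_component_singleton)
      show ?thesis by measurable
    qed
    have m2: "(\<lambda>p. if k \<in> W then 0 else snd p k * a k n * z ^ k) \<in> borel_measurable ?P" for k z
    proof (cases "k \<in> W")
      case False
      then have [measurable]: "(\<lambda>x. x k) \<in> borel_measurable (PiM (- W) (\<lambda>_. borel :: complex measure))"
        by (intro measurable_component_singleton) auto
      show ?thesis using False by simp
    qed simp
    have m3: "(\<lambda>p. R z (snd p)) \<in> borel_measurable ?P" for z
      unfolding R_def by (intro borel_measurable_suminf m2)
    have m4: "(\<lambda>p. (\<Sum>k\<in>W. fst p k * a k n * z ^ k) + R z (snd p)) \<in> borel_measurable ?P" for z
      by (intro borel_measurable_add borel_measurable_sum m1 m3)
    have S: "S \<in> sets ?P"
    proof -
      have "S = space ?P \<inter> (\<Inter>z\<in>Z. {p\<in>space ?P. cmod ((\<Sum>k\<in>W. fst p k * a k n * z ^ k) + R z (snd p)) < e})"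
        using Z_ne by (auto simp: S_def)
      also have "\<dots> \<in> sets ?P"
      proof (intro sets.Int sets.top sets.finite_INT Z Z_ne)
        fix z
        show "{p\<in>space ?P. cmod ((\<Sum>k\<in>W. fst p k * a k n * z ^ k) + R z (snd p)) < e} \<in> sets ?P"
          using m4[of z] by measurable
      qed
      finally show ?thesis .
    qed
    have narrow: "\<forall>k\<in>W. dist (x' k) (x k) \<le> s" if xy: "(x, y) \<in> S" "(x', y) \<in> S" for x x' y
    proof
      fix k assume "k \<in> W"
      then obtain j where j: "j < m" "k = k0 + j" unfolding W_def by (metis add_diff_inverse_nat atLeastLessThan_iff nat_add_left_cancel_less not_less)
      define c where "c k = (x k - x' k) * a k n" for k
      define p where "p = (\<Sum>j<m. monom (c (k0 + j)) j)"
      note pw = poly_window[where c = c and m = m and ?k0.0 = k0, folded p_def]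
      have pz: "cmod z ^ k0 * cmod (poly p z) \<le> 2 * e" if "z \<in> Z" for z
      proof -
        have 1: "cmod ((\<Sum>k\<in>W. x k * a k n * z ^ k) + R z y) < e" "cmod ((\<Sum>k\<in>W. x' k * a k n * z ^ k) + R z y) < e"
          using xy that by (auto simp: S_def)
        have "z ^ k0 * poly p z = (\<Sum>k\<in>W. c k * z ^ k)" unfolding W_def by (rule pw(3))
        also have "\<dots> = ((\<Sum>k\<in>W. x k * a k n * z ^ k) + R z y) - ((\<Sum>k\<in>W. x' k * a k n * z ^ k) + R z y)"
          by (simp add: c_def sum_subtractf[symmetric] algebra_simps)
        also have "cmod \<dots> \<le> e + e"
          using 1 by (intro order_trans[OF norm_triangle_ineq4] add_mono) auto
        finally show ?thesis by (simp add: norm_mult norm_power)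
      qed
      \<comment> \<open>One modulus for the whole of \<open>Z\<close>: dividing by the smallest
        \<open>cmod z ^ k0\<close> gives a common bound for the polynomial values.\<close>
      obtain zm where zm: "zm \<in> Z" "\<And>z. z \<in> Z \<Longrightarrow> cmod zm \<le> cmod z"
        using ex_min_if_finite[of "cmod ` Z"] Z(1) Z_ne by (metis (no_types, lifting) arg_min_least arg_min_if_finite(1))
      have zp: "cmod zm ^ k0 > 0" using Z1(3)[OF zm(1)] by simp
      have "cmod (coeff p j) \<le> C * (2 * e / cmod zm ^ k0)"
      proof (rule C(2))
        show "degree p < card Z" using pw(1) m Z by simp
        fix z assume z: "z \<in> Z"
        have "cmod zm ^ k0 * cmod (poly p z) \<le> cmod z ^ k0 * cmod (poly p z)"
          using zm(2)[OF z] by (intro mult_right_mono power_mono) auto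
        then have "cmod zm ^ k0 * cmod (poly p z) \<le> 2 * e" using pz[OF z] by linarith
        then show "cmod (poly p z) \<le> 2 * e / cmod zm ^ k0" using zp by (simp add: field_simps)
      qed
      then have c1: "cmod (c k) * cmod zm ^ k0 \<le> 2 * C * e"
        using zp pw(2)[OF j(1)] j(2) by (simp add: field_simps)
      have "dist (x' k) (x k) * exp (real n * (u z0 - \<eta> / 2)) \<le> dist (x' k) (x k) * (cmod (a k n) * cmod zm ^ k0)"
        using elim(2) j Z1(2)[OF zm(1)] unfolding k0_def by (intro mult_left_mono) auto
      also have "\<dots> = cmod (c k) * cmod zm ^ k0"
        by (simp add: c_def norm_mult dist_norm norm_minus_commute)
      also note c1
      also have "2 * C * e = (2 * C * exp (- (real n * (\<eta> / 2)))) * exp (real n * (u z0 - \<eta> / 2))"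
        by (simp add: e_def mult.assoc exp_add[symmetric] algebra_simps)
      finally have "dist (x' k) (x k) \<le> 2 * C * exp (- (real n * (\<eta> / 2)))"
        by (subst (asm) mult_le_cancel_right) auto
      then show "dist (x' k) (x k) \<le> s" using elim(1) by linarith
    qed
    have meas: "{\<omega>\<in>space M. (\<lambda>k\<in>W. \<xi> k \<omega>, \<lambda>k\<in>-W. \<xi> k \<omega>) \<in> S} \<in> events"
    proof -
      have "(\<lambda>\<omega>. (\<lambda>k\<in>W. \<xi> k \<omega>, \<lambda>k\<in>-W. \<xi> k \<omega>)) \<in> measurable M ?P" by measurable
      from measurable_sets[OF this S] show ?thesis by (simp add: vimage_def Int_def conj_commute)
    qed
    have "prob {\<omega>\<in>space M. \<forall>z\<in>Z. cmod (random_series \<xi> a n \<omega> z) < exp (real n * (u z0 - \<eta>))}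
      \<le> prob {\<omega>\<in>space M. (\<lambda>k\<in>W. \<xi> k \<omega>, \<lambda>k\<in>-W. \<xi> k \<omega>) \<in> S}"
    proof (rule finite_measure_mono_AE[OF _ meas])
      \<comment> \<open>Almost surely the series converges at the points of \<open>Z\<close>, and
        there its sum may be split into the window and the rest.\<close>
      show "AE \<omega> in M. \<omega> \<in> {\<omega>\<in>space M. \<forall>z\<in>Z. cmod (random_series \<xi> a n \<omega> z) < exp (real n * (u z0 - \<eta>))} \<longrightarrow>
        \<omega> \<in> {\<omega>\<in>space M. (\<lambda>k\<in>W. \<xi> k \<omega>, \<lambda>k\<in>-W. \<xi> k \<omega>) \<in> S}"
        using AE_conv_radius
      proof (eventually_elim, intro impI)
        fix \<omega> assume cr: "\<forall>n\<ge>1. R0 \<le> conv_radius (\<lambda>k. \<xi> k \<omega> * a k n)"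
          and w: "\<omega> \<in> {\<omega>\<in>space M. \<forall>z\<in>Z. cmod (random_series \<xi> a n \<omega> z) < exp (real n * (u z0 - \<eta>))}"
        have "random_series \<xi> a n \<omega> z = (\<Sum>k\<in>W. (\<lambda>k\<in>W. \<xi> k \<omega>) k * a k n * z ^ k) + R z (\<lambda>k\<in>-W. \<xi> k \<omega>)" if "z \<in> Z" for z
        proof -
          have "ereal (cmod z) < conv_radius (\<lambda>k. \<xi> k \<omega> * a k n)"
            using Z1(4)[OF that] cr elim(3) by (meson less_le_trans)
          then have s: "summable (\<lambda>k. \<xi> k \<omega> * a k n * z ^ k)" by (rule summable_in_conv_radius)
          have s1: "(\<lambda>k. if k \<in> W then \<xi> k \<omega> * a k n * z ^ k else 0) sums (\<Sum>k\<in>W. \<xi> k \<omega> * a k n * z ^ k)"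
            using W(1) by (rule sums_If_finite_set)
          have "(\<lambda>k. \<xi> k \<omega> * a k n * z ^ k - (if k \<in> W then \<xi> k \<omega> * a k n * z ^ k else 0)) sums
            ((\<Sum>k. \<xi> k \<omega> * a k n * z ^ k) - (\<Sum>k\<in>W. \<xi> k \<omega> * a k n * z ^ k))"
            using s s1 by (intro sums_diff summable_sums)
          also have "(\<lambda>k. \<xi> k \<omega> * a k n * z ^ k - (if k \<in> W then \<xi> k \<omega> * a k n * z ^ k else 0)) =
            (\<lambda>k. if k \<in> W then 0 else (\<lambda>k\<in>-W. \<xi> k \<omega>) k * a k n * z ^ k)"
            by (auto simp: fun_eq_iff)
          finally have "R z (\<lambda>k\<in>-W. \<xi> k \<omega>) = (\<Sum>k. \<xi> k \<omega> * a k n * z ^ k) - (\<Sum>k\<in>W. \<xi> k \<omega> * a k n * z ^ k)"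
            unfolding R_def by (rule sums_unique[symmetric])
          then show ?thesis by (simp add: random_series_def)
        qed
        then show "\<omega> \<in> {\<omega>\<in>space M. (\<lambda>k\<in>W. \<xi> k \<omega>, \<lambda>k\<in>-W. \<xi> k \<omega>) \<in> S}"
          using w by (auto simp: S_def e_def space_pair_measure space_PiM)
      qed
    qed
    also have "\<dots> \<le> q ^ m"
      using prob_narrow_slices[OF W(1,2) sq(4) sq(2) S narrow] W(3) by simp
    also have "\<dots> \<le> \<kappa>" using m by simp
    finally show ?case .
  qed
  with Z Z1(1) show ?thesis by blast
qed

end

section \<open>The limit measure\<close>

text \<open>By Jensen the mean over \<open>c\<close> of ln |z - c w| is ln max(|z|, |w|) for almost
  every \<open>z\<close>. For Fubini, rotation invariance of Lebesgue measure makes the integral in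
  \<open>z\<close> of a dominating function independent of \<open>c\<close>.\<close>

lemma circle_avg_log_swap:
  assumes [measurable]: "\<psi> \<in> borel_measurable borel" and B: "\<And>z. \<bar>\<psi> z\<bar> \<le> B"
    and supp: "\<And>z. cmod z \<ge> \<rho> \<Longrightarrow> \<psi> z = 0"
  shows "(\<integral>c. (\<integral>z. \<psi> z * ln (cmod (z - c * w)) \<partial>lborel) \<partial>circle_measure) = (\<integral>z. \<psi> z * ln (max (cmod z) (cmod w)) \<partial>lborel)"
proof -
  interpret C: pair_sigma_finite circle_measure "lborel :: complex measure" by (rule pair_sigma_finite_circle)
  have [measurable]: "ball (0::complex) \<rho> \<in> sets borel" by simp
  let ?l = "\<lambda>w z. indicator (ball 0 \<rho>) z * ln (cmod (z - w))"
  have bound: "\<bar>\<psi> z * ln (cmod (z - v))\<bar> \<le> B * \<bar>?l v z\<bar>" for z v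
    using supp[of z] B[of z] by (cases "cmod z < \<rho>") (auto simp: abs_mult intro!: mult_right_mono)
  have i: "integrable lborel (\<lambda>z. \<psi> z * ln (cmod (z - v)))" for v
  proof (rule Bochner_Integration.integrable_bound)
    show "integrable lborel (\<lambda>z. B * \<bar>?l v z\<bar>)"
      by (intro integrable_mult_right integrable_abs integrable_ln_norm)
    show "AE z in lborel. norm (\<psi> z * ln (cmod (z - v))) \<le> norm (B * \<bar>?l v z\<bar>)"
      using bound by (intro AE_I2) (auto intro: order_trans[OF _ abs_ge_self])
  qed measurable
  have const: "(\<integral>z. \<bar>?l (c * w) z\<bar> \<partial>lborel) = (\<integral>z. \<bar>?l w z\<bar> \<partial>lborel)" if "cmod c = 1" for c
  proof -
    have "(\<integral>z. \<bar>?l (c * w) z\<bar> \<partial>lborel) = (\<integral>z. \<bar>?l (c * w) (c * z)\<bar> \<partial>lborel)"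
      by (rule integral_rotate(1)[OF that, symmetric]) measurable
    also have "\<dots> = (\<integral>z. \<bar>?l w z\<bar> \<partial>lborel)"
      using that by (intro Bochner_Integration.integral_cong refl)
        (simp add: norm_mult indicator_def right_diff_distrib[symmetric])
    finally show ?thesis .
  qed
  have i2: "integrable (circle_measure \<Otimes>\<^sub>M lborel) (\<lambda>(c, z). \<psi> z * ln (cmod (z - c * w)))"
  proof (rule C.Fubini_integrable)
    show "AE x in circle_measure. integrable lborel (\<lambda>y. case (x, y) of (c, z) \<Rightarrow> \<psi> z * ln (cmod (z - c * w)))"
      using i by simp
    have "AE x in circle_measure. norm (\<integral>y. norm (case (x, y) of (c, z) \<Rightarrow> \<psi> z * ln (cmod (z - c * w))) \<partial>lborel) \<le> B * (\<integral>z. \<bar>?l w z\<bar> \<partial>lborel)"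
      using AE_circle_measure
    proof eventually_elim
      case (elim c)
      have "(\<integral>z. \<bar>\<psi> z * ln (cmod (z - c * w))\<bar> \<partial>lborel) \<le> (\<integral>z. B * \<bar>?l (c * w) z\<bar> \<partial>lborel)"
        by (intro integral_mono integrable_abs i bound integrable_mult_right integrable_ln_norm)
      also have "\<dots> = B * (\<integral>z. \<bar>?l w z\<bar> \<partial>lborel)" using const[OF elim] by simp
      finally show ?case by simp
    qed
    then show "integrable circle_measure (\<lambda>x. \<integral>y. norm (case (x, y) of (c, z) \<Rightarrow> \<psi> z * ln (cmod (z - c * w))) \<partial>lborel)"
      by (intro circle.integrable_const_bound) auto
  qed measurable
  have "(\<integral>c. (\<integral>z. \<psi> z * ln (cmod (z - c * w)) \<partial>lborel) \<partial>circle_measure) = (\<integral>z. (\<integral>c. \<psi> z * ln (cmod (z - c * w)) \<partial>circle_measure) \<partial>lborel)"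
    by (rule C.Fubini_integral[OF i2, symmetric])
  also have "\<dots> = (\<integral>z. \<psi> z * ln (max (cmod z) (cmod w)) \<partial>lborel)"
  proof (rule integral_cong_AE)
    show "AE z in lborel. (\<integral>c. \<psi> z * ln (cmod (z - c * w)) \<partial>circle_measure) = \<psi> z * ln (max (cmod z) (cmod w))"
      using AE_norm_ne[of "cmod w"]
    proof eventually_elim
      case (elim z)
      have "(\<integral>c. ln (cmod (z + (- w) * c)) \<partial>circle_measure) = ln (max (cmod z) (cmod (- w)))"
        using elim by (intro circle_mean_ln_norm(2)) simp
      then show ?case by (simp add: mult.commute)
    qed
  qed measurable
  finally show ?thesis .
qed

context legendre_profile
begin

text \<open>Layer cake in the logarithmic radius: the integrand is the length of the set of \<sigma>
  in (ln x, ln \<rho>] with |w| < exp \<sigma>. Exchanging the integrals leaves an integral of the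
  profile \<open>L\<close>, which is an increment of \<open>J\<close>.\<close>

lemma integral_ln_quotient:
  assumes \<kappa>: "finite_measure \<kappa>" "sets \<kappa> = sets borel"
    and \<rho>: "\<rho> > 0" "ereal \<rho> < R0"
    and supp: "AE w in \<kappa>. cmod w < \<rho>"
    and prof: "\<And>t. 0 < t \<Longrightarrow> t \<le> \<rho> \<Longrightarrow> measure \<kappa> (ball 0 t) = L (ln t)"
    and z: "0 < x" "x < \<rho>"
  shows "(\<integral>w. ln \<rho> - ln (max x (cmod w)) \<partial>\<kappa>) = J (ln \<rho>) - J (ln x)"
proof -
  interpret K: finite_measure \<kappa> by fact
  note [measurable_cong] = \<kappa>(2)
  interpret P: pair_sigma_finite "lborel :: real measure" \<kappa> ..
  have dom: "ln \<rho> \<in> dom" using \<rho> by (simp add: dom_def)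
  let ?g = "\<lambda>(\<sigma>::real, w). indicator {y. cmod y < exp \<sigma>} w :: real"
  have gm[measurable]: "?g \<in> borel_measurable (lborel \<Otimes>\<^sub>M \<kappa>)"
  proof -
    have "(\<lambda>(\<sigma>::real, w). if cmod w < exp \<sigma> then 1 else 0 :: real) \<in> borel_measurable (lborel \<Otimes>\<^sub>M \<kappa>)" by measurable
    then show ?thesis by (simp add: indicator_def)
  qed
  have iv: "integrable lborel (indicator {ln x<..ln \<rho>} :: real \<Rightarrow> real)"
    using z by (intro integrable_real_indicator) auto
  have i: "integrable (lborel \<Otimes>\<^sub>M \<kappa>) (\<lambda>(\<sigma>, w). ?g (\<sigma>, w) * indicator {ln x<..ln \<rho>} \<sigma>)"
  proof -
    have gb: "\<bar>?g p\<bar> \<le> 1" for p by (cases p) (simp add: indicator_def)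
    show ?thesis by (rule integrable_pair_bounded_left[OF P.pair_sigma_finite_axioms K.finite_measure_axioms iv gm gb])
  qed
  have "AE w in \<kappa>. ln \<rho> - ln (max x (cmod w)) = (\<integral>\<sigma>. ?g (\<sigma>, w) * indicator {ln x<..ln \<rho>} \<sigma> \<partial>lborel)"
    using supp
  proof eventually_elim
    case (elim w)
    have "(\<lambda>\<sigma>. ?g (\<sigma>, w) * indicator {ln x<..ln \<rho>} \<sigma>) = indicator {ln (max x (cmod w))<..ln \<rho>}"
    proof
      fix \<sigma>
      have "(cmod w < exp \<sigma> \<and> ln x < \<sigma>) \<longleftrightarrow> ln (max x (cmod w)) < \<sigma>"
      proof -
        have "ln x < \<sigma> \<longleftrightarrow> x < exp \<sigma>" using z by (metis exp_less_cancel_iff exp_ln)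
        moreover have "ln (max x (cmod w)) < \<sigma> \<longleftrightarrow> max x (cmod w) < exp \<sigma>"
          using z by (metis exp_less_cancel_iff exp_ln less_max_iff_disj)
        ultimately show ?thesis by auto
      qed
      then show "?g (\<sigma>, w) * indicator {ln x<..ln \<rho>} \<sigma> = indicator {ln (max x (cmod w))<..ln \<rho>} \<sigma>"
        by (auto simp: indicator_def)
    qed
    moreover have "ln (max x (cmod w)) \<le> ln \<rho>" using elim z by (subst ln_le_cancel_iff) auto
    ultimately show ?case by simp
  qed
  then have "(\<integral>w. ln \<rho> - ln (max x (cmod w)) \<partial>\<kappa>) = (\<integral>w. (\<integral>\<sigma>. ?g (\<sigma>, w) * indicator {ln x<..ln \<rho>} \<sigma> \<partial>lborel) \<partial>\<kappa>)"
    by (intro integral_cong_AE) measurable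
  also have "\<dots> = (\<integral>\<sigma>. (\<integral>w. ?g (\<sigma>, w) * indicator {ln x<..ln \<rho>} \<sigma> \<partial>\<kappa>) \<partial>lborel)"
    using P.Fubini_integral[OF i] by simp
  also have "\<dots> = (\<integral>\<sigma>. indicator {ln x<..ln \<rho>} \<sigma> * L \<sigma> \<partial>lborel)"
  proof (rule Bochner_Integration.integral_cong[OF refl])
    fix \<sigma>
    show "(\<integral>w. ?g (\<sigma>, w) * indicator {ln x<..ln \<rho>} \<sigma> \<partial>\<kappa>) = indicator {ln x<..ln \<rho>} \<sigma> * L \<sigma>"
    proof (cases "\<sigma> \<in> {ln x<..ln \<rho>}")
      case True
      have "(\<integral>w. indicator {y. cmod y < exp \<sigma>} w \<partial>\<kappa>) = measure \<kappa> (ball 0 (exp \<sigma>))"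
      proof -
        have "{y::complex. cmod y < exp \<sigma>} = ball 0 (exp \<sigma>)" by auto
        moreover have "space \<kappa> = UNIV" using sets_eq_imp_space_eq[OF \<kappa>(2)] by simp
        ultimately show ?thesis by simp
      qed
      also have "\<dots> = L \<sigma>"
      proof -
        have "exp \<sigma> \<le> \<rho>" using True \<rho> by (metis exp_le_cancel_iff exp_ln greaterThanAtMost_iff)
        then show ?thesis by (subst prof) auto
      qed
      finally show ?thesis using True by simp
    qed simp
  qed
  also have "\<dots> = J (ln \<rho>) - J (ln x)"
    using z by (intro integral_L dom) simp
  finally show ?thesis .
qed

text \<open>By rotation invariance \<open>smoothing\<close> may be averaged over rotations of
  \<open>w\<close>, which gives, up to the factor \<open>N\<close>, the integral of
  \<open>\<psi>\<close> against ln max(|z|, |w|). Integration in \<open>w\<close> then produces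
  \<open>u\<close> up to an additive constant, and constants disappear because \<open>\<psi>\<close>
  has integral 0.\<close>

lemma potential_identity:
  assumes \<kappa>: "finite_measure \<kappa>" "sets \<kappa> = sets borel"
    and rot: "\<And>c. cmod c = 1 \<Longrightarrow> distr \<kappa> borel (\<lambda>z. c * z) = \<kappa>"
    and \<rho>: "\<rho> > 0" "ereal \<rho> < R0"
    and supp\<kappa>: "AE w in \<kappa>. cmod w < \<rho>"
    and prof: "\<And>t. 0 < t \<Longrightarrow> t \<le> \<rho> \<Longrightarrow> measure \<kappa> (ball 0 t) = L (ln t)"
    and [measurable]: "\<phi> \<in> borel_measurable borel" and B: "\<And>z. \<bar>\<phi> z\<bar> \<le> B"
    and supp: "\<And>z. cmod z > a \<Longrightarrow> \<phi> z = 0" and r: "r > 0" "a + r < \<rho>"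
  shows "(\<integral>w. smoothing r \<phi> w \<partial>\<kappa>) = (\<integral>z. circle_avg_diff r \<phi> z * u z \<partial>lborel) / (\<integral>w. radial_kernel r w \<partial>lborel)"
proof -
  interpret K: finite_measure \<kappa> by fact
  note [measurable_cong] = \<kappa>(2)
  interpret CK: pair_sigma_finite circle_measure \<kappa>
    by (intro pair_sigma_finite.intro circle.sigma_finite_measure_axioms K.sigma_finite_measure_axioms)
  interpret LK: pair_sigma_finite "lborel :: complex measure" \<kappa> ..
  have [measurable]: "ball (0::complex) \<rho> \<in> sets borel" by simp
  define N where "N = (\<integral>w. radial_kernel r w \<partial>lborel)"
  have N: "N > 0" unfolding N_def by (rule integral_radial_kernel_pos[OF r(1)])
  define \<psi> where "\<psi> = circle_avg_diff r \<phi>"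
  have [measurable]: "\<psi> \<in> borel_measurable borel" unfolding \<psi>_def by measurable
  have \<psi>B: "\<bar>\<psi> z\<bar> \<le> 2 * B" for z unfolding \<psi>_def by (rule circle_avg_diff_bound) (use B in auto)
  have "B \<ge> 0" using order_trans[OF abs_ge_zero B] .
  have \<psi>0: "\<psi> z = 0" if "cmod z \<ge> \<rho>" for z
    unfolding \<psi>_def using that r by (intro circle_avg_diff_eq_0[OF supp]) auto
  have Ssum: "N * smoothing r \<phi> w = (\<integral>z. \<psi> z * ln (cmod (z - w)) \<partial>lborel)" if w: "cmod w < \<rho>" for w
  proof -
    \<comment> \<open>The harmonic part is 0 here, so any radius above \<open>\<rho>\<close> can be
      taken for the ball.\<close>
    interpret P: log_potential "\<lambda>_. 0" 0 "\<rho> + 1" "{w}" "\<lambda>_. 1"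
      by unfold_locales auto
    have "(\<integral>z. (circle_avg r \<phi> z - circle_avg (r / 2) \<phi> z) * (indicator (ball 0 \<rho>) z * P.pot z) \<partial>lborel) = (\<Sum>w\<in>{w}. 1 * (\<integral>z. \<phi> z * radial_kernel r (z - w) \<partial>lborel))"
      by (rule P.discrete_laplacian_pot(2)[where a = a]) (use B supp r in auto)
    moreover have "(\<lambda>z. (circle_avg r \<phi> z - circle_avg (r / 2) \<phi> z) * (indicator (ball 0 \<rho>) z * P.pot z)) = (\<lambda>z. \<psi> z * ln (cmod (z - w)))"
    proof
      fix z show "(circle_avg r \<phi> z - circle_avg (r / 2) \<phi> z) * (indicator (ball 0 \<rho>) z * P.pot z) = \<psi> z * ln (cmod (z - w))"
        using \<psi>0[of z] unfolding \<psi>_def circle_avg_diff_def P.pot_def by (cases "cmod z < \<rho>") auto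
    qed
    ultimately show ?thesis using N by (simp add: smoothing_def N_def)
  qed
  have SB: "\<bar>smoothing r \<phi> w\<bar> \<le> B" for w
    using abs_smoothing_diff_le[where \<phi> = \<phi> and w = w and x = 0 and e = B, OF _ B r(1)] B by simp
  have i\<psi>: "integrable lborel \<psi>"
  proof (rule Bochner_Integration.integrable_bound[OF integrable_mult_right[OF integrable_indicator_ball[of 0 \<rho>], of "2 * B"]])
    show "AE z in lborel. norm (\<psi> z) \<le> norm (2 * B * indicator (ball (0::complex) \<rho>) z :: real)"
      using \<psi>B \<psi>0 \<open>B \<ge> 0\<close> by (intro AE_I2) (auto simp: indicator_def)
  qed measurable
  \<comment> \<open>Circle averaging preserves the integral of \<open>\<phi>\<close>, since for both
    radii the averaged function is still supported in the ball.\<close>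
  have \<psi>int: "(\<integral>z. \<psi> z \<partial>lborel) = 0"
  proof -
    note iv = integrable_indicator_ball[of 0 \<rho>]
    have *: "integrable lborel (\<lambda>z. circle_avg s \<phi> z * indicator (ball 0 \<rho>) z)"
       "(\<integral>z. circle_avg s \<phi> z * indicator (ball 0 \<rho>) z \<partial>lborel) = (\<integral>z. \<phi> z \<partial>lborel)" if s: "0 < s" "a + s < \<rho>" for s
    proof -
      note F = circle_avg_fubini[where \<phi> = \<phi> and r = s, OF _ B iv]
      show "integrable lborel (\<lambda>z. circle_avg s \<phi> z * indicator (ball 0 \<rho>) z)" by (rule F(1)) measurable
      have "(\<integral>z. circle_avg s \<phi> z * indicator (ball 0 \<rho>) z \<partial>lborel) = (\<integral>z. \<phi> z * (\<integral>c. indicator (ball 0 \<rho>) (z + of_real s * c) \<partial>circle_measure) \<partial>lborel)"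
        by (rule F(2)) measurable
      also have "\<dots> = (\<integral>z. \<phi> z \<partial>lborel)"
      proof (rule Bochner_Integration.integral_cong[OF refl])
        fix z
        show "\<phi> z * (\<integral>c. indicator (ball 0 \<rho>) (z + of_real s * c) \<partial>circle_measure) = \<phi> z"
        proof (cases "cmod z > a")
          case False
          have "AE c in circle_measure. indicator (ball 0 \<rho>) (z + of_real s * c) = (1::real)"
            using AE_circle_measure
          proof eventually_elim
            case (elim c)
            have "cmod (z + of_real s * c) \<le> cmod z + s"
              using norm_triangle_ineq[of z "of_real s * c"] elim s by (simp add: norm_mult)
            then show ?case using False s by simp
          qed
          then have "(\<integral>c. indicator (ball 0 \<rho>) (z + of_real s * c) \<partial>circle_measure) = (\<integral>c. (1::real) \<partial>circle_measure)"
            by (intro integral_cong_AE) auto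
          then show ?thesis using circle.prob_space by simp
        qed (simp add: supp)
      qed
      finally show "(\<integral>z. circle_avg s \<phi> z * indicator (ball 0 \<rho>) z \<partial>lborel) = (\<integral>z. \<phi> z \<partial>lborel)" .
    qed
    have "(\<integral>z. \<psi> z \<partial>lborel) = (\<integral>z. circle_avg r \<phi> z * indicator (ball 0 \<rho>) z - circle_avg (r/2) \<phi> z * indicator (ball 0 \<rho>) z \<partial>lborel)"
    proof (rule Bochner_Integration.integral_cong[OF refl])
      fix z show "\<psi> z = circle_avg r \<phi> z * indicator (ball 0 \<rho>) z - circle_avg (r/2) \<phi> z * indicator (ball 0 \<rho>) z"
        using \<psi>0[of z] by (cases "cmod z < \<rho>") (auto simp: \<psi>_def circle_avg_diff_def)
    qed
    also have "\<dots> = 0"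
      using *[of r] *[of "r/2"] r by (subst Bochner_Integration.integral_diff) auto
    finally show ?thesis .
  qed
  have "(\<integral>w. smoothing r \<phi> w \<partial>\<kappa>) = (\<integral>c. (\<integral>w. smoothing r \<phi> w \<partial>\<kappa>) \<partial>circle_measure)"
    using circle.prob_space by simp
  also have "\<dots> = (\<integral>c. (\<integral>w. smoothing r \<phi> (c * w) \<partial>\<kappa>) \<partial>circle_measure)"
  proof (rule integral_cong_AE)
    show "AE c in circle_measure. (\<integral>w. smoothing r \<phi> w \<partial>\<kappa>) = (\<integral>w. smoothing r \<phi> (c * w) \<partial>\<kappa>)"
      using AE_circle_measure
    proof eventually_elim
      case (elim c)
      have "(\<integral>w. smoothing r \<phi> w \<partial>distr \<kappa> borel (\<lambda>z. c * z)) = (\<integral>w. smoothing r \<phi> (c * w) \<partial>\<kappa>)"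
        by (subst integral_distr) auto
      then show ?case using rot[OF elim] by simp
    qed
  qed measurable
  also have "\<dots> = (\<integral>w. (\<integral>c. smoothing r \<phi> (c * w) \<partial>circle_measure) \<partial>\<kappa>)"
  proof -
    have "integrable (circle_measure \<Otimes>\<^sub>M \<kappa>) (\<lambda>(c, w). smoothing r \<phi> (c * w))"
      using integrable_pair_bounded_left[OF CK.pair_sigma_finite_axioms K.finite_measure_axioms, of "\<lambda>_. 1" "\<lambda>(c, w). smoothing r \<phi> (c * w)" B] SB
      by (simp add: split_beta')
    from CK.Fubini_integral[OF this] show ?thesis by simp
  qed
  finally have e1: "N * (\<integral>w. smoothing r \<phi> w \<partial>\<kappa>) = (\<integral>w. (\<integral>c. N * smoothing r \<phi> (c * w) \<partial>circle_measure) \<partial>\<kappa>)" by simp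
  define D where "D z = ln \<rho> - ln (cmod z)" for z :: complex
  have Dpos: "D z > 0" if "0 < cmod z" "cmod z < \<rho>" for z
    using that \<rho>(1) ln_less_cancel_iff[of "cmod z" \<rho>] by (simp add: D_def)
  define v where "v z = \<psi> z * D z" for z
  have iv: "integrable lborel v"
  proof -
    have "integrable lborel (\<lambda>z. 2 * B * \<bar>indicator (ball 0 \<rho>) z * ln (cmod (z - 0))\<bar> + 2 * B * \<bar>ln \<rho>\<bar> * indicator (ball 0 \<rho>) z)"
      by (intro Bochner_Integration.integrable_add integrable_mult_right integrable_abs integrable_ln_norm integrable_indicator_ball)
    then show ?thesis
    proof (rule Bochner_Integration.integrable_bound)
      show "AE z in lborel. norm (v z) \<le> norm (2 * B * \<bar>indicator (ball 0 \<rho>) z * ln (cmod (z - 0))\<bar> + 2 * B * \<bar>ln \<rho>\<bar> * indicator (ball 0 \<rho>) z)"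
      proof (intro AE_I2)
        fix z
        show "norm (v z) \<le> norm (2 * B * \<bar>indicator (ball 0 \<rho>) z * ln (cmod (z - 0))\<bar> + 2 * B * \<bar>ln \<rho>\<bar> * indicator (ball 0 \<rho>) z)"
        proof (cases "cmod z < \<rho>")
          case True
          have "\<bar>v z\<bar> \<le> 2 * B * (\<bar>ln (cmod z)\<bar> + \<bar>ln \<rho>\<bar>)"
            unfolding v_def abs_mult D_def using \<psi>B[of z] by (intro mult_mono) auto
          then show ?thesis using True \<open>B \<ge> 0\<close> by (simp add: algebra_simps)
        next
          case False
          then show ?thesis using \<psi>0[of z] by (simp add: v_def)
        qed
      qed
    qed (unfold v_def D_def, measurable)
  qed
  \<comment> \<open>The logarithm is unbounded near the origin. Dividing by \<open>D z\<close> gives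
    a kernel bounded by 1, the factor \<open>D z\<close> moves into the integrable \<open>v\<close>,
    and \<open>integrable_pair_bounded_left\<close> applies.\<close>
  define g where "g = (\<lambda>(z, w). if 0 < cmod z \<and> cmod z < \<rho> \<and> cmod w < \<rho> then (ln \<rho> - ln (max (cmod z) (cmod w))) / D z else 0)"
  have gm: "g \<in> borel_measurable (lborel \<Otimes>\<^sub>M \<kappa>)" unfolding g_def D_def by measurable
  have gB: "\<bar>g p\<bar> \<le> 1" for p
  proof (cases p)
    case (Pair z w)
    show ?thesis
    proof (cases "0 < cmod z \<and> cmod z < \<rho> \<and> cmod w < \<rho>")
      case True
      then have "ln (max (cmod z) (cmod w)) \<le> ln \<rho>" "ln (cmod z) \<le> ln (max (cmod z) (cmod w))"
        using \<rho>(1) by (auto intro!: ln_le_cancel_iff[THEN iffD2] simp: less_max_iff_disj)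
      then show ?thesis using True Dpos[of z] by (simp add: Pair g_def D_def)
    qed (auto simp: Pair g_def)
  qed
  have ig: "integrable (lborel \<Otimes>\<^sub>M \<kappa>) (\<lambda>(z, w). g (z, w) * v z)"
    by (rule integrable_pair_bounded_left[OF LK.pair_sigma_finite_axioms K.finite_measure_axioms iv gm gB])
  have inner: "(\<integral>c. N * smoothing r \<phi> (c * w) \<partial>circle_measure) = - (\<integral>z. g (z, w) * v z \<partial>lborel)" if w: "cmod w < \<rho>" for w
  proof -
    have "(\<integral>c. N * smoothing r \<phi> (c * w) \<partial>circle_measure) = (\<integral>c. (\<integral>z. \<psi> z * ln (cmod (z - c * w)) \<partial>lborel) \<partial>circle_measure)"
    proof (rule integral_cong_AE)
      show "AE c in circle_measure. N * smoothing r \<phi> (c * w) = (\<integral>z. \<psi> z * ln (cmod (z - c * w)) \<partial>lborel)"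
        using AE_circle_measure by eventually_elim (rule Ssum, use w in \<open>simp add: norm_mult\<close>)
    qed measurable
    also have "\<dots> = (\<integral>z. \<psi> z * ln (max (cmod z) (cmod w)) \<partial>lborel)"
      by (rule circle_avg_log_swap[where \<rho> = \<rho>]) (use \<psi>B \<psi>0 in auto)
    also have "\<dots> = (\<integral>z. ln \<rho> * \<psi> z - g (z, w) * v z \<partial>lborel)"
    proof (rule integral_cong_AE)
      have "AE z in lborel. cmod z \<noteq> 0" by (rule AE_norm_ne)
      then show "AE z in lborel. \<psi> z * ln (max (cmod z) (cmod w)) = ln \<rho> * \<psi> z - g (z, w) * v z"
      proof eventually_elim
        case (elim z)
        show ?case
        proof (cases "cmod z < \<rho>")
          case True
          then have "g (z, w) * D z = ln \<rho> - ln (max (cmod z) (cmod w))"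
            using elim w Dpos[of z] by (simp add: g_def)
          then have "g (z, w) * v z = \<psi> z * (ln \<rho> - ln (max (cmod z) (cmod w)))"
            unfolding v_def by (metis mult.left_commute)
          then show ?thesis by (simp add: algebra_simps)
        next
          case False
          then show ?thesis using \<psi>0[of z] by (simp add: v_def)
        qed
      qed
      have "w \<in> space \<kappa>" using sets_eq_imp_space_eq[OF \<kappa>(2)] by simp
      then have [measurable]: "(\<lambda>z. g (z, w)) \<in> borel_measurable lborel" using gm by measurable
      have [measurable]: "v \<in> borel_measurable lborel" using iv by auto
      show "(\<lambda>z. ln \<rho> * \<psi> z - g (z, w) * v z) \<in> borel_measurable lborel" by measurable
    qed measurable
    also have "\<dots> = ln \<rho> * (\<integral>z. \<psi> z \<partial>lborel) - (\<integral>z. g (z, w) * v z \<partial>lborel)"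
    proof -
      have "w \<in> space \<kappa>" using sets_eq_imp_space_eq[OF \<kappa>(2)] by simp
      then have [measurable]: "(\<lambda>z. g (z, w)) \<in> borel_measurable lborel" using gm by measurable
      have [measurable]: "v \<in> borel_measurable lborel" using iv by auto
      have i2: "integrable lborel (\<lambda>z. g (z, w) * v z)"
      proof (rule Bochner_Integration.integrable_bound[OF iv])
        show "AE z in lborel. norm (g (z, w) * v z) \<le> norm (v z)"
          using gB by (intro AE_I2) (simp add: abs_mult mult_left_le_one_le)
      qed measurable
      show ?thesis using i\<psi> i2 by (subst Bochner_Integration.integral_diff) auto
    qed
    finally show ?thesis using \<psi>int by simp
  qed
  have "(\<integral>w. (\<integral>c. N * smoothing r \<phi> (c * w) \<partial>circle_measure) \<partial>\<kappa>) = (\<integral>w. - (\<integral>z. g (z, w) * v z \<partial>lborel) \<partial>\<kappa>)"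
  proof (rule integral_cong_AE)
    show "AE w in \<kappa>. (\<integral>c. N * smoothing r \<phi> (c * w) \<partial>circle_measure) = - (\<integral>z. g (z, w) * v z \<partial>lborel)"
      using supp\<kappa> by eventually_elim (rule inner)
    have [measurable]: "g \<in> borel_measurable (lborel \<Otimes>\<^sub>M \<kappa>)" "v \<in> borel_measurable lborel" using gm iv by auto
    show "(\<lambda>w. - (\<integral>z. g (z, w) * v z \<partial>lborel)) \<in> borel_measurable \<kappa>" by measurable
  qed measurable
  also have "\<dots> = - (\<integral>z. (\<integral>w. g (z, w) * v z \<partial>\<kappa>) \<partial>lborel)"
    using LK.Fubini_integral[OF ig] by simp
  also have "(\<integral>z. (\<integral>w. g (z, w) * v z \<partial>\<kappa>) \<partial>lborel) = (\<integral>z. J (ln \<rho>) * \<psi> z - \<psi> z * u z \<partial>lborel)"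
  proof (rule integral_cong_AE)
    have "AE z in lborel. cmod z \<noteq> 0" by (rule AE_norm_ne)
    then show "AE z in lborel. (\<integral>w. g (z, w) * v z \<partial>\<kappa>) = J (ln \<rho>) * \<psi> z - \<psi> z * u z"
    proof eventually_elim
      case (elim z)
      show ?case
      proof (cases "cmod z < \<rho>")
        case True
        have zpos: "0 < cmod z" using elim by simp
        have "z \<in> space lborel" by simp
        then have [measurable]: "(\<lambda>w. g (z, w)) \<in> borel_measurable \<kappa>" using gm by measurable
        have "(\<integral>w. g (z, w) * v z \<partial>\<kappa>) = (\<integral>w. \<psi> z * (ln \<rho> - ln (max (cmod z) (cmod w))) \<partial>\<kappa>)"
        proof (rule integral_cong_AE)
          show "AE w in \<kappa>. g (z, w) * v z = \<psi> z * (ln \<rho> - ln (max (cmod z) (cmod w)))"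
            using supp\<kappa>
          proof eventually_elim
            case (elim w)
            then have "g (z, w) * D z = ln \<rho> - ln (max (cmod z) (cmod w))"
              using zpos True Dpos[of z] by (simp add: g_def)
            then show ?case unfolding v_def by (metis mult.left_commute)
          qed
        qed measurable
        also have "\<dots> = \<psi> z * (J (ln \<rho>) - J (ln (cmod z)))"
          using integral_ln_quotient[OF \<kappa> \<rho> supp\<kappa> prof zpos True] by simp
        finally show ?thesis using elim by (simp add: u_def algebra_simps)
      next
        case False
        then show ?thesis using \<psi>0[of z] by (simp add: v_def)
      qed
    qed
    have [measurable]: "g \<in> borel_measurable (lborel \<Otimes>\<^sub>M \<kappa>)" "v \<in> borel_measurable lborel" using gm iv by auto
    show "(\<lambda>z. \<integral>w. g (z, w) * v z \<partial>\<kappa>) \<in> borel_measurable lborel" by measurable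
    have [measurable]: "(\<lambda>z. indicator (ball 0 \<rho>) z * u z) \<in> borel_measurable borel"
      using borel_measurable_integrable[OF integrable_ball_continuous[OF u_continuous_cball[OF \<rho>(2)]]] by simp
    have "(\<lambda>z. J (ln \<rho>) * \<psi> z - \<psi> z * (indicator (ball 0 \<rho>) z * u z)) \<in> borel_measurable lborel" by measurable
    also have "(\<lambda>z. J (ln \<rho>) * \<psi> z - \<psi> z * (indicator (ball 0 \<rho>) z * u z)) = (\<lambda>z. J (ln \<rho>) * \<psi> z - \<psi> z * u z)"
      using \<psi>0 by (auto simp: fun_eq_iff indicator_def)
    finally show "(\<lambda>z. J (ln \<rho>) * \<psi> z - \<psi> z * u z) \<in> borel_measurable lborel" .
  qed
  also have "\<dots> = - (\<integral>z. \<psi> z * u z \<partial>lborel)"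
  proof -
    note ui = integrable_ball_continuous[OF u_continuous_cball[OF \<rho>(2)]]
    have "integrable lborel (\<lambda>z. \<psi> z * (indicator (ball 0 \<rho>) z * u z))"
    proof (rule Bochner_Integration.integrable_bound[OF integrable_mult_right[OF ui, of "2 * B"]])
      show "(\<lambda>z. \<psi> z * (indicator (ball 0 \<rho>) z * u z)) \<in> borel_measurable lborel"
        using borel_measurable_integrable[OF ui] by (rule borel_measurable_times[rotated]) simp
      show "AE z in lborel. norm (\<psi> z * (indicator (ball 0 \<rho>) z * u z)) \<le> norm (2 * B * (indicator (ball 0 \<rho>) z * u z))"
        using \<psi>B \<open>B \<ge> 0\<close> by (intro AE_I2) (simp add: abs_mult mult_right_mono)
    qed
    also have "(\<lambda>z. \<psi> z * (indicator (ball 0 \<rho>) z * u z)) = (\<lambda>z. \<psi> z * u z)"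
      using \<psi>0 by (auto simp: fun_eq_iff indicator_def)
    finally have i2: "integrable lborel (\<lambda>z. \<psi> z * u z)" .
    show ?thesis using i\<psi> i2 \<psi>int by (subst Bochner_Integration.integral_diff) auto
  qed
  finally have "N * (\<integral>w. smoothing r \<phi> w \<partial>\<kappa>) = (\<integral>z. \<psi> z * u z \<partial>lborel)" using e1 by simp
  then show ?thesis using N by (simp add: \<psi>_def N_def field_simps)
qed

end

section \<open>Measures with the prescribed radial profile\<close>

context legendre_profile
begin

definition admissible :: "complex measure \<Rightarrow> bool" where
  "admissible \<nu> \<longleftrightarrow> locally_finite_measure_on (eball 0 R0) \<nu> \<and> rotation_invariant \<nu> \<and>
     radial_profile (legendre_log f) R0 \<nu>"

lemma ball_subset_eball: "ereal \<rho> < R0 \<Longrightarrow> cball (0::complex) \<rho> \<subseteq> eball 0 R0"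
  by (auto intro!: le_less_trans[of _ "ereal \<rho>" R0])

lemma profile_iff:
  assumes "0 < r" "ereal r < R0"
  shows "((\<lambda>s. real_of_ereal (legendre_log f s)) has_real_derivative m) (at_left (ln r)) \<longleftrightarrow> m = L (ln r)"
proof -
  have dom: "ln r \<in> dom" using assms by (simp add: dom_def)
  have "((\<lambda>s. real_of_ereal (legendre_log f s)) has_real_derivative L (ln r)) (at_left (ln r))"
    using J_left_derivative[OF dom] unfolding J_def[abs_def] .
  moreover have "m = L (ln r)" if "((\<lambda>s. real_of_ereal (legendre_log f s)) has_real_derivative m) (at_left (ln r))"
    using that calculation unfolding has_field_derivative_iff
    by (rule tendsto_unique[OF trivial_limit_at_left_real])
  ultimately show ?thesis by blast
qed

text \<open>A measure on the disk may have infinite mass, and its sigma-algebra is that of the disk.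
  Restricted to a ball and pushed to the plane it becomes a finite Borel measure, as
  \<open>potential_identity\<close> and the later approximation arguments require.\<close>

lemma truncated_measure:
  assumes "admissible \<nu>" and \<rho>: "\<rho> > 0" "ereal \<rho> < R0"
  defines "\<kappa> \<equiv> distr (restrict_space \<nu> (ball 0 \<rho>)) borel (\<lambda>z. z)"
  shows "finite_measure \<kappa>" "sets \<kappa> = sets borel"
    and "\<And>c. cmod c = 1 \<Longrightarrow> distr \<kappa> borel (\<lambda>z. c * z) = \<kappa>"
    and "AE w in \<kappa>. cmod w < \<rho>"
    and "\<And>t. 0 < t \<Longrightarrow> t \<le> \<rho> \<Longrightarrow> measure \<kappa> (ball 0 t) = L (ln t)"
    and "\<And>g :: complex \<Rightarrow> real. g \<in> borel_measurable borel \<Longrightarrow> (\<And>z. cmod z \<ge> \<rho> \<Longrightarrow> g z = 0) \<Longrightarrow> (\<integral>z. g z \<partial>\<nu>) = (\<integral>z. g z \<partial>\<kappa>)"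
    and "\<And>A. A \<in> sets borel \<Longrightarrow> emeasure \<kappa> A = emeasure \<nu> (A \<inter> ball 0 \<rho>)"
proof -
  have \<nu>: "sets \<nu> = sets (restrict_space borel (eball 0 R0))" "\<And>K. compact K \<Longrightarrow> K \<subseteq> eball 0 R0 \<Longrightarrow> emeasure \<nu> K < \<infinity>"
    "\<And>c. cmod c = 1 \<Longrightarrow> distr \<nu> \<nu> (\<lambda>z. c * z) = \<nu>"
    "\<And>r. r > 0 \<Longrightarrow> ereal r < R0 \<Longrightarrow> measure \<nu> (ball 0 r) = L (ln r)"
    using assms(1) unfolding admissible_def locally_finite_measure_on_def rotation_invariant_def radial_profile_def
    by (auto simp: profile_iff)
  have sp: "space \<nu> = eball 0 R0"
    using sets_eq_imp_space_eq[OF \<nu>(1)] by (simp add: space_restrict_space)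
  have sub: "cball (0::complex) \<rho> \<subseteq> eball 0 R0" "ball (0::complex) \<rho> \<subseteq> eball 0 R0"
    using ball_subset_eball[OF \<rho>(2)] ball_subset_cball[of 0 \<rho>] by (simp, blast)
  have in_sets: "A \<in> sets \<nu>" if "A \<in> sets borel" "A \<subseteq> eball 0 R0" for A
    using that unfolding \<nu>(1) by (subst sets_restrict_space_iff) auto
  have bs: "ball 0 \<rho> \<in> sets \<nu>" using sub by (intro in_sets) auto
  have id: "(\<lambda>z. z) \<in> measurable \<nu> borel"
    using measurable_restrict_space1[of "\<lambda>z::complex. z" borel borel "eball 0 R0"] by (simp add: measurable_cong_sets[OF \<nu>(1) refl])
  have idr: "(\<lambda>z. z) \<in> measurable (restrict_space \<nu> (ball 0 \<rho>)) borel"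
    by (rule measurable_restrict_space1[OF id])
  show s: "sets \<kappa> = sets borel" by (simp add: \<kappa>_def)
  show em: "emeasure \<kappa> A = emeasure \<nu> (A \<inter> ball 0 \<rho>)" if "A \<in> sets borel" for A
  proof -
    have "emeasure \<kappa> A = emeasure (restrict_space \<nu> (ball 0 \<rho>)) (A \<inter> ball 0 \<rho>)"
      unfolding \<kappa>_def using that sub sp
      by (subst emeasure_distr[OF idr]) (auto simp: space_restrict_space vimage_def Int_def intro!: arg_cong2[of _ _ _ _ emeasure])
    also have "\<dots> = emeasure \<nu> (A \<inter> ball 0 \<rho>)"
      using bs sp sub(2) by (intro emeasure_restrict_space) (auto simp: Int_absorb2)
    finally show ?thesis .
  qed
  have "emeasure \<nu> (ball 0 \<rho>) < \<infinity>"
    using \<nu>(2)[OF compact_cball sub(1)] sub in_sets by (intro le_less_trans[OF emeasure_mono[of "ball 0 \<rho>" "cball 0 \<rho>"]]) auto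
  then show fin: "finite_measure \<kappa>"
    using em[of UNIV] by (intro finite_measureI) (simp add: \<kappa>_def)
  show "AE w in \<kappa>. cmod w < \<rho>"
  proof -
    have "- ball 0 \<rho> \<in> null_sets \<kappa>" using em[of "- ball 0 \<rho>"] by (simp add: null_sets_def s)
    then show ?thesis using AE_not_in by fastforce
  qed
  show "measure \<kappa> (ball 0 t) = L (ln t)" if "0 < t" "t \<le> \<rho>" for t
  proof -
    have "ball (0::complex) t \<inter> ball 0 \<rho> = ball 0 t" using that by auto
    then have "measure \<kappa> (ball 0 t) = measure \<nu> (ball 0 t)" using em[of "ball 0 t"] by (simp add: measure_def)
    also have "\<dots> = L (ln t)" using that \<rho>(2) by (intro \<nu>(4)) (auto intro: le_less_trans[of "ereal t" "ereal \<rho>" R0])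
    finally show ?thesis .
  qed
  show "distr \<kappa> borel (\<lambda>z. c * z) = \<kappa>" if c: "cmod c = 1" for c
  proof (rule measure_eqI)
    fix A assume "A \<in> sets (distr \<kappa> borel (\<lambda>z. c * z))"
    then have A[measurable]: "A \<in> sets borel" by simp
    have mc: "(\<lambda>z. c * z) \<in> measurable \<nu> \<nu>"
    proof (rule measurableI)
      show "c * x \<in> space \<nu>" if "x \<in> space \<nu>" for x using that c by (simp add: sp norm_mult)
      fix B assume "B \<in> sets \<nu>"
      then have B: "B \<in> sets borel" "B \<subseteq> eball 0 R0" using sp sets.sets_into_space
        by (auto simp: \<nu>(1) sets_restrict_space_iff)
      have "(\<lambda>z. c * z) -` B \<inter> space borel \<in> sets borel" by (rule measurable_sets[OF _ B(1)]) measurable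
      then show "(\<lambda>z. c * z) -` B \<inter> space \<nu> \<in> sets \<nu>" by (intro in_sets) (auto simp: sp)
    qed
    have cA: "{z. c * z \<in> A} \<in> sets borel" by measurable
    have "emeasure (distr \<kappa> borel (\<lambda>z. c * z)) A = emeasure \<kappa> {z. c * z \<in> A}"
      using sets_eq_imp_space_eq[OF s] by (subst emeasure_distr) (auto simp: measurable_cong_sets[OF s refl] vimage_def)
    also have "\<dots> = emeasure \<nu> ({z. c * z \<in> A} \<inter> ball 0 \<rho>)" by (rule em[OF cA])
    also have "{z. c * z \<in> A} \<inter> ball 0 \<rho> = (\<lambda>z. c * z) -` (A \<inter> ball 0 \<rho>) \<inter> space \<nu>"
      using c sub sp by (auto simp: norm_mult)
    also have "emeasure \<nu> \<dots> = emeasure (distr \<nu> \<nu> (\<lambda>z. c * z)) (A \<inter> ball 0 \<rho>)"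
      using sub by (intro emeasure_distr[symmetric] mc in_sets) auto
    also have "\<dots> = emeasure \<kappa> A" using \<nu>(3)[OF c] em[OF A] by simp
    finally show "emeasure (distr \<kappa> borel (\<lambda>z. c * z)) A = emeasure \<kappa> A" .
  qed (simp add: s)
  show "(\<integral>z. g z \<partial>\<nu>) = (\<integral>z. g z \<partial>\<kappa>)" if g: "g \<in> borel_measurable borel" "\<And>z. cmod z \<ge> \<rho> \<Longrightarrow> g z = 0" for g :: "complex \<Rightarrow> real"
  proof -
    have "(\<integral>z. g z \<partial>\<kappa>) = (\<integral>z. g z \<partial>restrict_space \<nu> (ball 0 \<rho>))"
      unfolding \<kappa>_def by (rule integral_distr[OF idr g(1)])
    also have "\<dots> = (\<integral>z. indicator (ball 0 \<rho>) z *\<^sub>R g z \<partial>\<nu>)"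
      using bs sp sub by (intro integral_restrict_space) (auto simp: Int_absorb2)
    also have "\<dots> = (\<integral>z. g z \<partial>\<nu>)"
      using g(2) by (intro Bochner_Integration.integral_cong) (auto simp: indicator_def)
    finally show ?thesis by simp
  qed
qed

lemma admissible_integral_smoothing:
  assumes \<nu>: "admissible \<nu>" and [measurable]: "\<phi> \<in> borel_measurable borel" and B: "\<And>z. \<bar>\<phi> z\<bar> \<le> B"
    and supp: "\<And>z. cmod z > a \<Longrightarrow> \<phi> z = 0" and r: "r > 0" "a + r < \<rho>" "ereal \<rho> < R0" "\<rho> > 0"
  shows "(\<integral>w. smoothing r \<phi> w \<partial>\<nu>) = (\<integral>z. circle_avg_diff r \<phi> z * u z \<partial>lborel) / (\<integral>w. radial_kernel r w \<partial>lborel)"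
proof -
  note T = truncated_measure[OF \<nu> r(4,3)]
  have "(\<integral>w. smoothing r \<phi> w \<partial>\<nu>) = (\<integral>w. smoothing r \<phi> w \<partial>distr (restrict_space \<nu> (ball 0 \<rho>)) borel (\<lambda>z. z))"
    by (rule T(6)) (use smoothing_eq_0[OF _ B r(1) supp] r in auto)
  also have "\<dots> = (\<integral>z. circle_avg_diff r \<phi> z * u z \<partial>lborel) / (\<integral>w. radial_kernel r w \<partial>lborel)"
    by (rule potential_identity[OF T(1,2,3) r(4,3) T(4,5) _ B supp r(1,2)]) auto
  finally show ?thesis .
qed

text \<open>
  Under Lebesgue measure on \<open>radial_domain\<close>, the generalised inverse \<open>radius\<close> of the profile
  \<open>x \<mapsto> L (ln x)\<close> has distribution function \<open>L (ln x)\<close>, also when the profile jumps.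
\<close>

definition radial_domain :: "real set" where
  "radial_domain = {t. t > 0 \<and> (\<exists>x>0. ereal x < R0 \<and> t < L (ln x))}"

definition radius :: "real \<Rightarrow> real" where
  "radius t = Sup (insert 0 {x. 0 < x \<and> ereal x < R0 \<and> L (ln x) \<le> t})"

lemma L_ln_mono: "0 < x \<Longrightarrow> x \<le> y \<Longrightarrow> ereal y < R0 \<Longrightarrow> L (ln x) \<le> L (ln y)"
  by (intro L_mono) (auto simp: dom_def)

lemma radius_bdd:
  assumes "0 < y" "ereal y < R0" "t < L (ln y)" "x \<in> insert 0 {x. 0 < x \<and> ereal x < R0 \<and> L (ln x) \<le> t}"
  shows "x \<le> y"
  using assms L_ln_mono[of y x] by (cases "x \<le> y") auto

lemma radius_le: "0 < y \<Longrightarrow> ereal y < R0 \<Longrightarrow> t < L (ln y) \<Longrightarrow> radius t \<le> y"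
  unfolding radius_def using radius_bdd by (intro cSup_least) auto

lemma radius_ge:
  assumes "t \<in> radial_domain" "x \<in> insert 0 {x. 0 < x \<and> ereal x < R0 \<and> L (ln x) \<le> t}"
  shows "x \<le> radius t"
proof -
  obtain y where y: "y > 0" "ereal y < R0" "t < L (ln y)" using assms(1) by (auto simp: radial_domain_def)
  have "bdd_above (insert 0 {x. 0 < x \<and> ereal x < R0 \<and> L (ln x) \<le> t})"
    by (rule bdd_aboveI[of _ y]) (rule radius_bdd[OF y])
  then show ?thesis unfolding radius_def using assms(2) by (intro cSup_upper)
qed

lemma radius_nonneg: "t \<in> radial_domain \<Longrightarrow> 0 \<le> radius t"
  by (rule radius_ge) auto

lemma radius_lt_R0: "t \<in> radial_domain \<Longrightarrow> ereal (radius t) < R0"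
proof -
  assume "t \<in> radial_domain"
  then obtain y where y: "y > 0" "ereal y < R0" "t < L (ln y)" by (auto simp: radial_domain_def)
  then have "ereal (radius t) \<le> ereal y" using radius_le by simp
  then show ?thesis using y(2) by (rule le_less_trans)
qed

text \<open>The strict inequality comes from left continuity: if \<open>t < L (ln x)\<close> then
  already \<open>t < L s\<close> for some \<open>s < ln x\<close>, which puts
  \<open>radius t\<close> at or below \<open>exp s\<close>.\<close>

lemma radius_less_iff:
  assumes x: "0 < x" "ereal x < R0" and t: "t > 0"
  shows "t \<in> radial_domain \<and> radius t < x \<longleftrightarrow> t < L (ln x)"
proof
  assume "t < L (ln x)"
  then have T: "t \<in> radial_domain" using x t by (auto simp: radial_domain_def)
  have "ln x \<in> dom" using x by (simp add: dom_def)
  then obtain s where s: "s < ln x" "t < L s" using L_gt_near \<open>t < L (ln x)\<close> by blast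
  have "exp s < x" using s x by (metis exp_less_cancel_iff exp_ln)
  then have "ereal (exp s) < R0" using x by (auto intro: less_trans[of _ "ereal x"])
  then have "radius t \<le> exp s" using s by (intro radius_le) auto
  then show "t \<in> radial_domain \<and> radius t < x" using T \<open>exp s < x\<close> by simp
next
  assume *: "t \<in> radial_domain \<and> radius t < x"
  show "t < L (ln x)"
  proof (rule ccontr)
    assume "\<not> t < L (ln x)"
    then have "x \<le> radius t" using * x by (intro radius_ge) auto
    then show False using * by simp
  qed
qed

lemma radial_domain_sets [measurable]: "radial_domain \<in> sets borel"
proof -
  have "radial_domain = (\<Union>x\<in>{x. 0 < x \<and> ereal x < R0}. {0<..<L (ln x)})"
    by (auto simp: radial_domain_def)
  then have "open radial_domain" by (simp only:) (intro open_UN ballI open_greaterThanLessThan)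
  then show ?thesis by (rule borel_open)
qed

lemma radius_measurable [measurable]: "radius \<in> borel_measurable (restrict_space lborel radial_domain)"
proof (rule borel_measurableI_less)
  fix y
  have "{t \<in> radial_domain. radius t < y} \<in> sets borel"
  proof -
    consider "y \<le> 0" | "0 < y" "ereal y < R0" | "R0 \<le> ereal y" by (meson not_less)
    then show ?thesis
    proof cases
      case 1
      have "{t \<in> radial_domain. radius t < y} = {}"
      proof -
        have "\<not> radius t < y" if "t \<in> radial_domain" for t using radius_nonneg[OF that] 1 by linarith
        then show ?thesis by blast
      qed
      then show ?thesis by (simp only: sets.empty_sets)
    next
      case 2
      have "{t \<in> radial_domain. radius t < y} = {0<..<L (ln y)}"
      proof (rule set_eqI)
        fix t
        have "t \<in> radial_domain \<Longrightarrow> t > 0" by (simp add: radial_domain_def)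
        then show "t \<in> {t \<in> radial_domain. radius t < y} \<longleftrightarrow> t \<in> {0<..<L (ln y)}"
          using radius_less_iff[OF 2, of t] by auto
      qed
      then show ?thesis by (simp only: borel_open open_greaterThanLessThan)
    next
      case 3
      have "radius t < y" if "t \<in> radial_domain" for t
        using less_le_trans[OF radius_lt_R0[OF that] 3] by simp
      then have "{t \<in> radial_domain. radius t < y} = radial_domain" by auto
      then show ?thesis by (simp only: radial_domain_sets)
    qed
  qed
  then show "{x \<in> space (restrict_space lborel radial_domain). radius x < y} \<in> sets (restrict_space lborel radial_domain)"
    by (subst sets_restrict_space_iff) (auto simp: space_restrict_space)
qed

definition radial_law :: "real measure" where "radial_law = restrict_space lborel radial_domain"

text \<open>Polar coordinates, with the radius distributed through \<open>radial_law\<close>. Since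
  \<open>circle_measure\<close> lives on the plane, \<open>sgn c\<close>, equal to \<open>c\<close>
  almost everywhere, keeps the map inside the disk at every point.\<close>

definition limit_measure :: "complex measure" where
  "limit_measure = distr (radial_law \<Otimes>\<^sub>M circle_measure) (restrict_space borel (eball 0 R0)) (\<lambda>(t, c). of_real (radius t) * sgn c)"

lemma limit_map_measurable:
  "(\<lambda>(t, c). of_real (radius t) * sgn c) \<in> measurable (radial_law \<Otimes>\<^sub>M circle_measure) (restrict_space borel (eball 0 R0))"
proof (rule measurable_restrict_space2)
  show "(\<lambda>(t, c). of_real (radius t) * sgn c) \<in> space (radial_law \<Otimes>\<^sub>M circle_measure) \<rightarrow> eball 0 R0"
  proof safe
    fix t :: real and c :: complex assume "(t, c) \<in> space (radial_law \<Otimes>\<^sub>M circle_measure)"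
    then have t: "t \<in> radial_domain" by (auto simp: space_pair_measure radial_law_def space_restrict_space)
    have "cmod (of_real (radius t) * sgn c) \<le> radius t"
      using radius_nonneg[OF t] by (simp add: norm_mult norm_sgn)
    then show "of_real (radius t) * sgn c \<in> eball 0 R0"
      using radius_lt_R0[OF t] by (auto intro: le_less_trans[of _ "ereal (radius t)"])
  qed
  have [measurable]: "radius \<in> borel_measurable radial_law" unfolding radial_law_def by (rule radius_measurable)
  have [measurable]: "(sgn :: complex \<Rightarrow> complex) \<in> borel_measurable borel"
  proof -
    have "(\<lambda>z::complex. z / of_real (cmod z)) \<in> borel_measurable borel" by measurable
    then show ?thesis by (simp add: complex_sgn_def divide_inverse scaleR_conv_of_real mult.commute cong: measurable_cong)
  qed
  show "(\<lambda>(t, c). of_real (radius t) * sgn c) \<in> borel_measurable (radial_law \<Otimes>\<^sub>M circle_measure)"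
    by measurable
qed

lemma emeasure_limit_measure:
  assumes A: "A \<in> sets borel" "A \<subseteq> eball 0 R0"
  shows "emeasure limit_measure A = (\<integral>\<^sup>+t. emeasure circle_measure {c. of_real (radius t) * c \<in> A} \<partial>radial_law)"
proof -
  have AD: "A \<in> sets (restrict_space borel (eball 0 R0))" using A by (subst sets_restrict_space_iff) auto
  let ?P = "(\<lambda>(t, c). of_real (radius t) * sgn c) -` A \<inter> space (radial_law \<Otimes>\<^sub>M circle_measure)"
  have P: "?P \<in> sets (radial_law \<Otimes>\<^sub>M circle_measure)" by (rule measurable_sets[OF limit_map_measurable AD])
  have "emeasure limit_measure A = emeasure (radial_law \<Otimes>\<^sub>M circle_measure) ?P"
    unfolding limit_measure_def by (rule emeasure_distr[OF limit_map_measurable AD])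
  also have "\<dots> = (\<integral>\<^sup>+t. emeasure circle_measure (Pair t -` ?P) \<partial>radial_law)"
    by (rule circle.emeasure_pair_measure_alt[OF P])
  also have "\<dots> = (\<integral>\<^sup>+t. emeasure circle_measure {c. of_real (radius t) * c \<in> A} \<partial>radial_law)"
  proof (rule nn_integral_cong)
    fix t assume t: "t \<in> space radial_law"
    show "emeasure circle_measure (Pair t -` ?P) = emeasure circle_measure {c. of_real (radius t) * c \<in> A}"
    proof (rule emeasure_eq_AE)
      show "AE c in circle_measure. c \<in> Pair t -` ?P \<longleftrightarrow> c \<in> {c. of_real (radius t) * c \<in> A}"
        using AE_circle_measure by eventually_elim (use t in \<open>auto simp: space_pair_measure sgn_div_norm\<close>)
      show "Pair t -` ?P \<in> sets circle_measure" by (rule sets_Pair1[OF P])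
      have "(\<lambda>c::complex. of_real (radius t) * c) -` A \<inter> space borel \<in> sets borel"
        by (rule measurable_sets[OF _ A(1)]) measurable
      then show "{c. of_real (radius t) * c \<in> A} \<in> sets circle_measure" by (simp add: vimage_def)
    qed
  qed
  finally show ?thesis .
qed

lemma sets_limit_measure: "sets limit_measure = sets (restrict_space borel (eball 0 R0))"
  by (simp add: limit_measure_def)

text \<open>The parameters with radius below \<open>r\<close> form the interval (0, L (ln r)), whose
  length is the profile.\<close>

lemma emeasure_limit_measure_ball:
  assumes r: "0 < r" "ereal r < R0"
  shows "emeasure limit_measure (ball 0 r) = ennreal (L (ln r))"
proof -
  have dom: "ln r \<in> dom" using r by (simp add: dom_def)
  have subT: "{0<..<L (ln r)} \<subseteq> radial_domain" using r by (auto simp: radial_domain_def)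
  have "ball (0::complex) r \<subseteq> eball 0 R0" using ball_subset_eball[OF r(2)] ball_subset_cball[of 0 r] by blast
  then have "emeasure limit_measure (ball 0 r) = (\<integral>\<^sup>+t. emeasure circle_measure {c. of_real (radius t) * c \<in> ball 0 r} \<partial>radial_law)"
    by (intro emeasure_limit_measure) auto
  also have "\<dots> = (\<integral>\<^sup>+t. indicator {0<..<L (ln r)} t \<partial>radial_law)"
  proof (rule nn_integral_cong)
    fix t assume "t \<in> space radial_law"
    then have t: "t \<in> radial_domain" by (simp add: radial_law_def space_restrict_space)
    then have "t > 0" by (simp add: radial_domain_def)
    have "emeasure circle_measure {c. of_real (radius t) * c \<in> ball 0 r} = emeasure circle_measure (if radius t < r then UNIV else {})"
    proof (rule emeasure_eq_AE)
      show "AE c in circle_measure. c \<in> {c. of_real (radius t) * c \<in> ball 0 r} \<longleftrightarrow> c \<in> (if radius t < r then UNIV else {})"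
        using AE_circle_measure by eventually_elim (use radius_nonneg[OF t] in \<open>auto simp: norm_mult\<close>)
      have "(\<lambda>c::complex. of_real (radius t) * c) -` ball 0 r \<inter> space borel \<in> sets borel"
        by (intro measurable_sets[of _ borel borel]) auto
      then show "{c. of_real (radius t) * c \<in> ball 0 r} \<in> sets circle_measure" by (simp add: vimage_def)
    qed auto
    also have "\<dots> = indicator {0<..<L (ln r)} t"
      using radius_less_iff[OF r \<open>t > 0\<close>] t \<open>t > 0\<close> circle.emeasure_space_1 by (auto simp: indicator_def)
    finally show "emeasure circle_measure {c. of_real (radius t) * c \<in> ball 0 r} = indicator {0<..<L (ln r)} t" .
  qed
  also have "\<dots> = emeasure radial_law {0<..<L (ln r)}"
    using subT by (intro nn_integral_indicator) (simp add: radial_law_def sets_restrict_space_iff)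
  also have "\<dots> = emeasure lborel {0<..<L (ln r)}"
    unfolding radial_law_def using subT by (intro emeasure_restrict_space) auto
  also have "\<dots> = ennreal (L (ln r))" using L_nonneg[OF dom] by simp
  finally show ?thesis .
qed

lemma compact_subset_ball:
  assumes "compact K" "K \<subseteq> eball (0::complex) R0"
  obtains r where "r > 0" "ereal r < R0" "K \<subseteq> ball 0 r"
proof -
  obtain r where r: "ereal r < R0" "r \<ge> 0" "\<And>z. z \<in> K \<Longrightarrow> cmod z \<le> r"
  proof (cases "K = {}")
    case False
    obtain x where x: "x \<in> K" "\<And>y. y \<in> K \<Longrightarrow> cmod y \<le> cmod x"
      using continuous_attains_sup[OF assms(1) False, of cmod] by (auto intro: continuous_intros)
    then show ?thesis using assms(2) by (intro that[of "cmod x"]) auto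
  qed (use R0_pos that[of 0] in \<open>auto simp: zero_ereal_def\<close>)
  obtain r' where "r < r'" "ereal r' < R0" using ereal_dense_real[OF r(1)] .
  then show ?thesis using r by (intro that[of r']) force+
qed

lemma limit_measure_admissible: "admissible limit_measure"
  unfolding admissible_def
proof (intro conjI)
  show "locally_finite_measure_on (eball 0 R0) limit_measure"
    unfolding locally_finite_measure_on_def
  proof (intro conjI allI impI)
    fix K :: "complex set" assume K: "compact K \<and> K \<subseteq> eball 0 R0"
    obtain r where r: "r > 0" "ereal r < R0" "K \<subseteq> ball 0 r"
      using compact_subset_ball K by metis
    have "ball (0::complex) r \<in> sets limit_measure"
      using ball_subset_eball[OF r(2)] ball_subset_cball[of 0 r] unfolding sets_limit_measure
      by (subst sets_restrict_space_iff) auto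
    then have "emeasure limit_measure K \<le> emeasure limit_measure (ball 0 r)"
      using r(3) by (intro emeasure_mono)
    also have "\<dots> < \<infinity>" by (simp add: emeasure_limit_measure_ball[OF r(1,2)])
    finally show "emeasure limit_measure K < \<infinity>" .
  qed (rule sets_limit_measure)
  show "rotation_invariant limit_measure"
    unfolding rotation_invariant_def
  proof (intro allI impI)
    fix c0 :: complex assume c0: "cmod c0 = 1"
    show "distr limit_measure limit_measure (\<lambda>z. c0 * z) = limit_measure"
    proof (rule measure_eqI)
      fix A assume "A \<in> sets (distr limit_measure limit_measure (\<lambda>z. c0 * z))"
      then have A': "A \<in> sets limit_measure" by simp
      then have A: "A \<in> sets borel" "A \<subseteq> eball 0 R0"
        unfolding sets_limit_measure by (auto simp: sets_restrict_space_iff)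
      have sp: "space limit_measure = eball 0 R0" by (simp add: limit_measure_def space_restrict_space)
      have pre: "(\<lambda>z. c0 * z) -` B \<in> sets borel" if "B \<in> sets borel" for B
        using measurable_sets[of "\<lambda>z. c0 * z" borel borel B] that by simp
      have preD: "(\<lambda>z. c0 * z) -` B \<subseteq> eball 0 R0" if "B \<subseteq> eball 0 R0" for B
      proof
        fix z assume "z \<in> (\<lambda>z. c0 * z) -` B"
        then have "c0 * z \<in> eball 0 R0" using that by auto
        then show "z \<in> eball 0 R0" using c0 by (simp add: norm_mult)
      qed
      have m: "(\<lambda>z. c0 * z) \<in> measurable limit_measure limit_measure"
      proof (rule measurableI)
        show "c0 * x \<in> space limit_measure" if "x \<in> space limit_measure" for x
          using that c0 by (simp add: sp norm_mult)
        fix B assume "B \<in> sets limit_measure"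
        then have B: "B \<in> sets borel" "B \<subseteq> eball 0 R0"
          unfolding sets_limit_measure by (auto simp: sets_restrict_space_iff)
        show "(\<lambda>z. c0 * z) -` B \<inter> space limit_measure \<in> sets limit_measure"
          unfolding sets_limit_measure sp using pre[OF B(1)] by (subst sets_restrict_space_iff) auto
      qed
      have "emeasure (distr limit_measure limit_measure (\<lambda>z. c0 * z)) A = emeasure limit_measure ((\<lambda>z. c0 * z) -` A \<inter> space limit_measure)"
        by (rule emeasure_distr[OF m A'])
      also have "(\<lambda>z. c0 * z) -` A \<inter> space limit_measure = (\<lambda>z. c0 * z) -` A"
        using preD[OF A(2)] sp by auto
      also have "emeasure limit_measure \<dots> = (\<integral>\<^sup>+t. emeasure circle_measure {c. of_real (radius t) * c \<in> (\<lambda>z. c0 * z) -` A} \<partial>radial_law)"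
        by (rule emeasure_limit_measure[OF pre[OF A(1)] preD[OF A(2)]])
      also have "\<dots> = (\<integral>\<^sup>+t. emeasure circle_measure {c. of_real (radius t) * c \<in> A} \<partial>radial_law)"
      proof (rule nn_integral_cong)
        fix t
        let ?E = "{c. of_real (radius t) * c \<in> A}"
        have "(\<lambda>c::complex. of_real (radius t) * c) -` A \<inter> space borel \<in> sets borel"
          by (rule measurable_sets[OF _ A(1)]) measurable
        then have E: "?E \<in> sets borel" by (simp add: vimage_def)
        have "emeasure circle_measure ?E = emeasure (distr circle_measure borel (\<lambda>z. c0 * z)) ?E"
          by (simp add: circle_measure_rotate[OF c0])
        also have "\<dots> = emeasure circle_measure {c. c0 * c \<in> ?E}"
          using E by (subst emeasure_distr) (auto simp: vimage_def)
        finally show "emeasure circle_measure {c. of_real (radius t) * c \<in> (\<lambda>z. c0 * z) -` A} = emeasure circle_measure ?E"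
          by (simp add: mult.left_commute)
      qed
      also have "\<dots> = emeasure limit_measure A" by (rule emeasure_limit_measure[OF A, symmetric])
      finally show "emeasure (distr limit_measure limit_measure (\<lambda>z. c0 * z)) A = emeasure limit_measure A" .
    qed simp
  qed
  show "radial_profile (legendre_log f) R0 limit_measure"
    unfolding radial_profile_def
  proof (intro allI impI)
    fix r :: real assume r: "r > 0" "ereal r < R0"
    have "measure limit_measure (ball 0 r) = L (ln r)"
      using L_nonneg[of "ln r"] r by (simp add: measure_def emeasure_limit_measure_ball[OF r] dom_def)
    then show "((\<lambda>s. real_of_ereal (legendre_log f s)) has_real_derivative measure limit_measure (ball 0 r)) (at_left (ln r))"
      using profile_iff[OF r] by blast
  qed
qed

end

section \<open>Convergence of the zero measures\<close>

context legendre_profile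
begin

text \<open>Test functions on the disk, extended by zero to the plane: smoothing and circle averages
  evaluate them at displaced points, which may leave the disk.\<close>

definition bump_class :: "real \<Rightarrow> (complex \<Rightarrow> real) \<Rightarrow> bool" where
  "bump_class b \<phi> \<longleftrightarrow> continuous_on UNIV \<phi> \<and> 0 < b \<and> ereal b < R0 \<and> (\<forall>z. cmod z > b \<longrightarrow> \<phi> z = 0)"

lemma bump_classD:
  assumes "bump_class b \<phi>"
  shows "\<phi> \<in> borel_measurable borel" "0 < b" "ereal b < R0" "\<And>z. cmod z > b \<Longrightarrow> \<phi> z = 0"
    "uniformly_continuous_on UNIV \<phi>" "\<exists>B. \<forall>z. \<bar>\<phi> z\<bar> \<le> B"
proof -
  have c: "continuous_on UNIV \<phi>" and b: "0 < b" "ereal b < R0" and z: "\<And>z. cmod z > b \<Longrightarrow> \<phi> z = 0"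
    using assms by (auto simp: bump_class_def)
  show "\<phi> \<in> borel_measurable borel" by (rule borel_measurable_continuous_onI[OF c])
  show "0 < b" "ereal b < R0" "\<And>z. cmod z > b \<Longrightarrow> \<phi> z = 0" by fact+
  have "bounded (\<phi> ` cball 0 b)"
    by (intro compact_imp_bounded compact_continuous_image continuous_on_subset[OF c]) auto
  then obtain B where "\<forall>y\<in>\<phi> ` cball 0 b. norm y \<le> B" unfolding bounded_iff by blast
  then have "\<bar>\<phi> z\<bar> \<le> max B 0" for z using z[of z] by (cases "cmod z \<le> b") (auto intro: le_max_iff_disj[THEN iffD2])
  then show "\<exists>B. \<forall>z. \<bar>\<phi> z\<bar> \<le> B" by blast
  have uc: "uniformly_continuous_on (cball 0 (b + 1)) \<phi>"
    by (intro compact_uniformly_continuous continuous_on_subset[OF c]) auto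
  show "uniformly_continuous_on UNIV \<phi>"
    unfolding uniformly_continuous_on_def
  proof (intro allI impI)
    fix e :: real assume "e > 0"
    then obtain d where d: "d > 0" "\<And>x y. x \<in> cball 0 (b + 1) \<Longrightarrow> y \<in> cball 0 (b + 1) \<Longrightarrow> dist y x < d \<Longrightarrow> dist (\<phi> y) (\<phi> x) < e"
      using uc unfolding uniformly_continuous_on_def by blast
    show "\<exists>d>0. \<forall>x\<in>UNIV. \<forall>x'\<in>UNIV. dist x' x < d \<longrightarrow> dist (\<phi> x') (\<phi> x) < e"
    \<comment> \<open>Two points at distance below 1 either both lie in the ball of radius
      \<open>b + 1\<close>, where uniform continuity is known, or both lie where the function is
      0.\<close>
    proof (intro exI[of _ "min d 1"] conjI ballI impI)
      fix x x' :: complex assume x: "dist x' x < min d 1"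
      have t: "cmod x \<le> cmod x' + dist x' x" "cmod x' \<le> cmod x + dist x' x"
        using norm_triangle_ineq2[of x x'] norm_triangle_ineq2[of x' x] by (auto simp: dist_norm norm_minus_commute)
      show "dist (\<phi> x') (\<phi> x) < e"
      proof (cases "cmod x \<le> b + 1 \<and> cmod x' \<le> b + 1")
        case True
        then show ?thesis using d(2)[of x x'] x by simp
      next
        case False
        then have "cmod x > b" "cmod x' > b" using t x by auto
        then show ?thesis using z \<open>e > 0\<close> by simp
      qed
    qed (use d in auto)
  qed
qed

lemma smoothing_uniform:
  assumes \<phi>: "bump_class b \<phi>" and e: "e > 0"
  obtains d where "d > 0" "\<And>r w. 0 < r \<Longrightarrow> r < d \<Longrightarrow> \<bar>smoothing r \<phi> w - \<phi> w\<bar> \<le> e"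
proof -
  note D = bump_classD[OF \<phi>]
  obtain B where B: "\<And>z. \<bar>\<phi> z\<bar> \<le> B" using D(6) by blast
  have "\<exists>d>0. \<forall>x\<in>UNIV. \<forall>x'\<in>UNIV. dist x' x < d \<longrightarrow> dist (\<phi> x') (\<phi> x) < e"
    using D(5) e unfolding uniformly_continuous_on_def by simp
  then obtain d where d: "d > 0" "\<And>x y. dist y x < d \<Longrightarrow> dist (\<phi> y) (\<phi> x) < e" by auto
  show ?thesis
  proof (rule that[OF d(1)])
    fix r w assume r: "0 < r" "r < d"
    show "\<bar>smoothing r \<phi> w - \<phi> w\<bar> \<le> e"
    proof (rule abs_smoothing_diff_le[OF D(1) B r(1)])
      fix z assume "dist z w < r"
      then show "\<bar>\<phi> z - \<phi> w\<bar> \<le> e" using d(2)[of z w] r by (simp add: dist_real_def)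
    qed
  qed
qed

lemma cutoff_exists:
  assumes "0 < b1" "ereal b1 < R0"
  obtains b2 \<phi> where "b1 < b2" "bump_class b2 \<phi>" "\<And>z. cmod z \<le> b1 \<Longrightarrow> \<phi> z = 1" "\<And>z. 0 \<le> \<phi> z" "\<And>z. \<phi> z \<le> 1"
proof -
  obtain b2 where b2: "b1 < b2" "ereal b2 < R0" using ereal_dense_real[OF assms(2)] .
  define \<phi> where "\<phi> z = max 0 (min 1 ((b2 - cmod z) / (b2 - b1)))" for z :: complex
  have "continuous_on UNIV \<phi>" unfolding \<phi>_def using b2 by (intro continuous_intros) auto
  moreover have "\<phi> z = 0" if "cmod z > b2" for z
  proof -
    have "(b2 - cmod z) / (b2 - b1) \<le> 0" using that b2 by (intro divide_nonpos_pos) auto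
    then show ?thesis by (simp add: \<phi>_def)
  qed
  ultimately have "bump_class b2 \<phi>" using assms b2 by (simp add: bump_class_def)
  moreover have "\<phi> z = 1" if "cmod z \<le> b1" for z
  proof -
    have "(b2 - cmod z) / (b2 - b1) \<ge> 1" using that b2 by (simp add: field_simps)
    then show ?thesis by (simp add: \<phi>_def)
  qed
  ultimately show ?thesis using b2 by (intro that[of b2 \<phi>]) (auto simp: \<phi>_def)
qed

end

context random_series_setting
begin

abbreviation G :: "nat \<Rightarrow> 'w \<Rightarrow> complex \<Rightarrow> complex" where "G n \<omega> \<equiv> random_series \<xi> a n \<omega>"

text \<open>Stated through the coefficients, so that it is a measurable event; it makes the sum
  holomorphic on the disk and not identically zero.\<close>

definition good :: "nat \<Rightarrow> 'w \<Rightarrow> bool" where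
  "good n \<omega> \<longleftrightarrow> R0 \<le> conv_radius (\<lambda>k. \<xi> k \<omega> * a k n) \<and> (\<exists>k. \<xi> k \<omega> * a k n \<noteq> 0)"

lemma G_eq: "G n \<omega> z = (\<Sum>k. (\<xi> k \<omega> * a k n) * z ^ k)"
  by (simp add: random_series_def)

lemma eball_0: "0 \<in> eball (0::complex) R0"
  using R0_pos by (simp add: zero_ereal_def)

lemma good_imp_nonzero_holomorphic:
  assumes "good n \<omega>"
  shows "\<exists>z0. nonzero_holomorphic (G n \<omega>) (eball 0 R0) z0"
proof -
  define c where "c k = \<xi> k \<omega> * a k n" for k
  have cr: "R0 \<le> conv_radius c" and nz: "\<exists>k. c k \<noteq> 0" using assms by (auto simp: good_def c_def)
  have eq: "G n \<omega> = (\<lambda>z. \<Sum>k. c k * z ^ k)" by (simp add: fun_eq_iff G_eq c_def)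
  have hol: "G n \<omega> holomorphic_on eball 0 R0" unfolding eq by (rule power_series_holomorphic[OF cr])
  have "\<exists>z\<in>eball 0 R0. G n \<omega> z \<noteq> 0"
  proof (rule ccontr)
    assume z: "\<not> (\<exists>z\<in>eball 0 R0. G n \<omega> z \<noteq> 0)"
    have "Abs_fps c = 0"
    proof (rule eval_fps_eqD)
      show "0 < fps_conv_radius (Abs_fps c)" using R0_pos cr by (auto simp: fps_conv_radius_def intro: less_le_trans)
      show "0 < fps_conv_radius (0 :: complex fps)" by simp
      have "\<forall>\<^sub>F z in nhds 0. z \<in> eball (0::complex) R0"
        by (rule eventually_nhds_in_open[OF open_eball eball_0])
      then show "\<forall>\<^sub>F z in nhds 0. eval_fps (Abs_fps c) z = eval_fps 0 z"
      proof eventually_elim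
        case (elim w)
        then have "G n \<omega> w = 0" using z by blast
        then show ?case by (simp add: eq eval_fps_def)
      qed
    qed
    then have "c k = 0" for k by (metis Abs_fps_inverse UNIV_I fps_zero_nth fps_nth_Abs_fps)
    then show False using nz by blast
  qed
  then obtain z0 where "z0 \<in> eball 0 R0" "G n \<omega> z0 \<noteq> 0" by blast
  then have "nonzero_holomorphic (G n \<omega>) (eball 0 R0) z0"
    using hol by unfold_locales auto
  then show ?thesis by blast
qed

lemma G_measurable [measurable]: "(\<lambda>(\<omega>, z). G n \<omega> z) \<in> borel_measurable (M \<Otimes>\<^sub>M borel)"
  unfolding random_series_def by measurable

lemma G_measurable' [measurable]: "(\<lambda>\<omega>. G n \<omega> z) \<in> borel_measurable M"
  unfolding random_series_def by measurable

text \<open>Three exceptional events are removed: fast growth of the \<open>\<xi> k\<close>,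
  smallness at all chosen points near some point of the net, and divergence. Off them the upper and
  lower bounds feed \<open>submean_L1_bound\<close>; as \<open>\<psi>\<close> is bounded, closeness
  of the potentials in the mean gives closeness of the smoothed integrals.\<close>

lemma smoothing_convergence:
  assumes [measurable]: "\<phi> \<in> borel_measurable borel" and B: "\<And>z. \<bar>\<phi> z\<bar> \<le> B"
    and supp: "\<And>z. cmod z > b \<Longrightarrow> \<phi> z = 0" and r: "r > 0" "0 < b" "b + r < \<rho>" "ereal \<rho> < R0"
    and \<nu>: "admissible \<nu>" and \<epsilon>: "\<epsilon> > 0" and \<kappa>: "\<kappa> > 0"
  shows "\<forall>\<^sub>F n in sequentially. \<exists>Bad\<in>events. prob Bad \<le> \<kappa> \<and> (\<forall>\<omega>\<in>space M - Bad. good n \<omega> \<and>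
    \<bar>(\<integral>z. smoothing r \<phi> z \<partial>zero_measure (eball 0 R0) (G n \<omega>)) / real n - (\<integral>z. smoothing r \<phi> z \<partial>\<nu>)\<bar> \<le> \<epsilon>)"
proof -
  obtain \<rho>1 where \<rho>1: "\<rho> < \<rho>1" "ereal \<rho>1 < R0" using ereal_dense_real[OF r(4)] .
  have \<rho>pos: "\<rho> > 0" using r by simp
  have sub1: "cball (0::complex) \<rho>1 \<subseteq> eball 0 R0" by (rule ball_subset_eball[OF \<rho>1(2)])
  have sub: "cball (0::complex) \<rho> \<subseteq> eball 0 R0" by (rule ball_subset_eball[OF r(4)])
  have B0: "B \<ge> 0" using order_trans[OF abs_ge_zero B] .
  define N where "N = (\<integral>w. radial_kernel r w \<partial>lborel)"
  have N: "N > 0" unfolding N_def by (rule integral_radial_kernel_pos[OF r(1)])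
  define \<psi> where "\<psi> = circle_avg_diff r \<phi>"
  have \<psi>m[measurable]: "\<psi> \<in> borel_measurable borel" unfolding \<psi>_def by measurable
  have \<psi>B: "\<bar>\<psi> z\<bar> \<le> 2 * B" for z unfolding \<psi>_def by (rule circle_avg_diff_bound) (use B in auto)
  have \<psi>0: "\<psi> z = 0" if "cmod z > b + r" for z
    unfolding \<psi>_def using that r by (intro circle_avg_diff_eq_0[OF supp]) auto
  define V where "V = measure lborel (ball (0::complex) \<rho>)"
  have V: "V > 0" using \<rho>pos by (simp add: V_def)
  \<comment> \<open>Balances the bound \<open>13 * e * V\<close> of \<open>submean_L1_bound\<close>
    and the bound \<open>2 * B\<close> on \<open>\<psi>\<close> against the kernel mass
    \<open>N\<close>; \<open>B + 1\<close> avoids a division by 0.\<close>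
  define e where "e = \<epsilon> * N / (26 * (B + 1) * V)"
  have e: "e > 0" using \<epsilon> N V B0 by (simp add: e_def)
  have e_eq: "2 * B * (13 * e * V) \<le> \<epsilon> * N"
  proof -
    have "2 * B * (13 * e * V) \<le> 2 * (B + 1) * (13 * e * V)" using e V by (intro mult_right_mono) auto
    also have "\<dots> = e * (26 * (B + 1) * V)" by (simp add: algebra_simps)
    also have "\<dots> = \<epsilon> * N" using V B0 by (simp add: e_def)
    finally show ?thesis .
  qed
  have uc: "continuous_on (cball 0 \<rho>) u" by (rule u_continuous_cball[OF r(4)])
  then have "uniformly_continuous_on (cball 0 \<rho>) u" by (rule compact_uniformly_continuous) simp
  then obtain d where d: "d > 0" "\<And>x y. x \<in> cball 0 \<rho> \<Longrightarrow> y \<in> cball 0 \<rho> \<Longrightarrow> dist y x < d \<Longrightarrow> dist (u y) (u x) < e"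
    unfolding uniformly_continuous_on_def using e by blast
  \<comment> \<open>\<open>submean_L1_bound\<close> asks for oscillation control at distance
    \<open>5 * \<delta>\<close> and for \<open>b + r + 8 * \<delta> < \<rho>\<close>; the divisor 9
    makes the latter strict.\<close>
  define \<delta> where "\<delta> = min (d / 5) ((\<rho> - (b + r)) / 9)"
  have \<delta>: "\<delta> > 0" "5 * \<delta> \<le> d" "b + r + 8 * \<delta> < \<rho>" using d r by (auto simp: \<delta>_def min_def field_simps)
  obtain S :: "complex set" where S: "finite S" "S \<subseteq> ball 0 \<rho> - {0}" "\<And>x. x \<in> cball 0 (b + r + 2 * \<delta>) \<Longrightarrow> \<exists>s\<in>S. dist x s < \<delta>"
    using compact_punctured_net[OF \<delta>(1), of "b + r + 2 * \<delta>" \<rho>] \<delta> by auto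
  have "0 \<in> cball (0::complex) (b + r + 2 * \<delta>)" using r \<delta> by simp
  then obtain s0 where s0: "s0 \<in> S" using S(3) by blast
  obtain \<epsilon>' where \<epsilon>': "\<epsilon>' > 0" "\<forall>\<^sub>F n in sequentially. \<forall>x. (\<forall>k. cmod (x k) \<le> exp (\<epsilon>' * (real k + real n))) \<longrightarrow>
    (\<forall>z\<in>cball 0 \<rho>. cmod (\<Sum>k. x k * a k n * z ^ k) \<le> exp (real n * (u z + e)))"
    using series_upper_bound[OF \<rho>pos r(4) e] by blast
  \<comment> \<open>Half of \<open>\<kappa>\<close> is kept for the growth event, and the other half
    is shared by the points of the net.\<close>
  define \<kappa>' where "\<kappa>' = \<kappa> / (2 * real (card S))"
  have cS: "card S > 0" using S(1) s0 by (auto simp: card_gt_0_iff)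
  have \<kappa>': "\<kappa>' > 0" using \<kappa> cS by (simp add: \<kappa>'_def)
  have "\<forall>s\<in>S. \<exists>Z. finite Z \<and> Z \<subseteq> ball s \<delta> \<and> (\<forall>\<^sub>F n in sequentially.
    prob {\<omega>\<in>space M. \<forall>z\<in>Z. cmod (G n \<omega> z) < exp (real n * (u s - e))} \<le> \<kappa>')"
  proof
    fix s assume "s \<in> S"
    then have "s \<in> ball 0 \<rho>" "s \<noteq> 0" using S(2) by auto
    then have s: "s \<noteq> 0" "ereal (cmod s) < ereal \<rho>" by auto
    have sR: "ereal (cmod s) < R0" by (rule less_trans[OF s(2) r(4)])
    show "\<exists>Z. finite Z \<and> Z \<subseteq> ball s \<delta> \<and> (\<forall>\<^sub>F n in sequentially.
      prob {\<omega>\<in>space M. \<forall>z\<in>Z. cmod (G n \<omega> z) < exp (real n * (u s - e))} \<le> \<kappa>')"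
      by (rule prob_small_on_points[OF s(1) sR e \<delta>(1) \<kappa>'])
  qed
  then obtain Z where Z: "\<And>s. s \<in> S \<Longrightarrow> finite (Z s)" "\<And>s. s \<in> S \<Longrightarrow> Z s \<subseteq> ball s \<delta>"
    "\<And>s. s \<in> S \<Longrightarrow> \<forall>\<^sub>F n in sequentially. prob {\<omega>\<in>space M. \<forall>z\<in>Z s. cmod (G n \<omega> z) < exp (real n * (u s - e))} \<le> \<kappa>'"
    by (subst (asm) bchoice_iff) blast
  have ev: "\<forall>\<^sub>F n in sequentially. \<forall>s\<in>S. prob {\<omega>\<in>space M. \<forall>z\<in>Z s. cmod (G n \<omega> z) < exp (real n * (u s - e))} \<le> \<kappa>'"
    using Z(3) S(1) by (intro eventually_ball_finite) auto
  have ev2: "\<forall>\<^sub>F n in sequentially. prob {\<omega>\<in>space M. \<exists>k. exp (\<epsilon>' * (real k + real n)) < cmod (\<xi> k \<omega>)} < \<kappa> / 2"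
    using prob_growth[OF \<epsilon>'(1)] \<kappa> by (intro order_tendstoD) auto
  define conv where "conv \<omega> \<longleftrightarrow> (\<forall>n\<ge>1. R0 \<le> conv_radius (\<lambda>k. \<xi> k \<omega> * a k n))" for \<omega>
  have "AE \<omega> in M. conv \<omega>" unfolding conv_def by (rule AE_conv_radius)
  then obtain Nul where Nul: "Nul \<in> null_sets M" "\<And>\<omega>. \<omega> \<in> space M - Nul \<Longrightarrow> conv \<omega>"
    by (rule AE_E3) blast
  show ?thesis
    using \<epsilon>'(2) ev ev2 eventually_ge_at_top[of 1]
  proof eventually_elim
    case (elim n)
    have n: "real n > 0" using elim(4) by simp
    define Small where "Small s = {\<omega>\<in>space M. \<forall>z\<in>Z s. cmod (G n \<omega> z) < exp (real n * (u s - e))}" for s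
    define Grow where "Grow = {\<omega>\<in>space M. \<exists>k. exp (\<epsilon>' * (real k + real n)) < cmod (\<xi> k \<omega>)}"
    define Bad where "Bad = Grow \<union> (\<Union>s\<in>S. Small s) \<union> Nul"
    have Small_m: "Small s \<in> events" if "s \<in> S" for s
    proof -
      have "Small s = space M \<inter> (\<Inter>z\<in>Z s. {\<omega>\<in>space M. cmod (G n \<omega> z) < exp (real n * (u s - e))}) \<or> Small s = space M"
        unfolding Small_def by (cases "Z s = {}") auto
      moreover have "(\<Inter>z\<in>Z s. {\<omega>\<in>space M. cmod (G n \<omega> z) < exp (real n * (u s - e))}) \<in> events" if "Z s \<noteq> {}"
        using Z(1)[OF \<open>s \<in> S\<close>] that by (intro sets.finite_INT) measurable
      ultimately show ?thesis by (cases "Z s = {}") (auto simp: Small_def)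
    qed
    have Grow_m: "Grow \<in> events" unfolding Grow_def by measurable
    have Bad_m: "Bad \<in> events"
      unfolding Bad_def using Grow_m Small_m S(1) Nul(1) by (intro sets.Un sets.finite_UN) auto
    have "prob Bad \<le> prob (Grow \<union> (\<Union>s\<in>S. Small s)) + prob Nul"
      unfolding Bad_def using Grow_m Small_m S(1) Nul(1) by (intro measure_Un_le sets.Un sets.finite_UN) auto
    also have "prob Nul = 0" using Nul(1) by (simp add: measure_def null_setsD1)
    also have "prob (Grow \<union> (\<Union>s\<in>S. Small s)) \<le> prob Grow + prob (\<Union>s\<in>S. Small s)"
      using Grow_m Small_m S(1) by (intro measure_Un_le sets.finite_UN) auto
    also have "prob (\<Union>s\<in>S. Small s) \<le> (\<Sum>s\<in>S. prob (Small s))"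
      using Small_m S(1) by (intro finite_measure_subadditive_finite) auto
    also have "\<dots> \<le> (\<Sum>s\<in>S. \<kappa>')" using elim(2) by (intro sum_mono) (simp add: Small_def)
    also have "\<dots> = \<kappa> / 2" using cS by (simp add: \<kappa>'_def)
    finally have pBad: "prob Bad \<le> \<kappa>" using elim(3) by (simp add: Grow_def)
    have "good n \<omega> \<and> \<bar>(\<integral>z. smoothing r \<phi> z \<partial>zero_measure (eball 0 R0) (G n \<omega>)) / real n - (\<integral>z. smoothing r \<phi> z \<partial>\<nu>)\<bar> \<le> \<epsilon>"
      if \<omega>: "\<omega> \<in> space M - Bad" for \<omega>
    proof -
      have cr: "R0 \<le> conv_radius (\<lambda>k. \<xi> k \<omega> * a k n)"
        using \<omega> Nul(2)[of \<omega>] elim(4) by (simp add: Bad_def conv_def)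
      have up: "cmod (G n \<omega> z) \<le> exp (real n * (u z + e))" if "z \<in> cball 0 \<rho>" for z
      proof -
        have "\<forall>k. cmod (\<xi> k \<omega>) \<le> exp (\<epsilon>' * (real k + real n))"
          using \<omega> by (auto simp: Bad_def Grow_def not_less)
        then show ?thesis using elim(1)[rule_format, of "\<lambda>k. \<xi> k \<omega>" z] that by (simp add: random_series_def)
      qed
      have low: "\<exists>p\<in>ball s \<delta>. exp (real n * (u s - e)) \<le> cmod (G n \<omega> p)" if "s \<in> S" for s
      proof -
        have "\<omega> \<notin> Small s" using \<omega> that by (auto simp: Bad_def)
        then obtain p where "p \<in> Z s" "exp (real n * (u s - e)) \<le> cmod (G n \<omega> p)"
          using \<omega> by (auto simp: Small_def not_less)
        then show ?thesis using Z(2)[OF that] by blast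
      qed
      \<comment> \<open>The lower bound near a single point of the net already excludes that all
        coefficients vanish.\<close>
      have gd: "good n \<omega>"
      proof -
        obtain p where "exp (real n * (u s0 - e)) \<le> cmod (G n \<omega> p)" using low[OF s0] by blast
        then have "G n \<omega> p \<noteq> 0" by (metis exp_gt_zero norm_zero not_less)
        have "\<exists>k. \<xi> k \<omega> * a k n \<noteq> 0"
        proof (rule ccontr)
          assume "\<not> ?thesis"
          then have "\<xi> k \<omega> * a k n = 0" for k by blast
          then have "G n \<omega> p = 0" unfolding G_eq by (simp only: mult_zero_left suminf_zero)
          then show False using \<open>G n \<omega> p \<noteq> 0\<close> by blast
        qed
        then show ?thesis using cr by (simp add: good_def)
      qed
      obtain z0 where H: "nonzero_holomorphic (G n \<omega>) (eball 0 R0) z0" using good_imp_nonzero_holomorphic[OF gd] by blast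
      interpret H: nonzero_holomorphic "G n \<omega>" "eball 0 R0" z0 by (rule H)
      define v where "v z = ln (cmod (G n \<omega> z)) / real n" for z
      have iv: "integrable lborel (\<lambda>z. indicator (ball 0 \<rho>) z * v z)"
      proof -
        have "integrable lborel (\<lambda>z. (indicator (ball 0 \<rho>) z * ln (cmod (G n \<omega> z))) / real n)"
          by (intro integrable_divide H.integrable_ln_norm_holomorphic[OF sub1 \<rho>1(1)])
        then show ?thesis by (simp add: v_def)
      qed
      have "(\<integral>z. indicator (cball 0 (b + r)) z * \<bar>v z - u z\<bar> \<partial>lborel) \<le> 13 * e * measure lborel (ball (0::complex) \<rho>)"
      proof (rule submean_L1_bound[OF uc _ \<delta>(1,3) e iv _ S(3)])
        show "\<bar>u x - u y\<bar> < e" if "x \<in> ball 0 \<rho>" "y \<in> ball 0 \<rho>" "dist x y < 5 * \<delta>" for x y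
          using d(2)[of y x] that \<delta>(2) by (simp add: dist_real_def)
        show "AE z in lborel. z \<in> ball 0 \<rho> \<longrightarrow> v z \<le> u z + e"
          using H.AE_not_zeros[OF sub]
        proof eventually_elim
          case (elim z)
          show ?case
          proof
            assume z: "z \<in> ball 0 \<rho>"
            then have "ln (cmod (G n \<omega> z)) \<le> ln (exp (real n * (u z + e)))"
              using up[of z] elim by (subst ln_le_cancel_iff) auto
            then show "v z \<le> u z + e" using n by (simp add: v_def field_simps)
          qed
        qed
        fix s assume s: "s \<in> S"
        obtain p where p: "p \<in> ball s \<delta>" "exp (real n * (u s - e)) \<le> cmod (G n \<omega> p)" using low[OF s] by blast
        have Gp: "G n \<omega> p \<noteq> 0" using p(2) by (metis exp_gt_zero norm_zero not_less)
        have "ln (exp (real n * (u s - e))) \<le> ln (cmod (G n \<omega> p))"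
          using p(2) Gp by (subst ln_le_cancel_iff) auto
        then have vp: "u s - e \<le> v p" using n by (simp add: v_def field_simps)
        have "v p * measure lborel (ball p \<delta>') \<le> (\<integral>z. indicator (ball p \<delta>') z * v z \<partial>lborel)" if "\<delta>' > 0" "cmod p + \<delta>' < \<rho>" for \<delta>'
        proof -
          have "(\<integral>z. indicator (ball p \<delta>') z * v z \<partial>lborel) = (\<integral>z. indicator (ball p \<delta>') z * ln (cmod (G n \<omega> z)) / real n \<partial>lborel)"
            by (simp add: v_def)
          also have "\<dots> = (\<integral>z. indicator (ball p \<delta>') z * ln (cmod (G n \<omega> z)) \<partial>lborel) / real n" by simp
          finally show ?thesis
            using divide_right_mono[OF H.ln_norm_submean[OF sub that(2) Gp that(1)], of "real n"] n by (simp add: v_def)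
        qed
        then show "s \<in> ball 0 \<rho> \<and> (\<exists>p\<in>ball s \<delta>. u s - e \<le> v p \<and>
          (\<forall>\<delta>'>0. cmod p + \<delta>' < \<rho> \<longrightarrow> v p * measure lborel (ball p \<delta>') \<le> (\<integral>z. indicator (ball p \<delta>') z * v z \<partial>lborel)))"
          using s S(2) p(1) vp by blast
      qed
      then have L1: "(\<integral>z. indicator (cball 0 (b + r)) z * \<bar>v z - u z\<bar> \<partial>lborel) \<le> 13 * e * V" by (simp add: V_def)
      have iu: "integrable lborel (\<lambda>z. indicator (ball 0 \<rho>) z * u z)"
        by (rule integrable_ball_continuous[OF uc])
      have i\<psi>: "integrable lborel (\<lambda>z. \<psi> z * h z)" if ih: "integrable lborel (\<lambda>z. indicator (ball 0 \<rho>) z * h z)" for h :: "complex \<Rightarrow> real"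
      proof -
        have "integrable lborel (\<lambda>z. \<psi> z * (indicator (ball 0 \<rho>) z * h z))"
        proof (rule Bochner_Integration.integrable_bound[OF integrable_mult_right[OF ih, of "2 * B"]])
          have "(\<lambda>z. indicator (ball 0 \<rho>) z * h z) \<in> borel_measurable lborel" using ih by auto
          then show "(\<lambda>z. \<psi> z * (indicator (ball 0 \<rho>) z * h z)) \<in> borel_measurable lborel"
            by (rule borel_measurable_times[rotated]) simp
          show "AE z in lborel. norm (\<psi> z * (indicator (ball 0 \<rho>) z * h z)) \<le> norm (2 * B * (indicator (ball 0 \<rho>) z * h z))"
            using \<psi>B B0 by (intro AE_I2) (simp add: abs_mult mult_right_mono)
        qed
        also have "(\<lambda>z. \<psi> z * (indicator (ball 0 \<rho>) z * h z)) = (\<lambda>z. \<psi> z * h z)"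
          using \<psi>0 r by (auto simp: fun_eq_iff indicator_def)
        finally show ?thesis .
      qed
      have iabs: "integrable lborel (\<lambda>z. indicator (cball 0 (b + r)) z * \<bar>v z - u z\<bar>)"
      proof -
        have "integrable lborel (\<lambda>z. \<bar>indicator (ball 0 \<rho>) z * v z - indicator (ball 0 \<rho>) z * u z\<bar>)"
          using iv iu by (intro integrable_abs Bochner_Integration.integrable_diff)
        from integrable_mult_indicator[OF _ this, of "cball 0 (b + r)"]
        have "integrable lborel (\<lambda>z. indicator (cball 0 (b + r)) z * \<bar>indicator (ball 0 \<rho>) z * v z - indicator (ball 0 \<rho>) z * u z\<bar>)" by simp
        also have "(\<lambda>z. indicator (cball 0 (b + r)) z * \<bar>indicator (ball 0 \<rho>) z * v z - indicator (ball 0 \<rho>) z * u z\<bar>) = (\<lambda>z. indicator (cball 0 (b + r)) z * \<bar>v z - u z\<bar>)"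
          using r by (auto simp: fun_eq_iff indicator_def)
        finally show ?thesis .
      qed
      have "\<bar>(\<integral>z. \<psi> z * v z \<partial>lborel) - (\<integral>z. \<psi> z * u z \<partial>lborel)\<bar> = \<bar>\<integral>z. \<psi> z * v z - \<psi> z * u z \<partial>lborel\<bar>"
        by (subst Bochner_Integration.integral_diff[OF i\<psi>[OF iv] i\<psi>[OF iu]]) simp
      also have "\<dots> \<le> (\<integral>z. norm (\<psi> z * v z - \<psi> z * u z) \<partial>lborel)"
        using integral_norm_bound[of lborel "\<lambda>z. \<psi> z * v z - \<psi> z * u z"] by simp
      also have "\<dots> \<le> (\<integral>z. 2 * B * (indicator (cball 0 (b + r)) z * \<bar>v z - u z\<bar>) \<partial>lborel)"
      proof (rule integral_mono)
        show "integrable lborel (\<lambda>z. norm (\<psi> z * v z - \<psi> z * u z))"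
          by (intro integrable_norm Bochner_Integration.integrable_diff i\<psi> iv iu)
        show "integrable lborel (\<lambda>z. 2 * B * (indicator (cball 0 (b + r)) z * \<bar>v z - u z\<bar>))"
          by (intro integrable_mult_right iabs)
        fix z
        have "norm (\<psi> z * v z - \<psi> z * u z) = \<bar>\<psi> z\<bar> * \<bar>v z - u z\<bar>" by (simp add: abs_mult[symmetric] right_diff_distrib)
        then show "norm (\<psi> z * v z - \<psi> z * u z) \<le> 2 * B * (indicator (cball 0 (b + r)) z * \<bar>v z - u z\<bar>)"
          using \<psi>B[of z] \<psi>0[of z] by (cases "cmod z \<le> b + r") (auto intro!: mult_right_mono)
      qed
      also have "\<dots> = 2 * B * (\<integral>z. indicator (cball 0 (b + r)) z * \<bar>v z - u z\<bar> \<partial>lborel)" by simp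
      also have "\<dots> \<le> 2 * B * (13 * e * V)" using L1 B0 by (intro mult_left_mono) auto
      also note e_eq
      finally have main: "\<bar>(\<integral>z. \<psi> z * v z \<partial>lborel) - (\<integral>z. \<psi> z * u z \<partial>lborel)\<bar> \<le> \<epsilon> * N" .
      have z1: "(\<integral>z. smoothing r \<phi> z \<partial>zero_measure (eball 0 R0) (G n \<omega>)) = (\<integral>z. \<psi> z * ln (cmod (G n \<omega> z)) \<partial>lborel) / N"
        unfolding \<psi>_def N_def by (rule H.discrete_poincare_lelong[OF sub assms(1) B supp r(1,3)])
      have "(\<integral>z. \<psi> z * v z \<partial>lborel) = (\<integral>z. \<psi> z * ln (cmod (G n \<omega> z)) / real n \<partial>lborel)" by (simp add: v_def)
      also have "\<dots> = (\<integral>z. \<psi> z * ln (cmod (G n \<omega> z)) \<partial>lborel) / real n" by simp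
      finally have z2: "(\<integral>z. smoothing r \<phi> z \<partial>zero_measure (eball 0 R0) (G n \<omega>)) / real n = (\<integral>z. \<psi> z * v z \<partial>lborel) / N"
        by (simp add: z1)
      have z3: "(\<integral>z. smoothing r \<phi> z \<partial>\<nu>) = (\<integral>z. \<psi> z * u z \<partial>lborel) / N"
        unfolding \<psi>_def N_def by (rule admissible_integral_smoothing[OF \<nu> assms(1) B supp r(1,3,4) \<rho>pos])
      have "\<bar>(\<integral>z. \<psi> z * v z \<partial>lborel) / N - (\<integral>z. \<psi> z * u z \<partial>lborel) / N\<bar> \<le> \<epsilon>"
        using main N by (simp add: diff_divide_distrib[symmetric] field_simps)
      then show ?thesis using gd z2 z3 by simp
    qed
    then show ?case using Bad_m pBad by blast
  qed
qed

end

lemma integral_scale_measure: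
  fixes g :: "'a \<Rightarrow> real"
  assumes "g \<in> borel_measurable N" "c \<ge> 0"
  shows "(\<integral>x. g x \<partial>scale_measure (ennreal c) N) = c * (\<integral>x. g x \<partial>N)"
proof -
  have "scale_measure (ennreal c) N = density N (\<lambda>_. ennreal c)"
    by (rule measure_eqI) (auto simp: emeasure_density nn_integral_cmult)
  then show ?thesis using assms by (simp add: integral_density)
qed

lemma integral_null_measure:
  fixes g :: "'a \<Rightarrow> real"
  shows "(\<integral>x. g x \<partial>null_measure N) = 0"
proof (rule integral_eq_zero_AE)
  show "AE x in null_measure N. g x = 0"
    by (rule AE_I'[where N = "space N"]) (auto simp: null_sets_def)
qed

lemma space_zero_measure: "space (zero_measure D F) = D"
  by (simp add: zero_measure_def space_restrict_space)

lemma sets_zero_measure: "sets (zero_measure D F) = sets (restrict_space borel D)"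
  by (simp add: zero_measure_def)

lemma suminf_not_summable:
  assumes "\<not> summable c"
  shows "suminf c = (THE s. False)"
  using assms unfolding suminf_def by (metis (no_types, lifting) sums_summable)

section \<open>Uniqueness of the limit measure and extension of test functions\<close>

context legendre_profile
begin

lemma admissible_smoothing_tendsto:
  assumes \<nu>: "admissible \<nu>" and \<phi>: "bump_class b \<phi>"
  shows "((\<lambda>r. \<integral>z. smoothing r \<phi> z \<partial>\<nu>) \<longlongrightarrow> (\<integral>z. \<phi> z \<partial>\<nu>)) (at_right 0)"
proof -
  note D = bump_classD[OF \<phi>]
  note [measurable] = D(1)
  obtain B where B: "\<And>z. \<bar>\<phi> z\<bar> \<le> B" using D(6) by blast
  obtain \<rho> where \<rho>: "b < \<rho>" "ereal \<rho> < R0" using ereal_dense_real[OF D(3)] .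
  then have \<rho>pos: "\<rho> > 0" using D(2) by simp
  note T = truncated_measure[OF \<nu> \<rho>pos \<rho>(2)]
  define \<kappa> where "\<kappa> = distr (restrict_space \<nu> (ball 0 \<rho>)) borel (\<lambda>z. z)"
  note T = T[folded \<kappa>_def]
  interpret K: finite_measure \<kappa> by (rule T(1))
  note [measurable_cong] = T(2)
  define m where "m = measure \<kappa> (space \<kappa>)"
  have m: "m \<ge> 0" by (simp add: m_def)
  show ?thesis
  proof (rule tendstoI)
    fix e :: real assume e: "e > 0"
    define e' where "e' = e / (2 * (m + 1))"
    have e': "e' > 0" using e m by (simp add: e'_def)
    have e'm: "e' * m < e"
    proof -
      have "e' * m \<le> e' * (m + 1)" using e' by simp
      also have "\<dots> = e / 2" using m by (simp add: e'_def field_simps)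
      finally show ?thesis using e by simp
    qed
    obtain d where d: "d > 0" "\<And>r w. 0 < r \<Longrightarrow> r < d \<Longrightarrow> \<bar>smoothing r \<phi> w - \<phi> w\<bar> \<le> e'"
      using smoothing_uniform[OF \<phi> e'] by blast
    have "\<forall>\<^sub>F r in at_right 0. r \<in> {0<..<min d (\<rho> - b)}"
      using d(1) \<rho> by (intro eventually_at_right_real) auto
    then show "\<forall>\<^sub>F r in at_right 0. dist (\<integral>z. smoothing r \<phi> z \<partial>\<nu>) (\<integral>z. \<phi> z \<partial>\<nu>) < e"
    proof eventually_elim
      case (elim r)
      then have r: "0 < r" "r < d" "b + r < \<rho>" by auto
      have S0: "smoothing r \<phi> z = 0" if "cmod z \<ge> \<rho>" for z
        using that r by (intro smoothing_eq_0[OF D(1) B r(1) D(4)]) auto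
      have SB: "\<bar>smoothing r \<phi> z\<bar> \<le> B + e'" for z using d(2)[OF r(1,2), of z] B[of z] by linarith
      have i: "integrable \<kappa> (smoothing r \<phi>)" "integrable \<kappa> \<phi>"
      proof -
        show "integrable \<kappa> (smoothing r \<phi>)"
          by (rule K.integrable_const_bound[where B = "B + e'"]) (use SB in auto)
        show "integrable \<kappa> \<phi>"
          by (rule K.integrable_const_bound[where B = B]) (use B in auto)
      qed
      have "(\<integral>z. smoothing r \<phi> z \<partial>\<nu>) = (\<integral>z. smoothing r \<phi> z \<partial>\<kappa>)" by (rule T(6)) (use S0 in auto)
      moreover have "(\<integral>z. \<phi> z \<partial>\<nu>) = (\<integral>z. \<phi> z \<partial>\<kappa>)" by (rule T(6)) (use D(4) \<rho> in auto)
      ultimately have "dist (\<integral>z. smoothing r \<phi> z \<partial>\<nu>) (\<integral>z. \<phi> z \<partial>\<nu>) = \<bar>\<integral>z. smoothing r \<phi> z - \<phi> z \<partial>\<kappa>\<bar>"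
        using i by (simp add: dist_real_def)
      also have "\<dots> \<le> (\<integral>z. norm (smoothing r \<phi> z - \<phi> z) \<partial>\<kappa>)"
        using integral_norm_bound[of \<kappa> "\<lambda>z. smoothing r \<phi> z - \<phi> z"] by simp
      also have "\<dots> \<le> (\<integral>z. e' \<partial>\<kappa>)"
        using i d(2)[OF r(1,2)] by (intro integral_mono) auto
      also have "\<dots> = e' * m" by (simp add: m_def)
      finally show ?case using e'm by simp
    qed
  qed
qed

text \<open>For small \<open>r\<close> both smoothed integrals equal the same expression in
  \<open>u\<close>; then \<open>r\<close> tends to 0.\<close>

lemma admissible_integral_unique:
  assumes "admissible \<nu>1" "admissible \<nu>2" and \<phi>: "bump_class b \<phi>"
  shows "(\<integral>z. \<phi> z \<partial>\<nu>1) = (\<integral>z. \<phi> z \<partial>\<nu>2)"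
proof -
  note D = bump_classD[OF \<phi>]
  obtain B where B: "\<And>z. \<bar>\<phi> z\<bar> \<le> B" using D(6) by blast
  obtain \<rho> where \<rho>: "b < \<rho>" "ereal \<rho> < R0" using ereal_dense_real[OF D(3)] .
  then have \<rho>pos: "\<rho> > 0" using D(2) by simp
  have "\<forall>\<^sub>F r in at_right 0. r \<in> {0<..<\<rho> - b}" using \<rho> by (intro eventually_at_right_real) auto
  moreover define F where "F \<nu> r = (\<integral>z. smoothing r \<phi> z \<partial>\<nu>)" for \<nu> :: "complex measure" and r
  ultimately have ev: "\<forall>\<^sub>F r in at_right 0. F \<nu>2 r = F \<nu>1 r"
  proof (elim eventually_mono)
    fix r assume "r \<in> {0<..<\<rho> - b}"
    then have r: "0 < r" "b + r < \<rho>" by auto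
    show "F \<nu>2 r = F \<nu>1 r"
      unfolding F_def
      using admissible_integral_smoothing[OF assms(1) D(1) B D(4) r \<rho>(2) \<rho>pos]
        admissible_integral_smoothing[OF assms(2) D(1) B D(4) r \<rho>(2) \<rho>pos] by simp
  qed
  have lim: "(F \<nu> \<longlongrightarrow> (\<integral>z. \<phi> z \<partial>\<nu>)) (at_right 0)" if "admissible \<nu>" for \<nu>
    using admissible_smoothing_tendsto[OF that \<phi>] by (simp add: F_def[abs_def])
  have "(F \<nu>1 \<longlongrightarrow> (\<integral>z. \<phi> z \<partial>\<nu>2)) (at_right 0)"
    by (rule Lim_transform_eventually[OF lim[OF assms(2)] ev])
  with lim[OF assms(1)] show ?thesis
    by (rule tendsto_unique[OF trivial_limit_at_right_real])
qed

text \<open>Equal integrals of bump functions give equal measures of closed sets inside balls, hence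
  of Borel sets inside balls, and the balls exhaust the disk. Working on balls keeps both measures
  finite, as the generator argument requires.\<close>

lemma admissible_unique:
  assumes \<nu>1: "admissible \<nu>1" and \<nu>2: "admissible \<nu>2"
  shows "\<nu>1 = \<nu>2"
proof (rule measure_eqI)
  have s: "sets \<nu>1 = sets (restrict_space borel (eball 0 R0))" "sets \<nu>2 = sets (restrict_space borel (eball 0 R0))"
    using \<nu>1 \<nu>2 by (auto simp: admissible_def locally_finite_measure_on_def)
  then show "sets \<nu>1 = sets \<nu>2" by simp
  have trunc: "emeasure \<nu>1 (A \<inter> ball 0 \<rho>) = emeasure \<nu>2 (A \<inter> ball 0 \<rho>)"
    if A: "A \<in> sets borel" and \<rho>: "\<rho> > 0" "ereal \<rho> < R0" for A \<rho>
  proof -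
    define \<kappa>1 where "\<kappa>1 = distr (restrict_space \<nu>1 (ball 0 \<rho>)) borel (\<lambda>z. z)"
    define \<kappa>2 where "\<kappa>2 = distr (restrict_space \<nu>2 (ball 0 \<rho>)) borel (\<lambda>z. z)"
    note T1 = truncated_measure[OF \<nu>1 \<rho>, folded \<kappa>1_def]
    note T2 = truncated_measure[OF \<nu>2 \<rho>, folded \<kappa>2_def]
    have closed_eq: "emeasure \<kappa>1 F = emeasure \<kappa>2 F" if F: "closed F" for F
    proof (cases "F = {}")
      case False
      \<comment> \<open>The first factor tends to the indicator of the closed set \<open>F\<close>.
        The second vanishes from radius \<open>\<rho>\<close> on and tends to 1 at every point of
        the open ball.\<close>
      define h where "h j z = max 0 (1 - real j * infdist z F) * max 0 (min 1 (real j * (\<rho> - cmod z) - 1))" for j :: nat and z :: complex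
      have h_cont: "continuous_on UNIV (h j)" for j unfolding h_def by (intro continuous_intros)
      have h_bound: "0 \<le> h j z" "h j z \<le> 1" for j z
        unfolding h_def by (auto intro!: mult_nonneg_nonneg mult_le_one simp: infdist_nonneg)
      have h_supp: "h j z = 0" if "cmod z \<ge> \<rho>" for j z
      proof -
        have "real j * (\<rho> - cmod z) \<le> 0" using that by (intro mult_nonneg_nonpos) auto
        then show ?thesis by (simp add: h_def)
      qed
      have h_bump: "bump_class \<rho> (h j)" for j
        using h_cont \<rho> h_supp by (simp add: bump_class_def)
      have h_lim: "(\<lambda>j. h j z) \<longlonglongrightarrow> indicator (F \<inter> ball 0 \<rho>) z" for z
      proof (cases "z \<in> F \<inter> ball 0 \<rho>")
        case True
        have "\<forall>\<^sub>F j in sequentially. 2 \<le> real j * (\<rho> - cmod z)"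
          using True by real_asymp
        then have "\<forall>\<^sub>F j in sequentially. h j z = indicator (F \<inter> ball 0 \<rho>) z"
          by eventually_elim (use True in \<open>simp add: h_def\<close>)
        then show ?thesis by (rule tendsto_eventually)
      next
        case False
        then consider "cmod z \<ge> \<rho>" | "z \<notin> F" by force
        then show ?thesis
        proof cases
          case 1
          then show ?thesis using h_supp by simp
        next
          case 2
          then have "infdist z F > 0" using F \<open>F \<noteq> {}\<close> by (simp add: infdist_pos_not_in_closed)
          then have "\<forall>\<^sub>F j in sequentially. 1 \<le> real j * infdist z F" by real_asymp
          then have "\<forall>\<^sub>F j in sequentially. h j z = indicator (F \<inter> ball 0 \<rho>) z"
            by eventually_elim (use 2 in \<open>simp add: h_def\<close>)
          then show ?thesis by (rule tendsto_eventually)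
        qed
      qed
      have lim: "(\<lambda>j. \<integral>z. h j z \<partial>\<kappa>) \<longlonglongrightarrow> measure \<kappa> (F \<inter> ball 0 \<rho>)" if \<kappa>: "finite_measure \<kappa>" "sets \<kappa> = sets borel" for \<kappa>
      proof -
        interpret finite_measure \<kappa> by fact
        note [measurable_cong] = \<kappa>(2)
        have "(\<lambda>j. \<integral>z. h j z \<partial>\<kappa>) \<longlonglongrightarrow> (\<integral>z. indicator (F \<inter> ball 0 \<rho>) z \<partial>\<kappa>)"
        proof (rule integral_dominated_convergence[where w = "\<lambda>_. 1"])
          show "h j \<in> borel_measurable \<kappa>" for j
            using borel_measurable_continuous_onI[OF h_cont] by (simp add: measurable_cong_sets[OF \<kappa>(2) refl])
          have "F \<inter> ball 0 \<rho> \<in> sets \<kappa>" using F \<kappa>(2) by simp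
          then show "(indicator (F \<inter> ball 0 \<rho>) :: complex \<Rightarrow> real) \<in> borel_measurable \<kappa>" by simp
        qed (use h_lim h_bound in auto)
        moreover have "F \<inter> ball 0 \<rho> \<inter> space \<kappa> = F \<inter> ball 0 \<rho>" using sets_eq_imp_space_eq[OF \<kappa>(2)] by simp
        ultimately show ?thesis by simp
      qed
      have eq: "(\<integral>z. h j z \<partial>\<kappa>1) = (\<integral>z. h j z \<partial>\<kappa>2)" for j
      proof -
        have m: "h j \<in> borel_measurable borel" by (rule borel_measurable_continuous_onI[OF h_cont])
        have "(\<integral>z. h j z \<partial>\<kappa>1) = (\<integral>z. h j z \<partial>\<nu>1)" by (rule T1(6)[symmetric]) (use m h_supp in auto)
        also have "\<dots> = (\<integral>z. h j z \<partial>\<nu>2)" by (rule admissible_integral_unique[OF \<nu>1 \<nu>2 h_bump])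
        also have "\<dots> = (\<integral>z. h j z \<partial>\<kappa>2)" by (rule T2(6)) (use m h_supp in auto)
        finally show ?thesis .
      qed
      have "measure \<kappa>1 (F \<inter> ball 0 \<rho>) = measure \<kappa>2 (F \<inter> ball 0 \<rho>)"
        using lim[OF T1(1,2)] lim[OF T2(1,2)] unfolding eq by (rule LIMSEQ_unique)
      moreover have "F \<in> sets borel" "F \<inter> ball 0 \<rho> \<in> sets borel" using F by auto
      ultimately show ?thesis
        using T1(7)[of F] T1(7)[of "F \<inter> ball 0 \<rho>"] T2(7)[of F] T2(7)[of "F \<inter> ball 0 \<rho>"]
        by (simp add: finite_measure.emeasure_eq_measure[OF T1(1)] finite_measure.emeasure_eq_measure[OF T2(1)] Int_assoc)
    qed simp
    have "\<kappa>1 = \<kappa>2"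
    proof (rule measure_eqI_generator_eq[where E = "{F. closed F}" and A = "\<lambda>_. UNIV" and \<Omega> = UNIV])
      show "Int_stable {F :: complex set. closed F}" by (auto simp: Int_stable_def)
      show "sets \<kappa>1 = sigma_sets UNIV {F. closed F}" "sets \<kappa>2 = sigma_sets UNIV {F. closed F}"
        using T1(2) T2(2) by (simp_all add: borel_eq_closed)
      show "emeasure \<kappa>1 UNIV \<noteq> \<infinity>" for i :: nat
        using finite_measure.emeasure_eq_measure[OF T1(1)] by simp
    qed (use closed_eq in auto)
    then show ?thesis using T1(7)[OF A] T2(7)[OF A] by simp
  qed
  fix A assume "A \<in> sets \<nu>1"
  then have A: "A \<in> sets borel" "A \<subseteq> eball 0 R0" by (auto simp: s sets_restrict_space_iff)
  obtain \<rho> :: "nat \<Rightarrow> real" where \<rho>: "incseq \<rho>" "\<And>j. \<rho> j > 0" "\<And>j. ereal (\<rho> j) < R0" "\<And>x. ereal x < R0 \<Longrightarrow> \<exists>j. x < \<rho> j"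
  proof (cases "R0 = \<infinity>")
    case True
    show ?thesis
    proof (rule that[of "\<lambda>j. real j + 1"])
      fix x :: real
      obtain j :: nat where "x < real j" using reals_Archimedean2 by blast
      then have "x < real j + 1" by simp
      then show "\<exists>j. x < real j + 1" by blast
    qed (use True in \<open>auto simp: incseq_def\<close>)
  next
    case False
    then obtain R where R: "R0 = ereal R" "R > 0" using R0_pos by (cases R0) auto
    show ?thesis
    proof (rule that[of "\<lambda>j. R * (1 - 1 / (real j + 2))"])
      show "incseq (\<lambda>j. R * (1 - 1 / (real j + 2)))"
        using R by (intro incseq_SucI mult_left_mono) (auto simp: field_simps)
      show "0 < R * (1 - 1 / (real j + 2))" for j using R by (simp add: field_simps add_pos_nonneg)
      show "ereal (R * (1 - 1 / (real j + 2))) < R0" for j using R by (simp add: field_simps)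
      fix x assume x: "ereal x < R0"
      have "(\<lambda>j. R * (1 - 1 / (real j + 2))) \<longlonglongrightarrow> R" by real_asymp
      then have "\<forall>\<^sub>F j in sequentially. x < R * (1 - 1 / (real j + 2))" using x R by (intro order_tendstoD) auto
      then show "\<exists>j. x < R * (1 - 1 / (real j + 2))" unfolding eventually_sequentially by blast
    qed
  qed
  have un: "A = (\<Union>j. A \<inter> ball 0 (\<rho> j))"
  proof
    show "A \<subseteq> (\<Union>j. A \<inter> ball 0 (\<rho> j))"
    proof
      fix z assume z: "z \<in> A"
      then have "ereal (cmod z) < R0" using A(2) by auto
      then obtain j where "cmod z < \<rho> j" using \<rho>(4) by blast
      then show "z \<in> (\<Union>j. A \<inter> ball 0 (\<rho> j))" using z by auto
    qed
  qed blast
  have inc: "incseq (\<lambda>j. A \<inter> ball 0 (\<rho> j))"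
    using \<rho>(1) by (fastforce simp: incseq_def)
  have sets: "A \<inter> ball 0 (\<rho> j) \<in> sets \<nu>1" "A \<inter> ball 0 (\<rho> j) \<in> sets \<nu>2" for j
    using A by (auto simp: s sets_restrict_space_iff)
  have sup: "emeasure \<nu> A = (SUP j. emeasure \<nu> (A \<inter> ball 0 (\<rho> j)))" if "\<And>j. A \<inter> ball 0 (\<rho> j) \<in> sets \<nu>" for \<nu>
  proof -
    have "(SUP j. emeasure \<nu> (A \<inter> ball 0 (\<rho> j))) = emeasure \<nu> (\<Union>j. A \<inter> ball 0 (\<rho> j))"
      by (rule SUP_emeasure_incseq[OF _ inc]) (use that in auto)
    then show ?thesis by (simp only: un[symmetric])
  qed
  have "emeasure \<nu>1 A = (SUP j. emeasure \<nu>1 (A \<inter> ball 0 (\<rho> j)))" by (rule sup[OF sets(1)])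
  also have "\<dots> = (SUP j. emeasure \<nu>2 (A \<inter> ball 0 (\<rho> j)))"
    using trunc[OF A(1) \<rho>(2,3)] by simp
  also have "\<dots> = emeasure \<nu>2 A" by (rule sup[OF sets(2), symmetric])
  finally show "emeasure \<nu>1 A = emeasure \<nu>2 A" .
qed

text \<open>The open disk and the complement of \<open>K\<close> cover the plane; the extension is
  \<open>\<phi>\<close> on the first and 0 on the second, so it is continuous.\<close>

lemma test_function_extension:
  assumes "test_function_on (eball 0 R0) \<phi>"
  obtains \<phi>' b where "bump_class b \<phi>'" "\<And>z. z \<in> eball 0 R0 \<Longrightarrow> \<phi>' z = \<phi> z"
proof -
  obtain K where K: "continuous_on (eball 0 R0) \<phi>" "compact K" "K \<subseteq> eball 0 R0" "\<And>z. z \<in> eball 0 R0 - K \<Longrightarrow> \<phi> z = 0"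
    using assms by (auto simp: test_function_on_def)
  obtain b where b: "b > 0" "ereal b < R0" "K \<subseteq> ball 0 b" using compact_subset_ball[OF K(2,3)] by blast
  define \<phi>' where "\<phi>' z = (if z \<in> eball 0 R0 then \<phi> z else 0)" for z
  have z0: "\<phi>' z = 0" if "z \<notin> K" for z using K(4) that by (simp add: \<phi>'_def)
  have "continuous_on (eball 0 R0) \<phi>'"
    using K(1) by (rule continuous_on_eq) (simp add: \<phi>'_def)
  moreover have "continuous_on (- K) \<phi>'"
    by (rule continuous_on_eq[of _ "\<lambda>_. 0"]) (use z0 in auto)
  ultimately have "continuous_on (eball 0 R0 \<union> - K) \<phi>'"
    using compact_imp_closed[OF K(2)] by (intro continuous_on_open_Un) auto
  moreover have "eball 0 R0 \<union> - K = UNIV" using K(3) by blast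
  moreover have "\<phi>' z = 0" if "cmod z > b" for z
    using that b(3) by (intro z0) auto
  ultimately have "bump_class b \<phi>'"
    using b(1,2) by (simp add: bump_class_def)
  then show ?thesis by (rule that) (simp add: \<phi>'_def)
qed

end

section \<open>Convergence and measurability for test functions\<close>

context random_series_setting
begin

abbreviation zm :: "nat \<Rightarrow> 'w \<Rightarrow> complex measure" where
  "zm n \<omega> \<equiv> zero_measure (eball 0 R0) (G n \<omega>)"

text \<open>The cutoff \<open>\<phi>0\<close> is 1 on a neighbourhood of the support of
  \<open>\<phi>\<close>, so the error of smoothing is at most \<open>e\<close> times the smoothed
  cutoff. The integral of the latter against the zero measure, divided by \<open>n\<close>,
  converges as well, and so bounds the number of zeros that enter the error.\<close>

lemma integral_bump_convergence:
  assumes \<phi>: "bump_class b \<phi>" and \<nu>: "admissible \<nu>" and \<epsilon>: "\<epsilon> > 0" and \<kappa>: "\<kappa> > 0"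
  shows "\<forall>\<^sub>F n in sequentially. \<exists>Bad\<in>events. prob Bad \<le> \<kappa> \<and>
    (\<forall>\<omega>\<in>space M - Bad. \<bar>(\<integral>z. \<phi> z \<partial>zm n \<omega>) / real n - (\<integral>z. \<phi> z \<partial>\<nu>)\<bar> \<le> \<epsilon>)"
proof -
  note D = bump_classD[OF \<phi>]
  note [measurable] = D(1)
  obtain B where B: "\<And>z. \<bar>\<phi> z\<bar> \<le> B" using D(6) by blast
  obtain b1 where b1: "b < b1" "ereal b1 < R0" using ereal_dense_real[OF D(3)] .
  then have "0 < b1" using D(2) by simp
  obtain b2 \<phi>0 where b2: "b1 < b2" "bump_class b2 \<phi>0" "\<And>z. cmod z \<le> b1 \<Longrightarrow> \<phi>0 z = 1" "\<And>z. 0 \<le> \<phi>0 z" "\<And>z. \<phi>0 z \<le> 1"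
    using cutoff_exists[OF \<open>0 < b1\<close> b1(2)] by metis
  note D0 = bump_classD[OF b2(2)]
  note [measurable] = D0(1)
  have B0: "\<bar>\<phi>0 z\<bar> \<le> 1" for z using b2(4,5)[of z] by simp
  obtain \<rho> where \<rho>: "b2 < \<rho>" "ereal \<rho> < R0" using ereal_dense_real[OF D0(3)] .
  then have \<rho>pos: "\<rho> > 0" using D0(2) by simp
  have sub: "cball (0::complex) \<rho> \<subseteq> eball 0 R0" by (rule ball_subset_eball[OF \<rho>(2)])
  define K where "K = distr (restrict_space \<nu> (ball 0 \<rho>)) borel (\<lambda>z. z)"
  note T = truncated_measure[OF \<nu> \<rho>pos \<rho>(2), folded K_def]
  interpret K: finite_measure K by (rule T(1))
  note [measurable_cong] = T(2)
  define m where "m = measure K (space K)"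
  have m: "m \<ge> 0" by (simp add: m_def)
  \<comment> \<open>The total error will be \<open>e * (m + 1) + \<epsilon>1 + e * m\<close>: the
    scaled cutoff integral is at most \<open>m + 1\<close> by \<open>\<epsilon>1 \<le> 1\<close>,
    and \<open>e\<close> is chosen so that its two terms add up to
    \<open>\<epsilon> / 2\<close>.\<close>
  define \<epsilon>1 where "\<epsilon>1 = min 1 (\<epsilon> / 2)"
  define e where "e = \<epsilon> / (2 * (2 * m + 1))"
  have \<epsilon>1: "\<epsilon>1 > 0" "\<epsilon>1 \<le> 1" "\<epsilon>1 \<le> \<epsilon> / 2" using \<epsilon> by (auto simp: \<epsilon>1_def)
  have e: "e > 0" using \<epsilon> m by (simp add: e_def)
  have e_sum: "e * (2 * m + 1) = \<epsilon> / 2"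
  proof -
    have "2 * m + 1 > 0" using m by simp
    then show ?thesis by (simp add: e_def field_simps)
  qed
  obtain d where d: "d > 0" "\<And>r w. 0 < r \<Longrightarrow> r < d \<Longrightarrow> \<bar>smoothing r \<phi> w - \<phi> w\<bar> \<le> e"
    using smoothing_uniform[OF \<phi> e] by blast
  \<comment> \<open>\<open>b + 2 * r \<le> b1\<close> makes the smoothed cutoff equal to 1 on the
    ball of radius \<open>b + r\<close>, beyond which the smoothed \<open>\<phi>\<close>
    vanishes.\<close>
  define r where "r = min (d / 2) (min ((b1 - b) / 2) ((\<rho> - b2) / 2))"
  have r: "0 < r" "r < d" "b + 2 * r \<le> b1" "b2 + r < \<rho>" "b + r < \<rho>"
    using d(1) b1(1) b2(1) \<rho>(1) by (auto simp: r_def min_def field_simps)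
  have S0nn: "smoothing r \<phi>0 w \<ge> 0" for w by (rule smoothing_nonneg[OF b2(4) r(1)])
  have S0le: "smoothing r \<phi>0 w \<le> 1" for w
    using abs_smoothing_diff_le[OF D0(1) B0 r(1), where w = w and x = 0 and e = 1] B0 by simp
  have pointwise: "\<bar>\<phi> w - smoothing r \<phi> w\<bar> \<le> e * smoothing r \<phi>0 w" for w
  proof (cases "cmod w \<le> b + r")
    case True
    have "smoothing r \<phi>0 w = 1"
    proof (rule smoothing_eq_const[OF D0(1) B0 r(1)])
      fix z assume "dist z w < r"
      then have "cmod z \<le> b1" using True r(3) norm_triangle_ineq2[of z w] by (simp add: dist_norm)
      then show "\<phi>0 z = 1" by (rule b2(3))
    qed
    then show ?thesis using d(2)[OF r(1,2), of w] by (simp add: abs_minus_commute)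
  next
    case False
    have "smoothing r \<phi> w = 0" using False by (intro smoothing_eq_0[OF D(1) B r(1) D(4)]) auto
    moreover have "\<phi> w = 0" using False r(1) by (intro D(4)) simp
    ultimately show ?thesis using e S0nn[of w] by simp
  qed
  have \<phi>out: "\<phi> z = 0" if "cmod z \<ge> \<rho>" for z using that r(1,5) by (intro D(4)) simp
  have Sout: "smoothing r \<phi> z = 0" if "cmod z \<ge> \<rho>" for z
    using that r by (intro smoothing_eq_0[OF D(1) B r(1) D(4)]) auto
  have S0out: "smoothing r \<phi>0 z = 0" if "cmod z \<ge> \<rho>" for z
    using that r by (intro smoothing_eq_0[OF D0(1) B0 r(1) D0(4)]) auto
  have iK: "integrable K \<phi>" "integrable K (smoothing r \<phi>)" "integrable K (smoothing r \<phi>0)"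
  proof -
    show "integrable K \<phi>" by (rule K.integrable_const_bound[where B = B]) (use B in auto)
    have "\<bar>smoothing r \<phi> z\<bar> \<le> B + e" for z using d(2)[OF r(1,2), of z] B[of z] by linarith
    then show "integrable K (smoothing r \<phi>)" by (intro K.integrable_const_bound[where B = "B + e"]) auto
    show "integrable K (smoothing r \<phi>0)" by (rule K.integrable_const_bound[where B = 1]) (use S0nn S0le in auto)
  qed
  have I0: "(\<integral>z. smoothing r \<phi>0 z \<partial>\<nu>) \<le> m"
  proof -
    have "(\<integral>z. smoothing r \<phi>0 z \<partial>\<nu>) = (\<integral>z. smoothing r \<phi>0 z \<partial>K)" by (rule T(6)) (use S0out in auto)
    also have "\<dots> \<le> (\<integral>z. 1 \<partial>K)" using iK S0le by (intro integral_mono) auto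
    finally show ?thesis by (simp add: m_def)
  qed
  have I1: "\<bar>(\<integral>z. smoothing r \<phi> z \<partial>\<nu>) - (\<integral>z. \<phi> z \<partial>\<nu>)\<bar> \<le> e * m"
  proof -
    have "(\<integral>z. smoothing r \<phi> z \<partial>\<nu>) = (\<integral>z. smoothing r \<phi> z \<partial>K)" by (rule T(6)) (use Sout in auto)
    moreover have "(\<integral>z. \<phi> z \<partial>\<nu>) = (\<integral>z. \<phi> z \<partial>K)" by (rule T(6)) (use \<phi>out in auto)
    ultimately have "\<bar>(\<integral>z. smoothing r \<phi> z \<partial>\<nu>) - (\<integral>z. \<phi> z \<partial>\<nu>)\<bar> = \<bar>\<integral>z. smoothing r \<phi> z - \<phi> z \<partial>K\<bar>"
      using iK by simp
    also have "\<dots> \<le> (\<integral>z. norm (smoothing r \<phi> z - \<phi> z) \<partial>K)"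
      using integral_norm_bound[of K "\<lambda>z. smoothing r \<phi> z - \<phi> z"] by simp
    also have "\<dots> \<le> (\<integral>z. e \<partial>K)"
      using iK d(2)[OF r(1,2)] by (intro integral_mono) auto
    finally show ?thesis by (simp add: m_def mult.commute)
  qed
  have \<kappa>2: "\<kappa> / 2 > 0" using \<kappa> by simp
  have C1: "\<forall>\<^sub>F n in sequentially. \<exists>Bad\<in>events. prob Bad \<le> \<kappa> / 2 \<and> (\<forall>\<omega>\<in>space M - Bad. good n \<omega> \<and>
    \<bar>(\<integral>z. smoothing r \<phi> z \<partial>zm n \<omega>) / real n - (\<integral>z. smoothing r \<phi> z \<partial>\<nu>)\<bar> \<le> \<epsilon>1)"
    by (rule smoothing_convergence[OF D(1) B D(4) r(1) D(2) r(5) \<rho>(2) \<nu> \<epsilon>1(1) \<kappa>2])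
  have C0: "\<forall>\<^sub>F n in sequentially. \<exists>Bad\<in>events. prob Bad \<le> \<kappa> / 2 \<and> (\<forall>\<omega>\<in>space M - Bad. good n \<omega> \<and>
    \<bar>(\<integral>z. smoothing r \<phi>0 z \<partial>zm n \<omega>) / real n - (\<integral>z. smoothing r \<phi>0 z \<partial>\<nu>)\<bar> \<le> \<epsilon>1)"
    by (rule smoothing_convergence[OF D0(1) B0 D0(4) r(1) D0(2) r(4) \<rho>(2) \<nu> \<epsilon>1(1) \<kappa>2])
  show ?thesis
    using C1 C0 eventually_gt_at_top[of 0]
  proof eventually_elim
    case (elim n)
    have n: "real n > 0" using elim(3) by simp
    obtain Bad1 where Bad1: "Bad1 \<in> events" "prob Bad1 \<le> \<kappa> / 2"
      "\<And>\<omega>. \<omega> \<in> space M - Bad1 \<Longrightarrow> good n \<omega> \<and> \<bar>(\<integral>z. smoothing r \<phi> z \<partial>zm n \<omega>) / real n - (\<integral>z. smoothing r \<phi> z \<partial>\<nu>)\<bar> \<le> \<epsilon>1"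
      using elim(1) by blast
    obtain Bad0 where Bad0: "Bad0 \<in> events" "prob Bad0 \<le> \<kappa> / 2"
      "\<And>\<omega>. \<omega> \<in> space M - Bad0 \<Longrightarrow> good n \<omega> \<and> \<bar>(\<integral>z. smoothing r \<phi>0 z \<partial>zm n \<omega>) / real n - (\<integral>z. smoothing r \<phi>0 z \<partial>\<nu>)\<bar> \<le> \<epsilon>1"
      using elim(2) by blast
    have "prob (Bad1 \<union> Bad0) \<le> \<kappa>" using measure_Un_le[OF Bad1(1) Bad0(1)] Bad1(2) Bad0(2) by linarith
    moreover have "\<bar>(\<integral>z. \<phi> z \<partial>zm n \<omega>) / real n - (\<integral>z. \<phi> z \<partial>\<nu>)\<bar> \<le> \<epsilon>" if \<omega>: "\<omega> \<in> space M - (Bad1 \<union> Bad0)" for \<omega>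
    proof -
      have w1: "good n \<omega>" "\<bar>(\<integral>z. smoothing r \<phi> z \<partial>zm n \<omega>) / real n - (\<integral>z. smoothing r \<phi> z \<partial>\<nu>)\<bar> \<le> \<epsilon>1"
        using Bad1(3)[of \<omega>] \<omega> by auto
      have w0: "\<bar>(\<integral>z. smoothing r \<phi>0 z \<partial>zm n \<omega>) / real n - (\<integral>z. smoothing r \<phi>0 z \<partial>\<nu>)\<bar> \<le> \<epsilon>1"
        using Bad0(3)[of \<omega>] \<omega> by auto
      obtain z0 where H: "nonzero_holomorphic (G n \<omega>) (eball 0 R0) z0" using good_imp_nonzero_holomorphic[OF w1(1)] by blast
      interpret H: nonzero_holomorphic "G n \<omega>" "eball 0 R0" z0 by (rule H)
      have zint: "(\<integral>z. h z \<partial>zm n \<omega>) = (\<Sum>w\<in>H.zeros \<rho>. real_of_int (zorder (G n \<omega>) w) * h w)"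
        if "h \<in> borel_measurable borel" "\<And>z. cmod z \<ge> \<rho> \<Longrightarrow> h z = 0" for h
        by (rule H.integral_zero_measure[OF sub measurable_restrict_space1[OF that(1)] that(2)])
      have zpos: "real_of_int (zorder (G n \<omega>) w) \<ge> 0" if "w \<in> H.zeros \<rho>" for w
      proof -
        have "w \<in> cball 0 \<rho>" "G n \<omega> w = 0" using that by (auto simp: H.zeros_def)
        then have "zorder (G n \<omega>) w > 0" using sub by (intro H.zorder_pos) auto
        then show ?thesis by simp
      qed
      have "\<bar>(\<integral>z. \<phi> z \<partial>zm n \<omega>) - (\<integral>z. smoothing r \<phi> z \<partial>zm n \<omega>)\<bar>
        = \<bar>\<Sum>w\<in>H.zeros \<rho>. real_of_int (zorder (G n \<omega>) w) * (\<phi> w - smoothing r \<phi> w)\<bar>"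
        using zint[OF _ \<phi>out] zint[OF _ Sout] by (simp add: right_diff_distrib sum_subtractf)
      also have "\<dots> \<le> (\<Sum>w\<in>H.zeros \<rho>. real_of_int (zorder (G n \<omega>) w) * (e * smoothing r \<phi>0 w))"
        using zpos pointwise by (intro order_trans[OF sum_abs] sum_mono) (simp add: abs_mult mult_left_mono)
      also have "\<dots> = e * (\<integral>z. smoothing r \<phi>0 z \<partial>zm n \<omega>)"
        using zint[OF _ S0out] by (simp add: sum_distrib_left mult.left_commute)
      finally have "\<bar>(\<integral>z. \<phi> z \<partial>zm n \<omega>) - (\<integral>z. smoothing r \<phi> z \<partial>zm n \<omega>)\<bar> / real n \<le> e * (\<integral>z. smoothing r \<phi>0 z \<partial>zm n \<omega>) / real n"
        using n by (intro divide_right_mono) auto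
      then have "\<bar>(\<integral>z. \<phi> z \<partial>zm n \<omega>) / real n - (\<integral>z. smoothing r \<phi> z \<partial>zm n \<omega>) / real n\<bar> \<le> e * ((\<integral>z. smoothing r \<phi>0 z \<partial>zm n \<omega>) / real n)"
        using n by (simp add: diff_divide_distrib[symmetric])
      also have "\<dots> \<le> e * (m + 1)"
        using w0 I0 \<epsilon>1(2) e by (intro mult_left_mono) auto
      finally have "\<bar>(\<integral>z. \<phi> z \<partial>zm n \<omega>) / real n - (\<integral>z. \<phi> z \<partial>\<nu>)\<bar> \<le> e * (m + 1) + \<epsilon>1 + e * m"
        using w1(2) I1 by linarith
      also have "\<dots> = e * (2 * m + 1) + \<epsilon>1" by (simp add: algebra_simps)
      also have "\<dots> \<le> \<epsilon>" using e_sum \<epsilon>1(3) by simp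
      finally show ?thesis .
    qed
    ultimately show ?case using Bad1(1) Bad0(1) by blast
  qed
qed

text \<open>
  Where the series diverges, \<^const>\<open>suminf\<close> is an unspecified constant, so a random series with radius of
  convergence below \<open>R0\<close> that is nevertheless holomorphic on the disk is constant.
\<close>

lemma integral_not_good:
  assumes ng: "\<not> good n \<omega>" and \<phi>: "bump_class b \<phi>"
  shows "(\<integral>z. \<phi> z \<partial>zm n \<omega>) = 0"
proof (cases "G n \<omega> holomorphic_on eball 0 R0 \<and> (\<exists>z\<in>eball 0 R0. G n \<omega> z \<noteq> 0)")
  case False
  then have "zm n \<omega> = null_measure (restrict_space borel (eball 0 R0))" by (simp only: zero_measure_def if_False)
  then show ?thesis by (simp only: integral_null_measure)
next
  case True
  then obtain z0 where hol: "G n \<omega> holomorphic_on eball 0 R0" and z0: "z0 \<in> eball 0 R0" "G n \<omega> z0 \<noteq> 0" by blast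
  interpret H: nonzero_holomorphic "G n \<omega>" "eball 0 R0" z0
    by unfold_locales (use hol z0 in auto)
  define c where "c k = \<xi> k \<omega> * a k n" for k
  have Gc: "G n \<omega> z = (\<Sum>k. c k * z ^ k)" for z by (simp only: G_eq c_def)
  have "\<exists>k. c k \<noteq> 0"
  proof (rule ccontr)
    assume "\<not> ?thesis"
    then have "G n \<omega> z0 = 0" unfolding Gc by simp
    then show False using z0 by blast
  qed
  then have "conv_radius c < R0" using ng by (auto simp: good_def c_def[abs_def] not_le)
  then obtain t where t: "conv_radius c < ereal t" "ereal t < R0" using ereal_dense2 by blast
  define c0 where "c0 = (THE s::complex. False)"
  have const: "G n \<omega> z = c0" if "t < cmod z" for z
  proof -
    have "conv_radius c < ereal (cmod z)" using t(1) that by (meson less_ereal.simps(1) less_trans)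
    then have "\<not> summable (\<lambda>k. c k * z ^ k)" by (rule not_summable_outside_conv_radius)
    then show ?thesis unfolding Gc c0_def by (rule suminf_not_summable)
  qed
  have "0 \<le> ereal t" by (rule order_trans[OF conv_radius_nonneg less_imp_le[OF t(1)]])
  then have t0: "t \<ge> 0" by simp
  obtain t' where t': "t < t'" "ereal t' < R0" using ereal_dense_real[OF t(2)] .
  \<comment> \<open>The part of the disk beyond radius \<open>t\<close> is a nonempty open set, so
    the identity theorem spreads the constant to the whole disk. The constant is nonzero, hence
    there are no zeros.\<close>
  have all: "G n \<omega> z = c0" if z: "z \<in> eball 0 R0" for z
  proof (rule analytic_continuation_open[where f = "G n \<omega>" and s = "{z. t < cmod z} \<inter> eball 0 R0" and s' = "eball 0 R0" and g = "\<lambda>_. c0"])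
    show "open ({z::complex. t < cmod z} \<inter> eball 0 R0)"
      by (intro open_Int open_Collect_less continuous_intros open_eball)
    have "of_real t' \<in> {z::complex. t < cmod z} \<inter> eball 0 R0" using t' t0 by simp
    then show "{z::complex. t < cmod z} \<inter> eball 0 R0 \<noteq> {}" by blast
  qed (use hol const z in auto)
  then have "c0 \<noteq> 0" using z0 by auto
  note D = bump_classD[OF \<phi>]
  obtain \<rho> where \<rho>: "b < \<rho>" "ereal \<rho> < R0" using ereal_dense_real[OF D(3)] .
  have sub: "cball (0::complex) \<rho> \<subseteq> eball 0 R0" by (rule ball_subset_eball[OF \<rho>(2)])
  have "H.zeros \<rho> = {}"
  proof -
    have "G n \<omega> w \<noteq> 0" if "w \<in> ball 0 \<rho>" for w
    proof -
      have "w \<in> eball 0 R0" using that sub ball_subset_cball[of 0 \<rho>] by blast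
      then show ?thesis using all \<open>c0 \<noteq> 0\<close> by simp
    qed
    then show ?thesis unfolding H.zeros_def by blast
  qed
  moreover have "(\<integral>z. \<phi> z \<partial>zm n \<omega>) = (\<Sum>w\<in>H.zeros \<rho>. real_of_int (zorder (G n \<omega>) w) * \<phi> w)"
    by (rule H.integral_zero_measure[OF sub measurable_restrict_space1[OF D(1)]]) (use D(4) \<rho> in auto)
  ultimately show ?thesis by simp
qed

lemma good_measurable [measurable]: "Measurable.pred M (good n)"
proof -
  have root: "(\<lambda>x. root k x) \<in> borel_measurable borel" for k
    by (intro borel_measurable_continuous_onI continuous_intros)
  have "(\<lambda>\<omega>. ereal (root k (norm (\<xi> k \<omega> * a k n)))) \<in> borel_measurable M" for k
    by (intro borel_measurable_ereal measurable_compose[OF _ root]) measurable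
  then have [measurable]: "(\<lambda>\<omega>. conv_radius (\<lambda>k. \<xi> k \<omega> * a k n)) \<in> borel_measurable M"
    unfolding conv_radius_altdef by (intro borel_measurable_liminf borel_measurable_ereal_inverse)
  show ?thesis unfolding good_def[abs_def] by measurable
qed

text \<open>The smoothed integral is an integral of ln |G| with a jointly measurable integrand,
  hence measurable in the outcome. At each outcome only finitely many zeros enter, so the limit
  along the radii \<open>r j\<close> is taken term by term.\<close>

lemma integral_bump_measurable:
  assumes \<phi>: "bump_class b \<phi>"
  shows "(\<lambda>\<omega>. \<integral>z. \<phi> z \<partial>zm n \<omega>) \<in> borel_measurable M"
proof -
  note D = bump_classD[OF \<phi>]
  note [measurable] = D(1)
  obtain B where B: "\<And>z. \<bar>\<phi> z\<bar> \<le> B" using D(6) by blast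
  obtain \<rho> where \<rho>: "b < \<rho>" "ereal \<rho> < R0" using ereal_dense_real[OF D(3)] .
  have sub: "cball (0::complex) \<rho> \<subseteq> eball 0 R0" by (rule ball_subset_eball[OF \<rho>(2)])
  define r where "r j = (\<rho> - b) / (real j + 2)" for j :: nat
  have r: "0 < r j" "b + r j < \<rho>" for j
  proof -
    show "0 < r j" using \<rho> by (simp add: r_def)
    have "(\<rho> - b) / (real j + 2) \<le> (\<rho> - b) / 2" using \<rho> by (intro divide_left_mono) auto
    then show "b + r j < \<rho>" using \<rho> by (simp add: r_def field_simps)
  qed
  have r0: "r \<longlonglongrightarrow> 0" unfolding r_def by real_asymp
  \<comment> \<open>Off the event \<open>good\<close> the approximation is set to 0, the value found
    in \<open>integral_not_good\<close>.\<close>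
  define F where "F j \<omega> = (if good n \<omega> then (\<integral>z. circle_avg_diff (r j) \<phi> z * ln (cmod (G n \<omega> z)) \<partial>lborel) / (\<integral>w. radial_kernel (r j) w \<partial>lborel) else 0)" for j \<omega>
  show ?thesis
  proof (rule borel_measurable_LIMSEQ_real)
    show "F j \<in> borel_measurable M" for j
    proof -
      have "(\<lambda>(\<omega>, z). circle_avg_diff (r j) \<phi> z * ln (cmod (G n \<omega> z))) \<in> borel_measurable (M \<Otimes>\<^sub>M lborel)" by measurable
      then have [measurable]: "(\<lambda>\<omega>. \<integral>z. circle_avg_diff (r j) \<phi> z * ln (cmod (G n \<omega> z)) \<partial>lborel) \<in> borel_measurable M"
        by (rule lborel.borel_measurable_lebesgue_integral)
      show ?thesis unfolding F_def[abs_def] by measurable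
    qed
    fix \<omega>
    show "(\<lambda>j. F j \<omega>) \<longlonglongrightarrow> (\<integral>z. \<phi> z \<partial>zm n \<omega>)"
    proof (cases "good n \<omega>")
      case False
      then show ?thesis using integral_not_good[OF False \<phi>] by (simp add: F_def)
    next
      case True
      obtain z0 where H: "nonzero_holomorphic (G n \<omega>) (eball 0 R0) z0" using good_imp_nonzero_holomorphic[OF True] by blast
      interpret H: nonzero_holomorphic "G n \<omega>" "eball 0 R0" z0 by (rule H)
      have zint: "(\<integral>z. h z \<partial>zm n \<omega>) = (\<Sum>w\<in>H.zeros \<rho>. real_of_int (zorder (G n \<omega>) w) * h w)"
        if "h \<in> borel_measurable borel" "\<And>z. cmod z \<ge> \<rho> \<Longrightarrow> h z = 0" for h
        by (rule H.integral_zero_measure[OF sub measurable_restrict_space1[OF that(1)] that(2)])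
      have Fj: "F j \<omega> = (\<Sum>w\<in>H.zeros \<rho>. real_of_int (zorder (G n \<omega>) w) * smoothing (r j) \<phi> w)" for j
      proof -
        have "F j \<omega> = (\<integral>z. smoothing (r j) \<phi> z \<partial>zm n \<omega>)"
          using True H.discrete_poincare_lelong[OF sub D(1) B D(4) r] by (simp add: F_def)
        also have "\<dots> = (\<Sum>w\<in>H.zeros \<rho>. real_of_int (zorder (G n \<omega>) w) * smoothing (r j) \<phi> w)"
        proof (rule zint)
          fix z assume "cmod z \<ge> \<rho>"
          then show "smoothing (r j) \<phi> z = 0" using r[of j] by (intro smoothing_eq_0[OF D(1) B r(1) D(4)]) auto
        qed measurable
        finally show ?thesis .
      qed
      have S: "(\<lambda>j. smoothing (r j) \<phi> w) \<longlonglongrightarrow> \<phi> w" for w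
      proof (rule tendstoI)
        fix e :: real assume e: "e > 0"
        obtain d where d: "d > 0" "\<And>r w. 0 < r \<Longrightarrow> r < d \<Longrightarrow> \<bar>smoothing r \<phi> w - \<phi> w\<bar> \<le> e / 2"
          using smoothing_uniform[OF \<phi> half_gt_zero[OF e]] by blast
        have "\<forall>\<^sub>F j in sequentially. r j < d" using r0 d(1) by (rule order_tendstoD)
        then show "\<forall>\<^sub>F j in sequentially. dist (smoothing (r j) \<phi> w) (\<phi> w) < e"
        proof eventually_elim
          case (elim j)
          then show ?case using d(2)[OF r(1) elim, of w] e by (simp add: dist_real_def)
        qed
      qed
      have "(\<integral>z. \<phi> z \<partial>zm n \<omega>) = (\<Sum>w\<in>H.zeros \<rho>. real_of_int (zorder (G n \<omega>) w) * \<phi> w)"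
        by (rule zint) (use D(4) \<rho> in auto)
      then show ?thesis unfolding Fj by (simp only:) (intro tendsto_intros S)
    qed
  qed
qed

lemma vague_convergence:
  assumes \<nu>: "admissible \<nu>"
  shows "vaguely_converges_in_probability M (eball 0 R0)
      (\<lambda>n \<omega>. scale_measure (ennreal (1 / real n)) (zm n \<omega>)) (\<lambda>_. \<nu>)"
  unfolding vaguely_converges_in_probability_def
proof (intro allI impI)
  fix \<phi> :: "complex \<Rightarrow> real"
  assume test: "test_function_on (eball 0 R0) \<phi>"
  obtain \<phi>' b where \<phi>': "bump_class b \<phi>'" "\<And>z. z \<in> eball 0 R0 \<Longrightarrow> \<phi>' z = \<phi> z"
    using test_function_extension[OF test] by metis
  have sp: "space \<nu> = eball 0 R0"
    using \<nu> sets_eq_imp_space_eq[of \<nu> "restrict_space borel (eball 0 R0)"]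
    by (simp add: admissible_def locally_finite_measure_on_def space_restrict_space)
  have \<nu>eq: "(\<integral>z. \<phi> z \<partial>\<nu>) = (\<integral>z. \<phi>' z \<partial>\<nu>)"
    by (rule Bochner_Integration.integral_cong) (use \<phi>'(2) sp in auto)
  \<comment> \<open>This includes \<open>n = 0\<close>, where division by 0 makes both sides
    0.\<close>
  have eq: "integral\<^sup>L (scale_measure (ennreal (1 / real n)) (zm n \<omega>)) \<phi> = (\<integral>z. \<phi>' z \<partial>zm n \<omega>) / real n" for n \<omega>
  proof -
    have "continuous_on (eball 0 R0) \<phi>" using test by (simp add: test_function_on_def)
    then have "\<phi> \<in> borel_measurable (restrict_space borel (eball 0 R0))"
      by (rule borel_measurable_continuous_on_restrict)
    then have "\<phi> \<in> borel_measurable (zm n \<omega>)"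
      by (simp add: measurable_cong_sets[OF sets_zero_measure refl])
    then have "integral\<^sup>L (scale_measure (ennreal (1 / real n)) (zm n \<omega>)) \<phi> = 1 / real n * (\<integral>z. \<phi> z \<partial>zm n \<omega>)"
      by (intro integral_scale_measure) auto
    also have "(\<integral>z. \<phi> z \<partial>zm n \<omega>) = (\<integral>z. \<phi>' z \<partial>zm n \<omega>)"
      by (rule Bochner_Integration.integral_cong) (use \<phi>'(2) space_zero_measure in auto)
    finally show ?thesis by simp
  qed
  show "converges_in_probability M (\<lambda>n \<omega>. integral\<^sup>L (scale_measure (ennreal (1 / real n)) (zm n \<omega>)) \<phi>) (\<lambda>\<omega>. integral\<^sup>L \<nu> \<phi>)"
    unfolding converges_in_probability_def eq \<nu>eq
  proof (intro conjI allI impI)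
    show "(\<lambda>\<omega>. (\<integral>z. \<phi>' z \<partial>zm n \<omega>) / real n) \<in> borel_measurable M" for n
      by (intro borel_measurable_divide integral_bump_measurable[OF \<phi>'(1)]) auto
    fix \<epsilon> :: real assume \<epsilon>: "\<epsilon> > 0"
    show "(\<lambda>n. prob {\<omega> \<in> space M. \<epsilon> < \<bar>(\<integral>z. \<phi>' z \<partial>zm n \<omega>) / real n - (\<integral>z. \<phi>' z \<partial>\<nu>)\<bar>}) \<longlonglongrightarrow> 0"
    proof (rule tendstoI)
      fix e :: real assume e: "e > 0"
      show "\<forall>\<^sub>F n in sequentially. dist (prob {\<omega> \<in> space M. \<epsilon> < \<bar>(\<integral>z. \<phi>' z \<partial>zm n \<omega>) / real n - (\<integral>z. \<phi>' z \<partial>\<nu>)\<bar>}) 0 < e"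
        using integral_bump_convergence[OF \<phi>'(1) \<nu> \<epsilon> half_gt_zero[OF e]]
      proof eventually_elim
        case (elim n)
        then obtain Bad where Bad: "Bad \<in> events" "prob Bad \<le> e / 2"
          "\<forall>\<omega>\<in>space M - Bad. \<bar>(\<integral>z. \<phi>' z \<partial>zm n \<omega>) / real n - (\<integral>z. \<phi>' z \<partial>\<nu>)\<bar> \<le> \<epsilon>" by blast
        have "prob {\<omega> \<in> space M. \<epsilon> < \<bar>(\<integral>z. \<phi>' z \<partial>zm n \<omega>) / real n - (\<integral>z. \<phi>' z \<partial>\<nu>)\<bar>} \<le> prob Bad"
          using Bad(1,3) by (intro finite_measure_mono) force+
        then show ?case using Bad(2) e by simp
      qed
    qed
  qed simp
qed

end

theorem theorem2p8:
  fixes M :: "'w measure"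
    and \<xi> :: "nat \<Rightarrow> 'w \<Rightarrow> complex"
    and a :: "nat \<Rightarrow> nat \<Rightarrow> complex"
    and f :: "real \<Rightarrow> real"
    and T0 R0 :: ereal
  assumes "prob_space M"
    and indep: "prob_space.indep_vars M (\<lambda>_. borel) \<xi> UNIV"
    and ident: "\<And>k. distr M borel (\<xi> k) = distr M borel (\<xi> 0)"
    and nondegenerate: "\<not> (\<exists>c. AE \<omega> in M. \<xi> 0 \<omega> = c)"
    and log_moment: "integrable M (\<lambda>\<omega>. ln (1 + cmod (\<xi> 0 \<omega>)))"
    and f_nonneg: "\<And>t. t \<ge> 0 \<Longrightarrow> f t \<ge> 0"
    and T0_pos: "T0 > 0"
    and A1_pos: "\<And>t. t \<ge> 0 \<Longrightarrow> ereal t < T0 \<Longrightarrow> f t > 0"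
    and A1_zero: "\<And>t. t \<ge> 0 \<Longrightarrow> ereal t > T0 \<Longrightarrow> f t = 0"
    and A2_cont: "continuous_on {t. 0 \<le> t \<and> ereal t < T0} f"
    and A2_left: "\<And>T. T0 = ereal T \<Longrightarrow> continuous (at_left T) f"
    and A3: "\<And>A::real. A > 0 \<Longrightarrow>
      (\<lambda>n. SUP k\<in>{k::nat. real k \<le> A * real n}.
             \<bar>cmod (a k n) powr (1 / real n) - f (real k / real n)\<bar>) \<longlonglongrightarrow> 0"
    and A4_R0: "R0 = Liminf at_top (\<lambda>t. inv_root (f t) t)" "R0 > 0"
    and A4_fixed: "\<And>n. n \<ge> 1 \<Longrightarrow>
      liminf (\<lambda>k. inv_root (cmod (a k n)) (real k)) \<ge> R0"
    and A4_joint: "\<And>R::real. ereal R < R0 \<Longrightarrow>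
      \<exists>A>0. \<forall>n k. real n \<ge> A \<longrightarrow> real k \<ge> A * real n \<longrightarrow>
        inv_root (cmod (a k n)) (real k) \<ge> ereal R"
  shows "\<exists>\<mu>. locally_finite_measure_on (eball 0 R0) \<mu> \<and>
    vaguely_converges_in_probability M (eball 0 R0)
      (\<lambda>n \<omega>. scale_measure (ennreal (1 / real n))
                (zero_measure (eball 0 R0) (random_series \<xi> a n \<omega>)))
      (\<lambda>_. \<mu>) \<and>
    rotation_invariant \<mu> \<and>
    radial_profile (legendre_log f) R0 \<mu> \<and>
    (\<forall>\<nu>. locally_finite_measure_on (eball 0 R0) \<nu> \<and> rotation_invariant \<nu> \<and>
         radial_profile (legendre_log f) R0 \<nu> \<longrightarrow> \<nu> = \<mu>)"
proof -
  interpret prob_space M by fact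
  interpret random_series_setting M f T0 R0 a \<xi>
    by unfold_locales (fact f_nonneg T0_pos A1_pos A1_zero A2_cont A2_left A3 A4_R0 A4_fixed A4_joint
        indep ident nondegenerate log_moment)+
  note adm = limit_measure_admissible
  show ?thesis
    using adm vague_convergence[OF adm] admissible_unique[OF _ adm]
    unfolding admissible_def by blast
qed

end
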